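(* Let $T=(K,L,R)$ with $L=(1,-1)$, $R=(1)$ and $\deg K=2$, and let $(b_T(n))_{n\in\mathbb N_0}$ be any sequence associated with $T$. Then for every integer $h$ with $2\le h\le 41$ and $4\nmid h$, there exist infinitely many $n$ such that $h\mid b_T(n)$.
   Context: Let $K=(k_n)_{n\in\mathbb N_0}$ be a strictly increasing sequence of non-negative integers with $k_0=0$; set $k_{-n}=-n$ for $n\in\mathbb N$. With $L=(1,-1)$ and $R=(1)$, a sequence of integers $(b_T(n))_{n\in\mathbb N_0}$ (extended by $b_T(q)=0$ for $q<0$) is associated with $T=(K,L,R)$ if for every $n\in\mathbb N_0$: $b_T(k_n)=b_T(k_n+1)=\dots=b_T(k_{n+1}-1)$ and $b_T(k_n)-b_T(k_{n-1})=b_T(n)$ (initial values are otherwise arbitrary). The upper degree is $\overline{\deg}\,K=\sup\{d:\ k_n-k_{n-1}\ge d\text{ for infinitely many }n\}$, the lower degree is $\underline{\deg}\,K=\inf\{d:\ k_n-k_{n-1}=d\text{ for infinitely many }n\}$, and $\deg K$ denotes their common value when they are equal. *)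

theory Defs
  imports Main "HOL-Library.Extended_Nat"
begin

text \<open>The index sequence is given as \<open>k :: nat \<Rightarrow> nat\<close>; it is assumed strictly increasing where
  these notions are used, so the natural-number subtractions below do not truncate.
  Values lie in \<open>enat\<close>: the upper degree of a sequence with unbounded gaps is \<open>\<infinity>\<close>, and so is
  the lower degree if no gap occurs infinitely often.\<close>

definition upper_degree :: "(nat \<Rightarrow> nat) \<Rightarrow> enat" where
  "upper_degree k = Sup (enat ` {d. infinite {n. n \<ge> 1 \<and> k n - k (n - 1) \<ge> d}})"

definition lower_degree :: "(nat \<Rightarrow> nat) \<Rightarrow> enat" where
  "lower_degree k = Inf (enat ` {d. infinite {n. n \<ge> 1 \<and> k n - k (n - 1) = d}})"

definition has_degree :: "(nat \<Rightarrow> nat) \<Rightarrow> enat \<Rightarrow> bool" where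
  "has_degree k d \<longleftrightarrow> upper_degree k = d \<and> lower_degree k = d"

definition extend_index :: "(nat \<Rightarrow> nat) \<Rightarrow> int \<Rightarrow> int" where
  "extend_index k i = (if i \<ge> 0 then int (k (nat i)) else i)"

definition extend_zero :: "(nat \<Rightarrow> int) \<Rightarrow> int \<Rightarrow> int" where
  "extend_zero b q = (if q \<ge> 0 then b (nat q) else 0)"

text \<open>Association with \<open>(K, L, R)\<close> for the fixed coefficient tuples \<open>L = (1, -1)\<close> (left-hand
  side of the recurrence) and \<open>R = (1)\<close> (right-hand side).\<close>

definition associated :: "(nat \<Rightarrow> nat) \<Rightarrow> (nat \<Rightarrow> int) \<Rightarrow> bool" where
  "associated k b \<longleftrightarrow>
     (\<forall>n. (\<forall>m\<in>{k n..<k (Suc n)}. b m = b (k n)) \<and>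
          extend_zero b (extend_index k (int n)) - extend_zero b (extend_index k (int n - 1)) = b n)"

end

(* Since deg K = 2, eventually k n = 2 n + c; after a shift the values A m = b (k (m - c)) satisfy
   A (2 m) = A (2 m - 1) + A m and A (2 m + 1) = A (2 m) + A m for all large m.
   Suppose that h divides no A m. A window of consecutive residues A (2^j m + i) is continued to the
   next j by a single free residue, and almost every choice produces a zero; a finite search over these
   choices refutes every starting window. A window is normalised by a unit of Z/h and by reflection to
   (A m, A (2 m)) = (a, t). For large h, the pairs (a, t) are refuted one after the other, according to
   A (4 m), and what has been refuted may be used at every position of the later windows.
   For composite h, the search starts at an m with p dvd A m for some proper divisor p of h.
   For h = 2 q, either almost all values at odd indices are even, and the claim for q applies to the m
   with a large odd part, or the parity of A m alternates along m, 2 m, 4 m, ..., and one searches modulo q. *)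

theory Submission
  imports Defs "HOL-Number_Theory.Cong"
begin

text \<open>The search is carried out by rewriting, and its size shapes the development. A window of
  \<open>n\<close> values and one new residue \<open>v\<close> determine \<open>2 n + 1\<close>
  values at the doubled indices, and each value that must not vanish forbids one \<open>v\<close>.
  So all \<open>v\<close> are treated together: the forbidden ones are deleted from a binary trie of
  residues in one pass over the window, and only the survivors branch. The recurrences add when the
  index grows and subtract when it falls, and building a new window reverses its order. A window
  therefore carries a sign \<open>\<sigma>\<close> and a direction \<open>\<delta>\<close>, which
  become \<open>\<sigma> * \<delta>\<close> and \<open>- \<delta>\<close> in the next generation;
  then every step is an addition, and reflected windows need no extra treatment. A pair
  \<open>(A m, A (2 * m))\<close> matters only up to a unit and the sign of its second entry; its
  class is called a type below. Refuted types, and refuted values of \<open>A (4 * m)\<close> for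
  the type under study, prune the search wherever that type recurs. For \<open>h = 2 q\<close> only
  zeros at even values count in the search modulo \<open>q\<close>; the predicate \<open>C\<close>
  marks these positions, so that both modes share one formalisation.\<close>

section \<open>Windows of consecutive values\<close>

text \<open>A value in a window together with what is known about its position. \<open>E\<close>
  records, in the parity mode, that \<open>C\<close> holds there. \<open>S y i\<close> records a
  position \<open>2 * m\<close> at which \<open>(A m, A (2 * m))\<close> belongs to the type under
  study: up to signs, the factor \<open>i\<close> multiplies this pair to the representative
  \<open>(a0, t)\<close>.\<close>

datatype lt = R nat | E lt | S lt lt

primrec val :: "lt \<Rightarrow> nat" where
  "val (R n) = n"
| "val (E l) = val l"
| "val (S l i) = val l"

primrec isR :: "lt \<Rightarrow> bool" where
  "isR (R n) = True"
| "isR (E l) = False"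
| "isR (S l i) = False"

text \<open>In the parity mode an \<open>S\<close> tag is only given to a position
  \<open>2 * m\<close> with \<open>C\<close> failing at \<open>m\<close>. Then \<open>C\<close>
  holds at \<open>2 * m\<close>, so forgetting the mark leaves the tag \<open>E\<close>.\<close>

definition core :: "bool \<Rightarrow> lt \<Rightarrow> lt" where
  "core p l = (case l of S y i \<Rightarrow> (if p then E y else R (val y)) | _ \<Rightarrow> l)"

text \<open>Sets of residues as binary tries addressed by \<open>path\<close>. A dead address means
  a residue that has been discarded; a leaf carries its residue, so that the survivors can be read
  off.\<close>

datatype tr = Dead | Lf lt | Nd tr tr

text \<open>\<open>Dead\<close> and \<open>Lf\<close> act as their own subtrees. In particular a
  single \<open>Lf\<close> has no dead address at all and serves as an empty collection of
  bans.\<close>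

primrec lft :: "tr \<Rightarrow> tr" where
  "lft Dead = Dead" | "lft (Lf l) = Lf l" | "lft (Nd l r) = l"

primrec rgt :: "tr \<Rightarrow> tr" where
  "rgt Dead = Dead" | "rgt (Lf l) = Lf l" | "rgt (Nd l r) = r"

primrec get :: "bool list \<Rightarrow> tr \<Rightarrow> tr" where
  "get [] t = t"
| "get (b # p) t = get p (if b then rgt t else lft t)"

primrec kill :: "bool list \<Rightarrow> tr \<Rightarrow> tr" where
  "kill [] t = Dead"
| "kill (b # p) t = (if b then Nd (lft t) (kill p (rgt t)) else Nd (kill p (lft t)) (rgt t))"

primrec bits :: "nat \<Rightarrow> nat \<Rightarrow> bool list" where
  "bits 0 v = []"
| "bits (Suc n) v = bits n (v div 2) @ [odd v]"

definition code :: "nat \<Rightarrow> nat \<Rightarrow> nat \<Rightarrow> bool list" where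
  "code n c v = (if v < c then bits n v else bits (Suc n) (v + c))"

text \<open>For \<open>h < 16\<close> the bound \<open>32 - h\<close> exceeds every residue, so all
  words have length 4.\<close>

definition path :: "nat \<Rightarrow> nat \<Rightarrow> bool list" where
  "path h v = (if h \<le> 32 then code 4 (32 - h) v else code 5 (64 - h) v)"

text \<open>\<open>ml a\<close> lists the values at \<open>2 * m\<close> that complete a value
  \<open>a\<close> at \<open>m\<close> to the type under study, each with its normalising factor;
  \<open>bl a\<close> lists those that complete it to a type already refuted. The dead addresses of
  \<open>bt\<close> are the normalised values of \<open>A (4 * m)\<close> already excluded for the
  type under study.\<close>

datatype env = Env (hh: nat) (pm: bool) (ml: "nat \<Rightarrow> (nat \<times> nat) list") (bl: "nat \<Rightarrow> nat list") (bt: tr)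

text \<open>Along the doubled indices the values are partial sums: an entry \<open>a\<close> met
  with the sum \<open>y\<close> contributes \<open>y + a\<close> at the double of its position and
  \<open>y + 2 * a\<close> next to it. In the parity mode only doubles can satisfy \<open>C\<close>,
  and they do so exactly when \<open>C\<close> fails at the entry itself.\<close>

primrec hits :: "env \<Rightarrow> nat \<Rightarrow> lt list \<Rightarrow> bool" where
  "hits e y [] \<longleftrightarrow> False"
| "hits e y (l # us) \<longleftrightarrow>
     (\<not> pm e \<or> isR (core (pm e) l)) \<and> (y + val l) mod hh e = 0 \<or>
     \<not> pm e \<and> (y + 2 * val l) mod hh e = 0 \<or>
     (\<not> pm e \<or> isR (core (pm e) l)) \<and> (y + val l) mod hh e \<in> set (bl e (val l)) \<or>
     hits e ((y + 2 * val l) mod hh e) us"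

definition mark :: "env \<Rightarrow> nat \<Rightarrow> nat \<Rightarrow> lt" where
  "mark e a y = (case map_of (ml e a) y of
     None \<Rightarrow> if pm e then E (R y) else R y | Some i \<Rightarrow> S (R y) (R i))"

text \<open>For an entry at \<open>2 * m\<close> the sum \<open>x + val y\<close> is
  \<open>A (4 * m)\<close> up to sign; the factor \<open>i\<close> brings it to the scale on which
  \<open>bt\<close> records exclusions.\<close>

definition banned :: "env \<Rightarrow> nat \<Rightarrow> lt \<Rightarrow> bool" where
  "banned e x l = (case l of
     S y i \<Rightarrow> get (path (hh e) ((val i * (x + val y)) mod hh e)) (bt e) = Dead | _ \<Rightarrow> False)"

text \<open>New values are put in front, so a child runs against the direction of its parent.
  \<open>None\<close> stands for a child that is excluded by a ban.\<close>

primrec gch :: "env \<Rightarrow> nat \<Rightarrow> lt list \<Rightarrow> lt list \<Rightarrow> lt list option" where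
  "gch e x [] vs = Some vs"
| "gch e x (l # us) vs =
     (if banned e x l then None
      else gch e ((x + 2 * val l) mod hh e) us
        (R ((x + 2 * val l) mod hh e) #
         (if isR (core (pm e) l) then mark e (val l) ((x + val l) mod hh e)
          else R ((x + val l) mod hh e)) # vs))"

text \<open>Being a least fixed point, \<open>ref\<close> contains only well-founded searches, and
  no bound on their depth has to be given. A child that is \<open>None\<close> counts as refuted. In
  the parity mode \<open>v = 0\<close> gets no exemption: the free residue belongs to an odd index,
  where \<open>C\<close> fails.\<close>

inductive ref :: "env \<Rightarrow> lt list \<Rightarrow> bool" for e where
  ref: "(\<And>v. v < hh e \<Longrightarrow> (\<not> pm e \<and> v = 0) \<or> hits e v ws \<or>
     (\<forall>vs. gch e v ws [R v] = Some vs \<longrightarrow> ref e vs)) \<Longrightarrow> ref e ws"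

text \<open>A computation of \<open>gch\<close> in progress, followed by the refutation of its
  result: the head of \<open>us\<close> holds the current sum, \<open>vs\<close> the part of the
  child already built.\<close>

definition gen :: "env \<Rightarrow> lt list \<Rightarrow> lt list \<Rightarrow> bool" where
  "gen e us vs \<longleftrightarrow> (\<forall>ws. gch e (val (hd us)) (tl us) vs = Some ws \<longrightarrow> ref e ws)"

text \<open>\<open>Q\<close> is closed under the index maps of the recurrence, and \<open>C\<close>
  marks the positions where a zero is impossible. Only congruences modulo \<open>hh e\<close> are
  assumed, so a sequence may be multiplied by a unit before it is fitted. The minus sign in
  \<open>bt_ok\<close> comes from the reversal of direction between the generation of
  \<open>m\<close> and that of \<open>2 * m\<close>.\<close>

locale fitted =
  fixes e :: env and a0 t :: int and A :: "int \<Rightarrow> int" and Q :: "int set" and C :: "int \<Rightarrow> bool"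
  assumes hpos: "0 < hh e"
    and Q_left: "m \<in> Q \<Longrightarrow> 2 * m - 1 \<in> Q"
    and Q_mid: "m \<in> Q \<Longrightarrow> 2 * m \<in> Q"
    and Q_right: "m \<in> Q \<Longrightarrow> 2 * m + 1 \<in> Q"
    and rec_mid: "m \<in> Q \<Longrightarrow> [A (2 * m) = A (2 * m - 1) + A m] (mod int (hh e))"
    and rec_right: "m \<in> Q \<Longrightarrow> [A (2 * m + 1) = A (2 * m) + A m] (mod int (hh e))"
    and nz: "m \<in> Q \<Longrightarrow> C m \<Longrightarrow> \<not> int (hh e) dvd A m"
    and C_all: "\<not> pm e \<Longrightarrow> C m"
    and C_mid: "pm e \<Longrightarrow> m \<in> Q \<Longrightarrow> C (2 * m) \<longleftrightarrow> \<not> C m"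
    and C_left: "pm e \<Longrightarrow> m \<in> Q \<Longrightarrow> \<not> C (2 * m - 1)"
    and C_right: "pm e \<Longrightarrow> m \<in> Q \<Longrightarrow> \<not> C (2 * m + 1)"
    and ml_ok: "(y, i) \<in> set (ml e a) \<Longrightarrow>
      [int i * int a = a0] (mod int (hh e)) \<and>
      ([int i * int y = t] (mod int (hh e)) \<or> [int i * int y = - t] (mod int (hh e))) \<and>
      coprime (int i) (int (hh e))"
    and bt_ok: "s < hh e \<Longrightarrow> get (path (hh e) s) (bt e) = Dead \<Longrightarrow> m \<in> Q \<Longrightarrow> (pm e \<longrightarrow> \<not> C m) \<Longrightarrow>
      [A m = w * a0] (mod int (hh e)) \<Longrightarrow>
      [A (2 * m) = w * t] (mod int (hh e)) \<or> [A (2 * m) = - w * t] (mod int (hh e)) \<Longrightarrow>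
      coprime w (int (hh e)) \<Longrightarrow>
      [A (4 * m) = - w * int s] (mod int (hh e)) \<Longrightarrow> False"
    and bl_ok: "m \<in> Q \<Longrightarrow> (pm e \<longrightarrow> \<not> C m) \<Longrightarrow> c \<in> set (bl e a) \<Longrightarrow>
      \<sigma> \<in> {1, - 1} \<Longrightarrow> \<tau> \<in> {1, - 1} \<Longrightarrow> [int a = \<sigma> * A m] (mod int (hh e)) \<Longrightarrow>
      [int c = \<tau> * A (2 * m)] (mod int (hh e)) \<Longrightarrow> False"
begin

abbreviation cg :: "int \<Rightarrow> int \<Rightarrow> bool" (infix "\<approx>" 50) where
  "x \<approx> y \<equiv> [x = y] (mod int (hh e))"

text \<open>The factor \<open>i\<close> was fixed in the previous generation, where it inverted
  \<open>w\<close> up to the sign of that generation. Expressed by the present sign and direction,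
  it inverts \<open>- \<sigma> * \<delta> * w\<close>.\<close>

definition spec :: "int \<Rightarrow> int \<Rightarrow> int \<Rightarrow> lt \<Rightarrow> bool" where
  "spec \<sigma> \<delta> p l \<longleftrightarrow> (\<forall>y i. l = S y i \<longrightarrow> (\<exists>m\<in>Q. \<exists>w. p = 2 * m \<and> (pm e \<longrightarrow> \<not> C m) \<and>
     coprime w (int (hh e)) \<and>
     A m \<approx> w * a0 \<and> (A p \<approx> w * t \<or> A p \<approx> - w * t) \<and> int (val i) * (- \<sigma> * \<delta> * w) \<approx> 1))"

definition okl :: "int \<Rightarrow> int \<Rightarrow> int \<Rightarrow> lt \<Rightarrow> bool" where
  "okl \<sigma> \<delta> p l \<longleftrightarrow> p \<in> Q \<and> int (val l) \<approx> \<sigma> * A p \<and>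
     (pm e \<longrightarrow> (isR (core True l) \<longleftrightarrow> \<not> C p)) \<and> spec \<sigma> \<delta> p l"

primrec window :: "int \<Rightarrow> int \<Rightarrow> int \<Rightarrow> lt list \<Rightarrow> bool" where
  "window \<sigma> \<delta> p [] \<longleftrightarrow> True"
| "window \<sigma> \<delta> p (l # us) \<longleftrightarrow> okl \<sigma> \<delta> p l \<and> window \<sigma> \<delta> (p + \<delta>) us"

text \<open>For \<open>\<delta> = 1\<close> this is the first recurrence, for
  \<open>\<delta> = -1\<close> the second one solved for \<open>A (2 * p)\<close>; the sign
  \<open>\<sigma> * \<delta>\<close> of the new generation turns the subtraction into an
  addition.\<close>

lemma step_mid:
  assumes "\<sigma> \<in> {1, -1}" "\<delta> \<in> {1, -1}" "p \<in> Q" "int y \<approx> \<sigma> * \<delta> * A (2 * p - \<delta>)" "int a \<approx> \<sigma> * A p"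
  shows "int ((y + a) mod hh e) \<approx> \<sigma> * \<delta> * A (2 * p)"
proof -
  have "A (2 * p) \<approx> A (2 * p - \<delta>) + \<delta> * A p"
  proof (cases "\<delta> = 1")
    case True
    then show ?thesis using rec_mid[OF assms(3)] by simp
  next
    case False
    then have d: "\<delta> = -1" using assms(2) by simp
    have "A (2 * p) + A p - A p \<approx> A (2 * p + 1) - A p"
      by (rule cong_diff[OF cong_sym[OF rec_right[OF assms(3)]] cong_refl])
    then show ?thesis by (simp add: d)
  qed
  then have 1: "\<sigma> * \<delta> * A (2 * p) \<approx> \<sigma> * \<delta> * (A (2 * p - \<delta>) + \<delta> * A p)"
    by (rule cong_scalar_left)
  have 2: "\<sigma> * \<delta> * (A (2 * p - \<delta>) + \<delta> * A p) = \<sigma> * \<delta> * A (2 * p - \<delta>) + \<sigma> * A p"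
    using assms(2) by (auto simp: algebra_simps)
  have 3: "int y + int a \<approx> \<sigma> * \<delta> * A (2 * p - \<delta>) + \<sigma> * A p"
    by (rule cong_add[OF assms(4,5)])
  have 4: "int ((y + a) mod hh e) \<approx> int y + int a"
    by (simp add: zmod_int cong_mod_left)
  show ?thesis by (rule cong_trans[OF 4 cong_trans[OF 3[folded 2] cong_sym[OF 1]]])
qed

text \<open>The index reached is written as \<open>2 * (p + \<delta>) - \<delta>\<close> because
  this is where the walk enters the entry at \<open>p + \<delta>\<close>.\<close>

lemma step_right:
  assumes "\<sigma> \<in> {1, -1}" "\<delta> \<in> {1, -1}" "p \<in> Q" "int y \<approx> \<sigma> * \<delta> * A (2 * p - \<delta>)" "int a \<approx> \<sigma> * A p"
  shows "int ((y + 2 * a) mod hh e) \<approx> \<sigma> * \<delta> * A (2 * (p + \<delta>) - \<delta>)"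
proof -
  have "A (2 * p + \<delta>) \<approx> A (2 * p) + \<delta> * A p"
  proof (cases "\<delta> = 1")
    case True
    then show ?thesis using rec_right[OF assms(3)] by simp
  next
    case False
    then have d: "\<delta> = -1" using assms(2) by simp
    have "A (2 * p - 1) + A p - A p \<approx> A (2 * p) - A p"
      by (rule cong_diff[OF cong_sym[OF rec_mid[OF assms(3)]] cong_refl])
    then show ?thesis by (simp add: d)
  qed
  then have 1: "\<sigma> * \<delta> * A (2 * p + \<delta>) \<approx> \<sigma> * \<delta> * (A (2 * p) + \<delta> * A p)"
    by (rule cong_scalar_left)
  have 2: "\<sigma> * \<delta> * (A (2 * p) + \<delta> * A p) = \<sigma> * \<delta> * A (2 * p) + \<sigma> * A p"
    using assms(2) by (auto simp: algebra_simps)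
  have 3: "int ((y + a) mod hh e) + int a \<approx> \<sigma> * \<delta> * A (2 * p) + \<sigma> * A p"
    by (rule cong_add[OF step_mid[OF assms] assms(5)])
  have 4: "int ((y + 2 * a) mod hh e) \<approx> int ((y + a) mod hh e) + int a"
  proof -
    have eq: "(y + 2 * a) mod hh e = ((y + a) mod hh e + a) mod hh e"
      by (simp add: mod_simps mult_2 add.assoc)
    have "int (x mod hh e) \<approx> int x" for x
      by (simp add: zmod_int cong_mod_left)
    from this[of "(y + a) mod hh e + a"] show ?thesis
      unfolding eq of_nat_add .
  qed
  have 5: "2 * (p + \<delta>) - \<delta> = 2 * p + \<delta>" by simp
  show ?thesis unfolding 5 by (rule cong_trans[OF 4 cong_trans[OF 3[folded 2] cong_sym[OF 1]]])
qed

lemma zero_iff: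
  assumes "int v \<approx> \<sigma> * A p" "\<sigma> \<in> {1, -1}" "p \<in> Q" "C p" "v < hh e"
  shows "v \<noteq> 0"
proof
  assume "v = 0"
  then have "int (hh e) dvd \<sigma> * A p" using assms(1) by (simp add: cong_def dvd_eq_mod_eq_0)
  then have "int (hh e) dvd A p" using assms(2) by auto
  then show False using nz[OF assms(3,4)] by simp
qed

lemma Q_delta: "p \<in> Q \<Longrightarrow> \<delta> \<in> {1, -1} \<Longrightarrow> 2 * p + \<delta> \<in> Q \<and> 2 * p - \<delta> \<in> Q"
  using Q_left[of p] Q_right[of p] by auto

lemma C_delta: "pm e \<Longrightarrow> p \<in> Q \<Longrightarrow> \<delta> \<in> {1, -1} \<Longrightarrow> \<not> C (2 * p + \<delta>) \<and> \<not> C (2 * p - \<delta>)"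
  using C_left[of p] C_right[of p] by auto

lemma pm_sign: "\<sigma> \<in> {1, -1} \<Longrightarrow> \<delta> \<in> {1, -1} \<Longrightarrow> \<sigma> * \<delta> \<in> {1, -1 :: int}"
  by auto

text \<open>The numbers tested by \<open>hits\<close> are residues of actual values: a zero among
  them would contradict \<open>nz\<close>, a listed pair \<open>bl_ok\<close>.\<close>

lemma not_hits:
  assumes "\<sigma> \<in> {1, -1}" "\<delta> \<in> {1, -1}" "window \<sigma> \<delta> p us" "int y \<approx> \<sigma> * \<delta> * A (2 * p - \<delta>)"
  shows "\<not> hits e y us"
  using assms(3,4)
proof (induction us arbitrary: p y)
  case Nil
  then show ?case by simp
next
  case (Cons l us)
  let ?a = "val l"
  have l: "okl \<sigma> \<delta> p l" and w: "window \<sigma> \<delta> (p + \<delta>) us" using Cons.prems by auto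
  have p: "p \<in> Q" and a: "int ?a \<approx> \<sigma> * A p" using l by (auto simp: okl_def)
  have sd: "\<sigma> * \<delta> \<in> {1, -1}" by (rule pm_sign[OF assms(1,2)])
  have mid: "int ((y + ?a) mod hh e) \<approx> \<sigma> * \<delta> * A (2 * p)"
    by (rule step_mid[OF assms(1,2) p Cons.prems(2) a])
  have right: "int ((y + 2 * ?a) mod hh e) \<approx> \<sigma> * \<delta> * A (2 * (p + \<delta>) - \<delta>)"
    by (rule step_right[OF assms(1,2) p Cons.prems(2) a])
  have odd_p: "isR (core (pm e) l) \<Longrightarrow> pm e \<Longrightarrow> \<not> C p" using l by (auto simp: okl_def)
  have 1: "\<not> ((\<not> pm e \<or> isR (core (pm e) l)) \<and> (y + ?a) mod hh e = 0)"
  proof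
    assume H: "(\<not> pm e \<or> isR (core (pm e) l)) \<and> (y + ?a) mod hh e = 0"
    then have "C (2 * p)" using C_all C_mid[OF _ p] odd_p by auto
    from zero_iff[OF mid sd Q_mid[OF p] this] H hpos show False by simp
  qed
  have 2: "\<not> (\<not> pm e \<and> (y + 2 * ?a) mod hh e = 0)"
  proof
    assume H: "\<not> pm e \<and> (y + 2 * ?a) mod hh e = 0"
    have "2 * (p + \<delta>) - \<delta> \<in> Q" using Q_delta[OF p assms(2)] by (simp add: algebra_simps)
    from zero_iff[OF right sd this] H C_all hpos show False by simp
  qed
  have 3: "\<not> ((\<not> pm e \<or> isR (core (pm e) l)) \<and> (y + ?a) mod hh e \<in> set (bl e ?a))"
  proof
    assume H: "(\<not> pm e \<or> isR (core (pm e) l)) \<and> (y + ?a) mod hh e \<in> set (bl e ?a)"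
    show False by (rule bl_ok[OF p _ conjunct2[OF H] assms(1) sd a mid]) (use H odd_p in auto)
  qed
  have 4: "\<not> hits e ((y + 2 * ?a) mod hh e) us" by (rule Cons.IH[OF w right])
  show ?case using 1 2 3 4 by (simp del: mod_0_imp_dvd)
qed

text \<open>Undoing the normalisation of a residue found dead yields precisely the value of
  \<open>A (4 * m)\<close> that \<open>bt_ok\<close> rules out.\<close>

lemma not_banned:
  assumes "\<sigma> \<in> {1, -1}" "\<delta> \<in> {1, -1}" "okl \<sigma> \<delta> p l" "int x \<approx> \<sigma> * \<delta> * A (2 * p - \<delta>)"
  shows "\<not> banned e x l"
proof
  assume b: "banned e x l"
  then obtain y i where l: "l = S y i" by (cases l) (auto simp: banned_def)
  let ?s = "(val i * (x + val y)) mod hh e"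
  have g: "get (path (hh e) ?s) (bt e) = Dead" using b by (simp add: banned_def l)
  from assms(3) obtain m w where m: "m \<in> Q" "p = 2 * m" "pm e \<longrightarrow> \<not> C m" "coprime w (int (hh e))"
      "A m \<approx> w * a0" "A p \<approx> w * t \<or> A p \<approx> - w * t" "int (val i) * (- \<sigma> * \<delta> * w) \<approx> 1"
    by (auto simp: okl_def spec_def l)
  have p: "p \<in> Q" and a: "int (val y) \<approx> \<sigma> * A p" using assms(3) by (auto simp: okl_def l)
  have mid: "int ((x + val y) mod hh e) \<approx> \<sigma> * \<delta> * A (2 * p)"
    by (rule step_mid[OF assms(1,2) p assms(4) a])
  have "int ?s \<approx> int (val i) * int ((x + val y) mod hh e)"
    unfolding zmod_int by (simp add: cong_def mod_simps)
  also have "int (val i) * int ((x + val y) mod hh e) \<approx> int (val i) * (\<sigma> * \<delta> * A (2 * p))"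
    by (rule cong_scalar_left[OF mid])
  finally have "- w * int ?s \<approx> - w * (int (val i) * (\<sigma> * \<delta> * A (2 * p)))"
    by (rule cong_scalar_left)
  also have "- w * (int (val i) * (\<sigma> * \<delta> * A (2 * p))) = (int (val i) * (- \<sigma> * \<delta> * w)) * A (4 * m)"
    by (simp add: m(2))
  also have "\<dots> \<approx> 1 * A (4 * m)" by (rule cong_scalar_right[OF m(7)])
  finally have "A (4 * m) \<approx> - w * int ?s" by (simp add: cong_sym_eq)
  with bt_ok[OF _ g m(1,3,5) _ m(4)] m(2,6) hpos show False by simp
qed

lemma core_cases: "isR (core (pm e) l) \<or> \<not> isR (core True l)"
  by (cases l) (auto simp: core_def)

text \<open>The delicate entry is a newly marked one: from the factor \<open>i\<close> stored with
  it, the unit demanded by \<open>spec\<close> has to be recovered, with the sign and the direction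
  of the next generation.\<close>

lemma gch_window:
  assumes "\<sigma> \<in> {1, -1}" "\<delta> \<in> {1, -1}" "window \<sigma> \<delta> p us" "int x \<approx> \<sigma> * \<delta> * A (2 * p - \<delta>)"
    and "window (\<sigma> * \<delta>) (- \<delta>) (2 * p - \<delta>) vs" "vs \<noteq> []"
  shows "\<exists>ws q. gch e x us vs = Some ws \<and> window (\<sigma> * \<delta>) (- \<delta>) q ws \<and> ws \<noteq> []"
  using assms(3-)
proof (induction us arbitrary: p x vs)
  case Nil
  then show ?case by auto
next
  case (Cons l us)
  let ?a = "val l"
  let ?y = "(x + ?a) mod hh e" and ?z = "(x + 2 * ?a) mod hh e"
  let ?c = "if isR (core (pm e) l) then mark e ?a ?y else R ?y"
  have l: "okl \<sigma> \<delta> p l" and w: "window \<sigma> \<delta> (p + \<delta>) us" using Cons.prems by auto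
  have p: "p \<in> Q" and a: "int ?a \<approx> \<sigma> * A p" using l by (auto simp: okl_def)
  have sd: "\<sigma> * \<delta> \<in> {1, -1}" by (rule pm_sign[OF assms(1,2)])
  have mid: "int ?y \<approx> \<sigma> * \<delta> * A (2 * p)"
    by (rule step_mid[OF assms(1,2) p Cons.prems(2) a])
  have right: "int ?z \<approx> \<sigma> * \<delta> * A (2 * (p + \<delta>) - \<delta>)"
    by (rule step_right[OF assms(1,2) p Cons.prems(2) a])
  have q: "2 * (p + \<delta>) - \<delta> = 2 * p + \<delta>" by simp
  have dd: "\<delta> * \<delta> = 1" using assms(2) by auto
  have nb: "\<not> banned e x l" by (rule not_banned[OF assms(1,2) l Cons.prems(2)])
  have okz: "okl (\<sigma> * \<delta>) (- \<delta>) (2 * (p + \<delta>) - \<delta>) (R ?z)"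
    unfolding okl_def spec_def using right Q_delta[OF p assms(2)] C_delta[OF _ p assms(2)]
    by (auto simp: q core_def add.commute[of \<delta> "2 * p"])
  have okc: "okl (\<sigma> * \<delta>) (- \<delta>) (2 * p) ?c"
  proof (cases "isR (core (pm e) l) \<and> map_of (ml e ?a) ?y \<noteq> None")
    case False
    have "isR (core True ?c) \<longleftrightarrow> \<not> C (2 * p)" if "pm e"
      using that False C_mid[OF that p] l core_cases[of l] by (auto simp: okl_def mark_def core_def)
    moreover have "val ?c = ?y" using False by (auto simp: mark_def)
    moreover have "spec (\<sigma> * \<delta>) (- \<delta>) (2 * p) ?c" using False by (auto simp: spec_def mark_def)
    ultimately show ?thesis using mid Q_mid[OF p] by (auto simp: okl_def)
  next
    case True
    then obtain i where i: "map_of (ml e ?a) ?y = Some i" by auto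
    then have mi: "(?y, i) \<in> set (ml e ?a)" by (rule map_of_SomeD)
    have c: "?c = S (R ?y) (R i)" using True i by (simp add: mark_def)
    have nC: "pm e \<longrightarrow> \<not> C p" using True l by (auto simp: okl_def)
    from ml_ok[OF mi] have i1: "int i * int ?a \<approx> a0" and i2: "int i * int ?y \<approx> t \<or> int i * int ?y \<approx> - t"
      and i3: "coprime (int i) (int (hh e))" by auto
    obtain j where j: "int i * j \<approx> 1" using cong_solve_coprime_int[OF i3] by auto
    \<comment> \<open>The entry is \<open>\<sigma> * A p\<close> rather than \<open>A p\<close>, so
      the unit that takes \<open>(a0, t)\<close> to the true pair is the inverse of \<open>i\<close>
      only up to this sign.\<close>
    define w where "w = \<sigma> * j"
    have ss: "\<sigma> * \<sigma> = 1" using assms(1) by auto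
    have cw: "coprime w (int (hh e))"
    proof -
      have "coprime (int i * j) (int (hh e))" using j by (metis cong_imp_coprime cong_sym coprime_1_left)
      then have "coprime j (int (hh e))" by simp
      then show ?thesis using assms(1) by (auto simp: w_def)
    qed
    have "w * a0 \<approx> w * (int i * int ?a)" by (rule cong_scalar_left[OF cong_sym[OF i1]])
    also have "w * (int i * int ?a) = \<sigma> * (int i * j) * int ?a" by (simp add: w_def)
    also have "\<dots> \<approx> \<sigma> * 1 * int ?a" by (intro cong_mult j cong_refl)
    also have "\<sigma> * 1 * int ?a \<approx> \<sigma> * (\<sigma> * A p)" using cong_scalar_left[OF a, of \<sigma>] by simp
    finally have A1: "A p \<approx> w * a0" by (simp add: mult.assoc[symmetric] ss cong_sym_eq)
    have yy: "j * (int i * int ?y) \<approx> int ?y"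
    proof -
      have "(int i * j) * int ?y \<approx> 1 * int ?y" by (rule cong_scalar_right[OF j])
      then show ?thesis by (simp add: ac_simps)
    qed
    have A2: "A (2 * p) \<approx> w * t \<or> A (2 * p) \<approx> - w * t"
    proof -
      have "\<sigma> * \<delta> * int ?y \<approx> \<sigma> * \<delta> * (\<sigma> * \<delta> * A (2 * p))" by (rule cong_scalar_left[OF mid])
      moreover have "\<sigma> * \<delta> * (\<sigma> * \<delta> * A (2 * p)) = A (2 * p)"
        using ss dd by (metis (no_types) mult.assoc mult.commute mult.left_neutral)
      ultimately have y1: "A (2 * p) \<approx> \<sigma> * \<delta> * int ?y" by (simp add: cong_sym_eq)
      have "\<sigma> * \<delta> * (j * (int i * int ?y)) \<approx> \<sigma> * \<delta> * int ?y" by (rule cong_scalar_left[OF yy])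
      with y1 have y2: "A (2 * p) \<approx> \<sigma> * \<delta> * (j * (int i * int ?y))" by (metis cong_sym cong_trans)
      from i2 show ?thesis
      proof
        assume "int i * int ?y \<approx> t"
        then have "\<sigma> * \<delta> * (j * (int i * int ?y)) \<approx> \<sigma> * \<delta> * (j * t)" by (intro cong_scalar_left)
        with y2 have "A (2 * p) \<approx> \<sigma> * \<delta> * (j * t)" by (rule cong_trans)
        then show ?thesis using assms(2) by (auto simp: w_def ac_simps)
      next
        assume "int i * int ?y \<approx> - t"
        then have "\<sigma> * \<delta> * (j * (int i * int ?y)) \<approx> \<sigma> * \<delta> * (j * - t)" by (intro cong_scalar_left)
        with y2 have "A (2 * p) \<approx> \<sigma> * \<delta> * (j * - t)" by (rule cong_trans)
        then show ?thesis using assms(2) by (auto simp: w_def ac_simps)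
      qed
    qed
    have A3: "int (val (R i)) * (- (\<sigma> * \<delta>) * (- \<delta>) * w) \<approx> 1"
    proof -
      have "int (val (R i)) * (- (\<sigma> * \<delta>) * (- \<delta>) * w) = (\<sigma> * \<sigma>) * (\<delta> * \<delta>) * (int i * j)"
        by (simp add: w_def)
      also have "\<dots> = int i * j" by (simp add: ss dd)
      finally show ?thesis using j by (simp only:)
    qed
    have "pm e \<longrightarrow> C (2 * p)" using C_mid[OF _ p] nC by auto
    then show ?thesis unfolding c okl_def spec_def
      using mid Q_mid[OF p] p nC cw A1 A2 A3 by (auto simp: core_def)
  qed
  have "window (\<sigma> * \<delta>) (- \<delta>) (2 * (p + \<delta>) - \<delta>) (R ?z # ?c # vs)"
    using okz okc Cons.prems(3) by (simp add: q)
  from Cons.IH[OF w right this] show ?case using nb by simp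
qed

text \<open>The residue that is free in the search is determined by the sequence. The branch
  selected by it meets an actual window at every node, whereas in a well-founded search all branches
  end in contradictions.\<close>

theorem ref_sound:
  "ref e ws \<Longrightarrow> \<sigma> \<in> {1, -1} \<Longrightarrow> \<delta> \<in> {1, -1} \<Longrightarrow> window \<sigma> \<delta> p ws \<Longrightarrow> ws \<noteq> [] \<Longrightarrow> False"
proof (induction arbitrary: \<sigma> \<delta> p rule: ref.induct)
  case (ref ws)
  from ref.prems obtain l us where ws: "ws = l # us" by (cases ws) auto
  have p: "p \<in> Q" using ref.prems(3) by (simp add: ws okl_def)
  have sd: "\<sigma> * \<delta> \<in> {1, -1}" by (rule pm_sign[OF ref.prems(1,2)])
  \<comment> \<open>The choice that the sequence itself makes for the free residue.\<close>
  define v where "v = nat ((\<sigma> * \<delta> * A (2 * p - \<delta>)) mod int (hh e))"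
  have vh: "v < hh e" using hpos by (simp add: v_def nat_less_iff)
  have v: "int v \<approx> \<sigma> * \<delta> * A (2 * p - \<delta>)" using hpos by (simp add: v_def cong_mod_left)
  have q: "2 * p - \<delta> \<in> Q" using Q_delta[OF p ref.prems(2)] by simp
  have okv: "window (\<sigma> * \<delta>) (- \<delta>) (2 * p - \<delta>) [R v]"
    using v q C_delta[OF _ p ref.prems(2)] by (auto simp: okl_def spec_def core_def)
  have nz: "\<not> (\<not> pm e \<and> v = 0)" using zero_iff[OF v sd q _ vh] C_all by auto
  have nh: "\<not> hits e v ws" by (rule not_hits[OF ref.prems(1,2,3) v])
  from gch_window[OF ref.prems(1,2,3) v okv] obtain vs q' where
    g: "gch e v ws [R v] = Some vs" "window (\<sigma> * \<delta>) (- \<delta>) q' vs" "vs \<noteq> []" by auto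
  have "- \<delta> \<in> {1, -1}" using ref.prems(2) by auto
  with ref.IH[OF vh] nz nh g sd show False by blast
qed

end

section \<open>Rewrite rules for the search\<close>

lemma ref_iff: "ref e ws \<longleftrightarrow> (\<forall>v<hh e. (\<not> pm e \<and> v = 0) \<or> hits e v ws \<or> gen e (R v # ws) [R v])"
  unfolding gen_def by (subst ref.simps) auto

lemma gen_Nil: "gen e [x] vs = ref e vs"
  by (simp add: gen_def)

lemma gen_R: "gen e (R x # R a # us) vs =
    gen e (R ((x + 2 * a) mod hh e) # us) (R ((x + 2 * a) mod hh e) # mark e a ((x + a) mod hh e) # vs)"
  by (simp add: gen_def banned_def core_def)

lemma gen_E: "gen e (R x # E (R a) # us) vs =
    gen e (R ((x + 2 * a) mod hh e) # us) (R ((x + 2 * a) mod hh e) # R ((x + a) mod hh e) # vs)"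
  by (simp add: gen_def banned_def core_def)

text \<open>Separates the test of a ban from the continuation \<open>P\<close>, so that the
  continuation can stay unevaluated until the test has been decided.\<close>

definition bsel :: "nat \<Rightarrow> tr \<Rightarrow> lt \<Rightarrow> bool \<Rightarrow> bool" where
  "bsel h B s P \<longleftrightarrow> get (path h (val s)) B = Dead \<or> P"

definition bleaf :: "tr \<Rightarrow> bool \<Rightarrow> bool" where
  "bleaf x P \<longleftrightarrow> x = Dead \<or> P"

lemma bleaf_simps: "bleaf Dead P = True" "bleaf (Lf l) P = P"
  by (simp_all add: bleaf_def)

section \<open>Prefix codes and updates of tries\<close>

lemma bits_inj: "v < 2 ^ n \<Longrightarrow> w < 2 ^ n \<Longrightarrow> bits n v = bits n w \<Longrightarrow> v = w"
proof (induction n arbitrary: v w)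
  case (Suc n)
  then have "v div 2 = w div 2" by (intro Suc.IH) auto
  moreover have "odd v = odd w" using Suc.prems(3) by simp
  ultimately show ?case by (metis dvd_mult_div_cancel odd_two_times_div_two_succ)
qed simp

lemma length_bits [simp]: "length (bits n v) = n"
  by (induction n arbitrary: v) auto

text \<open>Words that part at a common place address disjoint subtrees. Being different would not
  be enough, as one word could be a prefix of the other.\<close>

definition indep :: "bool list \<Rightarrow> bool list \<Rightarrow> bool" where
  "indep p q \<longleftrightarrow> (\<exists>i. i < length p \<and> i < length q \<and> p ! i \<noteq> q ! i)"

lemma get_kill_indep: "indep p q \<Longrightarrow> get p (kill q t) = get p t"
proof (induction p arbitrary: q t)
  case Nil
  then show ?case by (simp add: indep_def)
next
  case (Cons b p)
  then obtain c q' where q: "q = c # q'" by (cases q) (auto simp: indep_def)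
  show ?case
  proof (cases "b = c")
    case True
    with Cons.prems q have "indep p q'" unfolding indep_def
      by (metis Suc_less_eq length_Cons not0_implies_Suc nth_Cons_0 nth_Cons_Suc)
    with Cons.IH show ?thesis by (simp add: q True)
  next
    case False
    then show ?thesis by (simp add: q)
  qed
qed

lemma get_kill_same: "get p (kill p t) = Dead"
  by (induction p arbitrary: t) auto

lemma indep_same_length: "length p = length q \<Longrightarrow> p \<noteq> q \<Longrightarrow> indep p q"
  unfolding indep_def using nth_equalityI[of p q] by auto

lemma indep_append: "indep p q \<Longrightarrow> indep (p @ x) (q @ y)"
  unfolding indep_def by (metis (no_types, lifting) length_append nth_append trans_less_add1)

lemma indep_sym: "indep p q \<Longrightarrow> indep q p"
  unfolding indep_def by metis

text \<open>The mixed case is the interesting one: the first \<open>n\<close> digits of a long word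
  for \<open>w\<close> spell \<open>(w + c) div 2\<close>, which is at least \<open>c\<close> and so
  differs from every residue with a short word.\<close>

lemma code_indep:
  assumes "v < h" "w < h" "h + c = 2 ^ Suc n" "v \<noteq> w" "c \<le> 2 ^ n"
  shows "indep (code n c v) (code n c w)"
proof -
  have *: "indep (code n c v) (code n c w)" if "v < c" "\<not> w < c" "w < h" for v w
  proof -
    have "v \<noteq> (w + c) div 2" using that by auto
    moreover have "v < 2 ^ n" "(w + c) div 2 < 2 ^ n" using that assms by auto
    ultimately have "bits n v \<noteq> bits n ((w + c) div 2)" using bits_inj by blast
    then have "indep (bits n v @ []) (bits n ((w + c) div 2) @ [odd (w + c)])"
      by (intro indep_append indep_same_length) auto
    then show ?thesis using that by (simp add: code_def)
  qed
  consider "v < c" "w < c" | "\<not> v < c" "\<not> w < c" | "v < c" "\<not> w < c" | "\<not> v < c" "w < c" by blast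
  then show ?thesis
  proof cases
    case 1
    then have "bits n v \<noteq> bits n w" using bits_inj[of v n w] assms by auto
    then show ?thesis using 1 by (intro indep_same_length) (auto simp: code_def)
  next
    case 2
    then have "bits (Suc n) (v + c) \<noteq> bits (Suc n) (w + c)"
      using bits_inj[of "v + c" "Suc n" "w + c"] assms by auto
    then show ?thesis using 2 by (intro indep_same_length) (auto simp: code_def simp del: bits.simps)
  qed (use * assms indep_sym in blast)+
qed

lemma path_indep:
  assumes "v < h" "w < h" "h \<le> 64" "v \<noteq> w"
  shows "indep (path h v) (path h w)"
proof (cases "h \<le> 32")
  case True
  show ?thesis
  proof (cases "h < 16")
    case True
    then have "bits 4 v \<noteq> bits 4 w" using bits_inj[of v 4 w] assms by auto
    then show ?thesis using True assms by (intro indep_same_length) (auto simp: path_def code_def)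
  next
    case False
    then show ?thesis using True assms code_indep[of v h w "32 - h" 4] by (simp add: path_def)
  qed
next
  case False
  then show ?thesis using assms code_indep[of v h w "64 - h" 5] by (simp add: path_def)
qed

lemma get_kills:
  assumes "v < h" "h \<le> 64" "\<forall>k\<in>set ks. k < h"
  shows "get (path h v) (fold (\<lambda>k. kill (path h k)) ks T) = (if v \<in> set ks then Dead else get (path h v) T)"
  using assms(3)
proof (induction ks arbitrary: T)
  case (Cons k ks)
  then show ?case
    using path_indep[OF assms(1) _ assms(2), of k]
    by (cases "v = k") (auto simp: get_kill_same get_kill_indep)
qed simp

lemma mod_flip:
  fixes v k c h m :: nat
  assumes "v < h" "c < h" "k \<le> m * h"
  shows "(v + k) mod h = c \<longleftrightarrow> v = (c + (m * h - k)) mod h"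
proof
  assume H: "(v + k) mod h = c"
  have "(c + (m * h - k)) mod h = ((v + k) + (m * h - k)) mod h"
    unfolding H[symmetric] by (simp add: mod_simps)
  also have "(v + k) + (m * h - k) = v + m * h" using assms by simp
  finally show "v = (c + (m * h - k)) mod h" using assms by simp
next
  assume H: "v = (c + (m * h - k)) mod h"
  have "(v + k) mod h = (c + (m * h - k) + k) mod h" unfolding H by (simp add: mod_simps)
  also have "c + (m * h - k) + k = c + m * h" using assms by simp
  finally show "(v + k) mod h = c" using assms by simp
qed

lemma get_Lf [simp]: "get p (Lf l) = Lf l"
  by (induction p) auto

lemma get_Dead [simp]: "get p Dead = Dead"
  by (induction p) auto

primrec put :: "bool list \<Rightarrow> lt \<Rightarrow> tr \<Rightarrow> tr" where
  "put [] v t = Lf v"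
| "put (b # p) v t = (if b then Nd (lft t) (put p v (rgt t)) else Nd (put p v (lft t)) (rgt t))"

lemma get_put_indep: "indep p q \<Longrightarrow> get p (put q v t) = get p t"
proof (induction p arbitrary: q t)
  case Nil
  then show ?case by (simp add: indep_def)
next
  case (Cons b p)
  then obtain c q' where q: "q = c # q'" by (cases q) (auto simp: indep_def)
  show ?case
  proof (cases "b = c")
    case True
    with Cons.prems q have "indep p q'" unfolding indep_def
      by (metis Suc_less_eq length_Cons not0_implies_Suc nth_Cons_0 nth_Cons_Suc)
    with Cons.IH show ?thesis by (simp add: q True)
  qed (simp add: q)
qed

lemma get_put_same: "get p (put p v t) = Lf v"
  by (induction p arbitrary: t) auto

primrec itm :: "tr \<Rightarrow> (bool list \<times> lt) list" where
  "itm Dead = []"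
| "itm (Lf l) = [([], l)]"
| "itm (Nd a b) = map (\<lambda>x. (False # fst x, snd x)) (itm a) @ map (\<lambda>x. (True # fst x, snd x)) (itm b)"

text \<open>This also says that no leaf lies anywhere else, so that reading off all leaves gives
  exactly the surviving residues.\<close>

definition good :: "nat \<Rightarrow> tr \<Rightarrow> bool" where
  "good h T \<longleftrightarrow> set (itm T) = (\<lambda>v. (path h v, R v)) ` {v. v < h \<and> get (path h v) T \<noteq> Dead}"

text \<open>Atomic names for the residues, 40 being the largest that occurs. Tables over constants
  can be matched without taking numerals apart.\<close>

definition r0 :: lt where "r0 = R 0"
definition r1 :: lt where "r1 = R 1"
definition r2 :: lt where "r2 = R 2"
definition r3 :: lt where "r3 = R 3"
definition r4 :: lt where "r4 = R 4"
definition r5 :: lt where "r5 = R 5"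
definition r6 :: lt where "r6 = R 6"
definition r7 :: lt where "r7 = R 7"
definition r8 :: lt where "r8 = R 8"
definition r9 :: lt where "r9 = R 9"
definition r10 :: lt where "r10 = R 10"
definition r11 :: lt where "r11 = R 11"
definition r12 :: lt where "r12 = R 12"
definition r13 :: lt where "r13 = R 13"
definition r14 :: lt where "r14 = R 14"
definition r15 :: lt where "r15 = R 15"
definition r16 :: lt where "r16 = R 16"
definition r17 :: lt where "r17 = R 17"
definition r18 :: lt where "r18 = R 18"
definition r19 :: lt where "r19 = R 19"
definition r20 :: lt where "r20 = R 20"
definition r21 :: lt where "r21 = R 21"
definition r22 :: lt where "r22 = R 22"
definition r23 :: lt where "r23 = R 23"
definition r24 :: lt where "r24 = R 24"
definition r25 :: lt where "r25 = R 25"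
definition r26 :: lt where "r26 = R 26"
definition r27 :: lt where "r27 = R 27"
definition r28 :: lt where "r28 = R 28"
definition r29 :: lt where "r29 = R 29"
definition r30 :: lt where "r30 = R 30"
definition r31 :: lt where "r31 = R 31"
definition r32 :: lt where "r32 = R 32"
definition r33 :: lt where "r33 = R 33"
definition r34 :: lt where "r34 = R 34"
definition r35 :: lt where "r35 = R 35"
definition r36 :: lt where "r36 = R 36"
definition r37 :: lt where "r37 = R 37"
definition r38 :: lt where "r38 = R 38"
definition r39 :: lt where "r39 = R 39"
definition r40 :: lt where "r40 = R 40"
lemmas r_fold = r0_def[symmetric] r1_def[symmetric] r2_def[symmetric] r3_def[symmetric] r4_def[symmetric] r5_def[symmetric] r6_def[symmetric] r7_def[symmetric] r8_def[symmetric] r9_def[symmetric] r10_def[symmetric] r11_def[symmetric] r12_def[symmetric] r13_def[symmetric] r14_def[symmetric] r15_def[symmetric] r16_def[symmetric] r17_def[symmetric] r18_def[symmetric] r19_def[symmetric] r20_def[symmetric] r21_def[symmetric] r22_def[symmetric] r23_def[symmetric] r24_def[symmetric] r25_def[symmetric] r26_def[symmetric] r27_def[symmetric] r28_def[symmetric] r29_def[symmetric] r30_def[symmetric] r31_def[symmetric] r32_def[symmetric] r33_def[symmetric] r34_def[symmetric] r35_def[symmetric] r36_def[symmetric] r37_def[symmetric] r38_def[symmetric] r39_def[symmetric] r40_def[symmetric]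
lemmas r_defs = r0_def r1_def r2_def r3_def r4_def r5_def r6_def r7_def r8_def r9_def r10_def r11_def r12_def r13_def r14_def r15_def r16_def r17_def r18_def r19_def r20_def r21_def r22_def r23_def r24_def r25_def r26_def r27_def r28_def r29_def r30_def r31_def r32_def r33_def r34_def r35_def r36_def r37_def r38_def r39_def r40_def

text \<open>Bundles what a branch needs besides its residue, so that it can be kept frozen while the
  survivors are being listed.\<close>

datatype bw = BW (ban: tr) (win: "lt list")

text \<open>During the search these operations are never unfolded: every modulus comes with tables
  of their values on the named residues.\<close>

definition pl :: "nat \<Rightarrow> lt \<Rightarrow> lt \<Rightarrow> lt" where "pl h x y = R ((val x + val y) mod h)"
definition ng :: "nat \<Rightarrow> lt \<Rightarrow> lt" where "ng h x = R ((h - val x) mod h)"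
definition mt :: "nat \<Rightarrow> lt \<Rightarrow> lt \<Rightarrow> lt" where "mt h x y = R ((val x * val y) mod h)"
definition pa :: "nat \<Rightarrow> lt \<Rightarrow> bool list" where "pa h x = path h (val x)"
definition eqr :: "lt \<Rightarrow> lt \<Rightarrow> bool" where "eqr x y \<longleftrightarrow> x = y"

section \<open>Trie patterns that perform several deletions in one rewriting step\<close>

datatype pat = Pat tr tr "tr list"

primrec lefts :: "bool list list \<Rightarrow> bool list list" where
  "lefts [] = []"
| "lefts (p # ps) = (case p of [] \<Rightarrow> lefts ps | b # q \<Rightarrow> if b then lefts ps else q # lefts ps)"

primrec rights :: "bool list list \<Rightarrow> bool list list" where
  "rights [] = []"
| "rights (p # ps) = (case p of [] \<Rightarrow> rights ps | b # q \<Rightarrow> if b then q # rights ps else rights ps)"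

primrec join :: "tr \<Rightarrow> tr \<Rightarrow> pat \<Rightarrow> pat" where
  "join l l' (Pat r r' vs) = Pat (Nd l r) (Nd l' r') vs"

primrec keep :: "tr list \<Rightarrow> pat" where
  "keep [] = Pat Dead Dead []" | "keep (v # vs) = Pat v v vs"

primrec drp :: "tr list \<Rightarrow> pat" where
  "drp [] = Pat Dead Dead []" | "drp (v # vs) = Pat v Dead vs"

text \<open>Spells out a trie only along the addresses \<open>ps\<close>. Off these addresses both
  trees carry the same variable from \<open>vs\<close>; at an address the left tree has a variable
  and the right one \<open>Dead\<close>. Rewriting the left tree to the right one thus performs all
  deletions at once and shares the untouched subtrees. The number bounds the depth.\<close>

primrec pt :: "nat \<Rightarrow> bool list list \<Rightarrow> tr list \<Rightarrow> pat" where
  "pt 0 ps vs = Pat Dead Dead vs"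
| "pt (Suc n) ps vs = (case ps of [] \<Rightarrow> keep vs | p # ps' \<Rightarrow> (case p of [] \<Rightarrow> drp vs
     | b # q \<Rightarrow> (case pt n (lefts ps) vs of Pat l l' us \<Rightarrow> join l l' (pt n (rights ps) us))))"

text \<open>Holds back the right half until the left half has been evaluated and the variables it
  leaves over are known.\<close>

definition jn :: "nat \<Rightarrow> bool list list \<Rightarrow> pat \<Rightarrow> pat" where
  "jn n ps t = (case t of Pat l l' us \<Rightarrow> join l l' (pt n ps us))"

lemma pt_simps:
  "pt (Suc n) [] vs = keep vs"
  "pt (Suc n) ([] # ps) vs = drp vs"
  "pt (Suc n) ((b # p) # ps) vs = jn n (rights ((b # p) # ps)) (pt n (lefts ((b # p) # ps)) vs)"
  "jn n ps (Pat l l' us) = join l l' (pt n ps us)"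
  by (simp_all add: jn_def del: lefts.simps rights.simps)

lemma lefts_simps:
  "lefts [] = []" "lefts ((False # p) # ps) = p # lefts ps" "lefts ((True # p) # ps) = lefts ps"
  "rights [] = []" "rights ((False # p) # ps) = rights ps" "rights ((True # p) # ps) = p # rights ps"
  by simp_all

lemma set_lefts: "q \<in> set (lefts ps) \<longleftrightarrow> False # q \<in> set ps"
  by (induction ps) (auto split: list.split)

lemma set_rights: "q \<in> set (rights ps) \<longleftrightarrow> True # q \<in> set ps"
  by (induction ps) (auto split: list.split)

lemma indep_Cons: "indep (b # p) (c # q) \<longleftrightarrow> b \<noteq> c \<or> indep p q"
proof
  assume "indep (b # p) (c # q)"
  then show "b \<noteq> c \<or> indep p q" unfolding indep_def
    by (metis Suc_less_eq length_Cons not0_implies_Suc nth_Cons_0 nth_Cons_Suc)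
next
  assume "b \<noteq> c \<or> indep p q"
  then show "indep (b # p) (c # q)" unfolding indep_def
    by (metis Suc_less_eq length_Cons nth_Cons_0 nth_Cons_Suc zero_less_Suc)
qed

lemma indep_Nil: "\<not> indep [] q" "\<not> indep q []"
  by (simp_all add: indep_def)

lemma pt_get:
  assumes "pt n ps vs = Pat l l' us" "\<forall>p\<in>set ps. p = q \<or> indep q p"
  shows "get q l' = (if q \<in> set ps then Dead else get q l)"
  using assms
proof (induction n arbitrary: ps vs l l' us q)
  case 0
  then show ?case by auto
next
  case (Suc n)
  show ?case
  proof (cases ps)
    case Nil
    with Suc.prems show ?thesis by (cases vs) auto
  next
    case ps: (Cons p ps')
    show ?thesis
    proof (cases p)
      case Nil
      with Suc.prems ps have "q = []" by (auto simp: indep_Nil)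
      with Suc.prems ps Nil show ?thesis by (cases vs) auto
    next
      case p: (Cons b p')
      have "q \<noteq> []" using Suc.prems(2) ps p by (auto simp: indep_Nil)
      then obtain c q' where q: "q = c # q'" by (cases q) auto
      obtain l1 l1' us1 where 1: "pt n (lefts ps) vs = Pat l1 l1' us1" by (metis pat.exhaust)
      obtain l2 l2' us2 where 2: "pt n (rights ps) us1 = Pat l2 l2' us2" by (metis pat.exhaust)
      have L: "l = Nd l1 l2" "l' = Nd l1' l2'" using Suc.prems(1) 1 2 ps p by auto
      show ?thesis
      proof (cases c)
        case True
        have "\<forall>p\<in>set (rights ps). p = q' \<or> indep q' p"
          using Suc.prems(2) True by (auto simp: set_rights q indep_Cons)
        with Suc.IH[OF 2] show ?thesis by (simp add: L q True set_rights)
      next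
        case False
        have "\<forall>p\<in>set (lefts ps). p = q' \<or> indep q' p"
          using Suc.prems(2) False by (fastforce simp: set_lefts q indep_Cons)
        with Suc.IH[OF 1] show ?thesis by (simp add: L q False set_lefts)
      qed
    qed
  qed
qed

section \<open>Walks along a window with the free residue as an unknown\<close>

primrec fw :: "(lt list \<Rightarrow> tr \<Rightarrow> tr) \<Rightarrow> lt list \<Rightarrow> lt \<Rightarrow> lt \<Rightarrow> lt \<Rightarrow> pat \<Rightarrow> bool" where
  "fw W us y a z (Pat l l' vs) \<longleftrightarrow> W (y # a # us) l = W (z # us) l'"

text \<open>At an entry \<open>a\<close> with offset \<open>y\<close> the tested values are
  \<open>v + y + a\<close> and \<open>v + y + 2 * a\<close>. These are the solutions
  \<open>v\<close> for the value 0, and for each forbidden value \<open>c\<close> of the former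
  sum.\<close>

definition kls :: "nat \<Rightarrow> bool \<Rightarrow> (lt \<Rightarrow> lt list) \<Rightarrow> lt \<Rightarrow> lt \<Rightarrow> lt list" where
  "kls h p f y a = ng h (pl h y a) # (if p then [] else [ng h (pl h (pl h y a) a)]) @
     map (\<lambda>c. pl h c (ng h (pl h y a))) (f a)"

definition blf :: "(lt \<Rightarrow> lt list) \<Rightarrow> nat \<Rightarrow> nat list" where
  "blf f a = map val (f (R a))"

text \<open>Every sum met by \<open>hits\<close> is \<open>v + y\<close> with the same unknown
  \<open>v\<close>, so one pass over the window serves all residues. In the parity mode an entry
  where \<open>C\<close> holds forbids nothing.\<close>

primrec wk :: "nat \<Rightarrow> bool \<Rightarrow> (lt \<Rightarrow> lt list) \<Rightarrow> lt \<Rightarrow> lt list \<Rightarrow> tr \<Rightarrow> tr" where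
  "wk h p f y [] T = T"
| "wk h p f y (l # us) T = wk h p f (pl h (pl h y l) l) us
     (if p \<and> \<not> isR (core p l) then T else fold (\<lambda>k. kill (pa h k)) (kls h p f y (R (val l))) T)"

lemma neg_mod:
  fixes v k h :: nat
  assumes "v < h" "c < h"
  shows "(v + k) mod h = c \<longleftrightarrow> v = (c + (h - k mod h) mod h) mod h"
proof -
  have "(v + k) mod h = c \<longleftrightarrow> (v + k mod h) mod h = c" by (simp add: mod_simps)
  also have "\<dots> \<longleftrightarrow> v = (c + (1 * h - k mod h)) mod h"
    using assms by (intro mod_flip) (auto simp: less_imp_le)
  also have "(c + (1 * h - k mod h)) mod h = (c + (h - k mod h) mod h) mod h"
    by (simp add: mod_simps)
  finally show ?thesis .
qed

lemma val_kls: "0 < h \<Longrightarrow> k \<in> set (kls h p f y a) \<Longrightarrow> val k < h"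
  by (auto simp: kls_def ng_def pl_def split: if_splits)

lemma get_kls:
  assumes "v < h" "h \<le> 64" "\<forall>k\<in>set ks. val k < h"
  shows "get (path h v) (fold (\<lambda>k. kill (pa h k)) ks T) = (if v \<in> val ` set ks then Dead else get (path h v) T)"
proof -
  have "fold (\<lambda>k. kill (pa h k)) ks T = fold (\<lambda>k. kill (path h k)) (map val ks) T"
    by (simp add: fold_map comp_def pa_def)
  then show ?thesis using get_kills[OF assms(1,2), of "map val ks"] assms(3) by simp
qed

text \<open>Each test in \<open>hits\<close> is an equation in which the free residue has
  coefficient 1, so it excludes exactly one residue.\<close>

lemma wk_hits:
  assumes e: "hh e = h" "pm e = p" "bl e = blf f" and h: "h \<le> 64" and f: "\<And>a. \<forall>c\<in>set (f a). val c < h"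
    and v: "v < h"
  shows "get (path h v) (wk h p f y us T) = Dead \<longleftrightarrow> get (path h v) T = Dead \<or> hits e ((v + val y) mod h) us"
proof (induction us arbitrary: y T)
  case Nil
  then show ?case by simp
next
  case (Cons l us)
  let ?a = "val l"
  have h0: "0 < h" using v by simp
  have n: "(v + val (pl h (pl h y l) l)) mod h = ((v + val y) mod h + 2 * ?a) mod h"
  proof -
    have "(v + val (pl h (pl h y l) l)) mod h = (v + val y + 2 * ?a) mod h"
      by (simp add: pl_def mod_simps mult_2 add.assoc)
    also have "\<dots> = ((v + val y) mod h + 2 * ?a) mod h" by (simp add: mod_simps)
    finally show ?thesis .
  qed
  have 1: "((v + val y) mod h + ?a) mod h = c \<longleftrightarrow> v = (c + (h - (val y + ?a) mod h) mod h) mod h" if "c < h" for c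
    using neg_mod[OF v that, of "val y + ?a"] by (simp add: mod_simps add.assoc)
  have 2: "((v + val y) mod h + 2 * ?a) mod h = 0 \<longleftrightarrow> v = (0 + (h - (val y + 2 * ?a) mod h) mod h) mod h"
    using neg_mod[OF v h0, of "val y + 2 * ?a"] by (simp add: mod_simps add.assoc)
  have v1: "val (ng h (pl h y (R ?a))) = (0 + (h - (val y + ?a) mod h) mod h) mod h"
    by (simp add: ng_def pl_def)
  have v2: "val (ng h (pl h (pl h y (R ?a)) (R ?a))) = (0 + (h - (val y + 2 * ?a) mod h) mod h) mod h"
    by (simp add: ng_def pl_def mod_simps mult_2 add.assoc)
  have v3: "val (pl h c (ng h (pl h y (R ?a)))) = (val c + (h - (val y + ?a) mod h) mod h) mod h" for c
    by (simp add: ng_def pl_def)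
  have b: "((v + val y) mod h + ?a) mod h \<in> set (bl e ?a) \<longleftrightarrow>
      v \<in> val ` set (map (\<lambda>c. pl h c (ng h (pl h y (R ?a)))) (f (R ?a)))"
  proof -
    have "((v + val y) mod h + ?a) mod h \<in> set (bl e ?a) \<longleftrightarrow> (\<exists>c\<in>set (f (R ?a)). ((v + val y) mod h + ?a) mod h = val c)"
      by (auto simp: e blf_def)
    also have "\<dots> \<longleftrightarrow> (\<exists>c\<in>set (f (R ?a)). v = val (pl h c (ng h (pl h y (R ?a)))))"
      using 1 f unfolding v3 by (intro bex_cong) auto
    finally show ?thesis by auto
  qed
  have g: "get (path h v) (fold (\<lambda>k. kill (pa h k)) (kls h p f y (R ?a)) T) =
      (if v \<in> val ` set (kls h p f y (R ?a)) then Dead else get (path h v) T)"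
    using val_kls[OF h0] by (intro get_kls v h) auto
  have k: "v \<in> val ` set (kls h p f y (R ?a)) \<longleftrightarrow> ((v + val y) mod h + ?a) mod h = 0 \<or>
      \<not> p \<and> ((v + val y) mod h + 2 * ?a) mod h = 0 \<or> ((v + val y) mod h + ?a) mod h \<in> set (bl e ?a)"
    unfolding b 1[OF h0] 2 v1[symmetric] v2[symmetric] by (auto simp: kls_def image_Un)
  show ?case
  proof (cases "p \<and> \<not> isR (core p l)")
    case True
    then have F: "isR (core p l) = False" "(\<not> p) = False" by blast+
    show ?thesis
      unfolding wk.simps Cons.IH n hits.simps e if_P[OF True] unfolding F by blast
  next
    case False
    have ifD: "(if X then Dead else t) = Dead \<longleftrightarrow> X \<or> t = Dead" for X t by simp
    have F: "(\<not> p \<or> isR (core p l)) = True" using False by blast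
    show ?thesis
      unfolding wk.simps Cons.IH n hits.simps e if_not_P[OF False] g ifD k[unfolded e] F by blast
  qed
qed

lemma fold_kill_Nd: "[] \<notin> set ps \<Longrightarrow> fold kill ps (Nd l r) = Nd (fold kill (lefts ps) l) (fold kill (rights ps) r)"
  by (induction ps arbitrary: l r) (auto split: list.split)

text \<open>No address is a proper prefix of another one, so the deletions split into independent
  ones in the two subtrees.\<close>

lemma pt_kill:
  assumes "pt n ps vs = Pat l l' us" "\<forall>p\<in>set ps. \<forall>q\<in>set ps. p = q \<or> indep p q" "\<forall>p\<in>set ps. length p < n"
  shows "fold kill ps l = l'"
  using assms
proof (induction n arbitrary: ps vs l l' us)
  case 0
  then show ?case by (cases ps) auto
next
  case (Suc n)
  show ?case
  proof (cases ps)
    case Nil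
    with Suc.prems show ?thesis by (cases vs) auto
  next
    case ps: (Cons p ps')
    show ?thesis
    proof (cases p)
      case Nil
      with Suc.prems ps have "\<forall>q\<in>set ps'. q = []" by (auto simp: indep_Nil)
      then have "fold kill ps' Dead = Dead" by (induction ps') auto
      with Suc.prems ps Nil show ?thesis by (cases vs) auto
    next
      case p: (Cons b p')
      have ne: "[] \<notin> set ps" using Suc.prems(2) ps p by (auto simp: indep_Nil)
      obtain l1 l1' us1 where 1: "pt n (lefts ps) vs = Pat l1 l1' us1" by (metis pat.exhaust)
      obtain l2 l2' us2 where 2: "pt n (rights ps) us1 = Pat l2 l2' us2" by (metis pat.exhaust)
      have L: "l = Nd l1 l2" "l' = Nd l1' l2'" using Suc.prems(1) 1 2 ps p by auto
      have "fold kill (lefts ps) l1 = l1'"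
        using Suc.prems(2,3) by (intro Suc.IH[OF 1]) (fastforce simp: set_lefts indep_Cons)+
      moreover have "fold kill (rights ps) l2 = l2'"
        using Suc.prems(2,3) by (intro Suc.IH[OF 2]) (fastforce simp: set_rights indep_Cons)+
      ultimately show ?thesis by (simp add: L fold_kill_Nd[OF ne])
    qed
  qed
qed

text \<open>Justifies the depth 7 of the deletion patterns: words have at most 6 digits.\<close>

lemma length_path: "length (path h v) < 7"
  by (simp add: path_def code_def)

text \<open>One rule for each offset \<open>y\<close> and each value \<open>a\<close>. The patterns
  are still symbolic here; for a concrete modulus they are evaluated into trees with
  variables.\<close>

lemma walk_table:
  assumes W: "\<And>us T. W us T = wk h p f (hd us) (tl us) T" and h: "0 < h" "h \<le> 64"
  shows "list_all (\<lambda>y. list_all (\<lambda>a. fw W us y a (pl h (pl h y a) a)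
     (pt (Suc (Suc (Suc (Suc (Suc (Suc (Suc 0))))))) (map (pa h) (kls h p f y a)) vs)) (map R ns)) (map R ns)"
proof -
  have "fw W us y (R a) (pl h (pl h y (R a)) (R a)) (pt (Suc (Suc (Suc (Suc (Suc (Suc (Suc 0))))))) (map (pa h) (kls h p f y (R a))) vs)" for y a
  proof -
    obtain l l' us' where pt: "pt (Suc (Suc (Suc (Suc (Suc (Suc (Suc 0))))))) (map (pa h) (kls h p f y (R a))) vs = Pat l l' us'" by (metis pat.exhaust)
    have "fold kill (map (pa h) (kls h p f y (R a))) l = l'"
    proof (rule pt_kill[OF pt])
      have "pa h k = pa h k' \<or> indep (pa h k) (pa h k')"
        if "k \<in> set (kls h p f y (R a))" "k' \<in> set (kls h p f y (R a))" for k k'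
        using path_indep[OF val_kls[OF h(1) that(1)] val_kls[OF h(1) that(2)] h(2)] unfolding pa_def by fastforce
      then show "\<forall>p'\<in>set (map (pa h) (kls h p f y (R a))). \<forall>q\<in>set (map (pa h) (kls h p f y (R a))). p' = q \<or> indep p' q"
        by auto
      show "\<forall>p'\<in>set (map (pa h) (kls h p f y (R a))). length p' < (Suc (Suc (Suc (Suc (Suc (Suc (Suc 0)))))))"
        using length_path by (auto simp: pa_def numeral_eq_Suc)
    qed
    then show ?thesis by (simp add: pt W core_def fold_map comp_def del: pt.simps)
  qed
  then show ?thesis by (simp add: list_all_iff)
qed

section \<open>Tries as exact records of the surviving residues\<close>

lemma itm_kill:
  "\<forall>x\<in>set (itm T). fst x = p \<or> indep (fst x) p \<Longrightarrow> set (itm (kill p T)) = {x \<in> set (itm T). fst x \<noteq> p}"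
proof (induction p arbitrary: T)
  case Nil
  then show ?case by (auto simp: indep_Nil)
next
  case (Cons b p)
  show ?case
  proof (cases T)
    case (Nd l r)
    show ?thesis
    proof (cases b)
      case True
      have "\<forall>x\<in>set (itm r). fst x = p \<or> indep (fst x) p"
        using Cons.prems by (simp add: Nd True indep_Cons ball_Un)
      from Cons.IH[OF this] show ?thesis by (auto simp: Nd True)
    next
      case False
      have "\<forall>x\<in>set (itm l). fst x = p \<or> indep (fst x) p"
        using Cons.prems by (simp add: Nd False indep_Cons ball_Un)
      from Cons.IH[OF this] show ?thesis by (auto simp: Nd False)
    qed
  next
    case Dead
    then show ?thesis using Cons.IH[of Dead] by auto
  next
    case (Lf l)
    then show ?thesis using Cons.prems by (auto simp: indep_Nil)
  qed
qed

lemma itm_put: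
  "\<forall>x\<in>set (itm T). fst x = p \<or> indep (fst x) p \<Longrightarrow> set (itm (put p v T)) = insert (p, v) {x \<in> set (itm T). fst x \<noteq> p}"
proof (induction p arbitrary: T)
  case Nil
  then show ?case by (auto simp: indep_Nil)
next
  case (Cons b p)
  show ?case
  proof (cases T)
    case (Nd l r)
    show ?thesis
    proof (cases b)
      case True
      have "\<forall>x\<in>set (itm r). fst x = p \<or> indep (fst x) p"
        using Cons.prems by (simp add: Nd True indep_Cons ball_Un)
      from Cons.IH[OF this] show ?thesis by (auto simp: Nd True)
    next
      case False
      have "\<forall>x\<in>set (itm l). fst x = p \<or> indep (fst x) p"
        using Cons.prems by (simp add: Nd False indep_Cons ball_Un)
      from Cons.IH[OF this] show ?thesis by (auto simp: Nd False)
    qed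
  next
    case Dead
    then show ?thesis using Cons.IH[of Dead] by auto
  next
    case (Lf l)
    then show ?thesis using Cons.prems by (auto simp: indep_Nil)
  qed
qed

lemma good_paths:
  assumes "good h T" "k < h" "h \<le> 64" "x \<in> set (itm T)"
  shows "fst x = path h k \<or> indep (fst x) (path h k)"
proof -
  obtain v where "v < h" "fst x = path h v" using assms(1,4) unfolding good_def by auto
  then show ?thesis using path_indep[OF _ assms(2,3), of v] by (cases "v = k") auto
qed

lemma good_kill:
  assumes "good h T" "k < h" "h \<le> 64"
  shows "good h (kill (path h k) T)"
proof -
  have *: "set (itm (kill (path h k) T)) = {x \<in> set (itm T). fst x \<noteq> path h k}"
    using good_paths[OF assms] by (intro itm_kill) blast
  have g: "get (path h v) (kill (path h k) T) = (if v = k then Dead else get (path h v) T)" if "v < h" for v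
    using get_kills[OF that assms(3), of "[k]" T] assms(2) by simp
  have "path h v \<noteq> path h k" if "v < h" "v \<noteq> k" for v
    using path_indep[OF that(1) assms(2,3) that(2)] by (auto simp: indep_def)
  then have "{x \<in> (\<lambda>v. (path h v, R v)) ` {v. v < h \<and> get (path h v) T \<noteq> Dead}. fst x \<noteq> path h k}
      = (\<lambda>v. (path h v, R v)) ` {v. v < h \<and> v \<noteq> k \<and> get (path h v) T \<noteq> Dead}"
    by force
  moreover have "{v. v < h \<and> v \<noteq> k \<and> get (path h v) T \<noteq> Dead} = {v. v < h \<and> get (path h v) (kill (path h k) T) \<noteq> Dead}"
    using g by (auto split: if_splits)
  ultimately show ?thesis unfolding good_def * assms(1)[unfolded good_def] by simp
qed

lemma get_put:
  assumes "v < h" "k < h" "h \<le> 64"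
  shows "get (path h v) (put (path h k) l T) = (if v = k then Lf l else get (path h v) T)"
  using path_indep[OF assms] by (auto simp: get_put_same get_put_indep)

lemma good_put:
  assumes "good h T" "k < h" "h \<le> 64"
  shows "good h (put (path h k) (R k) T)"
proof -
  have *: "set (itm (put (path h k) (R k) T)) = insert (path h k, R k) {x \<in> set (itm T). fst x \<noteq> path h k}"
    using good_paths[OF assms] by (intro itm_put) blast
  have "path h v \<noteq> path h k" if "v < h" "v \<noteq> k" for v
    using path_indep[OF that(1) assms(2,3) that(2)] by (auto simp: indep_def)
  then have 1: "{x \<in> (\<lambda>v. (path h v, R v)) ` {v. v < h \<and> get (path h v) T \<noteq> Dead}. fst x \<noteq> path h k}
      = (\<lambda>v. (path h v, R v)) ` {v. v < h \<and> v \<noteq> k \<and> get (path h v) T \<noteq> Dead}"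
    by force
  have 2: "{v. v < h \<and> get (path h v) (put (path h k) (R k) T) \<noteq> Dead} = insert k {v. v < h \<and> v \<noteq> k \<and> get (path h v) T \<noteq> Dead}"
    using get_put[OF _ assms(2,3)] assms(2) by force
  show ?thesis unfolding good_def * assms(1)[unfolded good_def] 1 2 by simp
qed

lemma good_fold_kill: "good h T \<Longrightarrow> h \<le> 64 \<Longrightarrow> \<forall>k\<in>set ks. val k < h \<Longrightarrow> good h (fold (\<lambda>k. kill (pa h k)) ks T)"
  by (induction ks arbitrary: T) (auto simp: good_kill pa_def)

lemma good_wk: "good h T \<Longrightarrow> 0 < h \<Longrightarrow> h \<le> 64 \<Longrightarrow> good h (wk h p f y us T)"
proof (induction us arbitrary: y T)
  case (Cons l us)
  have "good h (fold (\<lambda>k. kill (pa h k)) (kls h p f y (R (val l))) T)"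
    using good_fold_kill[OF Cons.prems(1,3)] val_kls[OF Cons.prems(2)] by blast
  with Cons show ?case by (simp only: wk.simps split: if_split) blast
qed simp

lemma kill_commute: "indep p q \<Longrightarrow> kill p (kill q t) = kill q (kill p t)"
proof (induction p arbitrary: q t)
  case Nil
  then show ?case by (simp add: indep_Nil)
next
  case (Cons b p)
  then obtain c q' where "q = c # q'" by (cases q) (auto simp: indep_Nil)
  with Cons show ?case by (auto simp: indep_Cons)
qed

lemma kill_idem: "kill p (kill p t) = kill p t"
  by (induction p arbitrary: t) auto

text \<open>The new deletion can be moved past those at separated addresses until it meets its own
  copy. This makes the trie without survivors a fixed point of every walk.\<close>

lemma kill_fold:
  assumes "p \<in> set ps" "\<forall>q\<in>set ps. p = q \<or> indep p q"
  shows "kill p (fold kill ps t) = fold kill ps t"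
  using assms
proof (induction ps rule: rev_induct)
  case (snoc q ps)
  show ?case
  proof (cases "p = q")
    case True
    then show ?thesis by (simp add: kill_idem)
  next
    case False
    with snoc have "indep p q" "kill p (fold kill ps t) = fold kill ps t" by auto
    then show ?thesis using kill_commute[of p q "fold kill ps t"] by simp
  qed
qed simp

section \<open>Tables as balanced conjunctions\<close>

fun ev :: "'a list \<Rightarrow> 'a list" where
  "ev [] = []" | "ev [x] = [x]" | "ev (x # y # xs) = x # ev xs"

fun od :: "'a list \<Rightarrow> 'a list" where
  "od [] = []" | "od [x] = []" | "od (x # y # xs) = y # od xs"

lemma ev_od: "list_all P (ev xs) \<and> list_all P (od xs) \<longleftrightarrow> list_all P xs"
  by (induction xs rule: ev.induct) auto

text \<open>A conjunction of depth \<open>n\<close>, obtained by splitting into even and odd places;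
  the rules of a large table are then reached by few projections, two levels at a time with
  \<open>q1\<close> to \<open>q4\<close>.\<close>

primrec bal :: "nat \<Rightarrow> ('a \<Rightarrow> bool) \<Rightarrow> 'a list \<Rightarrow> bool" where
  "bal 0 P xs = list_all P xs"
| "bal (Suc n) P xs = (bal n P (ev xs) \<and> bal n P (od xs))"

lemma bal_iff: "bal n P xs = list_all P xs"
  by (induction n arbitrary: xs) (simp_all add: ev_od)

lemma bal1: "list_all P xs \<Longrightarrow> bal n P xs"
  by (simp add: bal_iff)

lemma bal2: "list_all (\<lambda>y. list_all (P y) xs) ys \<Longrightarrow> bal n (\<lambda>y. bal n (P y) xs) ys"
  by (simp add: bal_iff)

lemma q1: "(a \<and> b) \<and> c \<and> d \<Longrightarrow> a" and q2: "(a \<and> b) \<and> c \<and> d \<Longrightarrow> b"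
  and q3: "(a \<and> b) \<and> c \<and> d \<Longrightarrow> c" and q4: "(a \<and> b) \<and> c \<and> d \<Longrightarrow> d"
  by simp_all

lemma path_table: "list_all (\<lambda>v. pa h (R v) = (if h \<le> 32 then code 4 (32 - h) v else code 5 (64 - h) v)) ns"
  by (simp add: path_def pa_def list_all_iff)

definition nums :: "nat list" where "nums = [0, 1, 2, 3, 4, 5, 6, 7, 8, 9, 10, 11, 12, 13, 14, 15, 16, 17, 18, 19, 20, 21, 22, 23, 24, 25, 26, 27, 28, 29, 30, 31, 32, 33, 34, 35, 36, 37, 38, 39, 40]"

lemma pl_table: "list_all (\<lambda>x. list_all (\<lambda>y. pl h (R x) (R y) = R ((x + y) mod h)) ns) ns"
  by (simp add: pl_def list_all_iff)
lemma ng_table: "list_all (\<lambda>x. ng h (R x) = R ((h - x) mod h)) ns"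
  by (simp add: ng_def list_all_iff)
lemma mt_table: "list_all (\<lambda>x. list_all (\<lambda>y. mt h (R x) (R y) = R ((x * y) mod h)) ns) ns"
  by (simp add: mt_def list_all_iff)
lemma eqr_table: "list_all (\<lambda>x. list_all (\<lambda>y. eqr (R x) (R y) = (x = y)) ns) ns"
  by (simp add: eqr_def list_all_iff)

lemma bits_numeral: "bits 4 v = bits (Suc (Suc (Suc (Suc 0)))) v" "bits 5 v = bits (Suc (Suc (Suc (Suc (Suc 0))))) v"
  "bits (Suc 4) v = bits (Suc (Suc (Suc (Suc (Suc 0))))) v" "bits (Suc 5) v = bits (Suc (Suc (Suc (Suc (Suc (Suc 0)))))) v"
  by (simp_all add: numeral_eq_Suc)

lemma nat_01: "nat 0 = (0::nat)" "nat 1 = (1::nat)"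
  by simp_all

lemmas arith = nat_01 list.pred_inject div_0 mod_0 mod_by_1 one_mod_numeral numeral_mod_numeral
      of_bool_eq one_neq_zero
      numeral_neq_zero arith_simps arith_special divmod_trivial
      divmod_cancel divmod_steps divmod_step_def fst_conv snd_conv numeral_One
      case_prod_beta rel_simps if_True if_False simp_thms
      numeral_times_numeral mult_zero_right mult_1_right mult_zero_left mult_1_left add_0_left add_0_right
      euclidean_size_nat_less_eq_iff diff_nat_numeral nat_numeral

lemmas bal_simps = bal.simps ev.simps od.simps list.pred_inject simp_thms

lemmas shape_simps = bal_simps kls_def pt_simps lefts_simps join.simps keep.simps drp.simps fw.simps
   list.map if_True if_False append.simps

primrec asc :: "(lt \<times> 'a list) list \<Rightarrow> lt \<Rightarrow> 'a list" where
  "asc [] a = []"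
| "asc (b # xs) a = (if eqr a (fst b) then snd b else asc xs a)"

primrec mkl :: "bool \<Rightarrow> (lt \<times> lt) list \<Rightarrow> lt \<Rightarrow> lt" where
  "mkl p [] c = (if p then E c else c)"
| "mkl p (b # l) c = (if eqr c (fst b) then S c (snd b) else mkl p l c)"

definition mlf :: "(lt \<Rightarrow> (lt \<times> lt) list) \<Rightarrow> nat \<Rightarrow> (nat \<times> nat) list" where
  "mlf f a = map (\<lambda>b. (val (fst b), val (snd b))) (f (R a))"

lemma mark_mkl:
  assumes "ml e = mlf f" "list_all (\<lambda>b. isR (fst b) \<and> isR (snd b)) (f (R a))"
  shows "mark e a c = mkl (pm e) (f (R a)) (R c)"
proof -
  have [simp]: "R (val l) = l" if "isR l" for l using that by (cases l) auto
  have "(case map_of (map (\<lambda>b. (val (fst b), val (snd b))) l) c of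
     None \<Rightarrow> if pm e then E (R c) else R c | Some i \<Rightarrow> S (R c) (R i)) = mkl (pm e) l (R c)"
    if "list_all (\<lambda>b. isR (fst b) \<and> isR (snd b)) l" for l
    using that
  proof (induction l)
    case (Cons b l)
    then have b: "R (val (fst b)) = fst b" "R (val (snd b)) = snd b" by auto
    then have "c = val (fst b) \<longleftrightarrow> R c = fst b" by (metis val.simps(1))
    with Cons b show ?case by (auto simp: eqr_def)
  qed simp
  with assms show ?thesis by (simp add: mark_def mlf_def)
qed

text \<open>The ban tree influences neither the sums nor the marks, so one table serves all ban
  trees.\<close>

lemma gen_table:
  assumes G: "\<And>B us vs. G B us vs = gen (K B) us vs"
    and K: "\<And>B. hh (K B) = h" "\<And>B. pm (K B) = p" "\<And>B. ml (K B) = mlf f"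
    and f: "list_all (\<lambda>a. list_all (\<lambda>b. isR (fst b) \<and> isR (snd b)) (f a)) (map R ns)"
  shows "list_all (\<lambda>a. list_all (\<lambda>y. G B (y # a # us) vs =
     G B (pl h (pl h y a) a # us) (pl h (pl h y a) a # mkl p (f a) (pl h y a) # vs)) (map R ns)) (map R ns)"
proof -
  have "G B (R y # R a # us) vs = G B (pl h (pl h (R y) (R a)) (R a) # us)
      (pl h (pl h (R y) (R a)) (R a) # mkl p (f (R a)) (pl h (R y) (R a)) # vs)" if "a \<in> set ns" for y a
    using mark_mkl[of "K B" f a] that f
    by (simp add: G gen_R K pl_def mod_simps mult_2 add.assoc list_all_iff)
  then show ?thesis by (simp add: list_all_iff)
qed

lemma gen_table_E:
  assumes G: "\<And>B us vs. G B us vs = gen (K B) us vs" and K: "\<And>B. hh (K B) = h"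
  shows "list_all (\<lambda>a. list_all (\<lambda>y. G B (y # E a # us) vs =
     G B (pl h (pl h y a) a # us) (pl h (pl h y a) a # pl h y a # vs)) (map R ns)) (map R ns)"
  by (simp add: list_all_iff G gen_E K pl_def mod_simps mult_2 add.assoc)

lemma walk_table_E:
  assumes W: "\<And>us T. W us T = wk h p f (hd us) (tl us) T" and p: "p"
  shows "list_all (\<lambda>a. list_all (\<lambda>y. W (y # E a # us) T = W (pl h (pl h y a) a # us) T) (map R ns)) (map R ns)"
  by (simp add: list_all_iff W core_def p pl_def)

lemma gen_table_S:
  assumes G: "\<And>B us vs. G B us vs = gen (K B) us vs"
    and K: "\<And>B. hh (K B) = h" "\<And>B. pm (K B) = p" "\<And>B. bt (K B) = B"
  shows "list_all (\<lambda>y. G B (x # S y i # us) vs =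
     bsel h B (mt h i (pl h x y)) (G B (x # (if p then E y else y) # us) vs)) (map R ns)"
proof -
  have "val (mt h i (pl h x (R y))) = (val i * (val x + y)) mod h" for y
    by (simp add: mt_def pl_def mod_simps)
  then show ?thesis
    by (cases p) (auto simp: list_all_iff G gen_def banned_def bsel_def core_def K)
qed

text \<open>The multiples of \<open>i\<close> by repeated addition: the table of products is
  obtained from the table of sums alone.\<close>

primrec gsl :: "nat \<Rightarrow> lt \<Rightarrow> lt list \<Rightarrow> lt \<Rightarrow> (lt \<times> lt) list" where
  "gsl h i [] d = []"
| "gsl h i (x # xs) d = (x, d) # gsl h i xs (pl h d i)"

lemma mt_table':
  assumes ns: "ns = [0..<h]"
  shows "list_all (\<lambda>i. list_all (\<lambda>c. mt h i (fst c) = snd c) (gsl h i (map R ns) (R 0))) (map R ns)"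
proof -
  have *: "list_all (\<lambda>c. mt h i (fst c) = snd c) (gsl h i (map R [h - n..<h]) (R ((val i * (h - n)) mod h)))" if "n \<le> h" for i n
    using that
  proof (induction n)
    case 0
    then show ?case by simp
  next
    case (Suc n)
    let ?k = "h - Suc n"
    have k: "?k < h" "Suc ?k = h - n" using Suc.prems by auto
    have "[?k..<h] = ?k # [h - n..<h]" using k upt_conv_Cons by metis
    moreover have "pl h (R ((val i * ?k) mod h)) i = R ((val i * (h - n)) mod h)"
      unfolding k(2)[symmetric] by (simp add: pl_def mod_simps algebra_simps)
    ultimately show ?case using Suc by (simp add: mt_def)
  qed
  from *[of h] show ?thesis by (simp add: list_all_iff ns)
qed

lemma gsl_bal: "list_all (\<lambda>b. list_all (Q b) (f b)) l \<Longrightarrow> bal n (\<lambda>b. bal m (Q b) (f b)) l"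
  by (simp add: bal_iff)

text \<open>In the pattern only the address of \<open>s\<close> is spelt out; the subtree found
  there decides the test, and everything else is a variable.\<close>

primrec fb :: "nat \<Rightarrow> lt \<Rightarrow> bool \<Rightarrow> pat \<Rightarrow> bool" where
  "fb h s P (Pat l l' vs) \<longleftrightarrow> bsel h l s P = bleaf (get (pa h s) l) P"

lemma bsel_table: "list_all (\<lambda>s. fb h s P (pt n [pa h s] vs)) xs"
proof -
  have "fb h s P x" for s x by (cases x) (simp add: bsel_def bleaf_def pa_def)
  then show ?thesis by (simp add: list_all_iff)
qed

lemma get_simps: "get [] t = t" "get (True # p) (Nd l r) = get p r" "get (False # p) (Nd l r) = get p l"
  by simp_all

definition tree0 :: "nat \<Rightarrow> lt list \<Rightarrow> tr" where
  "tree0 h C = fold (\<lambda>v. put (pa h v) v) C Dead"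

text \<open>The empty set in the shape of a full trie: the patterns match branching nodes, which a
  bare \<open>Dead\<close> would not provide.\<close>

definition treeD :: "nat \<Rightarrow> lt list \<Rightarrow> tr" where
  "treeD h C = fold (\<lambda>v. kill (pa h v)) C (tree0 h C)"

lemma tree_simps:
  "put [] v t = Lf v"
  "put (True # p) v (Nd l r) = Nd l (put p v r)" "put (False # p) v (Nd l r) = Nd (put p v l) r"
  "put (True # p) v Dead = Nd Dead (put p v Dead)" "put (False # p) v Dead = Nd (put p v Dead) Dead"
  "kill [] t = Dead"
  "kill (True # p) (Nd l r) = Nd l (kill p r)" "kill (False # p) (Nd l r) = Nd (kill p l) r"
  by simp_all

lemma fold_pa: "fold (\<lambda>v. g (pa h v)) (map R ns) = fold (\<lambda>v. g (path h v)) ns"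
  by (simp add: fold_map comp_def pa_def)

lemma tree0_props:
  assumes "h \<le> 64" "\<forall>k\<in>set ns. k < h"
  shows "good h (tree0 h (map R ns)) \<and> (\<forall>v<h. get (path h v) (tree0 h (map R ns)) = (if v \<in> set ns then Lf (R v) else Dead))"
  using assms(2)
proof (induction ns rule: rev_induct)
  case Nil
  then show ?case by (simp add: tree0_def good_def)
next
  case (snoc k ns)
  then show ?case
    using good_put[of h "tree0 h (map R ns)" k] assms(1) get_put[of _ h k]
    by (auto simp: tree0_def pa_def)
qed

lemma get_tree0: "v < h \<Longrightarrow> h \<le> 64 \<Longrightarrow> get (path h v) (tree0 h (map R [0..<h])) = Lf (R v)"
  using tree0_props[of h "[0..<h]"] by simp

lemma good_tree0: "h \<le> 64 \<Longrightarrow> good h (tree0 h (map R [0..<h]))"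
  using tree0_props[of h "[0..<h]"] by simp

lemma good_treeD: "h \<le> 64 \<Longrightarrow> good h (treeD h (map R [0..<h]))"
  unfolding treeD_def by (intro good_fold_kill good_tree0) auto

lemma get_treeD: "v < h \<Longrightarrow> h \<le> 64 \<Longrightarrow> get (path h v) (treeD h (map R [0..<h])) = Dead"
  using get_kills[of v h "[0..<h]"] by (simp add: treeD_def fold_pa)

primrec lv :: "tr \<Rightarrow> lt list \<Rightarrow> lt list" where
  "lv Dead vs = vs"
| "lv (Lf l) vs = l # vs"
| "lv (Nd a b) vs = lv a (lv b vs)"

lemma lv_itm: "lv T vs = map snd (itm T) @ vs"
  by (induction T arbitrary: vs) auto

lemma lv_skip:
  "lv (Nd Dead r) vs = lv r vs"
  "lv (Nd r Dead) vs = lv r vs"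
  "lv (Nd (Nd Dead Dead) r) vs = lv r vs"
  "lv (Nd r (Nd Dead Dead)) vs = lv r vs"
  "lv (Nd (Lf l) r) vs = l # lv r vs"
  "lv (Nd r (Lf l)) vs = lv r (l # vs)"
  "lv (Nd (Nd (Nd Dead Dead) (Nd Dead Dead)) r) vs = lv r vs"
  "lv (Nd r (Nd (Nd Dead Dead) (Nd Dead Dead))) vs = lv r vs"
  "lv (Nd (Nd (Nd (Nd Dead Dead) (Nd Dead Dead)) (Nd (Nd Dead Dead) (Nd Dead Dead))) r) vs = lv r vs"
  "lv (Nd r (Nd (Nd (Nd Dead Dead) (Nd Dead Dead)) (Nd (Nd Dead Dead) (Nd Dead Dead)))) vs = lv r vs"
  by simp_all

primrec fin :: "(tr \<Rightarrow> lt list \<Rightarrow> lt list \<Rightarrow> bool) \<Rightarrow> bw \<Rightarrow> lt list \<Rightarrow> bool" where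
  "fin G x [] = True"
| "fin G x (v # vs) = (G (ban x) (v # win x) [v] \<and> fin G x vs)"

lemma fin_simps:
  "fin G x [] = True"
  "fin G (BW B ws) [v] = G B (v # ws) [v]"
  "fin G (BW B ws) (v # vs) = (G B (v # ws) [v] \<and> fin G (BW B ws) vs)"
  by simp_all

lemma fin_all: "fin G x vs \<longleftrightarrow> (\<forall>v\<in>set vs. G (ban x) (v # win x) [v])"
  by (induction vs) auto

text \<open>After the walk the leaves are the residues that were alive before and for which
  \<open>hits\<close> fails; only these need a child.\<close>

lemma fin_gen:
  assumes G: "\<And>B us vs. G B us vs = gen (K B) us vs"
    and W: "\<And>us T. W us T = wk h p f (hd us) (tl us) T"
    and K: "\<And>B. hh (K B) = h" "\<And>B. pm (K B) = p" "\<And>B. bl (K B) = blf f"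
    and f: "\<And>a. \<forall>c\<in>set (f a). val c < h" and h: "0 < h" "h \<le> 64" and T: "good h T"
  shows "fin G (BW B ws) (lv (W (R 0 # ws) T) []) \<longleftrightarrow>
    (\<forall>v<h. get (path h v) T = Dead \<or> hits (K B) v ws \<or> gen (K B) (R v # ws) [R v])"
proof -
  have *: "get (path h v) (W (R 0 # ws) T) = Dead \<longleftrightarrow> get (path h v) T = Dead \<or> hits (K B) v ws" if "v < h" for v
    using wk_hits[OF K h(2) f that, of "R 0" ws T] that by (simp add: W)
  have g: "good h (W (R 0 # ws) T)" unfolding W by (intro good_wk T h)
  have "snd ` set (itm (W (R 0 # ws) T)) = R ` {v. v < h \<and> get (path h v) (W (R 0 # ws) T) \<noteq> Dead}"
    unfolding g[unfolded good_def] by (simp add: image_image)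
  then show ?thesis using * by (auto simp: fin_all lv_itm G)
qed

text \<open>Outside the parity mode the residue 0 is removed in advance. In the parity mode the free
  residue stands at an odd index and may vanish.\<close>

lemma node_table:
  assumes G: "\<And>B us vs. G B us vs = gen (K B) us vs"
    and W: "\<And>us T. W us T = wk h p f (hd us) (tl us) T"
    and K: "\<And>B. hh (K B) = h" "\<And>B. pm (K B) = p" "\<And>B. bl (K B) = blf f"
    and f: "\<And>a. \<forall>c\<in>set (f a). val c < h" and h: "0 < h" "h \<le> 64" "ns = [0..<h]"
  shows "G B [x] vs = fin G (BW B vs) (lv (W (R 0 # vs)
     (if p then tree0 h (map R ns) else kill (pa h (R 0)) (tree0 h (map R ns)))) [])"
proof -
  have "get (path h v) (if p then tree0 h (map R ns) else kill (pa h (R 0)) (tree0 h (map R ns))) = Dead \<longleftrightarrow> \<not> p \<and> v = 0"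
    if "v < h" for v
    using get_tree0[OF that h(2)] path_indep[of v h 0] that h(2) get_kill_indep
    by (cases "v = 0") (auto simp: pa_def get_kill_same h(3))
  moreover have "good h (if p then tree0 h (map R ns) else kill (pa h (R 0)) (tree0 h (map R ns)))"
    using good_tree0[OF h(2)] good_kill[OF good_tree0[OF h(2)] h(1,2)] by (simp add: pa_def h(3))
  ultimately show ?thesis
    by (subst fin_gen[OF G W K f h(1,2)]) (auto simp: G gen_Nil ref_iff K)
qed

lemma walk_end:
  assumes W: "\<And>us T. W us T = wk h p f (hd us) (tl us) T"
  shows "W [y] T = T"
  by (simp add: W)

text \<open>Once no residue survives, the rest of the window need not be read.\<close>

lemma walk_dead:
  assumes W: "\<And>us T. W us T = wk h p f (hd us) (tl us) T" and h: "0 < h" "h \<le> 64" "ns = [0..<h]"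
  shows "W us (treeD h (map R ns)) = treeD h (map R ns)"
proof -
  have "kill (path h k) (treeD h (map R ns)) = treeD h (map R ns)" if "k < h" for k
  proof -
    have "path h k = path h q \<or> indep (path h k) (path h q)" if "q < h" for q
      using path_indep[OF \<open>k < h\<close> that h(2)] by fastforce
    then show ?thesis
      unfolding treeD_def fold_pa h(3) fold_map[symmetric, of kill "path h", unfolded comp_def]
      using that by (intro kill_fold) auto
  qed
  then have *: "fold (\<lambda>k. kill (pa h k)) ks (treeD h (map R ns)) = treeD h (map R ns)" if "\<forall>k\<in>set ks. val k < h" for ks
    using that by (induction ks) (auto simp: pa_def)
  have "wk h p f y us (treeD h (map R ns)) = treeD h (map R ns)" for y us
  proof (induction us arbitrary: y)
    case (Cons l us)
    have "fold (\<lambda>k. kill (pa h k)) (kls h p f y (R (val l))) (treeD h (map R ns)) = treeD h (map R ns)"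
      using val_kls[OF h(1)] by (intro *) blast
    then show ?case by (simp only: wk.simps Cons.IH if_cancel)
  qed simp
  then show ?thesis by (simp add: W)
qed

lemma lv_dead: "h \<le> 64 \<Longrightarrow> ns = [0..<h] \<Longrightarrow> lv (treeD h (map R ns)) vs = vs"
proof -
  assume h: "h \<le> 64" "ns = [0..<h]"
  have "set (itm (treeD h (map R ns))) = {}"
    using good_treeD[OF h(1), unfolded good_def] get_treeD[OF _ h(1)] h(2) by auto
  then show ?thesis by (simp add: lv_itm)
qed

lemma walk_table_S:
  assumes W: "\<And>us T. W us T = wk h p f (hd us) (tl us) T"
  shows "list_all (\<lambda>a. W (y # S a i # us) T = W (y # (if p then E a else a) # us) T) (map R ns)"
  by (simp add: list_all_iff W core_def pl_def)

section \<open>Stages with a prescribed first residue, and chains of stages\<close>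

definition stage :: "(tr \<Rightarrow> lt list \<Rightarrow> lt list \<Rightarrow> bool) \<Rightarrow> (lt list \<Rightarrow> tr \<Rightarrow> tr) \<Rightarrow> nat \<Rightarrow> lt list \<Rightarrow> tr \<Rightarrow> tr \<Rightarrow> bool" where
  "stage G W h ws B T = fin G (BW B ws) (lv (W (R 0 # ws) T) [])"

text \<open>Replaces the ban tree, a large term, by a variable \<open>b\<close>. Its content stays
  accessible through the equation for \<open>bsel\<close>, which is applied only when a ban is
  tested.\<close>

lemma stage_abs:
  assumes "\<And>b. (\<And>s P. bsel h b s P = bsel h B s P) \<Longrightarrow> fin G (BW b ws) (lv (W (R 0 # ws) T) [])"
  shows "stage G W h ws B T"
  using assms unfolding stage_def by blast

text \<open>\<open>k\<close> is \<open>- (3 * t + 2 * a0)\<close> modulo \<open>h\<close> and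
  converts a value \<open>s\<close> into the free residue of the root window. One member of a group
  is searched; afterwards the whole group is banned for the groups that follow.\<close>

primrec chain :: "nat \<Rightarrow> (tr \<Rightarrow> tr \<Rightarrow> bool) \<Rightarrow> lt \<Rightarrow> tr \<Rightarrow> tr \<Rightarrow> lt list list \<Rightarrow> bool" where
  "chain h P k D B [] \<longleftrightarrow> True"
| "chain h P k D B (g # gs) \<longleftrightarrow> P B (put (pa h (pl h (hd g) k)) (pl h (hd g) k) D) \<and>
     chain h P k D (fold (\<lambda>s. kill (pa h s)) g B) gs"

text \<open>A pattern has at most as many leaves as there are addresses, so sixty variables are
  enough for all moduli up to 41.\<close>

lemmas walk_table_vs = walk_table[where vs = "[v0, v1, v2, v3, v4, v5, v6, v7, v8, v9, v10, v11, v12, v13, v14, v15, v16, v17, v18, v19, v20, v21, v22, v23, v24, v25, v26, v27, v28, v29, v30, v31, v32, v33, v34, v35, v36, v37, v38, v39, v40, v41, v42, v43, v44, v45, v46, v47, v48, v49, v50, v51, v52, v53, v54, v55, v56, v57, v58, v59]"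
  for v0 v1 v2 v3 v4 v5 v6 v7 v8 v9 v10 v11 v12 v13 v14 v15 v16 v17 v18 v19 v20 v21 v22 v23 v24 v25 v26 v27 v28 v29 v30 v31 v32 v33 v34 v35 v36 v37 v38 v39 v40 v41 v42 v43 v44 v45 v46 v47 v48 v49 v50 v51 v52 v53 v54 v55 v56 v57 v58 v59]

type_synonym marks = "(lt \<times> (lt \<times> lt) list) list"

abbreviation plain_marks :: "marks \<Rightarrow> bool" where
  "plain_marks \<equiv> list_all (\<lambda>b. list_all (\<lambda>b. isR (fst b) \<and> isR (snd b)) (snd b))"

abbreviation less_marks :: "nat \<Rightarrow> marks \<Rightarrow> bool" where
  "less_marks h \<equiv> list_all (\<lambda>b. list_all (\<lambda>c. val (fst c) < h) (snd b))"

lemmas tree_unf = treeD_def tree0_def list.map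
lemmas map_fold = list.map r_fold
lemmas list_simps = list.pred_inject simp_thms if_True if_False
lemmas leaf_simps = fin_simps lv.simps lv_skip simp_thms

lemmas conj4 = q1 q2 q3 q4
lemmas conj16 = conj4[THEN q1] conj4[THEN q2] conj4[THEN q3] conj4[THEN q4]
lemmas conj64 = conj16[THEN q1] conj16[THEN q2] conj16[THEN q3] conj16[THEN q4]

lemma asc_set: "list_all (\<lambda>b. list_all P (snd b)) xs \<Longrightarrow> \<forall>c\<in>set (asc xs a). P c"
  by (induction xs) (auto simp: list_all_iff)

lemma asc_list: "list_all (\<lambda>b. list_all P (snd b)) xs \<Longrightarrow> list_all (\<lambda>a. list_all P (asc xs a)) ys"
proof -
  assume "list_all (\<lambda>b. list_all P (snd b)) xs"
  then have "list_all P (asc xs a)" for a by (induction xs) auto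
  then show ?thesis by (simp add: list_all_iff)
qed

lemma mt_pairs: "list_all (\<lambda>b. mt h (R (snd b)) (R (fst b)) = R ((snd b * fst b) mod h)) l"
  by (simp add: mt_def list_all_iff)

lemmas eqrs0 = eqr_table[of nums, THEN bal2[where n = "Suc (Suc (Suc (Suc (Suc 0))))"], unfolded nums_def, simplified bal_simps arith, unfolded r_fold]
lemmas eqrs1 = eqrs0[THEN q1] eqrs0[THEN q2] eqrs0[THEN q3] eqrs0[THEN q4]
lemmas eqrs2 = eqrs1[THEN q1] eqrs1[THEN q2] eqrs1[THEN q3] eqrs1[THEN q4]
lemmas eqrs3 = eqrs2[THEN q1] eqrs2[THEN q2] eqrs2[THEN q3] eqrs2[THEN q4]
lemmas eqrs = eqrs3[THEN q1] eqrs3[THEN q2] eqrs3[THEN q3] eqrs3[THEN q4]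

text \<open>Congruence rules that make the evaluation lazy: in \<open>bsel\<close> only the tested
  residue is normalised, in \<open>bleaf\<close> nothing, in \<open>fin\<close> only the list of
  survivors. A continuation is entered only after its test.\<close>

lemma bsel_cong: "s = s' \<Longrightarrow> bsel h B s P = bsel h B s' P" by simp
lemma bleaf_cong: "bleaf x P = bleaf x P" ..
lemma fin_cong: "vs = vs' \<Longrightarrow> fin G x vs = fin G x vs'" by simp

section \<open>Soundness of the search\<close>

lemma (in fitted) start_window:
  assumes "int v \<approx> \<sigma> * \<delta> * A (2 * q - \<delta>)" "q \<in> Q" "\<delta> \<in> {1, -1}"
  shows "window (\<sigma> * \<delta>) (- \<delta>) (2 * q - \<delta>) [R v]"
  using assms Q_delta[OF assms(2,3)] C_delta[OF _ assms(2,3)] by (auto simp: okl_def spec_def core_def)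

text \<open>In the first generation the free residue may be prescribed; from the child on, the
  refutation is again one for arbitrary residues.\<close>

lemma (in fitted) root_contr:
  assumes s: "\<sigma> \<in> {1, -1}" "\<delta> \<in> {1, -1}" "window \<sigma> \<delta> q ws" "ws \<noteq> []" "int v \<approx> \<sigma> * \<delta> * A (2 * q - \<delta>)"
    and g: "hits e v ws \<or> gen e (R v # ws) [R v]"
  shows False
proof -
  have q: "q \<in> Q" using s(3,4) by (cases ws) (auto simp: okl_def)
  have "\<not> hits e v ws" by (rule not_hits[OF s(1,2,3,5)])
  with g have gen: "gen e (R v # ws) [R v]" by blast
  obtain vs q' where "gch e v ws [R v] = Some vs" "window (\<sigma> * \<delta>) (- \<delta>) q' vs" "vs \<noteq> []"
    using gch_window[OF s(1,2,3,5) start_window[OF s(5) q s(2)]] by auto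
  moreover from this gen have "ref e vs" by (simp add: gen_def)
  moreover have "- \<delta> \<in> {1, -1}" using s(2) by auto
  ultimately show False using ref_sound pm_sign[OF s(1,2)] by blast
qed

text \<open>The values around \<open>2 * m\<close> are \<open>A (2 * m) + A m\<close>,
  \<open>A (2 * m)\<close> and \<open>A (2 * m) - A m\<close>, so the type alone fixes a window of
  three. Knowing \<open>A (4 * m)\<close> in addition fixes the first free residue.\<close>

lemma (in fitted) root_window:
  assumes m: "m \<in> Q" "pm e \<longrightarrow> \<not> C m" "A m \<approx> a0" "A (2 * m) \<approx> t \<or> A (2 * m) \<approx> - t"
    and x: "int x \<approx> t + a0" "int y \<approx> t" "int z \<approx> t - a0"
    and l: "l = S (R y) (R 1) \<or> l = (if pm e then E (R y) else R y)"
  shows "\<exists>\<sigma> \<delta> q. \<sigma> \<in> {1, -1} \<and> \<delta> \<in> {1, -1} \<and> window \<sigma> \<delta> q [R x, l, R z] \<and>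
    (\<forall>v. int v \<approx> - A (4 * m) - 3 * t - 2 * a0 \<longrightarrow> int v \<approx> \<sigma> * \<delta> * A (2 * q - \<delta>))"
proof -
  have r1: "A (2 * m + 1) \<approx> A (2 * m) + a0"
    using cong_trans[OF rec_right[OF m(1)] cong_add[OF cong_refl m(3)]] .
  have r2: "A (2 * m - 1) \<approx> A (2 * m) - a0"
  proof -
    have "A (2 * m) - A m \<approx> (A (2 * m - 1) + A m) - A m"
      by (rule cong_diff[OF rec_mid[OF m(1)] cong_refl])
    then have "A (2 * m - 1) \<approx> A (2 * m) - A m" by (simp add: cong_sym_eq)
    then show ?thesis using cong_trans cong_diff[OF cong_refl m(3)] by blast
  qed
  have Q: "2 * m - 1 \<in> Q" "2 * m \<in> Q" "2 * m + 1 \<in> Q" using Q_left Q_mid Q_right m(1) by auto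
  have C: "pm e \<Longrightarrow> C (2 * m) \<and> \<not> C (2 * m + 1) \<and> \<not> C (2 * m - 1)"
    using C_mid C_left C_right m by blast
  have cp: "isR (core True l) \<longleftrightarrow> \<not> pm e" if "pm e" using l that by (auto simp: core_def)
  from m(4) show ?thesis
  proof
    assume t: "A (2 * m) \<approx> t"
    have 1: "int x \<approx> 1 * A (2 * m + 1)"
      using cong_trans[OF x(1) cong_sym[OF cong_trans[OF r1 cong_add[OF t cong_refl]]]] by simp
    have 2: "int y \<approx> 1 * A (2 * m)" using cong_trans[OF x(2) cong_sym[OF t]] by simp
    have 3: "int z \<approx> 1 * A (2 * m - 1)"
      using cong_trans[OF x(3) cong_sym[OF cong_trans[OF r2 cong_diff[OF t cong_refl]]]] by simp
    have sp: "spec 1 (- 1) (2 * m) l"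
      using l m(1,2,3) t by (auto simp: spec_def intro!: bexI[of _ m] exI[of _ 1] split: if_splits)
    have w: "window 1 (- 1) (2 * m + 1) [R x, l, R z]"
      using Q C 1 2 3 sp cp l by (auto simp: okl_def core_def spec_def split: if_splits)
    \<comment> \<open>The window starts at \<open>2 * m + 1\<close> and runs downwards, so its free
      residue sits at \<open>4 * m + 3\<close>. The three steps from \<open>4 * m\<close> to there
      contribute \<open>A (2 * m)\<close> once and \<open>A (2 * m + 1)\<close> twice.\<close>
    have "A (4 * m + 3) \<approx> A (4 * m) + 3 * t + 2 * a0"
    proof -
      have a: "A (4 * m + 3) \<approx> A (4 * m + 2) + A (2 * m + 1)" using rec_right[OF Q(3)] by (simp add: algebra_simps)
      have b: "A (4 * m + 2) \<approx> A (4 * m + 1) + A (2 * m + 1)" using rec_mid[OF Q(3)] by (simp add: algebra_simps)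
      have c: "A (4 * m + 1) \<approx> A (4 * m) + A (2 * m)" using rec_right[OF Q(2)] by (simp add: algebra_simps)
      have d: "A (2 * m + 1) \<approx> t + a0" using cong_trans[OF r1 cong_add[OF t cong_refl]] .
      have e: "A (4 * m + 3) \<approx> ((A (4 * m) + A (2 * m)) + A (2 * m + 1)) + A (2 * m + 1)"
        by (rule cong_trans[OF a cong_add[OF cong_trans[OF b cong_add[OF c cong_refl]] cong_refl]])
      have "((A (4 * m) + A (2 * m)) + A (2 * m + 1)) + A (2 * m + 1) \<approx> ((A (4 * m) + t) + (t + a0)) + (t + a0)"
        by (intro cong_add cong_refl t d)
      from cong_trans[OF e this] show ?thesis by (simp add: algebra_simps)
    qed
    then have "- A (4 * m + 3) \<approx> - (A (4 * m) + 3 * t + 2 * a0)" by (simp only: cong_minus_minus_iff)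
    from cong_sym[OF this] have v: "- A (4 * m) - 3 * t - 2 * a0 \<approx> - A (4 * m + 3)"
      by (simp only: minus_add_distrib add_uminus_conv_diff)
    show ?thesis
      by (rule exI[of _ 1], rule exI[of _ "- 1"], rule exI[of _ "2 * m + 1"])
        (use w cong_trans[OF _ v] in \<open>auto simp: algebra_simps\<close>)
  next
    \<comment> \<open>The mirror image: read upwards from \<open>2 * m - 1\<close> and negated, the
      values are again \<open>t + a0\<close>, \<open>t\<close>, \<open>t - a0\<close>, and the free
      residue sits at \<open>4 * m - 3\<close>.\<close>
    assume t: "A (2 * m) \<approx> - t"
    have neg: "u \<approx> - 1 * c" if "u \<approx> - b" "c \<approx> b" for u b c
    proof -
      have "- b \<approx> - c" using cong_sym[OF that(2)] by (simp only: cong_minus_minus_iff)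
      from cong_trans[OF that(1) this] show ?thesis by simp
    qed
    have 1: "int x \<approx> - 1 * A (2 * m - 1)"
      by (rule neg[of _ "- t - a0"]) (use x(1) cong_trans[OF r2 cong_diff[OF t cong_refl]] in \<open>simp_all add: algebra_simps\<close>)
    have 2: "int y \<approx> - 1 * A (2 * m)" by (rule neg[of _ "- t"]) (use x(2) t in simp_all)
    have 3: "int z \<approx> - 1 * A (2 * m + 1)"
      by (rule neg[of _ "- t + a0"]) (use x(3) cong_trans[OF r1 cong_add[OF t cong_refl]] in \<open>simp_all add: algebra_simps\<close>)
    have sp: "spec (- 1) 1 (2 * m) l"
      using l m(1,2,3) t by (auto simp: spec_def intro!: bexI[of _ m] exI[of _ 1] split: if_splits)
    have w: "window (- 1) 1 (2 * m - 1) [R x, l, R z]"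
      using Q C 1 2 3 sp cp l by (auto simp: okl_def core_def spec_def split: if_splits)
    have "A (4 * m - 3) \<approx> A (4 * m) + 3 * t + 2 * a0"
    proof -
      have sub: "u \<approx> v - w" if "v \<approx> u + w" for u v w
        using cong_diff[OF that cong_refl, of w] by (simp add: cong_sym_eq)
      have a: "A (4 * m - 3) \<approx> A (4 * m - 2) - A (2 * m - 1)"
        using sub[OF rec_mid[OF Q(1)]] by (simp add: algebra_simps)
      have b: "A (4 * m - 2) \<approx> A (4 * m - 1) - A (2 * m - 1)"
        using sub[OF rec_right[OF Q(1)]] by (simp add: algebra_simps)
      have c: "A (4 * m - 1) \<approx> A (4 * m) - A (2 * m)" using sub[OF rec_mid[OF Q(2)]] by (simp add: algebra_simps)
      have d: "A (2 * m - 1) \<approx> - t - a0" using cong_trans[OF r2 cong_diff[OF t cong_refl]] .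
      have e: "A (4 * m - 3) \<approx> ((A (4 * m) - A (2 * m)) - A (2 * m - 1)) - A (2 * m - 1)"
        by (rule cong_trans[OF a cong_diff[OF cong_trans[OF b cong_diff[OF c cong_refl]] cong_refl]])
      have "((A (4 * m) - A (2 * m)) - A (2 * m - 1)) - A (2 * m - 1) \<approx> ((A (4 * m) - (- t)) - (- t - a0)) - (- t - a0)"
        by (intro cong_diff cong_refl t d)
      from cong_trans[OF e this] show ?thesis by (simp add: algebra_simps)
    qed
    then have "- A (4 * m - 3) \<approx> - (A (4 * m) + 3 * t + 2 * a0)" by (simp only: cong_minus_minus_iff)
    from cong_sym[OF this] have v: "- A (4 * m) - 3 * t - 2 * a0 \<approx> - A (4 * m - 3)"
      by (simp only: minus_add_distrib add_uminus_conv_diff)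
    show ?thesis
      by (rule exI[of _ "- 1"], rule exI[of _ 1], rule exI[of _ "2 * m - 1"])
        (use w cong_trans[OF _ v] in \<open>auto simp: algebra_simps\<close>)
  qed
qed

section \<open>Types of positions and the action of the units\<close>

locale base =
  fixes h :: nat and p :: bool and A :: "int \<Rightarrow> int" and Q :: "int set" and C :: "int \<Rightarrow> bool"
  assumes h0: "0 < h"
    and Q_left: "m \<in> Q \<Longrightarrow> 2 * m - 1 \<in> Q"
    and Q_mid: "m \<in> Q \<Longrightarrow> 2 * m \<in> Q"
    and Q_right: "m \<in> Q \<Longrightarrow> 2 * m + 1 \<in> Q"
    and rec_mid: "m \<in> Q \<Longrightarrow> [A (2 * m) = A (2 * m - 1) + A m] (mod int h)"
    and rec_right: "m \<in> Q \<Longrightarrow> [A (2 * m + 1) = A (2 * m) + A m] (mod int h)"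
    and nz: "m \<in> Q \<Longrightarrow> C m \<Longrightarrow> \<not> int h dvd A m"
    and C_all: "\<not> p \<Longrightarrow> C m"
    and C_mid: "p \<Longrightarrow> m \<in> Q \<Longrightarrow> C (2 * m) \<longleftrightarrow> \<not> C m"
    and C_left: "p \<Longrightarrow> m \<in> Q \<Longrightarrow> \<not> C (2 * m - 1)"
    and C_right: "p \<Longrightarrow> m \<in> Q \<Longrightarrow> \<not> C (2 * m + 1)"

text \<open>The position \<open>m\<close> realises the type \<open>(a, t)\<close> with the scale
  \<open>w\<close>. The sign of the second entry is left open because the reflected window realises
  the opposite one.\<close>

definition pt3 :: "nat \<Rightarrow> bool \<Rightarrow> (int \<Rightarrow> int) \<Rightarrow> int set \<Rightarrow> (int \<Rightarrow> bool) \<Rightarrow> nat \<Rightarrow> nat \<Rightarrow> int \<Rightarrow> int \<Rightarrow> bool" where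
  "pt3 h p A Q C a t m w \<longleftrightarrow> m \<in> Q \<and> (p \<longrightarrow> \<not> C m) \<and> coprime w (int h) \<and> [A m = w * int a] (mod int h) \<and>
     ([A (2 * m) = w * int t] (mod int h) \<or> [A (2 * m) = - w * int t] (mod int h))"

definition tban :: "nat \<Rightarrow> bool \<Rightarrow> (int \<Rightarrow> int) \<Rightarrow> int set \<Rightarrow> (int \<Rightarrow> bool) \<Rightarrow> nat \<Rightarrow> nat \<Rightarrow> bool" where
  "tban h p A Q C a t \<longleftrightarrow> (\<forall>m w. \<not> pt3 h p A Q C a t m w)"

text \<open>\<open>s\<close> is \<open>- A (4 * m)\<close> measured in the scale \<open>w\<close>,
  which is the quantity computed by \<open>banned\<close>.\<close>

definition forb :: "nat \<Rightarrow> bool \<Rightarrow> (int \<Rightarrow> int) \<Rightarrow> int set \<Rightarrow> (int \<Rightarrow> bool) \<Rightarrow> nat \<Rightarrow> nat \<Rightarrow> nat \<Rightarrow> bool" where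
  "forb h p A Q C a t s \<longleftrightarrow> (\<forall>m w. pt3 h p A Q C a t m w \<longrightarrow> \<not> [A (4 * m) = - w * int s] (mod int h))"

lemma inverse_exists:
  assumes "coprime w (int h)"
  obtains u where "[u * w = 1] (mod int h)" "coprime u (int h)"
proof -
  obtain u where u: "[w * u = 1] (mod int h)" using cong_solve_coprime_int[OF assms] by auto
  then have "coprime (w * u) (int h)" by (metis cong_imp_coprime cong_sym coprime_1_left)
  with u show thesis by (intro that[of u]) (simp_all add: mult.commute)
qed

lemma unscale:
  assumes "[u * w = 1] (mod h)" "[w * x = y] (mod h)"
  shows "[x = u * y] (mod (h::int))"
proof -
  have "[u * (w * x) = u * y] (mod h)" by (rule cong_scalar_left[OF assms(2)])
  moreover have "[(u * w) * x = 1 * x] (mod h)" by (rule cong_scalar_right[OF assms(1)])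
  ultimately show ?thesis by (simp add: mult.assoc) (metis cong_sym cong_trans)
qed

lemma pt3_unscale:
  assumes "[u * w = 1] (mod int h)" "coprime u (int h)" "pt3 h p (\<lambda>n. w * A n) Q C a t m v"
  shows "pt3 h p A Q C a t m (u * v)"
  using assms(2,3) unscale[OF assms(1), of "A m" "v * int a"] unscale[OF assms(1), of "A (2 * m)" "v * int t"]
    unscale[OF assms(1), of "A (2 * m)" "- v * int t"]
  by (auto simp: pt3_def mult.assoc)

lemma tban_scale:
  assumes "coprime w (int h)" "tban h p A Q C a t"
  shows "tban h p (\<lambda>n. w * A n) Q C a t"
  using inverse_exists[OF assms(1)] pt3_unscale assms(2) unfolding tban_def by metis

lemma forb_scale:
  assumes "coprime w (int h)" "forb h p A Q C a t s"
  shows "forb h p (\<lambda>n. w * A n) Q C a t s"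
proof -
  obtain u where u: "[u * w = 1] (mod int h)" "coprime u (int h)" using inverse_exists[OF assms(1)] .
  show ?thesis unfolding forb_def
  proof (intro allI impI notI)
    fix m v assume 1: "pt3 h p (\<lambda>n. w * A n) Q C a t m v" "[w * A (4 * m) = - v * int s] (mod int h)"
    have "[A (4 * m) = u * (- v * int s)] (mod int h)" by (rule unscale[OF u(1) 1(2)])
    then have "[A (4 * m) = - (u * v) * int s] (mod int h)" by (simp add: algebra_simps)
    then show False using assms(2) pt3_unscale[OF u 1(1)] unfolding forb_def by blast
  qed
qed

text \<open>Units respect the recurrence and non-divisibility by \<open>h\<close>. The soundness
  proofs use this to reduce to the scale 1.\<close>

lemma (in base) base_scale:
  assumes "coprime w (int h)"
  shows "base h p (\<lambda>n. w * A n) Q C"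
proof unfold_locales
  fix m assume "m \<in> Q" "C m"
  then show "\<not> int h dvd w * A m" using nz assms by (simp add: coprime_dvd_mult_right_iff coprime_commute)
qed (use h0 Q_left Q_mid Q_right C_all C_mid C_left C_right cong_scalar_left[OF rec_mid, of _ w] cong_scalar_left[OF rec_right, of _ w] in \<open>auto simp: algebra_simps\<close>)

definition ent :: "nat \<Rightarrow> nat \<Rightarrow> nat \<Rightarrow> nat \<Rightarrow> nat \<Rightarrow> nat \<Rightarrow> bool" where
  "ent h a t b y i \<longleftrightarrow> (i * b) mod h = a mod h \<and> ((i * y) mod h = t mod h \<or> (i * y + t) mod h = 0) \<and> coprime i h"

lemma ent_int:
  assumes "ent h a t b y i"
  shows "[int i * int b = int a] (mod int h)"
    "[int i * int y = int t] (mod int h) \<or> [int i * int y = - int t] (mod int h)" "coprime (int i) (int h)"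
proof -
  have c: "[int k = int l] (mod int h)" if "k mod h = l mod h" for k l
    using that by (simp add: cong_def flip: zmod_int)
  show "[int i * int b = int a] (mod int h)" using c[of "i * b" a] assms by (simp add: ent_def)
  show "coprime (int i) (int h)" using assms by (simp add: ent_def)
  show "[int i * int y = int t] (mod int h) \<or> [int i * int y = - int t] (mod int h)"
  proof (cases "(i * y) mod h = t mod h")
    case True
    then show ?thesis using c[of "i * y" t] by simp
  next
    case False
    then have "h dvd i * y + t" using assms by (auto simp: ent_def)
    then have "int h dvd int i * int y + int t" by (metis of_nat_dvd_iff of_nat_add of_nat_mult)
    then show ?thesis by (simp add: cong_iff_dvd_diff)
  qed
qed

text \<open>The lists of marks used below are plain data, and this test certifies them: every entry
  is brought to one of the types in \<open>TL\<close> by its factor, whose inverse is found in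
  \<open>U\<close>.\<close>

definition chk :: "nat \<Rightarrow> nat list \<Rightarrow> (nat \<times> nat) list \<Rightarrow> (lt \<times> (lt \<times> lt) list) list \<Rightarrow> bool" where
  "chk h U TL M \<longleftrightarrow> list_all (\<lambda>b. list_all (\<lambda>c. list_ex (\<lambda>x.
     (val (snd c) * val (fst b)) mod h = fst x mod h \<and>
     ((val (snd c) * val (fst c)) mod h = snd x mod h \<or> (val (snd c) * val (fst c) + snd x) mod h = 0)) TL \<and>
     list_ex (\<lambda>j. (val (snd c) * j) mod h = 1) U) (snd b)) M"

lemma mod_1_coprime: "(i * j) mod h = (1::nat) \<Longrightarrow> coprime i h"
  unfolding coprime_iff_invertible_nat by (rule exI[of _ j]) (cases "h = 1", auto simp: cong_def)

lemma asc_in: "c \<in> set (asc xs a) \<Longrightarrow> \<exists>b\<in>set xs. fst b = a \<and> c \<in> set (snd b)"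
  by (induction xs) (auto simp: eqr_def split: if_splits)

lemma chk_ent:
  assumes "chk h U TL M" "c \<in> set (asc M (R a))"
  shows "\<exists>x\<in>set TL. ent h (fst x) (snd x) a (val (fst c)) (val (snd c))"
proof -
  obtain b where "b \<in> set M" "fst b = R a" "c \<in> set (snd b)" using asc_in[OF assms(2)] by auto
  with assms(1) obtain x j where "x \<in> set TL" "(val (snd c) * a) mod h = fst x mod h"
     "(val (snd c) * val (fst c)) mod h = snd x mod h \<or> (val (snd c) * val (fst c) + snd x) mod h = 0"
     "(val (snd c) * j) mod h = 1"
    unfolding chk_def list_all_iff list_ex_iff by fastforce
  then show ?thesis by (intro bexI[of _ x]) (auto simp: ent_def intro: mod_1_coprime)
qed

abbreviation mkenv :: "nat \<Rightarrow> bool \<Rightarrow> (lt \<times> (lt \<times> lt) list) list \<Rightarrow> (lt \<times> (lt \<times> lt) list) list \<Rightarrow> tr \<Rightarrow> env" where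
  "mkenv h p M N B \<equiv> Env h p (mlf (asc M)) (blf (\<lambda>a. map fst (asc N a))) B"

lemma (in base) fit:
  assumes M: "chk h U [(a0, t)] M" and N: "chk h U TL N" "\<forall>x\<in>set TL. tban h p A Q C (fst x) (snd x)"
    and F: "\<forall>s<h. get (path h s) B = Dead \<longrightarrow> forb h p A Q C a0 t s"
  shows "fitted (mkenv h p M N B) (int a0) (int t) A Q C"
proof (unfold_locales, goal_cases)
  \<comment> \<open>The cases 12, 13 and 14 are \<open>ml_ok\<close>, \<open>bt_ok\<close> and
    \<open>bl_ok\<close>.\<close>
  case (12 y i a)
  then obtain c where c: "c \<in> set (asc M (R a))" "y = val (fst c)" "i = val (snd c)" by (auto simp: mlf_def)
  from chk_ent[OF M c(1)] have "ent h a0 t a y i" by (simp add: c)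
  from ent_int[OF this] show ?case by simp
next
  case (13 s m w)
  then have "pt3 h p A Q C a0 t m w" by (auto simp: pt3_def)
  then show ?case using 13 F by (auto simp: forb_def)
next
  case (14 m c a \<sigma> \<tau>)
  then obtain d where d: "d \<in> set (asc N (R a))" "c = val (fst d)" by (auto simp: blf_def)
  from chk_ent[OF N(1) d(1)] obtain x where x: "x \<in> set TL" "ent h (fst x) (snd x) a c (val (snd d))"
    by (auto simp: d)
  let ?i = "int (val (snd d))"
  note e = ent_int[OF x(2)]
  obtain j where j: "[j * ?i = 1] (mod int h)" "coprime j (int h)" using inverse_exists[OF e(3)] .
  have ss: "\<sigma> * \<sigma> = 1" "\<tau> * \<tau> = 1" using 14 by auto
  have flip: "[X = s * Y] (mod int h)" if "[Y = s * X] (mod int h)" "s * s = 1" for X Y s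
    using cong_scalar_left[OF that(1), of s] that(2) by (simp add: cong_sym_eq flip: mult.assoc)
  have "[A m = \<sigma> * int a] (mod int h)" using flip 14 ss by simp
  also have "[int a = j * int (fst x)] (mod int h)" by (rule unscale[OF j(1) e(1)])
  then have "[\<sigma> * int a = \<sigma> * (j * int (fst x))] (mod int h)" by (rule cong_scalar_left)
  finally have 1: "[A m = (\<sigma> * j) * int (fst x)] (mod int h)" by (simp add: mult.assoc)
  have A2: "[A (2 * m) = \<tau> * int c] (mod int h)" using flip 14 ss by simp
  have "[int c = j * int (snd x)] (mod int h) \<or> [int c = j * - int (snd x)] (mod int h)"
    using e(2) unscale[OF j(1)] by blast
  then have "[A (2 * m) = \<tau> * (j * int (snd x))] (mod int h) \<or> [A (2 * m) = \<tau> * (j * - int (snd x))] (mod int h)"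
    using cong_trans[OF A2 cong_scalar_left] by blast
  then have 2: "[A (2 * m) = (\<sigma> * j) * int (snd x)] (mod int h) \<or> [A (2 * m) = - (\<sigma> * j) * int (snd x)] (mod int h)"
    using 14 by (auto simp: algebra_simps)
  have "coprime (\<sigma> * j) (int h)" using j(2) 14 by auto
  then have "pt3 h p A Q C (fst x) (snd x) m (\<sigma> * j)" using 1 2 14 by (auto simp: pt3_def)
  then show ?case using N(2) x(1) by (auto simp: tban_def)
qed (use h0 Q_left Q_mid Q_right rec_mid rec_right nz C_all C_mid C_left C_right in auto)

lemma (in base) pt3_normalize:
  assumes "pt3 h p A Q C a t m w" "[u * w = 1] (mod int h)"
  shows "m \<in> Q" "p \<longrightarrow> \<not> C m" "[u * A m = int a] (mod int h)"
    "[u * A (2 * m) = int t] (mod int h) \<or> [u * A (2 * m) = - int t] (mod int h)"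
proof -
  have s: "[u * X = Y] (mod int h)" if "[X = w * Y] (mod int h)" for X Y
    using cong_trans[OF cong_scalar_left[OF that] cong_scalar_right[OF assms(2), of Y, unfolded mult.assoc]] by simp
  show "m \<in> Q" "p \<longrightarrow> \<not> C m" "[u * A m = int a] (mod int h)"
    using assms(1) s[of "A m" "int a"] by (auto simp: pt3_def)
  show "[u * A (2 * m) = int t] (mod int h) \<or> [u * A (2 * m) = - int t] (mod int h)"
    using assms(1) s[of "A (2 * m)" "int t"] s[of "A (2 * m)" "- int t"] by (auto simp: pt3_def)
qed

text \<open>Allows a long chain to be proved in separate pieces: \<open>ds\<close> collects the
  values excluded by the earlier pieces, and each piece starts with these as bans.\<close>

primrec links :: "nat \<Rightarrow> (tr \<Rightarrow> tr \<Rightarrow> bool) \<Rightarrow> lt \<Rightarrow> tr \<Rightarrow> tr \<Rightarrow> lt list \<Rightarrow> lt list list list \<Rightarrow> bool" where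
  "links h P k D B ds [] \<longleftrightarrow> True"
| "links h P k D B ds (c # cs) \<longleftrightarrow> chain h P k D (fold (\<lambda>s. kill (pa h s)) ds B) c \<and> links h P k D B (ds @ concat c) cs"

text \<open>The data of one search. \<open>G\<close> and \<open>W\<close> are opaque names for
  \<open>gen\<close> and \<open>wk\<close>, so that only the tabulated rules apply to them;
  \<open>TL\<close> holds the types refuted before.\<close>

locale inst =
  fixes h :: nat and p :: bool and M N :: "(lt \<times> (lt \<times> lt) list) list"
    and G :: "tr \<Rightarrow> lt list \<Rightarrow> lt list \<Rightarrow> bool" and W :: "lt list \<Rightarrow> tr \<Rightarrow> tr" and U :: "nat list" and TL :: "(nat \<times> nat) list"
  assumes G: "G B us vs = gen (mkenv h p M N B) us vs"
    and W: "W us T = wk h p (\<lambda>a. map fst (asc N a)) (hd us) (tl us) T"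
    and h: "0 < h" "h \<le> 64"
    and N_less: "\<forall>c\<in>set (map fst (asc N a)). val c < h"
    and cN: "chk h U TL N"
    and cU: "list_all (\<lambda>u. coprime u h) U"
begin

text \<open>Multiplying the sequence by the inverse of \<open>w\<close> makes the scale 1 and
  preserves all earlier exclusions. Then \<open>A (4 * m)\<close> is \<open>- s\<close>, and the
  first free residue of the root window is \<open>s - 3 * t - 2 * a0\<close>, the only one left
  alive.\<close>

lemma stage_sound:
  assumes b: "base h p A Q C" and T: "\<forall>x\<in>set TL. tban h p A Q C (fst x) (snd x)" and M: "chk h U [(a0, t)] M"
    and F: "\<forall>s<h. get (path h s) B = Dead \<longrightarrow> forb h p A Q C a0 t s"
    and s: "stage G W h [R ((t + a0) mod h), S (R t) (R 1), R ((t + (h - a0)) mod h)] B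
      (put (path h v) (R v) (treeD h (map R [0..<h])))"
    and v: "v < h" "(v + 3 * t + 2 * a0) mod h = s mod h" "a0 \<le> h"
  shows "forb h p A Q C a0 t s"
  unfolding forb_def
proof (intro allI impI notI)
  fix m w assume pt: "pt3 h p A Q C a0 t m w" and s4: "[A (4 * m) = - w * int s] (mod int h)"
  let ?ws = "[R ((t + a0) mod h), S (R t) (R 1), R ((t + (h - a0)) mod h)]"
  let ?e = "mkenv h p M N B"
  obtain u where u: "[u * w = 1] (mod int h)" "coprime u (int h)" using pt inverse_exists by (auto simp: pt3_def)
  interpret base h p A Q C by (rule b)
  have "\<forall>x\<in>set TL. tban h p (\<lambda>n. u * A n) Q C (fst x) (snd x)" using T tban_scale[OF u(2)] by blast
  moreover have "\<forall>s<h. get (path h s) B = Dead \<longrightarrow> forb h p (\<lambda>n. u * A n) Q C a0 t s"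
    using F forb_scale[OF u(2)] by blast
  ultimately interpret f: fitted ?e "int a0" "int t" "\<lambda>n. u * A n" Q C
    by (rule base.fit[OF base_scale[OF u(2)] M cN])
  note n = pt3_normalize[OF pt u(1)]
  have x: "[int ((t + a0) mod h) = int t + int a0] (mod int h)" by (simp add: zmod_int cong_mod_left)
  have "[int ((t + (h - a0)) mod h) = int t + (int h - int a0)] (mod int h)"
    using v(3) by (simp add: zmod_int cong_mod_left of_nat_diff add_diff_eq)
  moreover have "[int t + (int h - int a0) = int t - int a0] (mod int h)" by (simp add: cong_iff_dvd_diff)
  ultimately have z: "[int ((t + (h - a0)) mod h) = int t - int a0] (mod int h)" by (rule cong_trans)
  obtain \<sigma> \<delta> q where w: "\<sigma> \<in> {1, -1}" "\<delta> \<in> {1, -1}" "f.window \<sigma> \<delta> q ?ws"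
    "\<And>v. [int v = - (u * A (4 * m)) - 3 * int t - 2 * int a0] (mod int h) \<Longrightarrow> [int v = \<sigma> * \<delta> * (u * A (2 * q - \<delta>))] (mod int h)"
    using f.root_window[of m "(t + a0) mod h" t "(t + (h - a0)) mod h" "S (R t) (R 1)"] n x z by auto
  have "[u * A (4 * m) = (u * w) * - int s] (mod int h)" using cong_scalar_left[OF s4, of u] by (simp add: algebra_simps)
  also have "[(u * w) * - int s = 1 * - int s] (mod int h)" by (rule cong_scalar_right[OF u(1)])
  finally have "[- (u * A (4 * m)) = int s] (mod int h)" by (metis cong_minus_minus_iff minus_minus mult_1)
  moreover have "[int v + 3 * int t + 2 * int a0 = int s] (mod int h)"
  proof -
    have "[v + 3 * t + 2 * a0 = s] (mod h)" using v(2) by (simp add: cong_def)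
    then have "[int (v + 3 * t + 2 * a0) = int s] (mod int h)" by (simp only: cong_int_iff)
    then show ?thesis by simp
  qed
  ultimately have "[int v + 3 * int t + 2 * int a0 = - (u * A (4 * m))] (mod int h)" by (metis cong_sym cong_trans)
  from cong_diff[OF this cong_refl[of "3 * int t + 2 * int a0"]]
  have "[int v = - (u * A (4 * m)) - 3 * int t - 2 * int a0] (mod int h)" by (simp add: algebra_simps)
  then have vv: "[int v = \<sigma> * \<delta> * (u * A (2 * q - \<delta>))] (mod int h)" by (rule w(4))
  have gT: "good h (put (path h v) (R v) (treeD h (map R [0..<h])))" by (intro good_put good_treeD v h)
  have "\<forall>v'<h. get (path h v') (put (path h v) (R v) (treeD h (map R [0..<h]))) = Dead \<or>
      hits ?e v' ?ws \<or> gen ?e (R v' # ?ws) [R v']"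
    using s fin_gen[of G "mkenv h p M N", OF G W _ _ _ N_less h gT, of B ?ws] by (simp add: stage_def)
  then have gg: "hits ?e v ?ws \<or> gen ?e (R v # ?ws) [R v]" 
    using get_put[OF v(1) v(1) h(2)] v(1) by (metis tr.distinct(1))
  have vv': "[int v = \<sigma> * \<delta> * (u * A (2 * q - \<delta>))] (mod int (hh ?e))" using vv by simp
  show False by (rule f.root_contr[OF w(1,2,3) list.distinct(2) vv' gg])
qed

text \<open>A unit \<open>u\<close> that fixes \<open>a0\<close>, and fixes \<open>t\<close> up to
  sign, is a symmetry of the type and multiplies \<open>s\<close> by \<open>u\<close>. One search
  therefore settles the whole group.\<close>

definition eqs :: "nat \<Rightarrow> nat \<Rightarrow> lt list \<Rightarrow> bool" where
  "eqs a0 t g \<longleftrightarrow> g \<noteq> [] \<and> list_all (\<lambda>s. list_ex (\<lambda>u. (u * val (hd g)) mod h = val s \<and> (u * a0) mod h = a0 mod h \<and>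
      ((u * t) mod h = t mod h \<or> (u * t + t) mod h = 0)) U) g"

lemma eqs_forb:
  assumes "eqs a0 t g" "forb h p A Q C a0 t (val (hd g))" "s \<in> set g"
  shows "forb h p A Q C a0 t (val s)"
proof -
  obtain u where u: "(u * val (hd g)) mod h = val s" "(u * a0) mod h = a0 mod h"
      "(u * t) mod h = t mod h \<or> (u * t + t) mod h = 0" "u \<in> set U"
  proof -
    have "list_ex (\<lambda>u. (u * val (hd g)) mod h = val s \<and> (u * a0) mod h = a0 mod h \<and>
      ((u * t) mod h = t mod h \<or> (u * t + t) mod h = 0)) U"
      using assms(1,3) by (simp add: eqs_def list_all_iff)
    then show thesis unfolding list_ex_iff by (elim bexE conjE) (rule that; assumption)
  qed
  have "ent h a0 t a0 t u"
    unfolding ent_def by (intro conjI u(2,3) bspec[OF cU[unfolded list_all_iff] u(4)])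
  note e = ent_int[OF this]
  show ?thesis unfolding forb_def
  proof (intro allI impI notI)
    fix m w assume pt: "pt3 h p A Q C a0 t m w" and s4: "[A (4 * m) = - w * int (val s)] (mod int h)"
    have sc: "[w * X = (w * int u) * Y] (mod int h)" if "[int u * Y = X] (mod int h)" for X Y
      using cong_scalar_left[OF cong_sym[OF that], of w] by (simp add: mult.assoc)
    have "[A m = (w * int u) * int a0] (mod int h)"
      using pt sc[OF e(1)] cong_trans unfolding pt3_def by blast
    moreover have "[A (2 * m) = (w * int u) * int t] (mod int h) \<or> [A (2 * m) = - (w * int u) * int t] (mod int h)"
    proof -
      have n: "[- X = - Y] (mod int h)" if "[X = Y] (mod int h)" for X Y using that by (simp only: cong_minus_minus_iff)
      consider "[w * int t = (w * int u) * int t] (mod int h)" | "[w * int t = - ((w * int u) * int t)] (mod int h)"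
        using e(2) sc[of "int t" "int t"] n[OF sc[where X = "- int t" and Y = "int t"]] by auto
      then show ?thesis
      proof cases
        case 1
        then show ?thesis using pt n[OF 1] cong_trans unfolding pt3_def by (metis mult_minus_left)
      next
        case 2
        then show ?thesis using pt n[OF 2] cong_trans unfolding pt3_def by (metis mult_minus_left minus_minus)
      qed
    qed
    moreover have "coprime (w * int u) (int h)" using pt e(3) by (auto simp: pt3_def)
    ultimately have "pt3 h p A Q C a0 t m (w * int u)" using pt by (auto simp: pt3_def)
    moreover have "[A (4 * m) = - (w * int u) * int (val (hd g))] (mod int h)"
    proof -
      have "[int (u * val (hd g)) = int (val s)] (mod int h)"
        unfolding u(1)[symmetric] cong_int_iff by (simp add: cong_def)
      then have "[- w * (int u * int (val (hd g))) = - w * int (val s)] (mod int h)"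
        unfolding of_nat_mult by (rule cong_scalar_left)
      then show ?thesis using cong_trans[OF s4 cong_sym] by (simp add: mult.assoc)
    qed
    ultimately show False using assms(2) unfolding forb_def by blast
  qed
qed

text \<open>What a group excludes holds at every position of the type, hence may be put into the ban
  tree before the next group is searched.\<close>

lemma chain_sound:
  assumes b: "base h p A Q C" and T: "\<forall>x\<in>set TL. tban h p A Q C (fst x) (snd x)" and M: "chk h U [(a0, t)] M"
    and k: "(k + 3 * t + 2 * a0) mod h = 0" "a0 \<le> h"
    and c: "chain h (stage G W h [R ((t + a0) mod h), S (R t) (R 1), R ((t + (h - a0)) mod h)]) (R k) (treeD h (map R [0..<h]))
      B gs" "\<forall>g\<in>set gs. eqs a0 t g" "list_all (list_all (\<lambda>s. val s < h)) gs"
    and F: "\<forall>s<h. get (path h s) B = Dead \<longrightarrow> forb h p A Q C a0 t s"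
  shows "\<forall>s\<in>set (concat gs). forb h p A Q C a0 t (val s)"
  using c F
proof (induction gs arbitrary: B)
  case Nil
  then show ?case by simp
next
  case (Cons g gs)
  let ?v = "(val (hd g) + k) mod h"
  have "hd g \<in> set g" using Cons.prems(2) by (auto simp: eqs_def)
  have st: "stage G W h [R ((t + a0) mod h), S (R t) (R 1), R ((t + (h - a0)) mod h)] B (put (path h ?v) (R ?v) (treeD h (map R [0..<h])))"
    using Cons.prems(1) by (simp add: pa_def pl_def)
  have "(?v + 3 * t + 2 * a0) mod h = (val (hd g) + (k + 3 * t + 2 * a0)) mod h"
    by (simp add: mod_simps add.assoc)
  also have "\<dots> = (val (hd g) + (k + 3 * t + 2 * a0) mod h) mod h" by (simp only: mod_add_right_eq)
  also have "\<dots> = val (hd g) mod h" by (simp only: k(1) add_0_right)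
  finally have v: "(?v + 3 * t + 2 * a0) mod h = val (hd g) mod h" .
  have F1: "forb h p A Q C a0 t (val (hd g))"
    by (rule stage_sound[OF b T M Cons.prems(4) st _ v k(2)]) (use h in simp)
  have g: "forb h p A Q C a0 t (val s)" if "s \<in> set g" for s
    by (rule eqs_forb[OF _ F1 that]) (use Cons.prems(2) in simp)
  have "\<forall>s\<in>set (concat gs). forb h p A Q C a0 t (val s)"
  proof (rule Cons.IH)
    show "\<forall>s<h. get (path h s) (fold (\<lambda>s. kill (pa h s)) g B) = Dead \<longrightarrow> forb h p A Q C a0 t s"
      using Cons.prems(3,4) g get_kls[OF _ h(2), of _ g B] by (auto simp: list_all_iff split: if_splits)
  qed (use Cons.prems in auto)
  then show ?case using g by auto
qed

text \<open>At a position of the type, \<open>A (4 * m)\<close> is \<open>- w * s\<close> for some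
  \<open>s\<close>; when all \<open>s\<close> are excluded, there is no such position.\<close>

lemma chains_sound:
  assumes b: "base h p A Q C" and T: "\<forall>x\<in>set TL. tban h p A Q C (fst x) (snd x)" and M: "chk h U [(a0, t)] M"
    and k: "(k + 3 * t + 2 * a0) mod h = 0" "a0 \<le> h"
    and c: "links h (stage G W h [R ((t + a0) mod h), S (R t) (R 1), R ((t + (h - a0)) mod h)]) (R k) (treeD h (map R [0..<h]))
      (tree0 h (map R [0..<h])) [] cs"
      "list_all (list_all (eqs a0 t)) cs" "list_all (list_all (list_all (\<lambda>s. val s < h))) cs"
    and cov: "list_all (\<lambda>s. s \<in> val ` set (concat (concat cs))) [0..<h]"
  shows "tban h p A Q C a0 t"
proof -
  let ?P = "stage G W h [R ((t + a0) mod h), S (R t) (R 1), R ((t + (h - a0)) mod h)]"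
  have F: "\<forall>s\<in>set (concat (concat cs)). forb h p A Q C a0 t (val s)"
    if "links h ?P (R k) (treeD h (map R [0..<h])) (tree0 h (map R [0..<h])) ds cs"
      "list_all (list_all (eqs a0 t)) cs" "list_all (list_all (list_all (\<lambda>s. val s < h))) cs"
      "\<forall>s\<in>set ds. val s < h \<and> forb h p A Q C a0 t (val s)" for ds
    using that
  proof (induction cs arbitrary: ds)
    case Nil
    then show ?case by simp
  next
    case (Cons c cs)
    have F0: "\<forall>s<h. get (path h s) (fold (\<lambda>s. kill (pa h s)) ds (tree0 h (map R [0..<h]))) = Dead \<longrightarrow> forb h p A Q C a0 t s"
      using Cons.prems(4) get_kls[OF _ h(2), of _ ds] get_tree0[OF _ h(2)] by (auto split: if_splits)
    have 1: "\<forall>s\<in>set (concat c). forb h p A Q C a0 t (val s)"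
      by (rule chain_sound[OF b T M k _ _ _ F0]) (use Cons.prems in \<open>auto simp: list_all_iff\<close>)
    have "\<forall>s\<in>set (concat (concat cs)). forb h p A Q C a0 t (val s)"
      by (rule Cons.IH[of "ds @ concat c"]) (use Cons.prems 1 in \<open>auto simp: list_all_iff\<close>)
    then show ?case using 1 by auto
  qed
  have all: "forb h p A Q C a0 t s" if "s < h" for s
  proof -
    have "s \<in> val ` set (concat (concat cs))" using bspec[OF cov[unfolded list_all_iff], of s] that by simp
    moreover have "\<forall>r\<in>set (concat (concat cs)). forb h p A Q C a0 t (val r)" by (rule F[OF c]) simp
    ultimately show ?thesis by blast
  qed
  show ?thesis unfolding tban_def
  proof (intro allI notI)
    fix m w assume pt: "pt3 h p A Q C a0 t m w"
    then have "coprime w (int h)" by (simp add: pt3_def)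
    then obtain u where u: "[u * w = 1] (mod int h)" by (rule inverse_exists)
    define s where "s = nat ((- u * A (4 * m)) mod int h)"
    have sh: "s < h" using h by (simp add: s_def nat_less_iff)
    have "[int s = - u * A (4 * m)] (mod int h)" using h by (simp add: s_def cong_mod_left)
    then have "[- w * int s = - w * (- u * A (4 * m))] (mod int h)" by (rule cong_scalar_left)
    also have "- w * (- u * A (4 * m)) = (u * w) * A (4 * m)" by simp
    also have "[(u * w) * A (4 * m) = 1 * A (4 * m)] (mod int h)" by (rule cong_scalar_right[OF u])
    finally have "[A (4 * m) = - w * int s] (mod int h)" by (simp add: cong_sym_eq)
    with all[OF sh] pt show False unfolding forb_def by blast
  qed
qed

text \<open>With no marks and a single leaf as ban tree, pruning comes only from zeros and from the
  types in \<open>TL\<close>, and the first residue is left free.\<close>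

lemma plain_sound:
  assumes b: "base h p A Q C" and T: "\<forall>x\<in>set TL. tban h p A Q C (fst x) (snd x)" and M: "M = []"
    and a0: "a0 \<le> h"
    and g: "G (Lf l) [R 0] [R ((t + a0) mod h), (if p then E (R t) else R t), R ((t + (h - a0)) mod h)]"
  shows "tban h p A Q C a0 t"
  unfolding tban_def
proof (intro allI notI)
  fix m w assume pt: "pt3 h p A Q C a0 t m w"
  let ?ws = "[R ((t + a0) mod h), (if p then E (R t) else R t), R ((t + (h - a0)) mod h)]"
  let ?e = "mkenv h p M N (Lf l)"
  obtain u where u: "[u * w = 1] (mod int h)" "coprime u (int h)" using pt inverse_exists by (auto simp: pt3_def)
  interpret base h p A Q C by (rule b)
  have "\<forall>x\<in>set TL. tban h p (\<lambda>n. u * A n) Q C (fst x) (snd x)" using T tban_scale[OF u(2)] by blast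
  moreover have "\<forall>s<h. get (path h s) (Lf l) = Dead \<longrightarrow> forb h p (\<lambda>n. u * A n) Q C a0 t s" by simp
  moreover have "chk h U [(a0, t)] M" by (simp add: M chk_def)
  ultimately interpret f: fitted ?e "int a0" "int t" "\<lambda>n. u * A n" Q C
    using base.fit[OF base_scale[OF u(2)] _ cN] by blast
  note n = pt3_normalize[OF pt u(1)]
  have x: "[int ((t + a0) mod h) = int t + int a0] (mod int h)" by (simp add: zmod_int cong_mod_left)
  have "[int ((t + (h - a0)) mod h) = int t + (int h - int a0)] (mod int h)"
    using a0 by (simp add: zmod_int cong_mod_left of_nat_diff add_diff_eq)
  moreover have "[int t + (int h - int a0) = int t - int a0] (mod int h)" by (simp add: cong_iff_dvd_diff)
  ultimately have z: "[int ((t + (h - a0)) mod h) = int t - int a0] (mod int h)" by (rule cong_trans)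
  obtain \<sigma> \<delta> q where w: "\<sigma> \<in> {1, -1}" "\<delta> \<in> {1, -1}" "f.window \<sigma> \<delta> q ?ws"
    using f.root_window[of m "(t + a0) mod h" t "(t + (h - a0)) mod h" "if p then E (R t) else R t"] n x z by auto
  have "ref ?e ?ws" using g by (simp add: G gen_Nil)
  from f.ref_sound[OF this w] show False by simp
qed

lemma chains_tban:
  assumes "\<forall>x\<in>set TL. tban h p A Q C (fst x) (snd x)" "base h p A Q C" "chk h U [(a0, t)] M"
    and "x = (t + a0) mod h" "z = (t + (h - a0)) mod h" "(k + 3 * t + 2 * a0) mod h = 0" "a0 \<le> h" "ns = [0..<h]"
    and "links h (stage G W h [R x, S (R t) (R 1), R z]) (R k) (treeD h (map R ns)) (tree0 h (map R ns)) [] cs"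
    and "list_all (list_all (eqs a0 t)) cs" "list_all (list_all (list_all (\<lambda>s. val s < h))) cs"
    and "list_all (\<lambda>s. s \<in> val ` set (concat (concat cs))) [0..<h]"
  shows "tban h p A Q C a0 t"
  using assms by (intro chains_sound) simp_all

lemma plain_all:
  assumes "\<forall>x\<in>set TL. tban h p A Q C (fst x) (snd x)" "base h p A Q C" "M = []" "a0 \<le> h"
    and "list_all (\<lambda>t. G (Lf (R 0)) [R 0] [R ((t + a0) mod h), (if p then E (R t) else R t), R ((t + (h - a0)) mod h)]) ts"
  shows "\<forall>t\<in>set ts. tban h p A Q C a0 t"
  using assms(5) plain_sound[OF assms(2,1,3,4)] by (auto simp: list_all_iff)

end

text \<open>Write \<open>A m = x0 * a0\<close> and \<open>A (2 * m) = x0 * y\<close>. The value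
  \<open>y = 0\<close> puts a zero at \<open>2 * m\<close>; outside the parity mode
  \<open>y = a0\<close> and \<open>y = - a0\<close> put one at \<open>2 * m - 1\<close> and
  \<open>2 * m + 1\<close>. A triple \<open>(y, w, t)\<close> in \<open>V\<close> shows that
  \<open>y\<close> is \<open>w * t\<close> up to sign for a unit \<open>w\<close> fixing
  \<open>a0\<close>, so that a refuted type would occur.\<close>

lemma (in base) normal_type:
  assumes m: "m \<in> Q" "p \<longrightarrow> \<not> C m"
    and X: "[A m = int x] (mod int h)" "(x0 * a0) mod h = x mod h" "coprime x0 h"
    and V: "list_all (\<lambda>v. coprime (fst (snd v)) h \<and> (fst (snd v) * a0) mod h = a0 mod h \<and>
      ((fst (snd v) * snd (snd v)) mod h = fst v \<or> (fst (snd v) * snd (snd v) + fst v) mod h = 0) \<and> tban h p A Q C a0 (snd (snd v))) V"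
    and cov: "list_all (\<lambda>y. y = 0 \<or> \<not> p \<and> (y = a0 \<or> y + a0 = h) \<or> y \<in> fst ` set V) [0..<h]"
  shows False
proof -
  have int: "[int k = int l] (mod int h)" if "k mod h = l mod h" for k l
    using that by (simp add: cong_def flip: zmod_int)
  have "coprime (int x0) (int h)" using X(3) by simp
  then obtain u where u: "[u * int x0 = 1] (mod int h)" by (rule inverse_exists)
  define y where "y = nat ((u * A (2 * m)) mod int h)"
  have y: "y < h" using h0 by (simp add: y_def nat_less_iff)
  have "[int y = u * A (2 * m)] (mod int h)" using h0 by (simp add: y_def cong_mod_left)
  then have "[int x0 * int y = int x0 * (u * A (2 * m))] (mod int h)" by (rule cong_scalar_left)
  also have "int x0 * (u * A (2 * m)) = (u * int x0) * A (2 * m)" by simp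
  also have "[(u * int x0) * A (2 * m) = 1 * A (2 * m)] (mod int h)" by (rule cong_scalar_right[OF u])
  finally have Y: "[A (2 * m) = int x0 * int y] (mod int h)" by (simp add: cong_sym_eq)
  have X1: "[A m = int x0 * int a0] (mod int h)"
    using cong_trans[OF X(1) int[OF X(2)[symmetric]]] by simp
  have C2: "C (2 * m)" using C_all C_mid m by blast
  have dvd: "int h dvd a" if "[a = 0] (mod int h)" for a using that by (simp add: cong_0_iff)
  consider "y = 0" | "\<not> p" "y = a0" | "\<not> p" "y + a0 = h" | "y \<in> fst ` set V"
    using bspec[OF cov[unfolded list_all_iff], of y] y by auto
  then show False
  proof cases
    case 1
    then have "[A (2 * m) = 0] (mod int h)" using Y by simp
    from dvd[OF this] nz[OF Q_mid[OF m(1)] C2] show False by contradiction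
  next
    case 2
    have "[A (2 * m - 1) + A m - A m = A (2 * m) - A m] (mod int h)"
      by (rule cong_diff[OF cong_sym[OF rec_mid[OF m(1)]] cong_refl])
    moreover have "[A (2 * m) - A m = int x0 * int a0 - int x0 * int a0] (mod int h)"
      using cong_diff[OF Y X1] 2 by simp
    ultimately have "[A (2 * m - 1) = 0] (mod int h)" by (simp add: cong_def)
    from dvd[OF this] nz[OF Q_left[OF m(1)] C_all[OF 2(1)]] show False by contradiction
  next
    case 3
    have "[A (2 * m) + A m = int x0 * int y + int x0 * int a0] (mod int h)" by (rule cong_add[OF Y X1])
    moreover have "int x0 * int y + int x0 * int a0 = int x0 * int h" using 3 by (simp flip: distrib_left of_nat_add)
    ultimately have "[A (2 * m) + A m = 0] (mod int h)" by (simp add: cong_def)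
    from dvd[OF cong_trans[OF rec_right[OF m(1)] this]] nz[OF Q_right[OF m(1)] C_all[OF 3(1)]] show False by contradiction
  next
    case 4
    then obtain w t where v: "(y, w, t) \<in> set V" by force
    with V have e: "ent h a0 t a0 t w \<or> True" "coprime w h" "(w * a0) mod h = a0 mod h"
      "(w * t) mod h = y \<or> (w * t + y) mod h = 0" "tban h p A Q C a0 t"
      by (auto simp: list_all_iff)
    have 1: "[A m = (int x0 * int w) * int a0] (mod int h)"
      using cong_trans[OF X1 cong_sym[OF cong_scalar_left[OF int[OF e(3)], of "int x0"]]] by (simp add: mult.assoc)
    have 2: "[int y = int w * int t] (mod int h) \<or> [int y = - (int w * int t)] (mod int h)"
    proof (cases "(w * t) mod h = y")
      case True
      then show ?thesis using int[of y "w * t"] mod_less[OF y] by simp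
    next
      case False
      then have "h dvd w * t + y" using e(4) by auto
      then have "int h dvd int w * int t + int y" by (metis of_nat_dvd_iff of_nat_add of_nat_mult)
      then show ?thesis by (simp add: cong_iff_dvd_diff add.commute)
    qed
    have 3: "[A (2 * m) = int x0 * z] (mod int h)" if "[int y = z] (mod int h)" for z
      by (rule cong_trans[OF Y cong_scalar_left[OF that]])
    have "[A (2 * m) = (int x0 * int w) * int t] (mod int h) \<or> [A (2 * m) = - (int x0 * int w) * int t] (mod int h)"
      using 2 3[of "int w * int t"] 3[of "- (int w * int t)"] by (auto simp: mult.assoc)
    moreover have "coprime (int x0 * int w) (int h)" using X(3) e(2) by simp
    ultimately have "pt3 h p A Q C a0 t m (int x0 * int w)" using 1 m by (auto simp: pt3_def)
    with e(5) show False by (auto simp: tban_def)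
  qed
qed

definition reach :: "nat \<Rightarrow> bool" where
  "reach h \<longleftrightarrow> (\<forall>(A :: int \<Rightarrow> int) Q. Q \<noteq> {} \<longrightarrow>
     (\<forall>m\<in>Q. 2 * m - 1 \<in> Q \<and> 2 * m \<in> Q \<and> 2 * m + 1 \<in> Q \<and> A (2 * m) = A (2 * m - 1) + A m \<and> A (2 * m + 1) = A (2 * m) + A m) \<longrightarrow>
     (\<exists>m\<in>Q. int h dvd A m))"

definition upward :: "nat \<Rightarrow> bool" where
  "upward h \<longleftrightarrow> (\<forall>(A :: int \<Rightarrow> int) N. 1 \<le> N \<longrightarrow>
     (\<forall>m\<ge>N. A (2 * m) = A (2 * m - 1) + A m \<and> A (2 * m + 1) = A (2 * m) + A m) \<longrightarrow> (\<exists>m\<ge>N. int h dvd A m))"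

section \<open>From refuted types to zeros modulo \<open>h\<close>\<close>

lemma units_coprime: "list_all (\<lambda>u. list_ex (\<lambda>j. (u * j) mod h = (1::nat)) U) U \<Longrightarrow> list_all (\<lambda>u. coprime u h) U"
proof -
  assume a: "list_all (\<lambda>u. list_ex (\<lambda>j. (u * j) mod h = (1::nat)) U) U"
  have "coprime u h" if "u \<in> set U" for u
  proof -
    have "\<exists>j\<in>set U. (u * j) mod h = 1" using bspec[OF a[unfolded list_all_iff] that] by (simp only: list_ex_iff)
    then show ?thesis by (elim bexE) (rule mod_1_coprime)
  qed
  then show ?thesis unfolding list_all_iff by (rule ballI)
qed

lemma reach_1: "reach 1"
  by (auto simp: reach_def)

text \<open>By the case of the divisor \<open>c\<close>, some \<open>A m\<close> is a multiple of
  \<open>c\<close>. In the applications \<open>c\<close> is \<open>h\<close> divided by a prime, so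
  the nonzero multiples of \<open>c\<close> modulo \<open>h\<close> are unit multiples of
  \<open>a0 = c\<close>, and a single first entry of the types is enough.\<close>

lemma reach_step:
  assumes c: "reach c" "c dvd h" "0 < h"
    and T: "\<And>A Q C. base h False A Q C \<Longrightarrow> \<forall>t\<in>set TS. tban h False A Q C a0 t"
    and X: "list_all (\<lambda>x. x mod c \<noteq> 0 \<or> x = 0 \<or> list_ex (\<lambda>x0. (x0 * a0) mod h = x) U) [0..<h]"
    and U: "list_all (\<lambda>u. coprime u h) U"
    and V: "list_all (\<lambda>v. fst (snd v) \<in> set U \<and> (fst (snd v) * a0) mod h = a0 mod h \<and>
      ((fst (snd v) * snd (snd v)) mod h = fst v \<or> (fst (snd v) * snd (snd v) + fst v) mod h = 0) \<and> snd (snd v) \<in> set TS) V"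
    and cov: "list_all (\<lambda>y. y = 0 \<or> (y = a0 \<or> y + a0 = h) \<or> y \<in> fst ` set V) [0..<h]"
  shows "reach h"
  unfolding reach_def
proof (intro allI impI, rule ccontr)
  fix A :: "int \<Rightarrow> int" and Q :: "int set"
  assume ne: "Q \<noteq> {}" and r: "\<forall>m\<in>Q. 2 * m - 1 \<in> Q \<and> 2 * m \<in> Q \<and> 2 * m + 1 \<in> Q \<and> A (2 * m) = A (2 * m - 1) + A m \<and> A (2 * m + 1) = A (2 * m) + A m"
    and n: "\<not> (\<exists>m\<in>Q. int h dvd A m)"
  obtain m where m: "m \<in> Q" "int c dvd A m" using c(1) ne r unfolding reach_def by blast
  interpret base h False A Q "\<lambda>_. True"
    by unfold_locales (use r n c(3) in auto)
  define x where "x = nat (A m mod int h)"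
  have x: "int x = A m mod int h" "x < h" using c(3) by (auto simp: x_def nat_less_iff)
  have "int c dvd int x" unfolding x(1) using m(2) c(2) by (simp add: dvd_mod)
  then have "x mod c = 0" by simp
  moreover have "x \<noteq> 0" using n m(1) x(1) by (auto simp: dvd_eq_mod_eq_0)
  ultimately obtain x0 where x0: "x0 \<in> set U" "(x0 * a0) mod h = x" using bspec[OF X[unfolded list_all_iff], of x] x(2) by (auto simp: list_ex_iff)
  have xm: "[A m = int x] (mod int h)" unfolding x(1) by (simp add: cong_mod_right)
  show False
    by (rule normal_type[where m = m and x = x and V = V and ?a0.0 = a0 and ?x0.0 = x0])
      (use xm m(1) x0 x(2) U V cov T[OF base_axioms] in \<open>auto simp: list_all_iff\<close>)
qed

lemma reach_upward: "reach h \<Longrightarrow> upward h"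
  unfolding upward_def
proof (intro allI impI)
  fix A :: "int \<Rightarrow> int" and N :: int
  assume "reach h" "1 \<le> N" "\<forall>m\<ge>N. A (2 * m) = A (2 * m - 1) + A m \<and> A (2 * m + 1) = A (2 * m) + A m"
  then have "\<exists>m\<in>{N..}. int h dvd A m"
    unfolding reach_def by (elim allE[of _ A] allE[of _ "{N..}"] impE) auto
  then show "\<exists>m\<ge>N. int h dvd A m" by auto
qed

text \<open>Both cases use the result for \<open>q\<close>. In the first it gives the zero at once;
  in the second it gives an \<open>m\<close> with \<open>A m\<close> odd and divisible by
  \<open>q\<close>, from which the search with \<open>a0 = 0\<close> starts.\<close>

lemma parity_step:
  assumes q: "reach q" "odd q"
    and T: "\<And>A Q C. base q True A Q C \<Longrightarrow> \<forall>t\<in>set TS. tban q True A Q C 0 t"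
    and U: "list_all (\<lambda>u. coprime u q) U"
    and V: "list_all (\<lambda>v. fst (snd v) \<in> set U \<and>
      ((fst (snd v) * snd (snd v)) mod q = fst v \<or> (fst (snd v) * snd (snd v) + fst v) mod q = 0) \<and> snd (snd v) \<in> set TS) V"
    and cov: "list_all (\<lambda>y. y = 0 \<or> y \<in> fst ` set V) [0..<q]"
  shows "upward (2 * q)"
  unfolding upward_def
proof (intro allI impI, rule ccontr)
  fix A :: "int \<Rightarrow> int" and N :: int
  assume N: "1 \<le> N" and r: "\<forall>m\<ge>N. A (2 * m) = A (2 * m - 1) + A m \<and> A (2 * m + 1) = A (2 * m) + A m"
    and n: "\<not> (\<exists>m\<ge>N. int (2 * q) dvd A m)"
  have dv: "int (2 * q) dvd a" if "even a" "int q dvd a" for a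
    using divides_mult[of 2 a "int q"] that q(2) by simp
  \<comment> \<open>Because \<open>A (2 * m + 3) = A (2 * m + 1) + 2 * A (m + 1)\<close>.\<close>
  have step: "even (A (2 * (m + 1) + 1)) \<longleftrightarrow> even (A (2 * m + 1))" if "m \<ge> N" for m
    using r[rule_format, of "m + 1"] that by (simp add: algebra_simps)
  have const: "even (A (2 * m + 1)) \<longleftrightarrow> even (A (2 * N + 1))" if "m \<ge> N" for m
    using that by (induction rule: int_ge_induct) (simp_all only: step)
  show False
  proof (cases "even (A (2 * N + 1))")
    case True
    \<comment> \<open>Halving an index of \<open>Q\<close> down to its odd part never leaves the
      range of the recurrence, which lets evenness spread from the odd indices to all of
      \<open>Q\<close>.\<close>
    define Q where "Q = {m. \<exists>i j. odd j \<and> 2 * N + 1 \<le> j \<and> m = 2 ^ i * (j::int)}"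
    have ge: "m \<ge> 2 * N + 1" if mQ: "m \<in> Q" for m
    proof -
      obtain i j where "2 * N + 1 \<le> j" "m = 2 ^ i * j" using mQ by (auto simp: Q_def)
      moreover have "1 * j \<le> 2 ^ i * j" using N \<open>2 * N + 1 \<le> j\<close> by (intro mult_right_mono) auto
      ultimately show ?thesis by linarith
    qed
    have oddQ: "m \<in> Q" if "odd m" "2 * N + 1 \<le> m" for m
      unfolding Q_def using that by (intro CollectI exI[of _ 0] exI[of _ m]) simp
    have dbl: "2 * m \<in> Q" if mQ: "m \<in> Q" for m
    proof -
      obtain i j where "odd j" "2 * N + 1 \<le> j" "m = 2 ^ i * j" using mQ by (auto simp: Q_def)
      then show ?thesis unfolding Q_def by (intro CollectI exI[of _ "Suc i"] exI[of _ j]) simp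
    qed
    have ev: "even (A (2 ^ i * j))" if j: "odd j" "2 * N + 1 \<le> j" for i j
    proof (induction i)
      case 0
      obtain k where k: "j = 2 * k + 1" using j(1) by (auto elim: oddE)
      then show ?case using const[of k] j True by simp
    next
      case (Suc i)
      let ?m = "2 ^ i * j"
      have "?m \<in> Q" using j by (auto simp: Q_def)
      then have g: "?m \<ge> 2 * N + 1" by (rule ge)
      \<comment> \<open>The index before \<open>2 * ?m\<close> is odd and large, so its value is
        even; adding the even \<open>A ?m\<close> gives \<open>A (2 * ?m)\<close>.\<close>
      have "even (A (2 * (?m - 1) + 1))" using const[of "?m - 1"] g N True by simp
      then have "even (A (2 * ?m - 1))" by (simp add: algebra_simps)
      then have "even (A (2 * ?m))" using r[rule_format, of ?m] g N Suc by simp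
      then show ?case by (simp add: mult.assoc)
    qed
    have cl: "\<forall>m\<in>Q. 2 * m - 1 \<in> Q \<and> 2 * m \<in> Q \<and> 2 * m + 1 \<in> Q \<and> A (2 * m) = A (2 * m - 1) + A m \<and> A (2 * m + 1) = A (2 * m) + A m"
    proof
      fix m assume m: "m \<in> Q"
      show "2 * m - 1 \<in> Q \<and> 2 * m \<in> Q \<and> 2 * m + 1 \<in> Q \<and> A (2 * m) = A (2 * m - 1) + A m \<and> A (2 * m + 1) = A (2 * m) + A m"
      proof -
        have "m \<ge> N" "2 * N + 1 \<le> 2 * m - 1" "2 * N + 1 \<le> 2 * m + 1" using ge[OF m] N by linarith+
        then show ?thesis using r dbl[OF m] oddQ[of "2 * m - 1"] oddQ[of "2 * m + 1"] by simp
      qed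
    qed
    have "Q \<noteq> {}" using oddQ[of "2 * N + 1"] by auto
    then obtain m where m: "m \<in> Q" "int q dvd A m" using q(1) cl unfolding reach_def by blast
    moreover have "even (A m)" using m(1) ev by (auto simp: Q_def)
    moreover have "m \<ge> N" using ge[OF m(1)] N by linarith
    ultimately show False using n dv by blast
  next
    case False
    define Q where "Q = {2 * N + 2..}"
    \<comment> \<open>Large odd indices carry odd values here, so \<open>A m\<close> and
      \<open>A (2 * m)\<close> differ in parity. At an even value a zero modulo \<open>q\<close>
      would be a zero modulo \<open>2 * q\<close>.\<close>
    define C where "C = (\<lambda>m. even (A m))"
    have od: "odd (A m)" if om: "odd m" "m \<ge> 2 * N + 1" for m
    proof -
      obtain k where k: "m = 2 * k + 1" using om(1) by (auto elim: oddE)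
      then show ?thesis using const[of k] om False by simp
    qed
    interpret base q True A Q C
    proof unfold_locales
      fix m assume m: "m \<in> Q"
      then have g: "m \<ge> N" "2 * m - 1 \<ge> 2 * N + 1" using N by (auto simp: Q_def)
      show "\<not> C (2 * m - 1)" "\<not> C (2 * m + 1)" unfolding C_def using g by (intro od; simp)+
      then show "C (2 * m) \<longleftrightarrow> \<not> C m" using r g(1) by (simp add: C_def)
      show "[A (2 * m) = A (2 * m - 1) + A m] (mod int q)" "[A (2 * m + 1) = A (2 * m) + A m] (mod int q)"
        using r g(1) by simp_all
      show "\<not> int q dvd A m" if "C m" using n dv g(1) that unfolding C_def by blast
    qed (use N q(2) in \<open>auto simp: Q_def intro: odd_pos\<close>)
    have "Q \<noteq> {}" by (auto simp: Q_def)
    moreover have "\<forall>m\<in>Q. 2 * m - 1 \<in> Q \<and> 2 * m \<in> Q \<and> 2 * m + 1 \<in> Q \<and> A (2 * m) = A (2 * m - 1) + A m \<and> A (2 * m + 1) = A (2 * m) + A m"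
      using r N by (auto simp: Q_def)
    ultimately obtain m where m: "m \<in> Q" "int q dvd A m" using q(1) unfolding reach_def by blast
    \<comment> \<open>Being divisible by \<open>q\<close>, the value \<open>A m\<close> must be odd;
      then \<open>A (2 * m)\<close> is even, hence nonzero modulo \<open>q\<close>, and the first
      entry of the type is 0.\<close>
    have "\<not> C m" using nz m by blast
    show False
      by (rule normal_type[where m = m and x = 0 and ?x0.0 = 1 and ?a0.0 = 0 and V = V])
        (use m \<open>\<not> C m\<close> U V cov T[OF base_axioms] in \<open>auto simp: list_all_iff cong_0_iff\<close>)
  qed
qed

section \<open>From index sequences of degree 2 to the doubling recurrence\<close>

lemma degree_2_gaps:
  assumes "has_degree k 2"
  shows "\<exists>N\<ge>1. \<forall>n\<ge>N. k n - k (n - 1) = 2"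
proof -
  let ?I = "\<lambda>P. infinite {n. 1 \<le> n \<and> P (k n - k (n - 1))}"
  have up: "\<not> ?I (\<lambda>g. g \<ge> 3)"
  proof
    assume "?I (\<lambda>g. g \<ge> 3)"
    then have "enat 3 \<le> upper_degree k" unfolding upper_degree_def by (intro Sup_upper imageI) simp
    then have "enat 3 \<le> enat 2" using assms by (simp add: has_degree_def numeral_eq_enat)
    then show False by simp
  qed
  have low: "\<not> ?I (\<lambda>g. g = d)" if "d < 2" for d
  proof
    assume "?I (\<lambda>g. g = d)"
    then have "lower_degree k \<le> enat d" unfolding lower_degree_def by (intro Inf_lower imageI) simp
    then have "enat 2 \<le> enat d" using assms by (simp add: has_degree_def numeral_eq_enat)
    then show False using that by simp
  qed
  \<comment> \<open>The gaps different from 2: those of size at least 3 are finite in number by the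
    upper degree, those of size 0 or 1 by the lower degree.\<close>
  let ?F = "{n. 1 \<le> n \<and> k n - k (n - 1) \<ge> 3} \<union> {n. 1 \<le> n \<and> k n - k (n - 1) = 0} \<union> {n. 1 \<le> n \<and> k n - k (n - 1) = 1}"
  have "finite ?F" using up low[of 0] low[of 1] by simp
  then obtain N where N: "\<forall>n\<in>?F. n < N" using finite_nat_set_iff_bounded by meson
  have "k n - k (n - 1) = 2" if "n \<ge> Suc N" for n
  proof (rule ccontr)
    assume "k n - k (n - 1) \<noteq> 2"
    then have "n \<in> ?F" using that by auto
    then show False using bspec[OF N \<open>n \<in> ?F\<close>] that by simp
  qed
  then show ?thesis by (intro exI[of _ "Suc N"]) auto
qed

lemma upward_infinite:
  fixes k :: "nat \<Rightarrow> nat" and b :: "nat \<Rightarrow> int" and h :: int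
  assumes k: "strict_mono k" "has_degree k 2" and b: "associated k b"
    and u: "upward u" "h dvd int u"
  shows "infinite {n. h dvd b n}"
proof -
  obtain N where N: "1 \<le> N" "\<And>n. n \<ge> N \<Longrightarrow> k n - k (n - 1) = 2" using degree_2_gaps[OF k(2)] by auto
  \<comment> \<open>The constant term of the affine function \<open>2 * n + c\<close> with which
    \<open>k\<close> eventually agrees.\<close>
  define c where "c = int (k N) - 2 * int N"
  have kn: "int (k n) = 2 * int n + c" if "n \<ge> N" for n
    using that
  proof (induction n rule: dec_induct)
    case base
    then show ?case by (simp add: c_def)
  next
    case (step n)
    have "k (Suc n) - k n = 2" using N(2)[of "Suc n"] step by simp
    moreover have "k n < k (Suc n)" using k(1) by (simp add: strict_mono_def)
    ultimately have "k (Suc n) = k n + 2" by simp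
    then show ?case using step by simp
  qed
  have rec: "b (k n) = b (k (n - 1)) + b n" if "n \<ge> N" for n
  proof -
    have "n \<ge> 1" using that N(1) by simp
    then have "nat (int n - 1) = n - 1" by simp
    then show ?thesis using b \<open>n \<ge> 1\<close> unfolding associated_def
      by (auto simp: extend_zero_def extend_index_def dest!: spec[of _ n])
  qed
  have pair: "b (Suc (k n)) = b (k n)" if "n \<ge> N" for n
  proof -
    have "k (Suc n) - k n = 2" using N(2)[of "Suc n"] that by simp
    then have "Suc (k n) \<in> {k n..<k (Suc n)}" by simp
    then show ?thesis using b unfolding associated_def by blast
  qed
  \<comment> \<open>The shift absorbs the constant: \<open>k (m - c) = 2 * m - c\<close>, so
    applying \<open>k\<close> to an index amounts to doubling \<open>m\<close>.\<close>
  define A where "A m = b (k (nat (m - c)))" for m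
  \<comment> \<open>Large enough for \<open>m - c\<close> and \<open>2 * m - c\<close> to be at
    least \<open>N\<close> whenever \<open>m \<ge> M\<close>.\<close>
  define M where "M = int N + 2 * \<bar>c\<bar> + 1"
  have A: "A (2 * m) = A (2 * m - 1) + A m \<and> A (2 * m + 1) = A (2 * m) + A m" if "m \<ge> M" for m
  proof -
    define j where "j = nat (m - c)"
    have j: "int j = m - c" "j \<ge> N" using that by (auto simp: j_def M_def)
    define n where "n = nat (2 * m - c)"
    have n: "int n = 2 * m - c" "n \<ge> N" "n \<ge> 1" using that by (auto simp: n_def M_def)
    have "int (k j) = int n" using kn[OF j(2)] j(1) n(1) by simp
    then have kj: "k j = n" by simp
    have 1: "nat (2 * m - 1 - c) = n - 1" "nat (2 * m + 1 - c) = Suc n" using n by auto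
    have "b (k n) = b (k (n - 1)) + b n" by (rule rec[OF n(2)])
    moreover have "b (k (Suc n)) = b (k n) + b (Suc n)" using rec[of "Suc n"] n(2) by simp
    moreover have "b (Suc n) = b n" using pair[OF j(2)] kj by simp
    ultimately show ?thesis unfolding A_def 1 j_def[symmetric] n_def[symmetric] kj by simp
  qed
  show ?thesis unfolding infinite_nat_iff_unbounded_le
  proof
    fix t
    \<comment> \<open>Starting beyond \<open>t + c\<close> makes \<open>m - c\<close>, and with it
      the index \<open>k (m - c)\<close> of the zero, at least \<open>t\<close>.\<close>
    define M' where "M' = max M (int t + c)"
    have "1 \<le> M'" by (auto simp: M'_def M_def)
    moreover have "\<forall>m\<ge>M'. A (2 * m) = A (2 * m - 1) + A m \<and> A (2 * m + 1) = A (2 * m) + A m"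
      using A by (auto simp: M'_def)
    ultimately obtain m where m: "m \<ge> M'" "int u dvd A m" using u(1) unfolding upward_def by blast
    have "t \<le> nat (m - c)" using m(1) by (auto simp: M'_def)
    also have "\<dots> \<le> k (nat (m - c))" using k(1) by (rule strict_mono_imp_increasing)
    finally show "\<exists>n\<ge>t. n \<in> {n. h dvd b n}" using m(2) u(2) unfolding A_def by (auto intro: dvd_trans)
  qed
qed

section \<open>The searches\<close>

abbreviation n3 :: "nat list" where "n3 \<equiv> [0, 1, 2]"
lemma upt3: "n3 = [0..<3]" by (simp add: upt_rec)
lemma le3: "3 \<le> (64::nat)" and z3: "0 < (3::nat)" by simp_all
definition U3 :: "nat list" where "U3 = [1, 2]"
lemma cop3: "list_all (\<lambda>u. coprime u 3) U3" by (rule units_coprime) (simp add: U3_def)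
lemmas pa3 = path_table[of 3 "n3", unfolded code_def bits_numeral, simplified, unfolded One_nat_def[symmetric], unfolded r_fold]
lemmas pl3_0 = pl_table[of 3 "n3", THEN bal2[where n = "Suc 0"], simplified bal_simps arith, unfolded r_fold]
lemmas pl3 = pl3_0[THEN q1] pl3_0[THEN q2] pl3_0[THEN q3] pl3_0[THEN q4]
lemmas ng3 = ng_table[of 3 "n3", simplified, unfolded One_nat_def[symmetric], unfolded r_fold]

text \<open>No type remains to be refuted, since modulo 3 every \<open>y\<close> is 0, 1 or
  -1.\<close>

lemma reach_3: "reach 3"
proof (rule reach_step[where c = 1 and ?a0.0 = 1 and U = U3 and TS = "[]" and V = "[]"])
  show "reach 1" by (rule reach_1)
  show "\<forall>t\<in>set []. tban 3 False A Q C 1 t" if "base 3 False A Q C" for A Q C by simp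
qed (rule cop3 | simp add: U3_def upt3[symmetric])+

abbreviation n5 :: "nat list" where "n5 \<equiv> [0, 1, 2, 3, 4]"
lemma upt5: "n5 = [0..<5]" by (simp add: upt_rec)
lemma le5: "5 \<le> (64::nat)" and z5: "0 < (5::nat)" by simp_all
definition U5 :: "nat list" where "U5 = [1, 2, 3, 4]"
lemma cop5: "list_all (\<lambda>u. coprime u 5) U5" by (rule units_coprime) (simp add: U5_def)
lemmas pa5 = path_table[of 5 "n5", unfolded code_def bits_numeral, simplified, unfolded One_nat_def[symmetric], unfolded r_fold]
lemmas pl5_0 = pl_table[of 5 "n5", THEN bal2[where n = "Suc (Suc 0)"], simplified bal_simps arith, unfolded r_fold]
lemmas pl5_1 = pl5_0[THEN q1] pl5_0[THEN q2] pl5_0[THEN q3] pl5_0[THEN q4]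
lemmas pl5 = pl5_1[THEN q1] pl5_1[THEN q2] pl5_1[THEN q3] pl5_1[THEN q4]
lemmas ng5 = ng_table[of 5 "n5", simplified, unfolded One_nat_def[symmetric], unfolded r_fold]

text \<open>The data of a search: the list \<open>MI\<close> marks the type under study, the list
  \<open>NI\<close> the types refuted earlier; both are empty when a type is refuted without such
  help. The final letter of the names distinguishes successive searches for one modulus.\<close>

definition MI5a :: marks where "MI5a = []"
definition NI5a :: marks where "NI5a = []"
abbreviation "EI5a \<equiv> mkenv 5 False MI5a NI5a"
definition "GI5a B = gen (EI5a B)"
definition "WI5a us = wk 5 False (\<lambda>a. map fst (asc NI5a a)) (hd us) (tl us)"
interpretation I5a: inst 5 False MI5a NI5a GI5a WI5a U5 "[]"
proof unfold_locales
  have "less_marks 5 NI5a" by (simp add: NI5a_def r_defs)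
  from asc_set[OF this] show "\<forall>c\<in>set (map fst (asc NI5a a)). val c < 5" for a by auto
  show "chk 5 U5 [] NI5a" by (simp add: chk_def NI5a_def U5_def r_defs)
qed (rule cop5 | simp add: GI5a_def WI5a_def)+
lemma mcI5a: "plain_marks MI5a" by (simp add: MI5a_def r_defs)
lemmas KI5a = env.sel[where ?x1.0 = 5 and ?x2.0 = False and ?x3.0 = "mlf (asc MI5a)" and ?x4.0 = "blf (\<lambda>a. map fst (asc NI5a a))"]
text \<open>The rules for walks, with all sums and deletion patterns evaluated in advance.\<close>

lemmas wtI5a_0 = walk_table_vs[where W = WI5a and ns = "n5", OF I5a.W z5 le5, THEN bal2[where n = "Suc (Suc 0)"],
  unfolded map_fold NI5a_def, simplified shape_simps asc.simps eqrs pl5 ng5 pa5 fst_conv snd_conv]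
lemmas gtI5a_0 = gen_table[where G = GI5a and K = EI5a and ns = "n5", OF I5a.G KI5a(1-3) asc_list[OF mcI5a], THEN bal2[where n = "Suc (Suc 0)"],
  unfolded map_fold MI5a_def, simplified bal_simps asc.simps mkl.simps if_True if_False eqrs pl5 fst_conv snd_conv]
lemmas rtI5a = node_table[where G = GI5a and W = WI5a and K = EI5a, OF I5a.G I5a.W KI5a(1,2,4) I5a.N_less z5 le5 upt5, unfolded tree_unf, unfolded r_fold, simplified if_True if_False fold_simps tree_simps pa5]
lemmas dtI5a = walk_dead[where W = WI5a, OF I5a.W z5 le5 upt5, unfolded tree_unf, unfolded r_fold, simplified fold_simps tree_simps pa5]
lemmas ftI5a = lv_dead[OF le5 upt5, unfolded tree_unf, unfolded r_fold, simplified fold_simps tree_simps pa5]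
text \<open>A congruence rule without premises: the arguments of a walk are left alone, since the
  table rewrites the call as a whole.\<close>

lemma cwI5a: "WI5a us T = WI5a us T" ..
lemmas runI5a =  rtI5a dtI5a ftI5a walk_end[where W = WI5a, OF I5a.W] leaf_simps
lemmas conI5a = cwI5a bsel_cong bleaf_cong fin_cong
text \<open>The window consists of \<open>t + a0\<close>, \<open>t\<close>, \<open>t - a0\<close>
  with \<open>a0 = 1\<close>. Modulo 5, and up to sign, 2 is the only \<open>t\<close> besides 0 and
  1.\<close>

lemma partI5a: "GI5a (Lf (R 0)) [R 0] [R 3, R 2, R 1]"
proof -
  note wt = conj4[OF wtI5a_0] and gt = conj4[OF gtI5a_0]
  show ?thesis
    unfolding r_fold
    by (simp only: wt gt runI5a cong: conI5a)
qed
lemma tban_I5a: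
  assumes "base 5 False A Q C"
  shows "\<forall>t\<in>set [2]. tban 5 False A Q C 1 t"
proof (rule I5a.plain_all)
  show "\<forall>x\<in>set []. tban 5 False A Q C (fst x) (snd x)" by simp
qed (use assms partI5a in \<open>simp_all add: MI5a_def\<close>)

lemma reach_5: "reach 5"
proof (rule reach_step[where c = 1 and ?a0.0 = 1 and U = U5 and TS = "[2]" and V = "[(2, 1, 2), (3, 1, 2)]"])
  show "reach 1" by (rule reach_1)
  show "\<forall>t\<in>set [2]. tban 5 False A Q C 1 t" if "base 5 False A Q C" for A Q C using tban_I5a[OF that] by simp
qed (rule cop5 | simp add: U5_def upt5[symmetric])+

abbreviation n7 :: "nat list" where "n7 \<equiv> [0, 1, 2, 3, 4, 5, 6]"
lemma upt7: "n7 = [0..<7]" by (simp add: upt_rec)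
lemma le7: "7 \<le> (64::nat)" and z7: "0 < (7::nat)" by simp_all
definition U7 :: "nat list" where "U7 = [1, 2, 3, 4, 5, 6]"
lemma cop7: "list_all (\<lambda>u. coprime u 7) U7" by (rule units_coprime) (simp add: U7_def)
lemmas pa7 = path_table[of 7 "n7", unfolded code_def bits_numeral, simplified, unfolded One_nat_def[symmetric], unfolded r_fold]
lemmas pl7_0 = pl_table[of 7 "n7", THEN bal2[where n = "Suc (Suc 0)"], simplified bal_simps arith, unfolded r_fold]
lemmas pl7_1 = pl7_0[THEN q1] pl7_0[THEN q2] pl7_0[THEN q3] pl7_0[THEN q4]
lemmas pl7 = pl7_1[THEN q1] pl7_1[THEN q2] pl7_1[THEN q3] pl7_1[THEN q4]
lemmas ng7 = ng_table[of 7 "n7", simplified, unfolded One_nat_def[symmetric], unfolded r_fold]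

definition MI7a :: marks where "MI7a = []"
definition NI7a :: marks where "NI7a = []"
abbreviation "EI7a \<equiv> mkenv 7 False MI7a NI7a"
definition "GI7a B = gen (EI7a B)"
definition "WI7a us = wk 7 False (\<lambda>a. map fst (asc NI7a a)) (hd us) (tl us)"
interpretation I7a: inst 7 False MI7a NI7a GI7a WI7a U7 "[]"
proof unfold_locales
  have "less_marks 7 NI7a" by (simp add: NI7a_def r_defs)
  from asc_set[OF this] show "\<forall>c\<in>set (map fst (asc NI7a a)). val c < 7" for a by auto
  show "chk 7 U7 [] NI7a" by (simp add: chk_def NI7a_def U7_def r_defs)
qed (rule cop7 | simp add: GI7a_def WI7a_def)+
lemma mcI7a: "plain_marks MI7a" by (simp add: MI7a_def r_defs)
lemmas KI7a = env.sel[where ?x1.0 = 7 and ?x2.0 = False and ?x3.0 = "mlf (asc MI7a)" and ?x4.0 = "blf (\<lambda>a. map fst (asc NI7a a))"]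
lemmas wtI7a_0 = walk_table_vs[where W = WI7a and ns = "n7", OF I7a.W z7 le7, THEN bal2[where n = "Suc (Suc 0)"],
  unfolded map_fold NI7a_def, simplified shape_simps asc.simps eqrs pl7 ng7 pa7 fst_conv snd_conv]
lemmas gtI7a_0 = gen_table[where G = GI7a and K = EI7a and ns = "n7", OF I7a.G KI7a(1-3) asc_list[OF mcI7a], THEN bal2[where n = "Suc (Suc 0)"],
  unfolded map_fold MI7a_def, simplified bal_simps asc.simps mkl.simps if_True if_False eqrs pl7 fst_conv snd_conv]
lemmas rtI7a = node_table[where G = GI7a and W = WI7a and K = EI7a, OF I7a.G I7a.W KI7a(1,2,4) I7a.N_less z7 le7 upt7, unfolded tree_unf, unfolded r_fold, simplified if_True if_False fold_simps tree_simps pa7]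
lemmas dtI7a = walk_dead[where W = WI7a, OF I7a.W z7 le7 upt7, unfolded tree_unf, unfolded r_fold, simplified fold_simps tree_simps pa7]
lemmas ftI7a = lv_dead[OF le7 upt7, unfolded tree_unf, unfolded r_fold, simplified fold_simps tree_simps pa7]
lemma cwI7a: "WI7a us T = WI7a us T" ..
lemmas runI7a =  rtI7a dtI7a ftI7a walk_end[where W = WI7a, OF I7a.W] leaf_simps
lemmas conI7a = cwI7a bsel_cong bleaf_cong fin_cong
lemma partI7a: "GI7a (Lf (R 0)) [R 0] [R 3, R 2, R 1] \<and>
  GI7a (Lf (R 0)) [R 0] [R 4, R 3, R 2]"
proof -
  note wt = conj4[OF wtI7a_0] and gt = conj4[OF gtI7a_0]
  show ?thesis
    unfolding r_fold
    by (simp only: wt gt runI7a cong: conI7a)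
qed
lemma tban_I7a:
  assumes "base 7 False A Q C"
  shows "\<forall>t\<in>set [2, 3]. tban 7 False A Q C 1 t"
proof (rule I7a.plain_all)
  show "\<forall>x\<in>set []. tban 7 False A Q C (fst x) (snd x)" by simp
qed (use assms partI7a in \<open>simp_all add: MI7a_def\<close>)

lemma reach_7: "reach 7"
proof (rule reach_step[where c = 1 and ?a0.0 = 1 and U = U7 and TS = "[2, 3]" and V = "[(2, 1, 2), (3, 1, 3), (4, 1, 3), (5, 1, 2)]"])
  show "reach 1" by (rule reach_1)
  show "\<forall>t\<in>set [2, 3]. tban 7 False A Q C 1 t" if "base 7 False A Q C" for A Q C using tban_I7a[OF that] by simp
qed (rule cop7 | simp add: U7_def upt7[symmetric])+

abbreviation n11 :: "nat list" where "n11 \<equiv> [0, 1, 2, 3, 4, 5, 6, 7, 8, 9, 10]"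
lemma upt11: "n11 = [0..<11]" by (simp add: upt_rec)
lemma le11: "11 \<le> (64::nat)" and z11: "0 < (11::nat)" by simp_all
definition U11 :: "nat list" where "U11 = [1, 2, 3, 4, 5, 6, 7, 8, 9, 10]"
lemma cop11: "list_all (\<lambda>u. coprime u 11) U11" by (rule units_coprime) (simp add: U11_def)
lemmas pa11 = path_table[of 11 "n11", unfolded code_def bits_numeral, simplified, unfolded One_nat_def[symmetric], unfolded r_fold]
lemmas pl11_0 = pl_table[of 11 "n11", THEN bal2[where n = "Suc (Suc (Suc 0))"], simplified bal_simps arith, unfolded r_fold]
lemmas pl11_1 = pl11_0[THEN q1] pl11_0[THEN q2] pl11_0[THEN q3] pl11_0[THEN q4]
lemmas pl11_2 = pl11_1[THEN q1] pl11_1[THEN q2] pl11_1[THEN q3] pl11_1[THEN q4]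
lemmas pl11 = pl11_2[THEN q1] pl11_2[THEN q2] pl11_2[THEN q3] pl11_2[THEN q4]
lemmas ng11 = ng_table[of 11 "n11", simplified, unfolded One_nat_def[symmetric], unfolded r_fold]

definition MI11a :: marks where "MI11a = []"
definition NI11a :: marks where "NI11a = []"
abbreviation "EI11a \<equiv> mkenv 11 False MI11a NI11a"
definition "GI11a B = gen (EI11a B)"
definition "WI11a us = wk 11 False (\<lambda>a. map fst (asc NI11a a)) (hd us) (tl us)"
interpretation I11a: inst 11 False MI11a NI11a GI11a WI11a U11 "[]"
proof unfold_locales
  have "less_marks 11 NI11a" by (simp add: NI11a_def r_defs)
  from asc_set[OF this] show "\<forall>c\<in>set (map fst (asc NI11a a)). val c < 11" for a by auto
  show "chk 11 U11 [] NI11a" by (simp add: chk_def NI11a_def U11_def r_defs)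
qed (rule cop11 | simp add: GI11a_def WI11a_def)+
lemma mcI11a: "plain_marks MI11a" by (simp add: MI11a_def r_defs)
lemmas KI11a = env.sel[where ?x1.0 = 11 and ?x2.0 = False and ?x3.0 = "mlf (asc MI11a)" and ?x4.0 = "blf (\<lambda>a. map fst (asc NI11a a))"]
lemmas wtI11a_0 = walk_table_vs[where W = WI11a and ns = "n11", OF I11a.W z11 le11, THEN bal2[where n = "Suc (Suc (Suc 0))"],
  unfolded map_fold NI11a_def, simplified shape_simps asc.simps eqrs pl11 ng11 pa11 fst_conv snd_conv]
lemmas gtI11a_0 = gen_table[where G = GI11a and K = EI11a and ns = "n11", OF I11a.G KI11a(1-3) asc_list[OF mcI11a], THEN bal2[where n = "Suc (Suc (Suc 0))"],
  unfolded map_fold MI11a_def, simplified bal_simps asc.simps mkl.simps if_True if_False eqrs pl11 fst_conv snd_conv]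
lemmas rtI11a = node_table[where G = GI11a and W = WI11a and K = EI11a, OF I11a.G I11a.W KI11a(1,2,4) I11a.N_less z11 le11 upt11, unfolded tree_unf, unfolded r_fold, simplified if_True if_False fold_simps tree_simps pa11]
lemmas dtI11a = walk_dead[where W = WI11a, OF I11a.W z11 le11 upt11, unfolded tree_unf, unfolded r_fold, simplified fold_simps tree_simps pa11]
lemmas ftI11a = lv_dead[OF le11 upt11, unfolded tree_unf, unfolded r_fold, simplified fold_simps tree_simps pa11]
lemma cwI11a: "WI11a us T = WI11a us T" ..
lemmas runI11a =  rtI11a dtI11a ftI11a walk_end[where W = WI11a, OF I11a.W] leaf_simps
lemmas conI11a = cwI11a bsel_cong bleaf_cong fin_cong
lemma partI11a: "GI11a (Lf (R 0)) [R 0] [R 3, R 2, R 1] \<and>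
  GI11a (Lf (R 0)) [R 0] [R 4, R 3, R 2] \<and>
  GI11a (Lf (R 0)) [R 0] [R 5, R 4, R 3] \<and>
  GI11a (Lf (R 0)) [R 0] [R 6, R 5, R 4]"
proof -
  note wt = conj64[OF wtI11a_0] and gt = conj64[OF gtI11a_0]
  show ?thesis
    unfolding r_fold
    by (simp only: wt gt runI11a cong: conI11a)
qed
lemma tban_I11a:
  assumes "base 11 False A Q C"
  shows "\<forall>t\<in>set [2, 3, 4, 5]. tban 11 False A Q C 1 t"
proof (rule I11a.plain_all)
  show "\<forall>x\<in>set []. tban 11 False A Q C (fst x) (snd x)" by simp
qed (use assms partI11a in \<open>simp_all add: MI11a_def\<close>)

lemma reach_11: "reach 11"
proof (rule reach_step[where c = 1 and ?a0.0 = 1 and U = U11 and TS = "[2, 3, 4, 5]" and V = "[(2, 1, 2), (3, 1, 3), (4, 1, 4), (5, 1, 5), (6, 1, 5), (7, 1, 4), (8, 1, 3), (9, 1, 2)]"])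
  show "reach 1" by (rule reach_1)
  show "\<forall>t\<in>set [2, 3, 4, 5]. tban 11 False A Q C 1 t" if "base 11 False A Q C" for A Q C using tban_I11a[OF that] by simp
qed (rule cop11 | simp add: U11_def upt11[symmetric])+

abbreviation n13 :: "nat list" where "n13 \<equiv> [0, 1, 2, 3, 4, 5, 6, 7, 8, 9, 10, 11, 12]"
lemma upt13: "n13 = [0..<13]" by (simp add: upt_rec)
lemma le13: "13 \<le> (64::nat)" and z13: "0 < (13::nat)" by simp_all
definition U13 :: "nat list" where "U13 = [1, 2, 3, 4, 5, 6, 7, 8, 9, 10, 11, 12]"
lemma cop13: "list_all (\<lambda>u. coprime u 13) U13" by (rule units_coprime) (simp add: U13_def)
lemmas pa13 = path_table[of 13 "n13", unfolded code_def bits_numeral, simplified, unfolded One_nat_def[symmetric], unfolded r_fold]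
lemmas pl13_0 = pl_table[of 13 "n13", THEN bal2[where n = "Suc (Suc (Suc 0))"], simplified bal_simps arith, unfolded r_fold]
lemmas pl13_1 = pl13_0[THEN q1] pl13_0[THEN q2] pl13_0[THEN q3] pl13_0[THEN q4]
lemmas pl13_2 = pl13_1[THEN q1] pl13_1[THEN q2] pl13_1[THEN q3] pl13_1[THEN q4]
lemmas pl13 = pl13_2[THEN q1] pl13_2[THEN q2] pl13_2[THEN q3] pl13_2[THEN q4]
lemmas ng13 = ng_table[of 13 "n13", simplified, unfolded One_nat_def[symmetric], unfolded r_fold]

definition MI13a :: marks where "MI13a = []"
definition NI13a :: marks where "NI13a = []"
abbreviation "EI13a \<equiv> mkenv 13 False MI13a NI13a"
definition "GI13a B = gen (EI13a B)"
definition "WI13a us = wk 13 False (\<lambda>a. map fst (asc NI13a a)) (hd us) (tl us)"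
interpretation I13a: inst 13 False MI13a NI13a GI13a WI13a U13 "[]"
proof unfold_locales
  have "less_marks 13 NI13a" by (simp add: NI13a_def r_defs)
  from asc_set[OF this] show "\<forall>c\<in>set (map fst (asc NI13a a)). val c < 13" for a by auto
  show "chk 13 U13 [] NI13a" by (simp add: chk_def NI13a_def U13_def r_defs)
qed (rule cop13 | simp add: GI13a_def WI13a_def)+
lemma mcI13a: "plain_marks MI13a" by (simp add: MI13a_def r_defs)
lemmas KI13a = env.sel[where ?x1.0 = 13 and ?x2.0 = False and ?x3.0 = "mlf (asc MI13a)" and ?x4.0 = "blf (\<lambda>a. map fst (asc NI13a a))"]
lemmas wtI13a_0 = walk_table_vs[where W = WI13a and ns = "n13", OF I13a.W z13 le13, THEN bal2[where n = "Suc (Suc (Suc 0))"],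
  unfolded map_fold NI13a_def, simplified shape_simps asc.simps eqrs pl13 ng13 pa13 fst_conv snd_conv]
lemmas gtI13a_0 = gen_table[where G = GI13a and K = EI13a and ns = "n13", OF I13a.G KI13a(1-3) asc_list[OF mcI13a], THEN bal2[where n = "Suc (Suc (Suc 0))"],
  unfolded map_fold MI13a_def, simplified bal_simps asc.simps mkl.simps if_True if_False eqrs pl13 fst_conv snd_conv]
lemmas rtI13a = node_table[where G = GI13a and W = WI13a and K = EI13a, OF I13a.G I13a.W KI13a(1,2,4) I13a.N_less z13 le13 upt13, unfolded tree_unf, unfolded r_fold, simplified if_True if_False fold_simps tree_simps pa13]
lemmas dtI13a = walk_dead[where W = WI13a, OF I13a.W z13 le13 upt13, unfolded tree_unf, unfolded r_fold, simplified fold_simps tree_simps pa13]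
lemmas ftI13a = lv_dead[OF le13 upt13, unfolded tree_unf, unfolded r_fold, simplified fold_simps tree_simps pa13]
lemma cwI13a: "WI13a us T = WI13a us T" ..
lemmas runI13a =  rtI13a dtI13a ftI13a walk_end[where W = WI13a, OF I13a.W] leaf_simps
lemmas conI13a = cwI13a bsel_cong bleaf_cong fin_cong
lemma partI13a: "GI13a (Lf (R 0)) [R 0] [R 3, R 2, R 1] \<and>
  GI13a (Lf (R 0)) [R 0] [R 4, R 3, R 2] \<and>
  GI13a (Lf (R 0)) [R 0] [R 5, R 4, R 3] \<and>
  GI13a (Lf (R 0)) [R 0] [R 6, R 5, R 4] \<and>
  GI13a (Lf (R 0)) [R 0] [R 7, R 6, R 5]"
proof -
  note wt = conj64[OF wtI13a_0] and gt = conj64[OF gtI13a_0]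
  show ?thesis
    unfolding r_fold
    by (simp only: wt gt runI13a cong: conI13a)
qed
lemma tban_I13a:
  assumes "base 13 False A Q C"
  shows "\<forall>t\<in>set [2, 3, 4, 5, 6]. tban 13 False A Q C 1 t"
proof (rule I13a.plain_all)
  show "\<forall>x\<in>set []. tban 13 False A Q C (fst x) (snd x)" by simp
qed (use assms partI13a in \<open>simp_all add: MI13a_def\<close>)

lemma reach_13: "reach 13"
proof (rule reach_step[where c = 1 and ?a0.0 = 1 and U = U13 and TS = "[2, 3, 4, 5, 6]" and V = "[(2, 1, 2), (3, 1, 3), (4, 1, 4), (5, 1, 5), (6, 1, 6), (7, 1, 6), (8, 1, 5), (9, 1, 4), (10, 1, 3), (11, 1, 2)]"])
  show "reach 1" by (rule reach_1)
  show "\<forall>t\<in>set [2, 3, 4, 5, 6]. tban 13 False A Q C 1 t" if "base 13 False A Q C" for A Q C using tban_I13a[OF that] by simp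
qed (rule cop13 | simp add: U13_def upt13[symmetric])+

abbreviation n17 :: "nat list" where "n17 \<equiv> [0, 1, 2, 3, 4, 5, 6, 7, 8, 9, 10, 11, 12, 13, 14, 15, 16]"
lemma upt17: "n17 = [0..<17]" by (simp add: upt_rec)
lemma le17: "17 \<le> (64::nat)" and z17: "0 < (17::nat)" by simp_all
definition U17 :: "nat list" where "U17 = [1, 2, 3, 4, 5, 6, 7, 8, 9, 10, 11, 12, 13, 14, 15, 16]"
lemma cop17: "list_all (\<lambda>u. coprime u 17) U17" by (rule units_coprime) (simp add: U17_def)
lemmas pa17 = path_table[of 17 "n17", unfolded code_def bits_numeral, simplified, unfolded One_nat_def[symmetric], unfolded r_fold]
lemmas pl17_0 = pl_table[of 17 "n17", THEN bal2[where n = "Suc (Suc (Suc (Suc 0)))"], simplified bal_simps arith, unfolded r_fold]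
lemmas pl17_1 = pl17_0[THEN q1] pl17_0[THEN q2] pl17_0[THEN q3] pl17_0[THEN q4]
lemmas pl17_2 = pl17_1[THEN q1] pl17_1[THEN q2] pl17_1[THEN q3] pl17_1[THEN q4]
lemmas pl17_3 = pl17_2[THEN q1] pl17_2[THEN q2] pl17_2[THEN q3] pl17_2[THEN q4]
lemmas pl17 = pl17_3[THEN q1] pl17_3[THEN q2] pl17_3[THEN q3] pl17_3[THEN q4]
lemmas ng17 = ng_table[of 17 "n17", simplified, unfolded One_nat_def[symmetric], unfolded r_fold]
text \<open>Products and ban tests are tabulated for those moduli that have a search by stages; for
  17 this is the one in the parity mode.\<close>

lemmas mt17_0 = mt_table'[OF upt17, THEN gsl_bal[where n = "Suc (Suc (Suc (Suc 0)))" and m = "Suc (Suc (Suc (Suc 0)))"], unfolded map_fold, simplified bal_simps gsl.simps fst_conv snd_conv pl17]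
lemmas bs17 = bsel_table[where h = 17 and xs = "map R n17" and n = "(Suc (Suc (Suc (Suc (Suc (Suc (Suc 0)))))))" and vs = "[v0,v1,v2,v3,v4,v5,v6]" for v0 v1 v2 v3 v4 v5 v6,
  unfolded map_fold, simplified list.pred_inject simp_thms pt_simps lefts_simps join.simps keep.simps drp.simps fb.simps get_simps pa17]

definition MI17a :: marks where "MI17a = []"
definition NI17a :: marks where "NI17a = []"
abbreviation "EI17a \<equiv> mkenv 17 False MI17a NI17a"
definition "GI17a B = gen (EI17a B)"
definition "WI17a us = wk 17 False (\<lambda>a. map fst (asc NI17a a)) (hd us) (tl us)"
interpretation I17a: inst 17 False MI17a NI17a GI17a WI17a U17 "[]"
proof unfold_locales
  have "less_marks 17 NI17a" by (simp add: NI17a_def r_defs)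
  from asc_set[OF this] show "\<forall>c\<in>set (map fst (asc NI17a a)). val c < 17" for a by auto
  show "chk 17 U17 [] NI17a" by (simp add: chk_def NI17a_def U17_def r_defs)
qed (rule cop17 | simp add: GI17a_def WI17a_def)+
lemma mcI17a: "plain_marks MI17a" by (simp add: MI17a_def r_defs)
lemmas KI17a = env.sel[where ?x1.0 = 17 and ?x2.0 = False and ?x3.0 = "mlf (asc MI17a)" and ?x4.0 = "blf (\<lambda>a. map fst (asc NI17a a))"]
lemmas wtI17a_0 = walk_table_vs[where W = WI17a and ns = "n17", OF I17a.W z17 le17, THEN bal2[where n = "Suc (Suc (Suc (Suc 0)))"],
  unfolded map_fold NI17a_def, simplified shape_simps asc.simps eqrs pl17 ng17 pa17 fst_conv snd_conv]
lemmas gtI17a_0 = gen_table[where G = GI17a and K = EI17a and ns = "n17", OF I17a.G KI17a(1-3) asc_list[OF mcI17a], THEN bal2[where n = "Suc (Suc (Suc (Suc 0)))"],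
  unfolded map_fold MI17a_def, simplified bal_simps asc.simps mkl.simps if_True if_False eqrs pl17 fst_conv snd_conv]
lemmas rtI17a = node_table[where G = GI17a and W = WI17a and K = EI17a, OF I17a.G I17a.W KI17a(1,2,4) I17a.N_less z17 le17 upt17, unfolded tree_unf, unfolded r_fold, simplified if_True if_False fold_simps tree_simps pa17]
lemmas dtI17a = walk_dead[where W = WI17a, OF I17a.W z17 le17 upt17, unfolded tree_unf, unfolded r_fold, simplified fold_simps tree_simps pa17]
lemmas ftI17a = lv_dead[OF le17 upt17, unfolded tree_unf, unfolded r_fold, simplified fold_simps tree_simps pa17]
lemma cwI17a: "WI17a us T = WI17a us T" ..
lemmas runI17a =  rtI17a dtI17a ftI17a walk_end[where W = WI17a, OF I17a.W] leaf_simps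
lemmas conI17a = cwI17a bsel_cong bleaf_cong fin_cong
lemma partI17a: "GI17a (Lf (R 0)) [R 0] [R 3, R 2, R 1] \<and>
  GI17a (Lf (R 0)) [R 0] [R 4, R 3, R 2] \<and>
  GI17a (Lf (R 0)) [R 0] [R 5, R 4, R 3] \<and>
  GI17a (Lf (R 0)) [R 0] [R 6, R 5, R 4] \<and>
  GI17a (Lf (R 0)) [R 0] [R 7, R 6, R 5] \<and>
  GI17a (Lf (R 0)) [R 0] [R 8, R 7, R 6] \<and>
  GI17a (Lf (R 0)) [R 0] [R 9, R 8, R 7]"
proof -
  note wt = conj64[OF wtI17a_0] and gt = conj64[OF gtI17a_0]
  show ?thesis
    unfolding r_fold
    by (simp only: wt gt runI17a cong: conI17a)
qed
lemma tban_I17a: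
  assumes "base 17 False A Q C"
  shows "\<forall>t\<in>set [2, 3, 4, 5, 6, 7, 8]. tban 17 False A Q C 1 t"
proof (rule I17a.plain_all)
  show "\<forall>x\<in>set []. tban 17 False A Q C (fst x) (snd x)" by simp
qed (use assms partI17a in \<open>simp_all add: MI17a_def\<close>)

lemma reach_17: "reach 17"
proof (rule reach_step[where c = 1 and ?a0.0 = 1 and U = U17 and TS = "[2, 3, 4, 5, 6, 7, 8]" and V = "[(2, 1, 2), (3, 1, 3), (4, 1, 4), (5, 1, 5), (6, 1, 6), (7, 1, 7), (8, 1, 8), (9, 1, 8), (10, 1, 7), (11, 1, 6), (12, 1, 5), (13, 1, 4), (14, 1, 3), (15, 1, 2)]"])
  show "reach 1" by (rule reach_1)
  show "\<forall>t\<in>set [2, 3, 4, 5, 6, 7, 8]. tban 17 False A Q C 1 t" if "base 17 False A Q C" for A Q C using tban_I17a[OF that] by simp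
qed (rule cop17 | simp add: U17_def upt17[symmetric])+

abbreviation n19 :: "nat list" where "n19 \<equiv> [0, 1, 2, 3, 4, 5, 6, 7, 8, 9, 10, 11, 12, 13, 14, 15, 16, 17, 18]"
lemma upt19: "n19 = [0..<19]" by (simp add: upt_rec)
lemma le19: "19 \<le> (64::nat)" and z19: "0 < (19::nat)" by simp_all
definition U19 :: "nat list" where "U19 = [1, 2, 3, 4, 5, 6, 7, 8, 9, 10, 11, 12, 13, 14, 15, 16, 17, 18]"
lemma cop19: "list_all (\<lambda>u. coprime u 19) U19" by (rule units_coprime) (simp add: U19_def)
lemmas pa19 = path_table[of 19 "n19", unfolded code_def bits_numeral, simplified, unfolded One_nat_def[symmetric], unfolded r_fold]
lemmas pl19_0 = pl_table[of 19 "n19", THEN bal2[where n = "Suc (Suc (Suc (Suc 0)))"], simplified bal_simps arith, unfolded r_fold]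
lemmas pl19_1 = pl19_0[THEN q1] pl19_0[THEN q2] pl19_0[THEN q3] pl19_0[THEN q4]
lemmas pl19_2 = pl19_1[THEN q1] pl19_1[THEN q2] pl19_1[THEN q3] pl19_1[THEN q4]
lemmas pl19_3 = pl19_2[THEN q1] pl19_2[THEN q2] pl19_2[THEN q3] pl19_2[THEN q4]
lemmas pl19 = pl19_3[THEN q1] pl19_3[THEN q2] pl19_3[THEN q3] pl19_3[THEN q4]
lemmas ng19 = ng_table[of 19 "n19", simplified, unfolded One_nat_def[symmetric], unfolded r_fold]
lemmas mt19_0 = mt_table'[OF upt19, THEN gsl_bal[where n = "Suc (Suc (Suc (Suc 0)))" and m = "Suc (Suc (Suc (Suc 0)))"], unfolded map_fold, simplified bal_simps gsl.simps fst_conv snd_conv pl19]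
lemmas bs19 = bsel_table[where h = 19 and xs = "map R n19" and n = "(Suc (Suc (Suc (Suc (Suc (Suc (Suc 0)))))))" and vs = "[v0,v1,v2,v3,v4,v5,v6]" for v0 v1 v2 v3 v4 v5 v6,
  unfolded map_fold, simplified list.pred_inject simp_thms pt_simps lefts_simps join.simps keep.simps drp.simps fb.simps get_simps pa19]

definition MI19a :: marks where "MI19a = []"
definition NI19a :: marks where "NI19a = []"
abbreviation "EI19a \<equiv> mkenv 19 False MI19a NI19a"
definition "GI19a B = gen (EI19a B)"
definition "WI19a us = wk 19 False (\<lambda>a. map fst (asc NI19a a)) (hd us) (tl us)"
interpretation I19a: inst 19 False MI19a NI19a GI19a WI19a U19 "[]"
proof unfold_locales
  have "less_marks 19 NI19a" by (simp add: NI19a_def r_defs)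
  from asc_set[OF this] show "\<forall>c\<in>set (map fst (asc NI19a a)). val c < 19" for a by auto
  show "chk 19 U19 [] NI19a" by (simp add: chk_def NI19a_def U19_def r_defs)
qed (rule cop19 | simp add: GI19a_def WI19a_def)+
lemma mcI19a: "plain_marks MI19a" by (simp add: MI19a_def r_defs)
lemmas KI19a = env.sel[where ?x1.0 = 19 and ?x2.0 = False and ?x3.0 = "mlf (asc MI19a)" and ?x4.0 = "blf (\<lambda>a. map fst (asc NI19a a))"]
lemmas wtI19a_0 = walk_table_vs[where W = WI19a and ns = "n19", OF I19a.W z19 le19, THEN bal2[where n = "Suc (Suc (Suc (Suc 0)))"],
  unfolded map_fold NI19a_def, simplified shape_simps asc.simps eqrs pl19 ng19 pa19 fst_conv snd_conv]
lemmas gtI19a_0 = gen_table[where G = GI19a and K = EI19a and ns = "n19", OF I19a.G KI19a(1-3) asc_list[OF mcI19a], THEN bal2[where n = "Suc (Suc (Suc (Suc 0)))"],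
  unfolded map_fold MI19a_def, simplified bal_simps asc.simps mkl.simps if_True if_False eqrs pl19 fst_conv snd_conv]
lemmas rtI19a = node_table[where G = GI19a and W = WI19a and K = EI19a, OF I19a.G I19a.W KI19a(1,2,4) I19a.N_less z19 le19 upt19, unfolded tree_unf, unfolded r_fold, simplified if_True if_False fold_simps tree_simps pa19]
lemmas dtI19a = walk_dead[where W = WI19a, OF I19a.W z19 le19 upt19, unfolded tree_unf, unfolded r_fold, simplified fold_simps tree_simps pa19]
lemmas ftI19a = lv_dead[OF le19 upt19, unfolded tree_unf, unfolded r_fold, simplified fold_simps tree_simps pa19]
lemma cwI19a: "WI19a us T = WI19a us T" ..
lemmas runI19a =  rtI19a dtI19a ftI19a walk_end[where W = WI19a, OF I19a.W] leaf_simps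
lemmas conI19a = cwI19a bsel_cong bleaf_cong fin_cong
lemma partI19a: "GI19a (Lf (R 0)) [R 0] [R 3, R 2, R 1] \<and>
  GI19a (Lf (R 0)) [R 0] [R 4, R 3, R 2] \<and>
  GI19a (Lf (R 0)) [R 0] [R 5, R 4, R 3] \<and>
  GI19a (Lf (R 0)) [R 0] [R 6, R 5, R 4] \<and>
  GI19a (Lf (R 0)) [R 0] [R 7, R 6, R 5] \<and>
  GI19a (Lf (R 0)) [R 0] [R 8, R 7, R 6] \<and>
  GI19a (Lf (R 0)) [R 0] [R 9, R 8, R 7] \<and>
  GI19a (Lf (R 0)) [R 0] [R 10, R 9, R 8]"
proof -
  note wt = conj64[OF wtI19a_0] and gt = conj64[OF gtI19a_0]
  show ?thesis
    unfolding r_fold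
    by (simp only: wt gt runI19a cong: conI19a)
qed
lemma tban_I19a:
  assumes "base 19 False A Q C"
  shows "\<forall>t\<in>set [2, 3, 4, 5, 6, 7, 8, 9]. tban 19 False A Q C 1 t"
proof (rule I19a.plain_all)
  show "\<forall>x\<in>set []. tban 19 False A Q C (fst x) (snd x)" by simp
qed (use assms partI19a in \<open>simp_all add: MI19a_def\<close>)

lemma reach_19: "reach 19"
proof (rule reach_step[where c = 1 and ?a0.0 = 1 and U = U19 and TS = "[2, 3, 4, 5, 6, 7, 8, 9]" and V = "[(2, 1, 2), (3, 1, 3), (4, 1, 4), (5, 1, 5), (6, 1, 6), (7, 1, 7), (8, 1, 8), (9, 1, 9), (10, 1, 9), (11, 1, 8), (12, 1, 7), (13, 1, 6), (14, 1, 5), (15, 1, 4), (16, 1, 3), (17, 1, 2)]"])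
  show "reach 1" by (rule reach_1)
  show "\<forall>t\<in>set [2, 3, 4, 5, 6, 7, 8, 9]. tban 19 False A Q C 1 t" if "base 19 False A Q C" for A Q C using tban_I19a[OF that] by simp
qed (rule cop19 | simp add: U19_def upt19[symmetric])+

section \<open>Moduli 9, 15 and 21: starting from a value divisible by 3, 5 and 7\<close>

abbreviation n9 :: "nat list" where "n9 \<equiv> [0, 1, 2, 3, 4, 5, 6, 7, 8]"
lemma upt9: "n9 = [0..<9]" by (simp add: upt_rec)
lemma le9: "9 \<le> (64::nat)" and z9: "0 < (9::nat)" by simp_all
definition U9 :: "nat list" where "U9 = [1, 2, 4, 5, 7, 8]"
lemma cop9: "list_all (\<lambda>u. coprime u 9) U9" by (rule units_coprime) (simp add: U9_def)
lemmas pa9 = path_table[of 9 "n9", unfolded code_def bits_numeral, simplified, unfolded One_nat_def[symmetric], unfolded r_fold]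
lemmas pl9_0 = pl_table[of 9 "n9", THEN bal2[where n = "Suc (Suc (Suc 0))"], simplified bal_simps arith, unfolded r_fold]
lemmas pl9_1 = pl9_0[THEN q1] pl9_0[THEN q2] pl9_0[THEN q3] pl9_0[THEN q4]
lemmas pl9_2 = pl9_1[THEN q1] pl9_1[THEN q2] pl9_1[THEN q3] pl9_1[THEN q4]
lemmas pl9 = pl9_2[THEN q1] pl9_2[THEN q2] pl9_2[THEN q3] pl9_2[THEN q4]
lemmas ng9 = ng_table[of 9 "n9", simplified, unfolded One_nat_def[symmetric], unfolded r_fold]

definition MI9a :: marks where "MI9a = []"
definition NI9a :: marks where "NI9a = []"
abbreviation "EI9a \<equiv> mkenv 9 False MI9a NI9a"
definition "GI9a B = gen (EI9a B)"
definition "WI9a us = wk 9 False (\<lambda>a. map fst (asc NI9a a)) (hd us) (tl us)"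
interpretation I9a: inst 9 False MI9a NI9a GI9a WI9a U9 "[]"
proof unfold_locales
  have "less_marks 9 NI9a" by (simp add: NI9a_def r_defs)
  from asc_set[OF this] show "\<forall>c\<in>set (map fst (asc NI9a a)). val c < 9" for a by auto
  show "chk 9 U9 [] NI9a" by (simp add: chk_def NI9a_def U9_def r_defs)
qed (rule cop9 | simp add: GI9a_def WI9a_def)+
lemma mcI9a: "plain_marks MI9a" by (simp add: MI9a_def r_defs)
lemmas KI9a = env.sel[where ?x1.0 = 9 and ?x2.0 = False and ?x3.0 = "mlf (asc MI9a)" and ?x4.0 = "blf (\<lambda>a. map fst (asc NI9a a))"]
lemmas wtI9a_0 = walk_table_vs[where W = WI9a and ns = "n9", OF I9a.W z9 le9, THEN bal2[where n = "Suc (Suc (Suc 0))"],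
  unfolded map_fold NI9a_def, simplified shape_simps asc.simps eqrs pl9 ng9 pa9 fst_conv snd_conv]
lemmas gtI9a_0 = gen_table[where G = GI9a and K = EI9a and ns = "n9", OF I9a.G KI9a(1-3) asc_list[OF mcI9a], THEN bal2[where n = "Suc (Suc (Suc 0))"],
  unfolded map_fold MI9a_def, simplified bal_simps asc.simps mkl.simps if_True if_False eqrs pl9 fst_conv snd_conv]
lemmas rtI9a = node_table[where G = GI9a and W = WI9a and K = EI9a, OF I9a.G I9a.W KI9a(1,2,4) I9a.N_less z9 le9 upt9, unfolded tree_unf, unfolded r_fold, simplified if_True if_False fold_simps tree_simps pa9]
lemmas dtI9a = walk_dead[where W = WI9a, OF I9a.W z9 le9 upt9, unfolded tree_unf, unfolded r_fold, simplified fold_simps tree_simps pa9]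
lemmas ftI9a = lv_dead[OF le9 upt9, unfolded tree_unf, unfolded r_fold, simplified fold_simps tree_simps pa9]
lemma cwI9a: "WI9a us T = WI9a us T" ..
lemmas runI9a =  rtI9a dtI9a ftI9a walk_end[where W = WI9a, OF I9a.W] leaf_simps
lemmas conI9a = cwI9a bsel_cong bleaf_cong fin_cong
lemma partI9a: "GI9a (Lf (R 0)) [R 0] [R 4, R 1, R 7]"
proof -
  note wt = conj64[OF wtI9a_0] and gt = conj64[OF gtI9a_0]
  show ?thesis
    unfolding r_fold
    by (simp only: wt gt runI9a cong: conI9a)
qed
lemma tban_I9a:
  assumes "base 9 False A Q C"
  shows "\<forall>t\<in>set [1]. tban 9 False A Q C 3 t"
proof (rule I9a.plain_all)
  show "\<forall>x\<in>set []. tban 9 False A Q C (fst x) (snd x)" by simp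
qed (use assms partI9a in \<open>simp_all add: MI9a_def\<close>)

text \<open>The units 1, 4, 7 modulo 9 fix 3 and, up to sign, carry 1 to every residue prime to 3;
  the residues 3 and 6 are \<open>a0\<close> and \<open>- a0\<close>. So a single type is
  left.\<close>

lemma reach_9: "reach 9"
proof (rule reach_step[where c = 3 and ?a0.0 = 3 and U = U9 and TS = "[1]" and V = "[(1, 1, 1), (2, 7, 1), (4, 4, 1), (5, 4, 1), (7, 7, 1), (8, 1, 1)]"])
  show "reach 3" by (rule reach_3)
  show "\<forall>t\<in>set [1]. tban 9 False A Q C 3 t" if "base 9 False A Q C" for A Q C using tban_I9a[OF that] by simp
qed (rule cop9 | simp add: U9_def upt9[symmetric])+

abbreviation n15 :: "nat list" where "n15 \<equiv> [0, 1, 2, 3, 4, 5, 6, 7, 8, 9, 10, 11, 12, 13, 14]"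
lemma upt15: "n15 = [0..<15]" by (simp add: upt_rec)
lemma le15: "15 \<le> (64::nat)" and z15: "0 < (15::nat)" by simp_all
definition U15 :: "nat list" where "U15 = [1, 2, 4, 7, 8, 11, 13, 14]"
lemma cop15: "list_all (\<lambda>u. coprime u 15) U15" by (rule units_coprime) (simp add: U15_def)
lemmas pa15 = path_table[of 15 "n15", unfolded code_def bits_numeral, simplified, unfolded One_nat_def[symmetric], unfolded r_fold]
lemmas pl15_0 = pl_table[of 15 "n15", THEN bal2[where n = "Suc (Suc (Suc 0))"], simplified bal_simps arith, unfolded r_fold]
lemmas pl15_1 = pl15_0[THEN q1] pl15_0[THEN q2] pl15_0[THEN q3] pl15_0[THEN q4]
lemmas pl15_2 = pl15_1[THEN q1] pl15_1[THEN q2] pl15_1[THEN q3] pl15_1[THEN q4]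
lemmas pl15 = pl15_2[THEN q1] pl15_2[THEN q2] pl15_2[THEN q3] pl15_2[THEN q4]
lemmas ng15 = ng_table[of 15 "n15", simplified, unfolded One_nat_def[symmetric], unfolded r_fold]
lemmas mt15_0 = mt_table'[OF upt15, THEN gsl_bal[where n = "Suc (Suc (Suc 0))" and m = "Suc (Suc (Suc 0))"], unfolded map_fold, simplified bal_simps gsl.simps fst_conv snd_conv pl15]
lemmas bs15 = bsel_table[where h = 15 and xs = "map R n15" and n = "(Suc (Suc (Suc (Suc (Suc (Suc (Suc 0)))))))" and vs = "[v0,v1,v2,v3,v4,v5,v6]" for v0 v1 v2 v3 v4 v5 v6,
  unfolded map_fold, simplified list.pred_inject simp_thms pt_simps lefts_simps join.simps keep.simps drp.simps fb.simps get_simps pa15]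

definition MI15a :: marks where "MI15a = []"
definition NI15a :: marks where "NI15a = []"
abbreviation "EI15a \<equiv> mkenv 15 False MI15a NI15a"
definition "GI15a B = gen (EI15a B)"
definition "WI15a us = wk 15 False (\<lambda>a. map fst (asc NI15a a)) (hd us) (tl us)"
interpretation I15a: inst 15 False MI15a NI15a GI15a WI15a U15 "[]"
proof unfold_locales
  have "less_marks 15 NI15a" by (simp add: NI15a_def r_defs)
  from asc_set[OF this] show "\<forall>c\<in>set (map fst (asc NI15a a)). val c < 15" for a by auto
  show "chk 15 U15 [] NI15a" by (simp add: chk_def NI15a_def U15_def r_defs)
qed (rule cop15 | simp add: GI15a_def WI15a_def)+
lemma mcI15a: "plain_marks MI15a" by (simp add: MI15a_def r_defs)
lemmas KI15a = env.sel[where ?x1.0 = 15 and ?x2.0 = False and ?x3.0 = "mlf (asc MI15a)" and ?x4.0 = "blf (\<lambda>a. map fst (asc NI15a a))"]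
lemmas wtI15a_0 = walk_table_vs[where W = WI15a and ns = "n15", OF I15a.W z15 le15, THEN bal2[where n = "Suc (Suc (Suc 0))"],
  unfolded map_fold NI15a_def, simplified shape_simps asc.simps eqrs pl15 ng15 pa15 fst_conv snd_conv]
lemmas gtI15a_0 = gen_table[where G = GI15a and K = EI15a and ns = "n15", OF I15a.G KI15a(1-3) asc_list[OF mcI15a], THEN bal2[where n = "Suc (Suc (Suc 0))"],
  unfolded map_fold MI15a_def, simplified bal_simps asc.simps mkl.simps if_True if_False eqrs pl15 fst_conv snd_conv]
lemmas rtI15a = node_table[where G = GI15a and W = WI15a and K = EI15a, OF I15a.G I15a.W KI15a(1,2,4) I15a.N_less z15 le15 upt15, unfolded tree_unf, unfolded r_fold, simplified if_True if_False fold_simps tree_simps pa15]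
lemmas dtI15a = walk_dead[where W = WI15a, OF I15a.W z15 le15 upt15, unfolded tree_unf, unfolded r_fold, simplified fold_simps tree_simps pa15]
lemmas ftI15a = lv_dead[OF le15 upt15, unfolded tree_unf, unfolded r_fold, simplified fold_simps tree_simps pa15]
lemma cwI15a: "WI15a us T = WI15a us T" ..
lemmas runI15a =  rtI15a dtI15a ftI15a walk_end[where W = WI15a, OF I15a.W] leaf_simps
lemmas conI15a = cwI15a bsel_cong bleaf_cong fin_cong
lemma partI15a: "GI15a (Lf (R 0)) [R 0] [R 6, R 1, R 11] \<and>
  GI15a (Lf (R 0)) [R 0] [R 8, R 3, R 13]"
proof -
  note wt = conj64[OF wtI15a_0] and gt = conj64[OF gtI15a_0]
  show ?thesis
    unfolding r_fold
    by (simp only: wt gt runI15a cong: conI15a)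
qed
lemma tban_I15a:
  assumes "base 15 False A Q C"
  shows "\<forall>t\<in>set [1, 3]. tban 15 False A Q C 5 t"
proof (rule I15a.plain_all)
  show "\<forall>x\<in>set []. tban 15 False A Q C (fst x) (snd x)" by simp
qed (use assms partI15a in \<open>simp_all add: MI15a_def\<close>)

text \<open>The units congruent to 1 modulo 3 fix 5. Up to sign they carry 1 to the residues prime
  to 15 and 3 to the nonzero multiples of 3, which leaves two types.\<close>

lemma reach_15: "reach 15"
proof (rule reach_step[where c = 5 and ?a0.0 = 5 and U = U15 and TS = "[1, 3]" and V = "[(1, 1, 1), (2, 13, 1), (3, 1, 3), (4, 4, 1), (6, 7, 3), (7, 7, 1), (8, 7, 1), (9, 7, 3), (11, 4, 1), (12, 1, 3), (13, 13, 1), (14, 1, 1)]"])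
  show "reach 5" by (rule reach_5)
  show "\<forall>t\<in>set [1, 3]. tban 15 False A Q C 5 t" if "base 15 False A Q C" for A Q C using tban_I15a[OF that] by simp
qed (rule cop15 | simp add: U15_def upt15[symmetric])+

abbreviation n21 :: "nat list" where "n21 \<equiv> [0, 1, 2, 3, 4, 5, 6, 7, 8, 9, 10, 11, 12, 13, 14, 15, 16, 17, 18, 19, 20]"
lemma upt21: "n21 = [0..<21]" by (simp add: upt_rec)
lemma le21: "21 \<le> (64::nat)" and z21: "0 < (21::nat)" by simp_all
definition U21 :: "nat list" where "U21 = [1, 2, 4, 5, 8, 10, 11, 13, 16, 17, 19, 20]"
lemma cop21: "list_all (\<lambda>u. coprime u 21) U21" by (rule units_coprime) (simp add: U21_def)
lemmas pa21 = path_table[of 21 "n21", unfolded code_def bits_numeral, simplified, unfolded One_nat_def[symmetric], unfolded r_fold]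
lemmas pl21_0 = pl_table[of 21 "n21", THEN bal2[where n = "Suc (Suc (Suc (Suc 0)))"], simplified bal_simps arith, unfolded r_fold]
lemmas pl21_1 = pl21_0[THEN q1] pl21_0[THEN q2] pl21_0[THEN q3] pl21_0[THEN q4]
lemmas pl21_2 = pl21_1[THEN q1] pl21_1[THEN q2] pl21_1[THEN q3] pl21_1[THEN q4]
lemmas pl21_3 = pl21_2[THEN q1] pl21_2[THEN q2] pl21_2[THEN q3] pl21_2[THEN q4]
lemmas pl21 = pl21_3[THEN q1] pl21_3[THEN q2] pl21_3[THEN q3] pl21_3[THEN q4]
lemmas ng21 = ng_table[of 21 "n21", simplified, unfolded One_nat_def[symmetric], unfolded r_fold]

definition MI21a :: marks where "MI21a = []"
definition NI21a :: marks where "NI21a = []"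
abbreviation "EI21a \<equiv> mkenv 21 False MI21a NI21a"
definition "GI21a B = gen (EI21a B)"
definition "WI21a us = wk 21 False (\<lambda>a. map fst (asc NI21a a)) (hd us) (tl us)"
interpretation I21a: inst 21 False MI21a NI21a GI21a WI21a U21 "[]"
proof unfold_locales
  have "less_marks 21 NI21a" by (simp add: NI21a_def r_defs)
  from asc_set[OF this] show "\<forall>c\<in>set (map fst (asc NI21a a)). val c < 21" for a by auto
  show "chk 21 U21 [] NI21a" by (simp add: chk_def NI21a_def U21_def r_defs)
qed (rule cop21 | simp add: GI21a_def WI21a_def)+
lemma mcI21a: "plain_marks MI21a" by (simp add: MI21a_def r_defs)
lemmas KI21a = env.sel[where ?x1.0 = 21 and ?x2.0 = False and ?x3.0 = "mlf (asc MI21a)" and ?x4.0 = "blf (\<lambda>a. map fst (asc NI21a a))"]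
lemmas wtI21a_0 = walk_table_vs[where W = WI21a and ns = "n21", OF I21a.W z21 le21, THEN bal2[where n = "Suc (Suc (Suc (Suc 0)))"],
  unfolded map_fold NI21a_def, simplified shape_simps asc.simps eqrs pl21 ng21 pa21 fst_conv snd_conv]
lemmas gtI21a_0 = gen_table[where G = GI21a and K = EI21a and ns = "n21", OF I21a.G KI21a(1-3) asc_list[OF mcI21a], THEN bal2[where n = "Suc (Suc (Suc (Suc 0)))"],
  unfolded map_fold MI21a_def, simplified bal_simps asc.simps mkl.simps if_True if_False eqrs pl21 fst_conv snd_conv]
lemmas rtI21a = node_table[where G = GI21a and W = WI21a and K = EI21a, OF I21a.G I21a.W KI21a(1,2,4) I21a.N_less z21 le21 upt21, unfolded tree_unf, unfolded r_fold, simplified if_True if_False fold_simps tree_simps pa21]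
lemmas dtI21a = walk_dead[where W = WI21a, OF I21a.W z21 le21 upt21, unfolded tree_unf, unfolded r_fold, simplified fold_simps tree_simps pa21]
lemmas ftI21a = lv_dead[OF le21 upt21, unfolded tree_unf, unfolded r_fold, simplified fold_simps tree_simps pa21]
lemma cwI21a: "WI21a us T = WI21a us T" ..
lemmas runI21a =  rtI21a dtI21a ftI21a walk_end[where W = WI21a, OF I21a.W] leaf_simps
lemmas conI21a = cwI21a bsel_cong bleaf_cong fin_cong
lemma partI21a: "GI21a (Lf (R 0)) [R 0] [R 8, R 1, R 15]"
proof -
  note wt = conj64[OF wtI21a_0] and gt = conj64[OF gtI21a_0]
  show ?thesis
    unfolding r_fold
    by (simp only: wt gt runI21a cong: conI21a)
qed
lemma tban_I21a:
  assumes "base 21 False A Q C"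
  shows "\<forall>t\<in>set [1]. tban 21 False A Q C 7 t"
proof (rule I21a.plain_all)
  show "\<forall>x\<in>set []. tban 21 False A Q C (fst x) (snd x)" by simp
qed (use assms partI21a in \<open>simp_all add: MI21a_def\<close>)

definition MI21b :: marks where "MI21b = []"
text \<open>The unit multiples of the refuted pair \<open>(7, 1)\<close>, up to the sign of the
  second entry, each with the unit leading back.\<close>

definition NI21b :: marks where "NI21b = [(r7, [(r1, r1), (r2, r10), (r4, r16), (r5, r4), (r8, r13), (r10, r19), (r11, r19), (r13, r13), (r16, r4), (r17, r16), (r19, r10), (r20, r1)]), (r14, [(r1, r20), (r2, r11), (r4, r5), (r5, r17), (r8, r8), (r10, r2), (r11, r2), (r13, r8), (r16, r17), (r17, r5), (r19, r11), (r20, r20)])]"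
abbreviation "EI21b \<equiv> mkenv 21 False MI21b NI21b"
definition "GI21b B = gen (EI21b B)"
definition "WI21b us = wk 21 False (\<lambda>a. map fst (asc NI21b a)) (hd us) (tl us)"
interpretation I21b: inst 21 False MI21b NI21b GI21b WI21b U21 "[(7, 1)]"
proof unfold_locales
  have "less_marks 21 NI21b" by (simp add: NI21b_def r_defs)
  from asc_set[OF this] show "\<forall>c\<in>set (map fst (asc NI21b a)). val c < 21" for a by auto
  show "chk 21 U21 [(7, 1)] NI21b" by (simp add: chk_def NI21b_def U21_def r_defs)
qed (rule cop21 | simp add: GI21b_def WI21b_def)+
lemma mcI21b: "plain_marks MI21b" by (simp add: MI21b_def r_defs)
lemmas KI21b = env.sel[where ?x1.0 = 21 and ?x2.0 = False and ?x3.0 = "mlf (asc MI21b)" and ?x4.0 = "blf (\<lambda>a. map fst (asc NI21b a))"]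
lemmas wtI21b_0 = walk_table_vs[where W = WI21b and ns = "n21", OF I21b.W z21 le21, THEN bal2[where n = "Suc (Suc (Suc (Suc 0)))"],
  unfolded map_fold NI21b_def, simplified shape_simps asc.simps eqrs pl21 ng21 pa21 fst_conv snd_conv]
lemmas gtI21b_0 = gen_table[where G = GI21b and K = EI21b and ns = "n21", OF I21b.G KI21b(1-3) asc_list[OF mcI21b], THEN bal2[where n = "Suc (Suc (Suc (Suc 0)))"],
  unfolded map_fold MI21b_def, simplified bal_simps asc.simps mkl.simps if_True if_False eqrs pl21 fst_conv snd_conv]
lemmas rtI21b = node_table[where G = GI21b and W = WI21b and K = EI21b, OF I21b.G I21b.W KI21b(1,2,4) I21b.N_less z21 le21 upt21, unfolded tree_unf, unfolded r_fold, simplified if_True if_False fold_simps tree_simps pa21]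
lemmas dtI21b = walk_dead[where W = WI21b, OF I21b.W z21 le21 upt21, unfolded tree_unf, unfolded r_fold, simplified fold_simps tree_simps pa21]
lemmas ftI21b = lv_dead[OF le21 upt21, unfolded tree_unf, unfolded r_fold, simplified fold_simps tree_simps pa21]
lemma cwI21b: "WI21b us T = WI21b us T" ..
lemmas runI21b =  rtI21b dtI21b ftI21b walk_end[where W = WI21b, OF I21b.W] leaf_simps
lemmas conI21b = cwI21b bsel_cong bleaf_cong fin_cong
lemma partI21b: "GI21b (Lf (R 0)) [R 0] [R 10, R 3, R 17]"
proof -
  note wt = conj64[OF wtI21b_0] and gt = conj64[OF gtI21b_0]
  show ?thesis
    unfolding r_fold
    by (simp only: wt gt runI21b cong: conI21b)
qed
lemma tban_I21b:
  assumes "base 21 False A Q C"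
  shows "\<forall>t\<in>set [3]. tban 21 False A Q C 7 t"
proof (rule I21b.plain_all)
  show "\<forall>x\<in>set [(7, 1)]. tban 21 False A Q C (fst x) (snd x)" using tban_I21a[OF assms] by simp
qed (use assms partI21b in \<open>simp_all add: MI21b_def\<close>)

lemma reach_21: "reach 21"
proof (rule reach_step[where c = 7 and ?a0.0 = 7 and U = U21 and TS = "[1, 3]" and V = "[(1, 1, 1), (2, 19, 1), (3, 1, 3), (4, 4, 1), (5, 16, 1), (6, 16, 3), (8, 13, 1), (9, 4, 3), (10, 10, 1), (11, 10, 1), (12, 4, 3), (13, 13, 1), (15, 16, 3), (16, 16, 1), (17, 4, 1), (18, 1, 3), (19, 19, 1), (20, 1, 1)]"])
  show "reach 7" by (rule reach_7)
  show "\<forall>t\<in>set [1, 3]. tban 21 False A Q C 7 t" if "base 21 False A Q C" for A Q C using tban_I21a[OF that] tban_I21b[OF that] by simp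
qed (rule cop21 | simp add: U21_def upt21[symmetric])+

section \<open>Modulus 23: the type \<open>(1, 2)\<close> first, then the others with its
  help\<close>

abbreviation n23 :: "nat list" where "n23 \<equiv> [0, 1, 2, 3, 4, 5, 6, 7, 8, 9, 10, 11, 12, 13, 14, 15, 16, 17, 18, 19, 20, 21, 22]"
lemma upt23: "n23 = [0..<23]" by (simp add: upt_rec)
lemma le23: "23 \<le> (64::nat)" and z23: "0 < (23::nat)" by simp_all
definition U23 :: "nat list" where "U23 = [1, 2, 3, 4, 5, 6, 7, 8, 9, 10, 11, 12, 13, 14, 15, 16, 17, 18, 19, 20, 21, 22]"
lemma cop23: "list_all (\<lambda>u. coprime u 23) U23" by (rule units_coprime) (simp add: U23_def)
lemmas pa23 = path_table[of 23 "n23", unfolded code_def bits_numeral, simplified, unfolded One_nat_def[symmetric], unfolded r_fold]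
lemmas pl23_0 = pl_table[of 23 "n23", THEN bal2[where n = "Suc (Suc (Suc (Suc 0)))"], simplified bal_simps arith, unfolded r_fold]
lemmas pl23_1 = pl23_0[THEN q1] pl23_0[THEN q2] pl23_0[THEN q3] pl23_0[THEN q4]
lemmas pl23_2 = pl23_1[THEN q1] pl23_1[THEN q2] pl23_1[THEN q3] pl23_1[THEN q4]
lemmas pl23_3 = pl23_2[THEN q1] pl23_2[THEN q2] pl23_2[THEN q3] pl23_2[THEN q4]
lemmas pl23 = pl23_3[THEN q1] pl23_3[THEN q2] pl23_3[THEN q3] pl23_3[THEN q4]
lemmas ng23 = ng_table[of 23 "n23", simplified, unfolded One_nat_def[symmetric], unfolded r_fold]

definition MI23a :: marks where "MI23a = []"
definition NI23a :: marks where "NI23a = []"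
abbreviation "EI23a \<equiv> mkenv 23 False MI23a NI23a"
definition "GI23a B = gen (EI23a B)"
definition "WI23a us = wk 23 False (\<lambda>a. map fst (asc NI23a a)) (hd us) (tl us)"
interpretation I23a: inst 23 False MI23a NI23a GI23a WI23a U23 "[]"
proof unfold_locales
  have "less_marks 23 NI23a" by (simp add: NI23a_def r_defs)
  from asc_set[OF this] show "\<forall>c\<in>set (map fst (asc NI23a a)). val c < 23" for a by auto
  show "chk 23 U23 [] NI23a" by (simp add: chk_def NI23a_def U23_def r_defs)
qed (rule cop23 | simp add: GI23a_def WI23a_def)+
lemma mcI23a: "plain_marks MI23a" by (simp add: MI23a_def r_defs)
lemmas KI23a = env.sel[where ?x1.0 = 23 and ?x2.0 = False and ?x3.0 = "mlf (asc MI23a)" and ?x4.0 = "blf (\<lambda>a. map fst (asc NI23a a))"]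
lemmas wtI23a_0 = walk_table_vs[where W = WI23a and ns = "n23", OF I23a.W z23 le23, THEN bal2[where n = "Suc (Suc (Suc (Suc 0)))"],
  unfolded map_fold NI23a_def, simplified shape_simps asc.simps eqrs pl23 ng23 pa23 fst_conv snd_conv]
lemmas gtI23a_0 = gen_table[where G = GI23a and K = EI23a and ns = "n23", OF I23a.G KI23a(1-3) asc_list[OF mcI23a], THEN bal2[where n = "Suc (Suc (Suc (Suc 0)))"],
  unfolded map_fold MI23a_def, simplified bal_simps asc.simps mkl.simps if_True if_False eqrs pl23 fst_conv snd_conv]
lemmas rtI23a = node_table[where G = GI23a and W = WI23a and K = EI23a, OF I23a.G I23a.W KI23a(1,2,4) I23a.N_less z23 le23 upt23, unfolded tree_unf, unfolded r_fold, simplified if_True if_False fold_simps tree_simps pa23]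
lemmas dtI23a = walk_dead[where W = WI23a, OF I23a.W z23 le23 upt23, unfolded tree_unf, unfolded r_fold, simplified fold_simps tree_simps pa23]
lemmas ftI23a = lv_dead[OF le23 upt23, unfolded tree_unf, unfolded r_fold, simplified fold_simps tree_simps pa23]
lemma cwI23a: "WI23a us T = WI23a us T" ..
lemmas runI23a =  rtI23a dtI23a ftI23a walk_end[where W = WI23a, OF I23a.W] leaf_simps
lemmas conI23a = cwI23a bsel_cong bleaf_cong fin_cong
lemma partI23a: "GI23a (Lf (R 0)) [R 0] [R 3, R 2, R 1]"
proof -
  note wt = conj64[OF wtI23a_0] and gt = conj64[OF gtI23a_0]
  show ?thesis
    unfolding r_fold
    by (simp only: wt gt runI23a cong: conI23a)
qed
lemma tban_I23a:
  assumes "base 23 False A Q C"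
  shows "\<forall>t\<in>set [2]. tban 23 False A Q C 1 t"
proof (rule I23a.plain_all)
  show "\<forall>x\<in>set []. tban 23 False A Q C (fst x) (snd x)" by simp
qed (use assms partI23a in \<open>simp_all add: MI23a_def\<close>)

definition MI23b :: marks where "MI23b = []"
definition NI23b :: marks where "NI23b = [(r1, [(r2, r1), (r21, r1)]), (r2, [(r4, r12), (r19, r12)]), (r3, [(r6, r8), (r17, r8)]), (r4, [(r8, r6), (r15, r6)]), (r5, [(r10, r14), (r13, r14)]), (r6, [(r11, r4), (r12, r4)]), (r7, [(r9, r10), (r14, r10)]), (r8, [(r7, r3), (r16, r3)]), (r9, [(r5, r18), (r18, r18)]), (r10, [(r3, r7), (r20, r7)]), (r11, [(r1, r21), (r22, r21)]), (r12, [(r1, r2), (r22, r2)]), (r13, [(r3, r16), (r20, r16)]), (r14, [(r5, r5), (r18, r5)]), (r15, [(r7, r20), (r16, r20)]), (r16, [(r9, r13), (r14, r13)]), (r17, [(r11, r19), (r12, r19)]), (r18, [(r10, r9), (r13, r9)]), (r19, [(r8, r17), (r15, r17)]), (r20, [(r6, r15), (r17, r15)]), (r21, [(r4, r11), (r19, r11)]), (r22, [(r2, r22), (r21, r22)])]"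
abbreviation "EI23b \<equiv> mkenv 23 False MI23b NI23b"
definition "GI23b B = gen (EI23b B)"
definition "WI23b us = wk 23 False (\<lambda>a. map fst (asc NI23b a)) (hd us) (tl us)"
interpretation I23b: inst 23 False MI23b NI23b GI23b WI23b U23 "[(1, 2)]"
proof unfold_locales
  have "less_marks 23 NI23b" by (simp add: NI23b_def r_defs)
  from asc_set[OF this] show "\<forall>c\<in>set (map fst (asc NI23b a)). val c < 23" for a by auto
  show "chk 23 U23 [(1, 2)] NI23b" by (simp add: chk_def NI23b_def U23_def r_defs)
qed (rule cop23 | simp add: GI23b_def WI23b_def)+
lemma mcI23b: "plain_marks MI23b" by (simp add: MI23b_def r_defs)
lemmas KI23b = env.sel[where ?x1.0 = 23 and ?x2.0 = False and ?x3.0 = "mlf (asc MI23b)" and ?x4.0 = "blf (\<lambda>a. map fst (asc NI23b a))"]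
lemmas wtI23b_0 = walk_table_vs[where W = WI23b and ns = "n23", OF I23b.W z23 le23, THEN bal2[where n = "Suc (Suc (Suc (Suc 0)))"],
  unfolded map_fold NI23b_def, simplified shape_simps asc.simps eqrs pl23 ng23 pa23 fst_conv snd_conv]
lemmas gtI23b_0 = gen_table[where G = GI23b and K = EI23b and ns = "n23", OF I23b.G KI23b(1-3) asc_list[OF mcI23b], THEN bal2[where n = "Suc (Suc (Suc (Suc 0)))"],
  unfolded map_fold MI23b_def, simplified bal_simps asc.simps mkl.simps if_True if_False eqrs pl23 fst_conv snd_conv]
lemmas rtI23b = node_table[where G = GI23b and W = WI23b and K = EI23b, OF I23b.G I23b.W KI23b(1,2,4) I23b.N_less z23 le23 upt23, unfolded tree_unf, unfolded r_fold, simplified if_True if_False fold_simps tree_simps pa23]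
lemmas dtI23b = walk_dead[where W = WI23b, OF I23b.W z23 le23 upt23, unfolded tree_unf, unfolded r_fold, simplified fold_simps tree_simps pa23]
lemmas ftI23b = lv_dead[OF le23 upt23, unfolded tree_unf, unfolded r_fold, simplified fold_simps tree_simps pa23]
lemma cwI23b: "WI23b us T = WI23b us T" ..
lemmas runI23b =  rtI23b dtI23b ftI23b walk_end[where W = WI23b, OF I23b.W] leaf_simps
lemmas conI23b = cwI23b bsel_cong bleaf_cong fin_cong
lemma partI23b: "GI23b (Lf (R 0)) [R 0] [R 4, R 3, R 2] \<and>
  GI23b (Lf (R 0)) [R 0] [R 5, R 4, R 3] \<and>
  GI23b (Lf (R 0)) [R 0] [R 6, R 5, R 4] \<and>
  GI23b (Lf (R 0)) [R 0] [R 7, R 6, R 5] \<and>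
  GI23b (Lf (R 0)) [R 0] [R 8, R 7, R 6] \<and>
  GI23b (Lf (R 0)) [R 0] [R 9, R 8, R 7] \<and>
  GI23b (Lf (R 0)) [R 0] [R 10, R 9, R 8] \<and>
  GI23b (Lf (R 0)) [R 0] [R 11, R 10, R 9] \<and>
  GI23b (Lf (R 0)) [R 0] [R 12, R 11, R 10]"
proof -
  note wt = conj64[OF wtI23b_0] and gt = conj64[OF gtI23b_0]
  show ?thesis
    unfolding r_fold
    by (simp only: wt gt runI23b cong: conI23b)
qed
lemma tban_I23b:
  assumes "base 23 False A Q C"
  shows "\<forall>t\<in>set [3, 4, 5, 6, 7, 8, 9, 10, 11]. tban 23 False A Q C 1 t"
proof (rule I23b.plain_all)
  show "\<forall>x\<in>set [(1, 2)]. tban 23 False A Q C (fst x) (snd x)" using tban_I23a[OF assms] by simp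
qed (use assms partI23b in \<open>simp_all add: MI23b_def\<close>)

lemma reach_23: "reach 23"
proof (rule reach_step[where c = 1 and ?a0.0 = 1 and U = U23 and TS = "[2, 3, 4, 5, 6, 7, 8, 9, 10, 11]" and V = "[(2, 1, 2), (3, 1, 3), (4, 1, 4), (5, 1, 5), (6, 1, 6), (7, 1, 7), (8, 1, 8), (9, 1, 9), (10, 1, 10), (11, 1, 11), (12, 1, 11), (13, 1, 10), (14, 1, 9), (15, 1, 8), (16, 1, 7), (17, 1, 6), (18, 1, 5), (19, 1, 4), (20, 1, 3), (21, 1, 2)]"])
  show "reach 1" by (rule reach_1)
  show "\<forall>t\<in>set [2, 3, 4, 5, 6, 7, 8, 9, 10, 11]. tban 23 False A Q C 1 t" if "base 23 False A Q C" for A Q C using tban_I23a[OF that] tban_I23b[OF that] by simp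
qed (rule cop23 | simp add: U23_def upt23[symmetric])+

section \<open>Moduli 25 and 27: starting from a value divisible by 5 and 9\<close>

abbreviation n25 :: "nat list" where "n25 \<equiv> [0, 1, 2, 3, 4, 5, 6, 7, 8, 9, 10, 11, 12, 13, 14, 15, 16, 17, 18, 19, 20, 21, 22, 23, 24]"
lemma upt25: "n25 = [0..<25]" by (simp add: upt_rec)
lemma le25: "25 \<le> (64::nat)" and z25: "0 < (25::nat)" by simp_all
definition U25 :: "nat list" where "U25 = [1, 2, 3, 4, 6, 7, 8, 9, 11, 12, 13, 14, 16, 17, 18, 19, 21, 22, 23, 24]"
lemma cop25: "list_all (\<lambda>u. coprime u 25) U25" by (rule units_coprime) (simp add: U25_def)
lemmas pa25 = path_table[of 25 "n25", unfolded code_def bits_numeral, simplified, unfolded One_nat_def[symmetric], unfolded r_fold]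
lemmas pl25_0 = pl_table[of 25 "n25", THEN bal2[where n = "Suc (Suc (Suc (Suc 0)))"], simplified bal_simps arith, unfolded r_fold]
lemmas pl25_1 = pl25_0[THEN q1] pl25_0[THEN q2] pl25_0[THEN q3] pl25_0[THEN q4]
lemmas pl25_2 = pl25_1[THEN q1] pl25_1[THEN q2] pl25_1[THEN q3] pl25_1[THEN q4]
lemmas pl25_3 = pl25_2[THEN q1] pl25_2[THEN q2] pl25_2[THEN q3] pl25_2[THEN q4]
lemmas pl25 = pl25_3[THEN q1] pl25_3[THEN q2] pl25_3[THEN q3] pl25_3[THEN q4]
lemmas ng25 = ng_table[of 25 "n25", simplified, unfolded One_nat_def[symmetric], unfolded r_fold]

definition MI25a :: marks where "MI25a = []"
definition NI25a :: marks where "NI25a = []"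
abbreviation "EI25a \<equiv> mkenv 25 False MI25a NI25a"
definition "GI25a B = gen (EI25a B)"
definition "WI25a us = wk 25 False (\<lambda>a. map fst (asc NI25a a)) (hd us) (tl us)"
interpretation I25a: inst 25 False MI25a NI25a GI25a WI25a U25 "[]"
proof unfold_locales
  have "less_marks 25 NI25a" by (simp add: NI25a_def r_defs)
  from asc_set[OF this] show "\<forall>c\<in>set (map fst (asc NI25a a)). val c < 25" for a by auto
  show "chk 25 U25 [] NI25a" by (simp add: chk_def NI25a_def U25_def r_defs)
qed (rule cop25 | simp add: GI25a_def WI25a_def)+
lemma mcI25a: "plain_marks MI25a" by (simp add: MI25a_def r_defs)
lemmas KI25a = env.sel[where ?x1.0 = 25 and ?x2.0 = False and ?x3.0 = "mlf (asc MI25a)" and ?x4.0 = "blf (\<lambda>a. map fst (asc NI25a a))"]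
lemmas wtI25a_0 = walk_table_vs[where W = WI25a and ns = "n25", OF I25a.W z25 le25, THEN bal2[where n = "Suc (Suc (Suc (Suc 0)))"],
  unfolded map_fold NI25a_def, simplified shape_simps asc.simps eqrs pl25 ng25 pa25 fst_conv snd_conv]
lemmas gtI25a_0 = gen_table[where G = GI25a and K = EI25a and ns = "n25", OF I25a.G KI25a(1-3) asc_list[OF mcI25a], THEN bal2[where n = "Suc (Suc (Suc (Suc 0)))"],
  unfolded map_fold MI25a_def, simplified bal_simps asc.simps mkl.simps if_True if_False eqrs pl25 fst_conv snd_conv]
lemmas rtI25a = node_table[where G = GI25a and W = WI25a and K = EI25a, OF I25a.G I25a.W KI25a(1,2,4) I25a.N_less z25 le25 upt25, unfolded tree_unf, unfolded r_fold, simplified if_True if_False fold_simps tree_simps pa25]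
lemmas dtI25a = walk_dead[where W = WI25a, OF I25a.W z25 le25 upt25, unfolded tree_unf, unfolded r_fold, simplified fold_simps tree_simps pa25]
lemmas ftI25a = lv_dead[OF le25 upt25, unfolded tree_unf, unfolded r_fold, simplified fold_simps tree_simps pa25]
lemma cwI25a: "WI25a us T = WI25a us T" ..
lemmas runI25a =  rtI25a dtI25a ftI25a walk_end[where W = WI25a, OF I25a.W] leaf_simps
lemmas conI25a = cwI25a bsel_cong bleaf_cong fin_cong
lemma partI25a: "GI25a (Lf (R 0)) [R 0] [R 6, R 1, R 21]"
proof -
  note wt = conj64[OF wtI25a_0] and gt = conj64[OF gtI25a_0]
  show ?thesis
    unfolding r_fold
    by (simp only: wt gt runI25a cong: conI25a)
qed
lemma tban_I25a:
  assumes "base 25 False A Q C"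
  shows "\<forall>t\<in>set [1]. tban 25 False A Q C 5 t"
proof (rule I25a.plain_all)
  show "\<forall>x\<in>set []. tban 25 False A Q C (fst x) (snd x)" by simp
qed (use assms partI25a in \<open>simp_all add: MI25a_def\<close>)

definition MI25b :: marks where "MI25b = []"
definition NI25b :: marks where "NI25b = [(r5, [(r1, r1), (r4, r6), (r6, r21), (r9, r11), (r11, r16), (r14, r16), (r16, r11), (r19, r21), (r21, r6), (r24, r1)]), (r10, [(r2, r13), (r3, r8), (r7, r18), (r8, r3), (r12, r23), (r13, r23), (r17, r3), (r18, r18), (r22, r8), (r23, r13)]), (r15, [(r2, r12), (r3, r17), (r7, r7), (r8, r22), (r12, r2), (r13, r2), (r17, r22), (r18, r7), (r22, r17), (r23, r12)]), (r20, [(r1, r24), (r4, r19), (r6, r4), (r9, r14), (r11, r9), (r14, r9), (r16, r14), (r19, r4), (r21, r19), (r24, r24)])]"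
abbreviation "EI25b \<equiv> mkenv 25 False MI25b NI25b"
definition "GI25b B = gen (EI25b B)"
definition "WI25b us = wk 25 False (\<lambda>a. map fst (asc NI25b a)) (hd us) (tl us)"
interpretation I25b: inst 25 False MI25b NI25b GI25b WI25b U25 "[(5, 1)]"
proof unfold_locales
  have "less_marks 25 NI25b" by (simp add: NI25b_def r_defs)
  from asc_set[OF this] show "\<forall>c\<in>set (map fst (asc NI25b a)). val c < 25" for a by auto
  show "chk 25 U25 [(5, 1)] NI25b" by (simp add: chk_def NI25b_def U25_def r_defs)
qed (rule cop25 | simp add: GI25b_def WI25b_def)+
lemma mcI25b: "plain_marks MI25b" by (simp add: MI25b_def r_defs)
lemmas KI25b = env.sel[where ?x1.0 = 25 and ?x2.0 = False and ?x3.0 = "mlf (asc MI25b)" and ?x4.0 = "blf (\<lambda>a. map fst (asc NI25b a))"]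
lemmas wtI25b_0 = walk_table_vs[where W = WI25b and ns = "n25", OF I25b.W z25 le25, THEN bal2[where n = "Suc (Suc (Suc (Suc 0)))"],
  unfolded map_fold NI25b_def, simplified shape_simps asc.simps eqrs pl25 ng25 pa25 fst_conv snd_conv]
lemmas gtI25b_0 = gen_table[where G = GI25b and K = EI25b and ns = "n25", OF I25b.G KI25b(1-3) asc_list[OF mcI25b], THEN bal2[where n = "Suc (Suc (Suc (Suc 0)))"],
  unfolded map_fold MI25b_def, simplified bal_simps asc.simps mkl.simps if_True if_False eqrs pl25 fst_conv snd_conv]
lemmas rtI25b = node_table[where G = GI25b and W = WI25b and K = EI25b, OF I25b.G I25b.W KI25b(1,2,4) I25b.N_less z25 le25 upt25, unfolded tree_unf, unfolded r_fold, simplified if_True if_False fold_simps tree_simps pa25]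
lemmas dtI25b = walk_dead[where W = WI25b, OF I25b.W z25 le25 upt25, unfolded tree_unf, unfolded r_fold, simplified fold_simps tree_simps pa25]
lemmas ftI25b = lv_dead[OF le25 upt25, unfolded tree_unf, unfolded r_fold, simplified fold_simps tree_simps pa25]
lemma cwI25b: "WI25b us T = WI25b us T" ..
lemmas runI25b =  rtI25b dtI25b ftI25b walk_end[where W = WI25b, OF I25b.W] leaf_simps
lemmas conI25b = cwI25b bsel_cong bleaf_cong fin_cong
lemma partI25b: "GI25b (Lf (R 0)) [R 0] [R 7, R 2, R 22] \<and>
  GI25b (Lf (R 0)) [R 0] [R 15, R 10, R 5]"
proof -
  note wt = conj64[OF wtI25b_0] and gt = conj64[OF gtI25b_0]
  show ?thesis
    unfolding r_fold
    by (simp only: wt gt runI25b cong: conI25b)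
qed
lemma tban_I25b:
  assumes "base 25 False A Q C"
  shows "\<forall>t\<in>set [2, 10]. tban 25 False A Q C 5 t"
proof (rule I25b.plain_all)
  show "\<forall>x\<in>set [(5, 1)]. tban 25 False A Q C (fst x) (snd x)" using tban_I25a[OF assms] by simp
qed (use assms partI25b in \<open>simp_all add: MI25b_def\<close>)

text \<open>The units congruent to 1 modulo 5 fix 5. Up to sign they carry 1, 2 and 10 to all
  residues other than 0, 5 and 20: the first two are told apart by their squares modulo 5.\<close>

lemma reach_25: "reach 25"
proof (rule reach_step[where c = 5 and ?a0.0 = 5 and U = U25 and TS = "[1, 2, 10]" and V = "[(1, 1, 1), (2, 1, 2), (3, 11, 2), (4, 21, 1), (6, 6, 1), (7, 16, 2), (8, 21, 2), (9, 16, 1), (10, 1, 10), (11, 11, 1), (12, 6, 2), (13, 6, 2), (14, 11, 1), (15, 1, 10), (16, 16, 1), (17, 21, 2), (18, 16, 2), (19, 6, 1), (21, 21, 1), (22, 11, 2), (23, 1, 2), (24, 1, 1)]"])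
  show "reach 5" by (rule reach_5)
  show "\<forall>t\<in>set [1, 2, 10]. tban 25 False A Q C 5 t" if "base 25 False A Q C" for A Q C using tban_I25a[OF that] tban_I25b[OF that] by simp
qed (rule cop25 | simp add: U25_def upt25[symmetric])+

abbreviation n27 :: "nat list" where "n27 \<equiv> [0, 1, 2, 3, 4, 5, 6, 7, 8, 9, 10, 11, 12, 13, 14, 15, 16, 17, 18, 19, 20, 21, 22, 23, 24, 25, 26]"
lemma upt27: "n27 = [0..<27]" by (simp add: upt_rec)
lemma le27: "27 \<le> (64::nat)" and z27: "0 < (27::nat)" by simp_all
definition U27 :: "nat list" where "U27 = [1, 2, 4, 5, 7, 8, 10, 11, 13, 14, 16, 17, 19, 20, 22, 23, 25, 26]"
lemma cop27: "list_all (\<lambda>u. coprime u 27) U27" by (rule units_coprime) (simp add: U27_def)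
lemmas pa27 = path_table[of 27 "n27", unfolded code_def bits_numeral, simplified, unfolded One_nat_def[symmetric], unfolded r_fold]
lemmas pl27_0 = pl_table[of 27 "n27", THEN bal2[where n = "Suc (Suc (Suc (Suc 0)))"], simplified bal_simps arith, unfolded r_fold]
lemmas pl27_1 = pl27_0[THEN q1] pl27_0[THEN q2] pl27_0[THEN q3] pl27_0[THEN q4]
lemmas pl27_2 = pl27_1[THEN q1] pl27_1[THEN q2] pl27_1[THEN q3] pl27_1[THEN q4]
lemmas pl27_3 = pl27_2[THEN q1] pl27_2[THEN q2] pl27_2[THEN q3] pl27_2[THEN q4]
lemmas pl27 = pl27_3[THEN q1] pl27_3[THEN q2] pl27_3[THEN q3] pl27_3[THEN q4]
lemmas ng27 = ng_table[of 27 "n27", simplified, unfolded One_nat_def[symmetric], unfolded r_fold]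

definition MI27a :: marks where "MI27a = []"
definition NI27a :: marks where "NI27a = []"
abbreviation "EI27a \<equiv> mkenv 27 False MI27a NI27a"
definition "GI27a B = gen (EI27a B)"
definition "WI27a us = wk 27 False (\<lambda>a. map fst (asc NI27a a)) (hd us) (tl us)"
interpretation I27a: inst 27 False MI27a NI27a GI27a WI27a U27 "[]"
proof unfold_locales
  have "less_marks 27 NI27a" by (simp add: NI27a_def r_defs)
  from asc_set[OF this] show "\<forall>c\<in>set (map fst (asc NI27a a)). val c < 27" for a by auto
  show "chk 27 U27 [] NI27a" by (simp add: chk_def NI27a_def U27_def r_defs)
qed (rule cop27 | simp add: GI27a_def WI27a_def)+
lemma mcI27a: "plain_marks MI27a" by (simp add: MI27a_def r_defs)
lemmas KI27a = env.sel[where ?x1.0 = 27 and ?x2.0 = False and ?x3.0 = "mlf (asc MI27a)" and ?x4.0 = "blf (\<lambda>a. map fst (asc NI27a a))"]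
lemmas wtI27a_0 = walk_table_vs[where W = WI27a and ns = "n27", OF I27a.W z27 le27, THEN bal2[where n = "Suc (Suc (Suc (Suc 0)))"],
  unfolded map_fold NI27a_def, simplified shape_simps asc.simps eqrs pl27 ng27 pa27 fst_conv snd_conv]
lemmas gtI27a_0 = gen_table[where G = GI27a and K = EI27a and ns = "n27", OF I27a.G KI27a(1-3) asc_list[OF mcI27a], THEN bal2[where n = "Suc (Suc (Suc (Suc 0)))"],
  unfolded map_fold MI27a_def, simplified bal_simps asc.simps mkl.simps if_True if_False eqrs pl27 fst_conv snd_conv]
lemmas rtI27a = node_table[where G = GI27a and W = WI27a and K = EI27a, OF I27a.G I27a.W KI27a(1,2,4) I27a.N_less z27 le27 upt27, unfolded tree_unf, unfolded r_fold, simplified if_True if_False fold_simps tree_simps pa27]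
lemmas dtI27a = walk_dead[where W = WI27a, OF I27a.W z27 le27 upt27, unfolded tree_unf, unfolded r_fold, simplified fold_simps tree_simps pa27]
lemmas ftI27a = lv_dead[OF le27 upt27, unfolded tree_unf, unfolded r_fold, simplified fold_simps tree_simps pa27]
lemma cwI27a: "WI27a us T = WI27a us T" ..
lemmas runI27a =  rtI27a dtI27a ftI27a walk_end[where W = WI27a, OF I27a.W] leaf_simps
lemmas conI27a = cwI27a bsel_cong bleaf_cong fin_cong
lemma partI27a: "GI27a (Lf (R 0)) [R 0] [R 10, R 1, R 19]"
proof -
  note wt = conj64[OF wtI27a_0] and gt = conj64[OF gtI27a_0]
  show ?thesis
    unfolding r_fold
    by (simp only: wt gt runI27a cong: conI27a)
qed
lemma tban_I27a:
  assumes "base 27 False A Q C"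
  shows "\<forall>t\<in>set [1]. tban 27 False A Q C 9 t"
proof (rule I27a.plain_all)
  show "\<forall>x\<in>set []. tban 27 False A Q C (fst x) (snd x)" by simp
qed (use assms partI27a in \<open>simp_all add: MI27a_def\<close>)

definition MI27b :: marks where "MI27b = []"
definition NI27b :: marks where "NI27b = [(r9, [(r1, r1), (r2, r13), (r4, r7), (r5, r16), (r7, r4), (r8, r10), (r10, r19), (r11, r22), (r13, r25), (r14, r25), (r16, r22), (r17, r19), (r19, r10), (r20, r4), (r22, r16), (r23, r7), (r25, r13), (r26, r1)]), (r18, [(r1, r26), (r2, r14), (r4, r20), (r5, r11), (r7, r23), (r8, r17), (r10, r8), (r11, r5), (r13, r2), (r14, r2), (r16, r5), (r17, r8), (r19, r17), (r20, r23), (r22, r11), (r23, r20), (r25, r14), (r26, r26)])]"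
abbreviation "EI27b \<equiv> mkenv 27 False MI27b NI27b"
definition "GI27b B = gen (EI27b B)"
definition "WI27b us = wk 27 False (\<lambda>a. map fst (asc NI27b a)) (hd us) (tl us)"
interpretation I27b: inst 27 False MI27b NI27b GI27b WI27b U27 "[(9, 1)]"
proof unfold_locales
  have "less_marks 27 NI27b" by (simp add: NI27b_def r_defs)
  from asc_set[OF this] show "\<forall>c\<in>set (map fst (asc NI27b a)). val c < 27" for a by auto
  show "chk 27 U27 [(9, 1)] NI27b" by (simp add: chk_def NI27b_def U27_def r_defs)
qed (rule cop27 | simp add: GI27b_def WI27b_def)+
lemma mcI27b: "plain_marks MI27b" by (simp add: MI27b_def r_defs)
lemmas KI27b = env.sel[where ?x1.0 = 27 and ?x2.0 = False and ?x3.0 = "mlf (asc MI27b)" and ?x4.0 = "blf (\<lambda>a. map fst (asc NI27b a))"]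
lemmas wtI27b_0 = walk_table_vs[where W = WI27b and ns = "n27", OF I27b.W z27 le27, THEN bal2[where n = "Suc (Suc (Suc (Suc 0)))"],
  unfolded map_fold NI27b_def, simplified shape_simps asc.simps eqrs pl27 ng27 pa27 fst_conv snd_conv]
lemmas gtI27b_0 = gen_table[where G = GI27b and K = EI27b and ns = "n27", OF I27b.G KI27b(1-3) asc_list[OF mcI27b], THEN bal2[where n = "Suc (Suc (Suc (Suc 0)))"],
  unfolded map_fold MI27b_def, simplified bal_simps asc.simps mkl.simps if_True if_False eqrs pl27 fst_conv snd_conv]
lemmas rtI27b = node_table[where G = GI27b and W = WI27b and K = EI27b, OF I27b.G I27b.W KI27b(1,2,4) I27b.N_less z27 le27 upt27, unfolded tree_unf, unfolded r_fold, simplified if_True if_False fold_simps tree_simps pa27]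
lemmas dtI27b = walk_dead[where W = WI27b, OF I27b.W z27 le27 upt27, unfolded tree_unf, unfolded r_fold, simplified fold_simps tree_simps pa27]
lemmas ftI27b = lv_dead[OF le27 upt27, unfolded tree_unf, unfolded r_fold, simplified fold_simps tree_simps pa27]
lemma cwI27b: "WI27b us T = WI27b us T" ..
lemmas runI27b =  rtI27b dtI27b ftI27b walk_end[where W = WI27b, OF I27b.W] leaf_simps
lemmas conI27b = cwI27b bsel_cong bleaf_cong fin_cong
lemma partI27b: "GI27b (Lf (R 0)) [R 0] [R 12, R 3, R 21]"
proof -
  note wt = conj64[OF wtI27b_0] and gt = conj64[OF gtI27b_0]
  show ?thesis
    unfolding r_fold
    by (simp only: wt gt runI27b cong: conI27b)
qed
lemma tban_I27b:
  assumes "base 27 False A Q C"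
  shows "\<forall>t\<in>set [3]. tban 27 False A Q C 9 t"
proof (rule I27b.plain_all)
  show "\<forall>x\<in>set [(9, 1)]. tban 27 False A Q C (fst x) (snd x)" using tban_I27a[OF assms] by simp
qed (use assms partI27b in \<open>simp_all add: MI27b_def\<close>)

text \<open>The units congruent to 1 modulo 3 fix 9. Up to sign they carry 1 to the residues prime
  to 3, and 3 to the multiples of 3 that are not multiples of 9.\<close>

lemma reach_27: "reach 27"
proof (rule reach_step[where c = 9 and ?a0.0 = 9 and U = U27 and TS = "[1, 3]" and V = "[(1, 1, 1), (2, 25, 1), (3, 1, 3), (4, 4, 1), (5, 22, 1), (6, 7, 3), (7, 7, 1), (8, 19, 1), (10, 10, 1), (11, 16, 1), (12, 4, 3), (13, 13, 1), (14, 13, 1), (15, 4, 3), (16, 16, 1), (17, 10, 1), (19, 19, 1), (20, 7, 1), (21, 7, 3), (22, 22, 1), (23, 4, 1), (24, 1, 3), (25, 25, 1), (26, 1, 1)]"])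
  show "reach 9" by (rule reach_9)
  show "\<forall>t\<in>set [1, 3]. tban 27 False A Q C 9 t" if "base 27 False A Q C" for A Q C using tban_I27a[OF that] tban_I27b[OF that] by simp
qed (rule cop27 | simp add: U27_def upt27[symmetric])+

section \<open>Moduli 29 and 31: the type \<open>(1, 2)\<close> is split by the value of
  \<open>A (4 * m)\<close>\<close>

abbreviation n29 :: "nat list" where "n29 \<equiv> [0, 1, 2, 3, 4, 5, 6, 7, 8, 9, 10, 11, 12, 13, 14, 15, 16, 17, 18, 19, 20, 21, 22, 23, 24, 25, 26, 27, 28]"
lemma upt29: "n29 = [0..<29]" by (simp add: upt_rec)
lemma le29: "29 \<le> (64::nat)" and z29: "0 < (29::nat)" by simp_all
definition U29 :: "nat list" where "U29 = [1, 2, 3, 4, 5, 6, 7, 8, 9, 10, 11, 12, 13, 14, 15, 16, 17, 18, 19, 20, 21, 22, 23, 24, 25, 26, 27, 28]"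
lemma cop29: "list_all (\<lambda>u. coprime u 29) U29" by (rule units_coprime) (simp add: U29_def)
lemmas pa29 = path_table[of 29 "n29", unfolded code_def bits_numeral, simplified, unfolded One_nat_def[symmetric], unfolded r_fold]
lemmas pl29_0 = pl_table[of 29 "n29", THEN bal2[where n = "Suc (Suc (Suc (Suc 0)))"], simplified bal_simps arith, unfolded r_fold]
lemmas pl29_1 = pl29_0[THEN q1] pl29_0[THEN q2] pl29_0[THEN q3] pl29_0[THEN q4]
lemmas pl29_2 = pl29_1[THEN q1] pl29_1[THEN q2] pl29_1[THEN q3] pl29_1[THEN q4]
lemmas pl29_3 = pl29_2[THEN q1] pl29_2[THEN q2] pl29_2[THEN q3] pl29_2[THEN q4]
lemmas pl29 = pl29_3[THEN q1] pl29_3[THEN q2] pl29_3[THEN q3] pl29_3[THEN q4]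
lemmas ng29 = ng_table[of 29 "n29", simplified, unfolded One_nat_def[symmetric], unfolded r_fold]
lemmas mt29_0 = mt_table'[OF upt29, THEN gsl_bal[where n = "Suc (Suc (Suc (Suc 0)))" and m = "Suc (Suc (Suc (Suc 0)))"], unfolded map_fold, simplified bal_simps gsl.simps fst_conv snd_conv pl29]
lemmas bs29 = bsel_table[where h = 29 and xs = "map R n29" and n = "(Suc (Suc (Suc (Suc (Suc (Suc (Suc 0)))))))" and vs = "[v0,v1,v2,v3,v4,v5,v6]" for v0 v1 v2 v3 v4 v5 v6,
  unfolded map_fold, simplified list.pred_inject simp_thms pt_simps lefts_simps join.simps keep.simps drp.simps fb.simps get_simps pa29]

text \<open>The unit multiples of \<open>(1, 2)\<close>, up to the sign of the second entry, with
  the unit leading back. Wherever this type reappears in its own search, the values of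
  \<open>A (4 * m)\<close> excluded so far apply to it.\<close>

definition MI29a :: marks where "MI29a = [(r1, [(r2, r1), (r27, r1)]), (r2, [(r4, r15), (r25, r15)]), (r3, [(r6, r10), (r23, r10)]), (r4, [(r8, r22), (r21, r22)]), (r5, [(r10, r6), (r19, r6)]), (r6, [(r12, r5), (r17, r5)]), (r7, [(r14, r25), (r15, r25)]), (r8, [(r13, r11), (r16, r11)]), (r9, [(r11, r13), (r18, r13)]), (r10, [(r9, r3), (r20, r3)]), (r11, [(r7, r8), (r22, r8)]), (r12, [(r5, r17), (r24, r17)]), (r13, [(r3, r9), (r26, r9)]), (r14, [(r1, r27), (r28, r27)]), (r15, [(r1, r2), (r28, r2)]), (r16, [(r3, r20), (r26, r20)]), (r17, [(r5, r12), (r24, r12)]), (r18, [(r7, r21), (r22, r21)]), (r19, [(r9, r26), (r20, r26)]), (r20, [(r11, r16), (r18, r16)]), (r21, [(r13, r18), (r16, r18)]), (r22, [(r14, r4), (r15, r4)]), (r23, [(r12, r24), (r17, r24)]), (r24, [(r10, r23), (r19, r23)]), (r25, [(r8, r7), (r21, r7)]), (r26, [(r6, r19), (r23, r19)]), (r27, [(r4, r14), (r25, r14)]), (r28, [(r2, r28), (r27, r28)])]"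
definition NI29a :: marks where "NI29a = []"
abbreviation "EI29a \<equiv> mkenv 29 False MI29a NI29a"
definition "GI29a B = gen (EI29a B)"
definition "WI29a us = wk 29 False (\<lambda>a. map fst (asc NI29a a)) (hd us) (tl us)"
interpretation I29a: inst 29 False MI29a NI29a GI29a WI29a U29 "[]"
proof unfold_locales
  have "less_marks 29 NI29a" by (simp add: NI29a_def r_defs)
  from asc_set[OF this] show "\<forall>c\<in>set (map fst (asc NI29a a)). val c < 29" for a by auto
  show "chk 29 U29 [] NI29a" by (simp add: chk_def NI29a_def U29_def r_defs)
qed (rule cop29 | simp add: GI29a_def WI29a_def)+
lemma mcI29a: "plain_marks MI29a" by (simp add: MI29a_def r_defs)
lemmas KI29a = env.sel[where ?x1.0 = 29 and ?x2.0 = False and ?x3.0 = "mlf (asc MI29a)" and ?x4.0 = "blf (\<lambda>a. map fst (asc NI29a a))"]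
lemmas wtI29a_0 = walk_table_vs[where W = WI29a and ns = "n29", OF I29a.W z29 le29, THEN bal2[where n = "Suc (Suc (Suc (Suc 0)))"],
  unfolded map_fold NI29a_def, simplified shape_simps asc.simps eqrs pl29 ng29 pa29 fst_conv snd_conv]
lemmas gtI29a_0 = gen_table[where G = GI29a and K = EI29a and ns = "n29", OF I29a.G KI29a(1-3) asc_list[OF mcI29a], THEN bal2[where n = "Suc (Suc (Suc (Suc 0)))"],
  unfolded map_fold MI29a_def, simplified bal_simps asc.simps mkl.simps if_True if_False eqrs pl29 fst_conv snd_conv]
lemmas gsI29a = gen_table_S[where G = GI29a and K = EI29a and ns = "n29", OF I29a.G KI29a(1,2,5), unfolded map_fold, simplified list_simps]
lemmas wsI29a = walk_table_S[where W = WI29a and ns = "n29", OF I29a.W, unfolded map_fold, simplified list_simps]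
lemmas rtI29a = node_table[where G = GI29a and W = WI29a and K = EI29a, OF I29a.G I29a.W KI29a(1,2,4) I29a.N_less z29 le29 upt29, unfolded tree_unf, unfolded r_fold, simplified if_True if_False fold_simps tree_simps pa29]
lemmas dtI29a = walk_dead[where W = WI29a, OF I29a.W z29 le29 upt29, unfolded tree_unf, unfolded r_fold, simplified fold_simps tree_simps pa29]
lemmas ftI29a = lv_dead[OF le29 upt29, unfolded tree_unf, unfolded r_fold, simplified fold_simps tree_simps pa29]
lemma cwI29a: "WI29a us T = WI29a us T" ..
lemmas runI29a = gsI29a wsI29a bs29 bleaf_simps rtI29a dtI29a ftI29a walk_end[where W = WI29a, OF I29a.W] leaf_simps
lemmas conI29a = cwI29a bsel_cong bleaf_cong fin_cong
text \<open>The shift 21 is \<open>- (3 * 2 + 2 * 1)\<close> modulo 29.\<close>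

abbreviation partI29a where
  "partI29a ds \<equiv> chain 29 (stage GI29a WI29a 29 [R 3, S (R 2) (R 1), R 1]) (R 21) (treeD 29 (map R n29))
    (fold (\<lambda>s. kill (pa 29 s)) ds (tree0 29 (map R n29)))"
text \<open>As \<open>s\<close> is \<open>- A (4 * m)\<close> in the scale of the type, the stages
  treat \<open>A (4 * m)\<close> as 0, 1, 2, ... times the scale. Only the unit 1 fixes
  \<open>a0 = 1\<close>, so all groups are singletons.\<close>

lemma partI29a_0:
  "partI29a [] [[R 0], [R 28], [R 27], [R 26], [R 25], [R 24], [R 23], [R 22], [R 21], [R 20], [R 19], [R 18], [R 17], [R 16], [R 15], [R 14], [R 13], [R 12], [R 11], [R 10], [R 9], [R 8], [R 7], [R 6], [R 5], [R 4], [R 3], [R 2], [R 1]]"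
proof -
  note wt = conj64[OF wtI29a_0] and gt = conj64[OF gtI29a_0] and mt = conj64[OF mt29_0] and pl = conj64[OF pl29_0]
  show ?thesis
    unfolding list.map r_fold treeD_def tree0_def
    apply (simp only: chain.simps fold_simps tree_simps pa29 list.sel pl simp_thms)
    \<comment> \<open>One goal per stage, in which the ban tree is now a variable known only through
      \<open>bsel\<close>.\<close>
    apply ((intro conjI)?; rule stage_abs[unfolded r_fold])
    apply (simp_all only: wt gt mt pl runI29a cong: conI29a)
    done
qed
lemma tban_29_2:
  assumes "base 29 False A Q C"
  shows "tban 29 False A Q C 1 2"
proof (rule I29a.chains_tban[where x = 3 and z = 1 and k = 21 and ns = "n29" and cs = "[[[R 0], [R 28], [R 27], [R 26], [R 25], [R 24], [R 23], [R 22], [R 21], [R 20], [R 19], [R 18], [R 17], [R 16], [R 15], [R 14], [R 13], [R 12], [R 11], [R 10], [R 9], [R 8], [R 7], [R 6], [R 5], [R 4], [R 3], [R 2], [R 1]]]"])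
  show "\<forall>x\<in>set []. tban 29 False A Q C (fst x) (snd x)" by simp
  show "base 29 False A Q C" by (rule assms)
  show "chk 29 U29 [(1, 2)] MI29a" by (simp add: chk_def MI29a_def U29_def r_defs)
  show "links 29 (stage GI29a WI29a 29 [R 3, S (R 2) (R 1), R 1]) (R 21) (treeD 29 (map R n29)) (tree0 29 (map R n29)) [] [[[R 0], [R 28], [R 27], [R 26], [R 25], [R 24], [R 23], [R 22], [R 21], [R 20], [R 19], [R 18], [R 17], [R 16], [R 15], [R 14], [R 13], [R 12], [R 11], [R 10], [R 9], [R 8], [R 7], [R 6], [R 5], [R 4], [R 3], [R 2], [R 1]]]"
    by (simp only: links.simps append.simps concat.simps partI29a_0 simp_thms)
qed (unfold I29a.eqs_def, simp_all add: U29_def upt29[symmetric])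

definition MI29b :: marks where "MI29b = []"
text \<open>The marks of the preceding search, now serving as exclusions.\<close>

definition NI29b :: marks where "NI29b = [(r1, [(r2, r1), (r27, r1)]), (r2, [(r4, r15), (r25, r15)]), (r3, [(r6, r10), (r23, r10)]), (r4, [(r8, r22), (r21, r22)]), (r5, [(r10, r6), (r19, r6)]), (r6, [(r12, r5), (r17, r5)]), (r7, [(r14, r25), (r15, r25)]), (r8, [(r13, r11), (r16, r11)]), (r9, [(r11, r13), (r18, r13)]), (r10, [(r9, r3), (r20, r3)]), (r11, [(r7, r8), (r22, r8)]), (r12, [(r5, r17), (r24, r17)]), (r13, [(r3, r9), (r26, r9)]), (r14, [(r1, r27), (r28, r27)]), (r15, [(r1, r2), (r28, r2)]), (r16, [(r3, r20), (r26, r20)]), (r17, [(r5, r12), (r24, r12)]), (r18, [(r7, r21), (r22, r21)]), (r19, [(r9, r26), (r20, r26)]), (r20, [(r11, r16), (r18, r16)]), (r21, [(r13, r18), (r16, r18)]), (r22, [(r14, r4), (r15, r4)]), (r23, [(r12, r24), (r17, r24)]), (r24, [(r10, r23), (r19, r23)]), (r25, [(r8, r7), (r21, r7)]), (r26, [(r6, r19), (r23, r19)]), (r27, [(r4, r14), (r25, r14)]), (r28, [(r2, r28), (r27, r28)])]"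
abbreviation "EI29b \<equiv> mkenv 29 False MI29b NI29b"
definition "GI29b B = gen (EI29b B)"
definition "WI29b us = wk 29 False (\<lambda>a. map fst (asc NI29b a)) (hd us) (tl us)"
interpretation I29b: inst 29 False MI29b NI29b GI29b WI29b U29 "[(1, 2)]"
proof unfold_locales
  have "less_marks 29 NI29b" by (simp add: NI29b_def r_defs)
  from asc_set[OF this] show "\<forall>c\<in>set (map fst (asc NI29b a)). val c < 29" for a by auto
  show "chk 29 U29 [(1, 2)] NI29b" by (simp add: chk_def NI29b_def U29_def r_defs)
qed (rule cop29 | simp add: GI29b_def WI29b_def)+
lemma mcI29b: "plain_marks MI29b" by (simp add: MI29b_def r_defs)
lemmas KI29b = env.sel[where ?x1.0 = 29 and ?x2.0 = False and ?x3.0 = "mlf (asc MI29b)" and ?x4.0 = "blf (\<lambda>a. map fst (asc NI29b a))"]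
lemmas wtI29b_0 = walk_table_vs[where W = WI29b and ns = "n29", OF I29b.W z29 le29, THEN bal2[where n = "Suc (Suc (Suc (Suc 0)))"],
  unfolded map_fold NI29b_def, simplified shape_simps asc.simps eqrs pl29 ng29 pa29 fst_conv snd_conv]
lemmas gtI29b_0 = gen_table[where G = GI29b and K = EI29b and ns = "n29", OF I29b.G KI29b(1-3) asc_list[OF mcI29b], THEN bal2[where n = "Suc (Suc (Suc (Suc 0)))"],
  unfolded map_fold MI29b_def, simplified bal_simps asc.simps mkl.simps if_True if_False eqrs pl29 fst_conv snd_conv]
lemmas rtI29b = node_table[where G = GI29b and W = WI29b and K = EI29b, OF I29b.G I29b.W KI29b(1,2,4) I29b.N_less z29 le29 upt29, unfolded tree_unf, unfolded r_fold, simplified if_True if_False fold_simps tree_simps pa29]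
lemmas dtI29b = walk_dead[where W = WI29b, OF I29b.W z29 le29 upt29, unfolded tree_unf, unfolded r_fold, simplified fold_simps tree_simps pa29]
lemmas ftI29b = lv_dead[OF le29 upt29, unfolded tree_unf, unfolded r_fold, simplified fold_simps tree_simps pa29]
lemma cwI29b: "WI29b us T = WI29b us T" ..
lemmas runI29b =  rtI29b dtI29b ftI29b walk_end[where W = WI29b, OF I29b.W] leaf_simps
lemmas conI29b = cwI29b bsel_cong bleaf_cong fin_cong
lemma partI29b: "GI29b (Lf (R 0)) [R 0] [R 4, R 3, R 2]"
proof -
  note wt = conj64[OF wtI29b_0] and gt = conj64[OF gtI29b_0]
  show ?thesis
    unfolding r_fold
    by (simp only: wt gt runI29b cong: conI29b)
qed
lemma tban_I29b:
  assumes "base 29 False A Q C"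
  shows "\<forall>t\<in>set [3]. tban 29 False A Q C 1 t"
proof (rule I29b.plain_all)
  show "\<forall>x\<in>set [(1, 2)]. tban 29 False A Q C (fst x) (snd x)" using tban_29_2[OF assms] by simp
qed (use assms partI29b in \<open>simp_all add: MI29b_def\<close>)

definition MI29c :: marks where "MI29c = []"
text \<open>With both \<open>(1, 2)\<close> and \<open>(1, 3)\<close> excluded, the remaining types
  fall to searches without a case distinction on \<open>A (4 * m)\<close>.\<close>

definition NI29c :: marks where "NI29c = [(r1, [(r2, r1), (r27, r1), (r3, r1), (r26, r1)]), (r2, [(r4, r15), (r25, r15), (r6, r15), (r23, r15)]), (r3, [(r6, r10), (r23, r10), (r9, r10), (r20, r10)]), (r4, [(r8, r22), (r21, r22), (r12, r22), (r17, r22)]), (r5, [(r10, r6), (r19, r6), (r14, r6), (r15, r6)]), (r6, [(r12, r5), (r17, r5), (r11, r5), (r18, r5)]), (r7, [(r14, r25), (r15, r25), (r8, r25), (r21, r25)]), (r8, [(r13, r11), (r16, r11), (r5, r11), (r24, r11)]), (r9, [(r11, r13), (r18, r13), (r2, r13), (r27, r13)]), (r10, [(r9, r3), (r20, r3), (r1, r3), (r28, r3)]), (r11, [(r7, r8), (r22, r8), (r4, r8), (r25, r8)]), (r12, [(r5, r17), (r24, r17), (r7, r17), (r22, r17)]), (r13, [(r3, r9), (r26, r9), (r10, r9), (r19, r9)]), (r14, [(r1, r27), (r28, r27), (r13, r27), (r16, r27)]), (r15, [(r1, r2), (r28, r2), (r13, r2), (r16, r2)]), (r16, [(r3, r20),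 (r26, r20), (r10, r20), (r19, r20)]), (r17, [(r5, r12), (r24, r12), (r7, r12), (r22, r12)]), (r18, [(r7, r21), (r22, r21), (r4, r21), (r25, r21)]), (r19, [(r9, r26), (r20, r26), (r1, r26), (r28, r26)]), (r20, [(r11, r16), (r18, r16), (r2, r16), (r27, r16)]), (r21, [(r13, r18), (r16, r18), (r5, r18), (r24, r18)]), (r22, [(r14, r4), (r15, r4), (r8, r4), (r21, r4)]), (r23, [(r12, r24), (r17, r24), (r11, r24), (r18, r24)]), (r24, [(r10, r23), (r19, r23), (r14, r23), (r15, r23)]), (r25, [(r8, r7), (r21, r7), (r12, r7), (r17, r7)]), (r26, [(r6, r19), (r23, r19), (r9, r19), (r20, r19)]), (r27, [(r4, r14), (r25, r14), (r6, r14), (r23, r14)]), (r28, [(r2, r28), (r27, r28), (r3, r28), (r26, r28)])]"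
abbreviation "EI29c \<equiv> mkenv 29 False MI29c NI29c"
definition "GI29c B = gen (EI29c B)"
definition "WI29c us = wk 29 False (\<lambda>a. map fst (asc NI29c a)) (hd us) (tl us)"
interpretation I29c: inst 29 False MI29c NI29c GI29c WI29c U29 "[(1, 2), (1, 3)]"
proof unfold_locales
  have "less_marks 29 NI29c" by (simp add: NI29c_def r_defs)
  from asc_set[OF this] show "\<forall>c\<in>set (map fst (asc NI29c a)). val c < 29" for a by auto
  show "chk 29 U29 [(1, 2), (1, 3)] NI29c" by (simp add: chk_def NI29c_def U29_def r_defs)
qed (rule cop29 | simp add: GI29c_def WI29c_def)+
lemma mcI29c: "plain_marks MI29c" by (simp add: MI29c_def r_defs)
lemmas KI29c = env.sel[where ?x1.0 = 29 and ?x2.0 = False and ?x3.0 = "mlf (asc MI29c)" and ?x4.0 = "blf (\<lambda>a. map fst (asc NI29c a))"]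
lemmas wtI29c_0 = walk_table_vs[where W = WI29c and ns = "n29", OF I29c.W z29 le29, THEN bal2[where n = "Suc (Suc (Suc (Suc 0)))"],
  unfolded map_fold NI29c_def, simplified shape_simps asc.simps eqrs pl29 ng29 pa29 fst_conv snd_conv]
lemmas gtI29c_0 = gen_table[where G = GI29c and K = EI29c and ns = "n29", OF I29c.G KI29c(1-3) asc_list[OF mcI29c], THEN bal2[where n = "Suc (Suc (Suc (Suc 0)))"],
  unfolded map_fold MI29c_def, simplified bal_simps asc.simps mkl.simps if_True if_False eqrs pl29 fst_conv snd_conv]
lemmas rtI29c = node_table[where G = GI29c and W = WI29c and K = EI29c, OF I29c.G I29c.W KI29c(1,2,4) I29c.N_less z29 le29 upt29, unfolded tree_unf, unfolded r_fold, simplified if_True if_False fold_simps tree_simps pa29]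
lemmas dtI29c = walk_dead[where W = WI29c, OF I29c.W z29 le29 upt29, unfolded tree_unf, unfolded r_fold, simplified fold_simps tree_simps pa29]
lemmas ftI29c = lv_dead[OF le29 upt29, unfolded tree_unf, unfolded r_fold, simplified fold_simps tree_simps pa29]
lemma cwI29c: "WI29c us T = WI29c us T" ..
lemmas runI29c =  rtI29c dtI29c ftI29c walk_end[where W = WI29c, OF I29c.W] leaf_simps
lemmas conI29c = cwI29c bsel_cong bleaf_cong fin_cong
lemma partI29c: "GI29c (Lf (R 0)) [R 0] [R 5, R 4, R 3] \<and>
  GI29c (Lf (R 0)) [R 0] [R 6, R 5, R 4] \<and>
  GI29c (Lf (R 0)) [R 0] [R 7, R 6, R 5] \<and>
  GI29c (Lf (R 0)) [R 0] [R 8, R 7, R 6] \<and>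
  GI29c (Lf (R 0)) [R 0] [R 9, R 8, R 7] \<and>
  GI29c (Lf (R 0)) [R 0] [R 10, R 9, R 8] \<and>
  GI29c (Lf (R 0)) [R 0] [R 11, R 10, R 9] \<and>
  GI29c (Lf (R 0)) [R 0] [R 12, R 11, R 10] \<and>
  GI29c (Lf (R 0)) [R 0] [R 13, R 12, R 11] \<and>
  GI29c (Lf (R 0)) [R 0] [R 14, R 13, R 12] \<and>
  GI29c (Lf (R 0)) [R 0] [R 15, R 14, R 13]"
proof -
  note wt = conj64[OF wtI29c_0] and gt = conj64[OF gtI29c_0]
  show ?thesis
    unfolding r_fold
    by (simp only: wt gt runI29c cong: conI29c)
qed
lemma tban_I29c:
  assumes "base 29 False A Q C"
  shows "\<forall>t\<in>set [4, 5, 6, 7, 8, 9, 10, 11, 12, 13, 14]. tban 29 False A Q C 1 t"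
proof (rule I29c.plain_all)
  show "\<forall>x\<in>set [(1, 2), (1, 3)]. tban 29 False A Q C (fst x) (snd x)" using tban_29_2[OF assms] tban_I29b[OF assms] by simp
qed (use assms partI29c in \<open>simp_all add: MI29c_def\<close>)

lemma reach_29: "reach 29"
proof (rule reach_step[where c = 1 and ?a0.0 = 1 and U = U29 and TS = "[2, 3, 4, 5, 6, 7, 8, 9, 10, 11, 12, 13, 14]" and V = "[(2, 1, 2), (3, 1, 3), (4, 1, 4), (5, 1, 5), (6, 1, 6), (7, 1, 7), (8, 1, 8), (9, 1, 9), (10, 1, 10), (11, 1, 11), (12, 1, 12), (13, 1, 13), (14, 1, 14), (15, 1, 14), (16, 1, 13), (17, 1, 12), (18, 1, 11), (19, 1, 10), (20, 1, 9), (21, 1, 8), (22, 1, 7), (23, 1, 6), (24, 1, 5), (25, 1, 4), (26, 1, 3), (27, 1, 2)]"])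
  show "reach 1" by (rule reach_1)
  show "\<forall>t\<in>set [2, 3, 4, 5, 6, 7, 8, 9, 10, 11, 12, 13, 14]. tban 29 False A Q C 1 t" if "base 29 False A Q C" for A Q C using tban_29_2[OF that] tban_I29b[OF that] tban_I29c[OF that] by simp
qed (rule cop29 | simp add: U29_def upt29[symmetric])+

abbreviation n31 :: "nat list" where "n31 \<equiv> [0, 1, 2, 3, 4, 5, 6, 7, 8, 9, 10, 11, 12, 13, 14, 15, 16, 17, 18, 19, 20, 21, 22, 23, 24, 25, 26, 27, 28, 29, 30]"
lemma upt31: "n31 = [0..<31]" by (simp add: upt_rec)
lemma le31: "31 \<le> (64::nat)" and z31: "0 < (31::nat)" by simp_all
definition U31 :: "nat list" where "U31 = [1, 2, 3, 4, 5, 6, 7, 8, 9, 10, 11, 12, 13, 14, 15, 16, 17, 18, 19, 20, 21, 22, 23, 24, 25, 26, 27, 28, 29, 30]"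
lemma cop31: "list_all (\<lambda>u. coprime u 31) U31" by (rule units_coprime) (simp add: U31_def)
lemmas pa31 = path_table[of 31 "n31", unfolded code_def bits_numeral, simplified, unfolded One_nat_def[symmetric], unfolded r_fold]
lemmas pl31_0 = pl_table[of 31 "n31", THEN bal2[where n = "Suc (Suc (Suc (Suc 0)))"], simplified bal_simps arith, unfolded r_fold]
lemmas pl31_1 = pl31_0[THEN q1] pl31_0[THEN q2] pl31_0[THEN q3] pl31_0[THEN q4]
lemmas pl31_2 = pl31_1[THEN q1] pl31_1[THEN q2] pl31_1[THEN q3] pl31_1[THEN q4]
lemmas pl31_3 = pl31_2[THEN q1] pl31_2[THEN q2] pl31_2[THEN q3] pl31_2[THEN q4]
lemmas pl31 = pl31_3[THEN q1] pl31_3[THEN q2] pl31_3[THEN q3] pl31_3[THEN q4]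
lemmas ng31 = ng_table[of 31 "n31", simplified, unfolded One_nat_def[symmetric], unfolded r_fold]
lemmas mt31_0 = mt_table'[OF upt31, THEN gsl_bal[where n = "Suc (Suc (Suc (Suc 0)))" and m = "Suc (Suc (Suc (Suc 0)))"], unfolded map_fold, simplified bal_simps gsl.simps fst_conv snd_conv pl31]
lemmas bs31 = bsel_table[where h = 31 and xs = "map R n31" and n = "(Suc (Suc (Suc (Suc (Suc (Suc (Suc 0)))))))" and vs = "[v0,v1,v2,v3,v4,v5,v6]" for v0 v1 v2 v3 v4 v5 v6,
  unfolded map_fold, simplified list.pred_inject simp_thms pt_simps lefts_simps join.simps keep.simps drp.simps fb.simps get_simps pa31]

definition MI31a :: marks where "MI31a = [(r1, [(r2, r1), (r29, r1)]), (r2, [(r4, r16), (r27, r16)]), (r3, [(r6, r21), (r25, r21)]), (r4, [(r8, r8), (r23, r8)]), (r5, [(r10, r25), (r21, r25)]), (r6, [(r12, r26), (r19, r26)]), (r7, [(r14, r9), (r17, r9)]), (r8, [(r15, r4), (r16, r4)]), (r9, [(r13, r7), (r18, r7)]), (r10, [(r11, r28), (r20, r28)]), (r11, [(r9, r17), (r22, r17)]), (r12, [(r7, r13), (r24, r13)]), (r13, [(r5, r12), (r26, r12)]), (r14, [(r3, r20), (r28, r20)]), (r15, [(r1, r29), (r30, r29)]), (r16, [(r1, r2), (r30, r2)]), (r17, [(r3, r11), (r28, r11)]), (r18, [(r5, r19), (r26, r19)]), (r19, [(r7, r18), (r24, r18)]), (r20, [(r9, r14), (r22, r14)]), (r21,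 [(r11, r3), (r20, r3)]), (r22, [(r13, r24), (r18, r24)]), (r23, [(r15, r27), (r16, r27)]), (r24, [(r14, r22), (r17, r22)]), (r25, [(r12, r5), (r19, r5)]), (r26, [(r10, r6), (r21, r6)]), (r27, [(r8, r23), (r23, r23)]), (r28, [(r6, r10), (r25, r10)]), (r29, [(r4, r15), (r27, r15)]), (r30, [(r2, r30), (r29, r30)])]"
definition NI31a :: marks where "NI31a = []"
abbreviation "EI31a \<equiv> mkenv 31 False MI31a NI31a"
definition "GI31a B = gen (EI31a B)"
definition "WI31a us = wk 31 False (\<lambda>a. map fst (asc NI31a a)) (hd us) (tl us)"
interpretation I31a: inst 31 False MI31a NI31a GI31a WI31a U31 "[]"
proof unfold_locales
  have "less_marks 31 NI31a" by (simp add: NI31a_def r_defs)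
  from asc_set[OF this] show "\<forall>c\<in>set (map fst (asc NI31a a)). val c < 31" for a by auto
  show "chk 31 U31 [] NI31a" by (simp add: chk_def NI31a_def U31_def r_defs)
qed (rule cop31 | simp add: GI31a_def WI31a_def)+
lemma mcI31a: "plain_marks MI31a" by (simp add: MI31a_def r_defs)
lemmas KI31a = env.sel[where ?x1.0 = 31 and ?x2.0 = False and ?x3.0 = "mlf (asc MI31a)" and ?x4.0 = "blf (\<lambda>a. map fst (asc NI31a a))"]
lemmas wtI31a_0 = walk_table_vs[where W = WI31a and ns = "n31", OF I31a.W z31 le31, THEN bal2[where n = "Suc (Suc (Suc (Suc 0)))"],
  unfolded map_fold NI31a_def, simplified shape_simps asc.simps eqrs pl31 ng31 pa31 fst_conv snd_conv]
lemmas gtI31a_0 = gen_table[where G = GI31a and K = EI31a and ns = "n31", OF I31a.G KI31a(1-3) asc_list[OF mcI31a], THEN bal2[where n = "Suc (Suc (Suc (Suc 0)))"],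
  unfolded map_fold MI31a_def, simplified bal_simps asc.simps mkl.simps if_True if_False eqrs pl31 fst_conv snd_conv]
lemmas gsI31a = gen_table_S[where G = GI31a and K = EI31a and ns = "n31", OF I31a.G KI31a(1,2,5), unfolded map_fold, simplified list_simps]
lemmas wsI31a = walk_table_S[where W = WI31a and ns = "n31", OF I31a.W, unfolded map_fold, simplified list_simps]
lemmas rtI31a = node_table[where G = GI31a and W = WI31a and K = EI31a, OF I31a.G I31a.W KI31a(1,2,4) I31a.N_less z31 le31 upt31, unfolded tree_unf, unfolded r_fold, simplified if_True if_False fold_simps tree_simps pa31]
lemmas dtI31a = walk_dead[where W = WI31a, OF I31a.W z31 le31 upt31, unfolded tree_unf, unfolded r_fold, simplified fold_simps tree_simps pa31]
lemmas ftI31a = lv_dead[OF le31 upt31, unfolded tree_unf, unfolded r_fold, simplified fold_simps tree_simps pa31]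
lemma cwI31a: "WI31a us T = WI31a us T" ..
lemmas runI31a = gsI31a wsI31a bs31 bleaf_simps rtI31a dtI31a ftI31a walk_end[where W = WI31a, OF I31a.W] leaf_simps
lemmas conI31a = cwI31a bsel_cong bleaf_cong fin_cong
abbreviation partI31a where
  "partI31a ds \<equiv> chain 31 (stage GI31a WI31a 31 [R 3, S (R 2) (R 1), R 1]) (R 23) (treeD 31 (map R n31))
    (fold (\<lambda>s. kill (pa 31 s)) ds (tree0 31 (map R n31)))"
lemma partI31a_0:
  "partI31a [] [[R 0], [R 30], [R 29], [R 28], [R 27], [R 26], [R 25], [R 24], [R 23], [R 22], [R 21], [R 20], [R 19], [R 18], [R 17], [R 16], [R 15], [R 14], [R 13], [R 12], [R 11], [R 10], [R 9], [R 8], [R 7], [R 6], [R 5], [R 4], [R 3], [R 2], [R 1]]"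
proof -
  note wt = conj64[OF wtI31a_0] and gt = conj64[OF gtI31a_0] and mt = conj64[OF mt31_0] and pl = conj64[OF pl31_0]
  show ?thesis
    unfolding list.map r_fold treeD_def tree0_def
    apply (simp only: chain.simps fold_simps tree_simps pa31 list.sel pl simp_thms)
    apply ((intro conjI)?; rule stage_abs[unfolded r_fold])
    apply (simp_all only: wt gt mt pl runI31a cong: conI31a)
    done
qed
lemma tban_31_2:
  assumes "base 31 False A Q C"
  shows "tban 31 False A Q C 1 2"
proof (rule I31a.chains_tban[where x = 3 and z = 1 and k = 23 and ns = "n31" and cs = "[[[R 0], [R 30], [R 29], [R 28], [R 27], [R 26], [R 25], [R 24], [R 23], [R 22], [R 21], [R 20], [R 19], [R 18], [R 17], [R 16], [R 15], [R 14], [R 13], [R 12], [R 11], [R 10], [R 9], [R 8], [R 7], [R 6], [R 5], [R 4], [R 3], [R 2], [R 1]]]"])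
  show "\<forall>x\<in>set []. tban 31 False A Q C (fst x) (snd x)" by simp
  show "base 31 False A Q C" by (rule assms)
  show "chk 31 U31 [(1, 2)] MI31a" by (simp add: chk_def MI31a_def U31_def r_defs)
  show "links 31 (stage GI31a WI31a 31 [R 3, S (R 2) (R 1), R 1]) (R 23) (treeD 31 (map R n31)) (tree0 31 (map R n31)) [] [[[R 0], [R 30], [R 29], [R 28], [R 27], [R 26], [R 25], [R 24], [R 23], [R 22], [R 21], [R 20], [R 19], [R 18], [R 17], [R 16], [R 15], [R 14], [R 13], [R 12], [R 11], [R 10], [R 9], [R 8], [R 7], [R 6], [R 5], [R 4], [R 3], [R 2], [R 1]]]"
    by (simp only: links.simps append.simps concat.simps partI31a_0 simp_thms)
qed (unfold I31a.eqs_def, simp_all add: U31_def upt31[symmetric])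

definition MI31b :: marks where "MI31b = []"
definition NI31b :: marks where "NI31b = [(r1, [(r2, r1), (r29, r1)]), (r2, [(r4, r16), (r27, r16)]), (r3, [(r6, r21), (r25, r21)]), (r4, [(r8, r8), (r23, r8)]), (r5, [(r10, r25), (r21, r25)]), (r6, [(r12, r26), (r19, r26)]), (r7, [(r14, r9), (r17, r9)]), (r8, [(r15, r4), (r16, r4)]), (r9, [(r13, r7), (r18, r7)]), (r10, [(r11, r28), (r20, r28)]), (r11, [(r9, r17), (r22, r17)]), (r12, [(r7, r13), (r24, r13)]), (r13, [(r5, r12), (r26, r12)]), (r14, [(r3, r20), (r28, r20)]), (r15, [(r1, r29), (r30, r29)]), (r16, [(r1, r2), (r30, r2)]), (r17, [(r3, r11), (r28, r11)]), (r18, [(r5, r19), (r26, r19)]), (r19, [(r7, r18), (r24, r18)]), (r20, [(r9, r14), (r22, r14)]), (r21, [(r11, r3), (r20, r3)]), (r22, [(r13, r24), (r18, r24)]), (r23, [(r15, r27), (r16, r27)]), (r24, [(r14, r22), (r17, r22)]), (r25, [(r12, r5), (r19, r5)]), (r26, [(r10, r6), (r21, r6)]), (r27, [(r8, r23), (r23, r23)]), (r28, [(r6, r10), (r25, r10)]), (r29, [(r4, r15), (r27, r15)]), (r30, [(r2, r30), (r29, r30)])]"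
abbreviation "EI31b \<equiv> mkenv 31 False MI31b NI31b"
definition "GI31b B = gen (EI31b B)"
definition "WI31b us = wk 31 False (\<lambda>a. map fst (asc NI31b a)) (hd us) (tl us)"
interpretation I31b: inst 31 False MI31b NI31b GI31b WI31b U31 "[(1, 2)]"
proof unfold_locales
  have "less_marks 31 NI31b" by (simp add: NI31b_def r_defs)
  from asc_set[OF this] show "\<forall>c\<in>set (map fst (asc NI31b a)). val c < 31" for a by auto
  show "chk 31 U31 [(1, 2)] NI31b" by (simp add: chk_def NI31b_def U31_def r_defs)
qed (rule cop31 | simp add: GI31b_def WI31b_def)+
lemma mcI31b: "plain_marks MI31b" by (simp add: MI31b_def r_defs)
lemmas KI31b = env.sel[where ?x1.0 = 31 and ?x2.0 = False and ?x3.0 = "mlf (asc MI31b)" and ?x4.0 = "blf (\<lambda>a. map fst (asc NI31b a))"]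
lemmas wtI31b_0 = walk_table_vs[where W = WI31b and ns = "n31", OF I31b.W z31 le31, THEN bal2[where n = "Suc (Suc (Suc (Suc 0)))"],
  unfolded map_fold NI31b_def, simplified shape_simps asc.simps eqrs pl31 ng31 pa31 fst_conv snd_conv]
lemmas gtI31b_0 = gen_table[where G = GI31b and K = EI31b and ns = "n31", OF I31b.G KI31b(1-3) asc_list[OF mcI31b], THEN bal2[where n = "Suc (Suc (Suc (Suc 0)))"],
  unfolded map_fold MI31b_def, simplified bal_simps asc.simps mkl.simps if_True if_False eqrs pl31 fst_conv snd_conv]
lemmas rtI31b = node_table[where G = GI31b and W = WI31b and K = EI31b, OF I31b.G I31b.W KI31b(1,2,4) I31b.N_less z31 le31 upt31, unfolded tree_unf, unfolded r_fold, simplified if_True if_False fold_simps tree_simps pa31]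
lemmas dtI31b = walk_dead[where W = WI31b, OF I31b.W z31 le31 upt31, unfolded tree_unf, unfolded r_fold, simplified fold_simps tree_simps pa31]
lemmas ftI31b = lv_dead[OF le31 upt31, unfolded tree_unf, unfolded r_fold, simplified fold_simps tree_simps pa31]
lemma cwI31b: "WI31b us T = WI31b us T" ..
lemmas runI31b =  rtI31b dtI31b ftI31b walk_end[where W = WI31b, OF I31b.W] leaf_simps
lemmas conI31b = cwI31b bsel_cong bleaf_cong fin_cong
lemma partI31b: "GI31b (Lf (R 0)) [R 0] [R 4, R 3, R 2]"
proof -
  note wt = conj64[OF wtI31b_0] and gt = conj64[OF gtI31b_0]
  show ?thesis
    unfolding r_fold
    by (simp only: wt gt runI31b cong: conI31b)
qed
lemma tban_I31b:
  assumes "base 31 False A Q C"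
  shows "\<forall>t\<in>set [3]. tban 31 False A Q C 1 t"
proof (rule I31b.plain_all)
  show "\<forall>x\<in>set [(1, 2)]. tban 31 False A Q C (fst x) (snd x)" using tban_31_2[OF assms] by simp
qed (use assms partI31b in \<open>simp_all add: MI31b_def\<close>)

definition MI31c :: marks where "MI31c = []"
definition NI31c :: marks where "NI31c = [(r1, [(r2, r1), (r29, r1), (r3, r1), (r28, r1)]), (r2, [(r4, r16), (r27, r16), (r6, r16), (r25, r16)]), (r3, [(r6, r21), (r25, r21), (r9, r21), (r22, r21)]), (r4, [(r8, r8), (r23, r8), (r12, r8), (r19, r8)]), (r5, [(r10, r25), (r21, r25), (r15, r25), (r16, r25)]), (r6, [(r12, r26), (r19, r26), (r13, r26), (r18, r26)]), (r7, [(r14, r9), (r17, r9), (r10, r9), (r21, r9)]), (r8, [(r15, r4), (r16, r4), (r7, r4), (r24, r4)]), (r9, [(r13, r7), (r18, r7), (r4, r7), (r27, r7)]), (r10, [(r11, r28), (r20, r28), (r1, r28), (r30, r28)]), (r11, [(r9, r17), (r22, r17), (r2, r17), (r29, r17)]), (r12, [(r7, r13), (r24, r13), (r5, r13), (r26, r13)]), (r13, [(r5, r12), (r26, r12), (r8, r12), (r23, r12)]), (r14, [(r3, r20), (r28, r20), (r11, r20), (r20, r20)]), (r15, [(r1, r29), (r30, r29), (r14, r29), (r17, r29)]), (r16, [(r1, r2), (r30, r2), (r14, r2), (r17, r2)]), (r17, [(r3, r11), (r28, r11), (r11, r11), (r20, r11)]), (r18, [(r5, r19), (r26, r19), (r8,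 r19), (r23, r19)]), (r19, [(r7, r18), (r24, r18), (r5, r18), (r26, r18)]), (r20, [(r9, r14), (r22, r14), (r2, r14), (r29, r14)]), (r21, [(r11, r3), (r20, r3), (r1, r3), (r30, r3)]), (r22, [(r13, r24), (r18, r24), (r4, r24), (r27, r24)]), (r23, [(r15, r27), (r16, r27), (r7, r27), (r24, r27)]), (r24, [(r14, r22), (r17, r22), (r10, r22), (r21, r22)]), (r25, [(r12, r5), (r19, r5), (r13, r5), (r18, r5)]), (r26, [(r10, r6), (r21, r6), (r15, r6), (r16, r6)]), (r27, [(r8, r23), (r23, r23), (r12, r23), (r19, r23)]), (r28, [(r6, r10), (r25, r10), (r9, r10), (r22, r10)]), (r29, [(r4, r15), (r27, r15), (r6, r15), (r25, r15)]), (r30, [(r2, r30), (r29, r30), (r3, r30), (r28, r30)])]"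
abbreviation "EI31c \<equiv> mkenv 31 False MI31c NI31c"
definition "GI31c B = gen (EI31c B)"
definition "WI31c us = wk 31 False (\<lambda>a. map fst (asc NI31c a)) (hd us) (tl us)"
interpretation I31c: inst 31 False MI31c NI31c GI31c WI31c U31 "[(1, 2), (1, 3)]"
proof unfold_locales
  have "less_marks 31 NI31c" by (simp add: NI31c_def r_defs)
  from asc_set[OF this] show "\<forall>c\<in>set (map fst (asc NI31c a)). val c < 31" for a by auto
  show "chk 31 U31 [(1, 2), (1, 3)] NI31c" by (simp add: chk_def NI31c_def U31_def r_defs)
qed (rule cop31 | simp add: GI31c_def WI31c_def)+
lemma mcI31c: "plain_marks MI31c" by (simp add: MI31c_def r_defs)
lemmas KI31c = env.sel[where ?x1.0 = 31 and ?x2.0 = False and ?x3.0 = "mlf (asc MI31c)" and ?x4.0 = "blf (\<lambda>a. map fst (asc NI31c a))"]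
lemmas wtI31c_0 = walk_table_vs[where W = WI31c and ns = "n31", OF I31c.W z31 le31, THEN bal2[where n = "Suc (Suc (Suc (Suc 0)))"],
  unfolded map_fold NI31c_def, simplified shape_simps asc.simps eqrs pl31 ng31 pa31 fst_conv snd_conv]
lemmas gtI31c_0 = gen_table[where G = GI31c and K = EI31c and ns = "n31", OF I31c.G KI31c(1-3) asc_list[OF mcI31c], THEN bal2[where n = "Suc (Suc (Suc (Suc 0)))"],
  unfolded map_fold MI31c_def, simplified bal_simps asc.simps mkl.simps if_True if_False eqrs pl31 fst_conv snd_conv]
lemmas rtI31c = node_table[where G = GI31c and W = WI31c and K = EI31c, OF I31c.G I31c.W KI31c(1,2,4) I31c.N_less z31 le31 upt31, unfolded tree_unf, unfolded r_fold, simplified if_True if_False fold_simps tree_simps pa31]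
lemmas dtI31c = walk_dead[where W = WI31c, OF I31c.W z31 le31 upt31, unfolded tree_unf, unfolded r_fold, simplified fold_simps tree_simps pa31]
lemmas ftI31c = lv_dead[OF le31 upt31, unfolded tree_unf, unfolded r_fold, simplified fold_simps tree_simps pa31]
lemma cwI31c: "WI31c us T = WI31c us T" ..
lemmas runI31c =  rtI31c dtI31c ftI31c walk_end[where W = WI31c, OF I31c.W] leaf_simps
lemmas conI31c = cwI31c bsel_cong bleaf_cong fin_cong
lemma partI31c: "GI31c (Lf (R 0)) [R 0] [R 5, R 4, R 3] \<and>
  GI31c (Lf (R 0)) [R 0] [R 6, R 5, R 4] \<and>
  GI31c (Lf (R 0)) [R 0] [R 7, R 6, R 5] \<and>
  GI31c (Lf (R 0)) [R 0] [R 8, R 7, R 6] \<and>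
  GI31c (Lf (R 0)) [R 0] [R 9, R 8, R 7] \<and>
  GI31c (Lf (R 0)) [R 0] [R 10, R 9, R 8] \<and>
  GI31c (Lf (R 0)) [R 0] [R 11, R 10, R 9] \<and>
  GI31c (Lf (R 0)) [R 0] [R 12, R 11, R 10] \<and>
  GI31c (Lf (R 0)) [R 0] [R 13, R 12, R 11] \<and>
  GI31c (Lf (R 0)) [R 0] [R 14, R 13, R 12] \<and>
  GI31c (Lf (R 0)) [R 0] [R 15, R 14, R 13] \<and>
  GI31c (Lf (R 0)) [R 0] [R 16, R 15, R 14]"
proof -
  note wt = conj64[OF wtI31c_0] and gt = conj64[OF gtI31c_0]
  show ?thesis
    unfolding r_fold
    by (simp only: wt gt runI31c cong: conI31c)
qed
lemma tban_I31c:
  assumes "base 31 False A Q C"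
  shows "\<forall>t\<in>set [4, 5, 6, 7, 8, 9, 10, 11, 12, 13, 14, 15]. tban 31 False A Q C 1 t"
proof (rule I31c.plain_all)
  show "\<forall>x\<in>set [(1, 2), (1, 3)]. tban 31 False A Q C (fst x) (snd x)" using tban_31_2[OF assms] tban_I31b[OF assms] by simp
qed (use assms partI31c in \<open>simp_all add: MI31c_def\<close>)

lemma reach_31: "reach 31"
proof (rule reach_step[where c = 1 and ?a0.0 = 1 and U = U31 and TS = "[2, 3, 4, 5, 6, 7, 8, 9, 10, 11, 12, 13, 14, 15]" and V = "[(2, 1, 2), (3, 1, 3), (4, 1, 4), (5, 1, 5), (6, 1, 6), (7, 1, 7), (8, 1, 8), (9, 1, 9), (10, 1, 10), (11, 1, 11), (12, 1, 12), (13, 1, 13), (14, 1, 14), (15, 1, 15), (16, 1, 15), (17, 1, 14), (18, 1, 13), (19, 1, 12), (20, 1, 11), (21, 1, 10), (22, 1, 9), (23, 1, 8), (24, 1, 7), (25, 1, 6), (26, 1, 5), (27, 1, 4), (28, 1, 3), (29, 1, 2)]"])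
  show "reach 1" by (rule reach_1)
  show "\<forall>t\<in>set [2, 3, 4, 5, 6, 7, 8, 9, 10, 11, 12, 13, 14, 15]. tban 31 False A Q C 1 t" if "base 31 False A Q C" for A Q C using tban_31_2[OF that] tban_I31b[OF that] tban_I31c[OF that] by simp
qed (rule cop31 | simp add: U31_def upt31[symmetric])+

section \<open>Moduli 33 and 35: starting from a value divisible by 11 and 7\<close>

abbreviation n33 :: "nat list" where "n33 \<equiv> [0, 1, 2, 3, 4, 5, 6, 7, 8, 9, 10, 11, 12, 13, 14, 15, 16, 17, 18, 19, 20, 21, 22, 23, 24, 25, 26, 27, 28, 29, 30, 31, 32]"
lemma upt33: "n33 = [0..<33]" by (simp add: upt_rec)
lemma le33: "33 \<le> (64::nat)" and z33: "0 < (33::nat)" by simp_all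
definition U33 :: "nat list" where "U33 = [1, 2, 4, 5, 7, 8, 10, 13, 14, 16, 17, 19, 20, 23, 25, 26, 28, 29, 31, 32]"
lemma cop33: "list_all (\<lambda>u. coprime u 33) U33" by (rule units_coprime) (simp add: U33_def)
lemmas pa33 = path_table[of 33 "n33", unfolded code_def bits_numeral, simplified, unfolded One_nat_def[symmetric], unfolded r_fold]
lemmas pl33_0 = pl_table[of 33 "n33", THEN bal2[where n = "Suc (Suc (Suc (Suc (Suc 0))))"], simplified bal_simps arith, unfolded r_fold]
lemmas pl33_1 = pl33_0[THEN q1] pl33_0[THEN q2] pl33_0[THEN q3] pl33_0[THEN q4]
lemmas pl33_2 = pl33_1[THEN q1] pl33_1[THEN q2] pl33_1[THEN q3] pl33_1[THEN q4]
lemmas pl33_3 = pl33_2[THEN q1] pl33_2[THEN q2] pl33_2[THEN q3] pl33_2[THEN q4]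
lemmas pl33_4 = pl33_3[THEN q1] pl33_3[THEN q2] pl33_3[THEN q3] pl33_3[THEN q4]
lemmas pl33 = pl33_4[THEN q1] pl33_4[THEN q2] pl33_4[THEN q3] pl33_4[THEN q4]
lemmas ng33 = ng_table[of 33 "n33", simplified, unfolded One_nat_def[symmetric], unfolded r_fold]
lemmas mt33_0 = mt_table'[OF upt33, THEN gsl_bal[where n = "Suc (Suc (Suc (Suc (Suc 0))))" and m = "Suc (Suc (Suc (Suc (Suc 0))))"], unfolded map_fold, simplified bal_simps gsl.simps fst_conv snd_conv pl33]
lemmas bs33 = bsel_table[where h = 33 and xs = "map R n33" and n = "(Suc (Suc (Suc (Suc (Suc (Suc (Suc 0)))))))" and vs = "[v0,v1,v2,v3,v4,v5,v6]" for v0 v1 v2 v3 v4 v5 v6,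
  unfolded map_fold, simplified list.pred_inject simp_thms pt_simps lefts_simps join.simps keep.simps drp.simps fb.simps get_simps pa33]

text \<open>Modulo 33 the type \<open>(11, 3)\<close> precedes \<open>(11, 1)\<close>. Its unit
  multiples have 11 or 22 in the first place and a nonzero multiple of 3 in the second.\<close>

definition MI33a :: marks where "MI33a = [(r11, [(r3, r1), (r6, r16), (r9, r4), (r12, r19), (r15, r13), (r18, r13), (r21, r19), (r24, r4), (r27, r16), (r30, r1)]), (r22, [(r3, r23), (r6, r5), (r9, r26), (r12, r8), (r15, r2), (r18, r2), (r21, r8), (r24, r26), (r27, r5), (r30, r23)])]"
definition NI33a :: marks where "NI33a = []"
abbreviation "EI33a \<equiv> mkenv 33 False MI33a NI33a"
definition "GI33a B = gen (EI33a B)"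
definition "WI33a us = wk 33 False (\<lambda>a. map fst (asc NI33a a)) (hd us) (tl us)"
interpretation I33a: inst 33 False MI33a NI33a GI33a WI33a U33 "[]"
proof unfold_locales
  have "less_marks 33 NI33a" by (simp add: NI33a_def r_defs)
  from asc_set[OF this] show "\<forall>c\<in>set (map fst (asc NI33a a)). val c < 33" for a by auto
  show "chk 33 U33 [] NI33a" by (simp add: chk_def NI33a_def U33_def r_defs)
qed (rule cop33 | simp add: GI33a_def WI33a_def)+
lemma mcI33a: "plain_marks MI33a" by (simp add: MI33a_def r_defs)
lemmas KI33a = env.sel[where ?x1.0 = 33 and ?x2.0 = False and ?x3.0 = "mlf (asc MI33a)" and ?x4.0 = "blf (\<lambda>a. map fst (asc NI33a a))"]
lemmas wtI33a_0 = walk_table_vs[where W = WI33a and ns = "n33", OF I33a.W z33 le33, THEN bal2[where n = "Suc (Suc (Suc (Suc (Suc 0))))"],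
  unfolded map_fold NI33a_def, simplified shape_simps asc.simps eqrs pl33 ng33 pa33 fst_conv snd_conv]
lemmas gtI33a_0 = gen_table[where G = GI33a and K = EI33a and ns = "n33", OF I33a.G KI33a(1-3) asc_list[OF mcI33a], THEN bal2[where n = "Suc (Suc (Suc (Suc (Suc 0))))"],
  unfolded map_fold MI33a_def, simplified bal_simps asc.simps mkl.simps if_True if_False eqrs pl33 fst_conv snd_conv]
lemmas gsI33a = gen_table_S[where G = GI33a and K = EI33a and ns = "n33", OF I33a.G KI33a(1,2,5), unfolded map_fold, simplified list_simps]
lemmas wsI33a = walk_table_S[where W = WI33a and ns = "n33", OF I33a.W, unfolded map_fold, simplified list_simps]
lemmas rtI33a = node_table[where G = GI33a and W = WI33a and K = EI33a, OF I33a.G I33a.W KI33a(1,2,4) I33a.N_less z33 le33 upt33, unfolded tree_unf, unfolded r_fold, simplified if_True if_False fold_simps tree_simps pa33]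
lemmas dtI33a = walk_dead[where W = WI33a, OF I33a.W z33 le33 upt33, unfolded tree_unf, unfolded r_fold, simplified fold_simps tree_simps pa33]
lemmas ftI33a = lv_dead[OF le33 upt33, unfolded tree_unf, unfolded r_fold, simplified fold_simps tree_simps pa33]
lemma cwI33a: "WI33a us T = WI33a us T" ..
lemmas runI33a = gsI33a wsI33a bs33 bleaf_simps rtI33a dtI33a ftI33a walk_end[where W = WI33a, OF I33a.W] leaf_simps
lemmas conI33a = cwI33a bsel_cong bleaf_cong fin_cong
abbreviation partI33a where
  "partI33a ds \<equiv> chain 33 (stage GI33a WI33a 33 [R 14, S (R 3) (R 1), R 25]) (R 2) (treeD 33 (map R n33))
    (fold (\<lambda>s. kill (pa 33 s)) ds (tree0 33 (map R n33)))"
text \<open>The unit 10 fixes 11 and negates 3 modulo 33, so \<open>s\<close> and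
  \<open>10 * s\<close> are settled together.\<close>

lemma partI33a_0:
  "partI33a [] [[R 0], [R 32, R 23], [R 31, R 13], [R 30, R 3], [R 29, R 26], [R 28, R 16]]"
proof -
  note wt = conj64[OF wtI33a_0] and gt = conj64[OF gtI33a_0] and mt = conj64[OF mt33_0] and pl = conj64[OF pl33_0]
  show ?thesis
    unfolding list.map r_fold treeD_def tree0_def
    apply (simp only: chain.simps fold_simps tree_simps pa33 list.sel pl simp_thms)
    apply ((intro conjI)?; rule stage_abs[unfolded r_fold])
    apply (simp_all only: wt gt mt pl runI33a cong: conI33a)
    done
qed
text \<open>The first list repeats the values excluded by the preceding piece, which act as bans
  from the start.\<close>

lemma partI33a_1:
  "partI33a [R 0, R 32, R 23, R 31, R 13, R 30, R 3, R 29, R 26, R 28, R 16] [[R 27, R 6], [R 25, R 19], [R 24, R 9], [R 22], [R 21, R 12], [R 20, R 2]]"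
proof -
  note wt = conj64[OF wtI33a_0] and gt = conj64[OF gtI33a_0] and mt = conj64[OF mt33_0] and pl = conj64[OF pl33_0]
  show ?thesis
    unfolding list.map r_fold treeD_def tree0_def
    apply (simp only: chain.simps fold_simps tree_simps pa33 list.sel pl simp_thms)
    apply ((intro conjI)?; rule stage_abs[unfolded r_fold])
    apply (simp_all only: wt gt mt pl runI33a cong: conI33a)
    done
qed
lemma partI33a_2:
  "partI33a [R 0, R 32, R 23, R 31, R 13, R 30, R 3, R 29, R 26, R 28, R 16, R 27, R 6, R 25, R 19, R 24, R 9, R 22, R 21, R 12, R 20, R 2] [[R 18, R 15], [R 17, R 5], [R 14, R 8], [R 11], [R 10, R 1], [R 7, R 4]]"
proof -
  note wt = conj64[OF wtI33a_0] and gt = conj64[OF gtI33a_0] and mt = conj64[OF mt33_0] and pl = conj64[OF pl33_0]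
  show ?thesis
    unfolding list.map r_fold treeD_def tree0_def
    apply (simp only: chain.simps fold_simps tree_simps pa33 list.sel pl simp_thms)
    apply ((intro conjI)?; rule stage_abs[unfolded r_fold])
    apply (simp_all only: wt gt mt pl runI33a cong: conI33a)
    done
qed
lemma tban_33_3:
  assumes "base 33 False A Q C"
  shows "tban 33 False A Q C 11 3"
proof (rule I33a.chains_tban[where x = 14 and z = 25 and k = 2 and ns = "n33" and cs = "[[[R 0], [R 32, R 23], [R 31, R 13], [R 30, R 3], [R 29, R 26], [R 28, R 16]], [[R 27, R 6], [R 25, R 19], [R 24, R 9], [R 22], [R 21, R 12], [R 20, R 2]], [[R 18, R 15], [R 17, R 5], [R 14, R 8], [R 11], [R 10, R 1], [R 7, R 4]]]"])
  show "\<forall>x\<in>set []. tban 33 False A Q C (fst x) (snd x)" by simp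
  show "base 33 False A Q C" by (rule assms)
  show "chk 33 U33 [(11, 3)] MI33a" by (simp add: chk_def MI33a_def U33_def r_defs)
  show "links 33 (stage GI33a WI33a 33 [R 14, S (R 3) (R 1), R 25]) (R 2) (treeD 33 (map R n33)) (tree0 33 (map R n33)) [] [[[R 0], [R 32, R 23], [R 31, R 13], [R 30, R 3], [R 29, R 26], [R 28, R 16]], [[R 27, R 6], [R 25, R 19], [R 24, R 9], [R 22], [R 21, R 12], [R 20, R 2]], [[R 18, R 15], [R 17, R 5], [R 14, R 8], [R 11], [R 10, R 1], [R 7, R 4]]]"
    by (simp only: links.simps append.simps concat.simps partI33a_0 partI33a_1 partI33a_2 simp_thms)
qed (unfold I33a.eqs_def, simp_all add: U33_def upt33[symmetric])

definition MI33b :: marks where "MI33b = [(r11, [(r1, r1), (r2, r16), (r4, r25), (r5, r13), (r7, r19), (r8, r4), (r10, r10), (r13, r28), (r14, r7), (r16, r31), (r17, r31), (r19, r7), (r20, r28), (r23, r10), (r25, r4), (r26, r19), (r28, r13), (r29, r25), (r31, r16), (r32, r1)]), (r22, [(r1, r32), (r2, r17), (r4, r8), (r5, r20), (r7, r14), (r8, r29), (r10, r23), (r13, r5), (r14, r26), (r16, r2), (r17, r2), (r19, r26), (r20, r5), (r23, r23), (r25, r29), (r26, r14), (r28, r20), (r29, r8), (r31, r17), (r32, r32)])]"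
definition NI33b :: marks where "NI33b = [(r11, [(r3, r1), (r6, r16), (r9, r4), (r12, r19), (r15, r13), (r18, r13), (r21, r19), (r24, r4), (r27, r16), (r30, r1)]), (r22, [(r3, r23), (r6, r5), (r9, r26), (r12, r8), (r15, r2), (r18, r2), (r21, r8), (r24, r26), (r27, r5), (r30, r23)])]"
abbreviation "EI33b \<equiv> mkenv 33 False MI33b NI33b"
definition "GI33b B = gen (EI33b B)"
definition "WI33b us = wk 33 False (\<lambda>a. map fst (asc NI33b a)) (hd us) (tl us)"
interpretation I33b: inst 33 False MI33b NI33b GI33b WI33b U33 "[(11, 3)]"
proof unfold_locales
  have "less_marks 33 NI33b" by (simp add: NI33b_def r_defs)
  from asc_set[OF this] show "\<forall>c\<in>set (map fst (asc NI33b a)). val c < 33" for a by auto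
  show "chk 33 U33 [(11, 3)] NI33b" by (simp add: chk_def NI33b_def U33_def r_defs)
qed (rule cop33 | simp add: GI33b_def WI33b_def)+
lemma mcI33b: "plain_marks MI33b" by (simp add: MI33b_def r_defs)
lemmas KI33b = env.sel[where ?x1.0 = 33 and ?x2.0 = False and ?x3.0 = "mlf (asc MI33b)" and ?x4.0 = "blf (\<lambda>a. map fst (asc NI33b a))"]
lemmas wtI33b_0 = walk_table_vs[where W = WI33b and ns = "n33", OF I33b.W z33 le33, THEN bal2[where n = "Suc (Suc (Suc (Suc (Suc 0))))"],
  unfolded map_fold NI33b_def, simplified shape_simps asc.simps eqrs pl33 ng33 pa33 fst_conv snd_conv]
lemmas gtI33b_0 = gen_table[where G = GI33b and K = EI33b and ns = "n33", OF I33b.G KI33b(1-3) asc_list[OF mcI33b], THEN bal2[where n = "Suc (Suc (Suc (Suc (Suc 0))))"],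
  unfolded map_fold MI33b_def, simplified bal_simps asc.simps mkl.simps if_True if_False eqrs pl33 fst_conv snd_conv]
lemmas gsI33b = gen_table_S[where G = GI33b and K = EI33b and ns = "n33", OF I33b.G KI33b(1,2,5), unfolded map_fold, simplified list_simps]
lemmas wsI33b = walk_table_S[where W = WI33b and ns = "n33", OF I33b.W, unfolded map_fold, simplified list_simps]
lemmas rtI33b = node_table[where G = GI33b and W = WI33b and K = EI33b, OF I33b.G I33b.W KI33b(1,2,4) I33b.N_less z33 le33 upt33, unfolded tree_unf, unfolded r_fold, simplified if_True if_False fold_simps tree_simps pa33]
lemmas dtI33b = walk_dead[where W = WI33b, OF I33b.W z33 le33 upt33, unfolded tree_unf, unfolded r_fold, simplified fold_simps tree_simps pa33]
lemmas ftI33b = lv_dead[OF le33 upt33, unfolded tree_unf, unfolded r_fold, simplified fold_simps tree_simps pa33]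
lemma cwI33b: "WI33b us T = WI33b us T" ..
lemmas runI33b = gsI33b wsI33b bs33 bleaf_simps rtI33b dtI33b ftI33b walk_end[where W = WI33b, OF I33b.W] leaf_simps
lemmas conI33b = cwI33b bsel_cong bleaf_cong fin_cong
abbreviation partI33b where
  "partI33b ds \<equiv> chain 33 (stage GI33b WI33b 33 [R 12, S (R 1) (R 1), R 23]) (R 8) (treeD 33 (map R n33))
    (fold (\<lambda>s. kill (pa 33 s)) ds (tree0 33 (map R n33)))"
text \<open>For the type \<open>(11, 1)\<close> the only symmetry is 1, since -1 does not fix 11;
  every \<open>s\<close> needs a stage of its own.\<close>

lemma partI33b_0:
  "partI33b [] [[R 0], [R 32], [R 31], [R 30], [R 29], [R 28]]"
proof -
  note wt = conj64[OF wtI33b_0] and gt = conj64[OF gtI33b_0] and mt = conj64[OF mt33_0] and pl = conj64[OF pl33_0]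
  show ?thesis
    unfolding list.map r_fold treeD_def tree0_def
    apply (simp only: chain.simps fold_simps tree_simps pa33 list.sel pl simp_thms)
    apply ((intro conjI)?; rule stage_abs[unfolded r_fold])
    apply (simp_all only: wt gt mt pl runI33b cong: conI33b)
    done
qed
lemma partI33b_1:
  "partI33b [R 0, R 32, R 31, R 30, R 29, R 28] [[R 27], [R 26], [R 25], [R 24], [R 23], [R 22]]"
proof -
  note wt = conj64[OF wtI33b_0] and gt = conj64[OF gtI33b_0] and mt = conj64[OF mt33_0] and pl = conj64[OF pl33_0]
  show ?thesis
    unfolding list.map r_fold treeD_def tree0_def
    apply (simp only: chain.simps fold_simps tree_simps pa33 list.sel pl simp_thms)
    apply ((intro conjI)?; rule stage_abs[unfolded r_fold])
    apply (simp_all only: wt gt mt pl runI33b cong: conI33b)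
    done
qed
lemma partI33b_2:
  "partI33b [R 0, R 32, R 31, R 30, R 29, R 28, R 27, R 26, R 25, R 24, R 23, R 22] [[R 21], [R 20], [R 19], [R 18], [R 17], [R 16]]"
proof -
  note wt = conj64[OF wtI33b_0] and gt = conj64[OF gtI33b_0] and mt = conj64[OF mt33_0] and pl = conj64[OF pl33_0]
  show ?thesis
    unfolding list.map r_fold treeD_def tree0_def
    apply (simp only: chain.simps fold_simps tree_simps pa33 list.sel pl simp_thms)
    apply ((intro conjI)?; rule stage_abs[unfolded r_fold])
    apply (simp_all only: wt gt mt pl runI33b cong: conI33b)
    done
qed
lemma partI33b_3:
  "partI33b [R 0, R 32, R 31, R 30, R 29, R 28, R 27, R 26, R 25, R 24, R 23, R 22, R 21, R 20, R 19, R 18, R 17, R 16] [[R 15], [R 14], [R 13], [R 12], [R 11], [R 10]]"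
proof -
  note wt = conj64[OF wtI33b_0] and gt = conj64[OF gtI33b_0] and mt = conj64[OF mt33_0] and pl = conj64[OF pl33_0]
  show ?thesis
    unfolding list.map r_fold treeD_def tree0_def
    apply (simp only: chain.simps fold_simps tree_simps pa33 list.sel pl simp_thms)
    apply ((intro conjI)?; rule stage_abs[unfolded r_fold])
    apply (simp_all only: wt gt mt pl runI33b cong: conI33b)
    done
qed
lemma partI33b_4:
  "partI33b [R 0, R 32, R 31, R 30, R 29, R 28, R 27, R 26, R 25, R 24, R 23, R 22, R 21, R 20, R 19, R 18, R 17, R 16, R 15, R 14, R 13, R 12, R 11, R 10] [[R 9], [R 8], [R 7], [R 6], [R 5], [R 4]]"
proof -
  note wt = conj64[OF wtI33b_0] and gt = conj64[OF gtI33b_0] and mt = conj64[OF mt33_0] and pl = conj64[OF pl33_0]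
  show ?thesis
    unfolding list.map r_fold treeD_def tree0_def
    apply (simp only: chain.simps fold_simps tree_simps pa33 list.sel pl simp_thms)
    apply ((intro conjI)?; rule stage_abs[unfolded r_fold])
    apply (simp_all only: wt gt mt pl runI33b cong: conI33b)
    done
qed
lemma partI33b_5:
  "partI33b [R 0, R 32, R 31, R 30, R 29, R 28, R 27, R 26, R 25, R 24, R 23, R 22, R 21, R 20, R 19, R 18, R 17, R 16, R 15, R 14, R 13, R 12, R 11, R 10, R 9, R 8, R 7, R 6, R 5, R 4] [[R 3], [R 2], [R 1]]"
proof -
  note wt = conj64[OF wtI33b_0] and gt = conj64[OF gtI33b_0] and mt = conj64[OF mt33_0] and pl = conj64[OF pl33_0]
  show ?thesis
    unfolding list.map r_fold treeD_def tree0_def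
    apply (simp only: chain.simps fold_simps tree_simps pa33 list.sel pl simp_thms)
    apply ((intro conjI)?; rule stage_abs[unfolded r_fold])
    apply (simp_all only: wt gt mt pl runI33b cong: conI33b)
    done
qed
lemma tban_33_1:
  assumes "base 33 False A Q C"
  shows "tban 33 False A Q C 11 1"
proof (rule I33b.chains_tban[where x = 12 and z = 23 and k = 8 and ns = "n33" and cs = "[[[R 0], [R 32], [R 31], [R 30], [R 29], [R 28]], [[R 27], [R 26], [R 25], [R 24], [R 23], [R 22]], [[R 21], [R 20], [R 19], [R 18], [R 17], [R 16]], [[R 15], [R 14], [R 13], [R 12], [R 11], [R 10]], [[R 9], [R 8], [R 7], [R 6], [R 5], [R 4]], [[R 3], [R 2], [R 1]]]"])
  show "\<forall>x\<in>set [(11, 3)]. tban 33 False A Q C (fst x) (snd x)" using tban_33_3[OF assms] by simp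
  show "base 33 False A Q C" by (rule assms)
  show "chk 33 U33 [(11, 1)] MI33b" by (simp add: chk_def MI33b_def U33_def r_defs)
  show "links 33 (stage GI33b WI33b 33 [R 12, S (R 1) (R 1), R 23]) (R 8) (treeD 33 (map R n33)) (tree0 33 (map R n33)) [] [[[R 0], [R 32], [R 31], [R 30], [R 29], [R 28]], [[R 27], [R 26], [R 25], [R 24], [R 23], [R 22]], [[R 21], [R 20], [R 19], [R 18], [R 17], [R 16]], [[R 15], [R 14], [R 13], [R 12], [R 11], [R 10]], [[R 9], [R 8], [R 7], [R 6], [R 5], [R 4]], [[R 3], [R 2], [R 1]]]"
    by (simp only: links.simps append.simps concat.simps partI33b_0 partI33b_1 partI33b_2 partI33b_3 partI33b_4 partI33b_5 simp_thms)
qed (unfold I33b.eqs_def, simp_all add: U33_def upt33[symmetric])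

text \<open>The units congruent to 1 modulo 3 fix 11. Up to sign they carry 3 to the nonzero
  multiples of 3 and 1 to the residues prime to 33.\<close>

lemma reach_33: "reach 33"
proof (rule reach_step[where c = 11 and ?a0.0 = 11 and U = U33 and TS = "[3, 1]" and V = "[(1, 1, 1), (2, 31, 1), (3, 1, 3), (4, 4, 1), (5, 28, 1), (6, 13, 3), (7, 7, 1), (8, 25, 1), (9, 19, 3), (10, 10, 1), (12, 4, 3), (13, 13, 1), (14, 19, 1), (15, 16, 3), (16, 16, 1), (17, 16, 1), (18, 16, 3), (19, 19, 1), (20, 13, 1), (21, 4, 3), (23, 10, 1), (24, 19, 3), (25, 25, 1), (26, 7, 1), (27, 13, 3), (28, 28, 1), (29, 4, 1), (30, 1, 3), (31, 31, 1), (32, 1, 1)]"])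
  show "reach 11" by (rule reach_11)
  show "\<forall>t\<in>set [3, 1]. tban 33 False A Q C 11 t" if "base 33 False A Q C" for A Q C using tban_33_3[OF that] tban_33_1[OF that] by simp
qed (rule cop33 | simp add: U33_def upt33[symmetric])+

abbreviation n35 :: "nat list" where "n35 \<equiv> [0, 1, 2, 3, 4, 5, 6, 7, 8, 9, 10, 11, 12, 13, 14, 15, 16, 17, 18, 19, 20, 21, 22, 23, 24, 25, 26, 27, 28, 29, 30, 31, 32, 33, 34]"
lemma upt35: "n35 = [0..<35]" by (simp add: upt_rec)
lemma le35: "35 \<le> (64::nat)" and z35: "0 < (35::nat)" by simp_all
definition U35 :: "nat list" where "U35 = [1, 2, 3, 4, 6, 8, 9, 11, 12, 13, 16, 17, 18, 19, 22, 23, 24, 26, 27, 29, 31, 32, 33, 34]"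
lemma cop35: "list_all (\<lambda>u. coprime u 35) U35" by (rule units_coprime) (simp add: U35_def)
lemmas pa35 = path_table[of 35 "n35", unfolded code_def bits_numeral, simplified, unfolded One_nat_def[symmetric], unfolded r_fold]
lemmas pl35_0 = pl_table[of 35 "n35", THEN bal2[where n = "Suc (Suc (Suc (Suc (Suc 0))))"], simplified bal_simps arith, unfolded r_fold]
lemmas pl35_1 = pl35_0[THEN q1] pl35_0[THEN q2] pl35_0[THEN q3] pl35_0[THEN q4]
lemmas pl35_2 = pl35_1[THEN q1] pl35_1[THEN q2] pl35_1[THEN q3] pl35_1[THEN q4]
lemmas pl35_3 = pl35_2[THEN q1] pl35_2[THEN q2] pl35_2[THEN q3] pl35_2[THEN q4]
lemmas pl35_4 = pl35_3[THEN q1] pl35_3[THEN q2] pl35_3[THEN q3] pl35_3[THEN q4]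
lemmas pl35 = pl35_4[THEN q1] pl35_4[THEN q2] pl35_4[THEN q3] pl35_4[THEN q4]
lemmas ng35 = ng_table[of 35 "n35", simplified, unfolded One_nat_def[symmetric], unfolded r_fold]
lemmas mt35_0 = mt_table'[OF upt35, THEN gsl_bal[where n = "Suc (Suc (Suc (Suc (Suc 0))))" and m = "Suc (Suc (Suc (Suc (Suc 0))))"], unfolded map_fold, simplified bal_simps gsl.simps fst_conv snd_conv pl35]
lemmas bs35 = bsel_table[where h = 35 and xs = "map R n35" and n = "(Suc (Suc (Suc (Suc (Suc (Suc (Suc 0)))))))" and vs = "[v0,v1,v2,v3,v4,v5,v6]" for v0 v1 v2 v3 v4 v5 v6,
  unfolded map_fold, simplified list.pred_inject simp_thms pt_simps lefts_simps join.simps keep.simps drp.simps fb.simps get_simps pa35]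

definition MI35a :: marks where "MI35a = [(r7, [(r1, r1), (r4, r26), (r6, r6), (r9, r31), (r11, r16), (r16, r11), (r19, r11), (r24, r16), (r26, r31), (r29, r6), (r31, r26), (r34, r1)]), (r14, [(r2, r18), (r3, r23), (r8, r13), (r12, r3), (r13, r8), (r17, r33), (r18, r33), (r22, r8), (r23, r3), (r27, r13), (r32, r23), (r33, r18)]), (r21, [(r2, r17), (r3, r12), (r8, r22), (r12, r32), (r13, r27), (r17, r2), (r18, r2), (r22, r27), (r23, r32), (r27, r22), (r32, r12), (r33, r17)]), (r28, [(r1, r34), (r4, r9), (r6, r29), (r9, r4), (r11, r19), (r16, r24), (r19, r24), (r24, r19), (r26, r4), (r29, r29), (r31, r9), (r34, r34)])]"
definition NI35a :: marks where "NI35a = []"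
abbreviation "EI35a \<equiv> mkenv 35 False MI35a NI35a"
definition "GI35a B = gen (EI35a B)"
definition "WI35a us = wk 35 False (\<lambda>a. map fst (asc NI35a a)) (hd us) (tl us)"
interpretation I35a: inst 35 False MI35a NI35a GI35a WI35a U35 "[]"
proof unfold_locales
  have "less_marks 35 NI35a" by (simp add: NI35a_def r_defs)
  from asc_set[OF this] show "\<forall>c\<in>set (map fst (asc NI35a a)). val c < 35" for a by auto
  show "chk 35 U35 [] NI35a" by (simp add: chk_def NI35a_def U35_def r_defs)
qed (rule cop35 | simp add: GI35a_def WI35a_def)+
lemma mcI35a: "plain_marks MI35a" by (simp add: MI35a_def r_defs)
lemmas KI35a = env.sel[where ?x1.0 = 35 and ?x2.0 = False and ?x3.0 = "mlf (asc MI35a)" and ?x4.0 = "blf (\<lambda>a. map fst (asc NI35a a))"]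
lemmas wtI35a_0 = walk_table_vs[where W = WI35a and ns = "n35", OF I35a.W z35 le35, THEN bal2[where n = "Suc (Suc (Suc (Suc (Suc 0))))"],
  unfolded map_fold NI35a_def, simplified shape_simps asc.simps eqrs pl35 ng35 pa35 fst_conv snd_conv]
lemmas gtI35a_0 = gen_table[where G = GI35a and K = EI35a and ns = "n35", OF I35a.G KI35a(1-3) asc_list[OF mcI35a], THEN bal2[where n = "Suc (Suc (Suc (Suc (Suc 0))))"],
  unfolded map_fold MI35a_def, simplified bal_simps asc.simps mkl.simps if_True if_False eqrs pl35 fst_conv snd_conv]
lemmas gsI35a = gen_table_S[where G = GI35a and K = EI35a and ns = "n35", OF I35a.G KI35a(1,2,5), unfolded map_fold, simplified list_simps]
lemmas wsI35a = walk_table_S[where W = WI35a and ns = "n35", OF I35a.W, unfolded map_fold, simplified list_simps]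
lemmas rtI35a = node_table[where G = GI35a and W = WI35a and K = EI35a, OF I35a.G I35a.W KI35a(1,2,4) I35a.N_less z35 le35 upt35, unfolded tree_unf, unfolded r_fold, simplified if_True if_False fold_simps tree_simps pa35]
lemmas dtI35a = walk_dead[where W = WI35a, OF I35a.W z35 le35 upt35, unfolded tree_unf, unfolded r_fold, simplified fold_simps tree_simps pa35]
lemmas ftI35a = lv_dead[OF le35 upt35, unfolded tree_unf, unfolded r_fold, simplified fold_simps tree_simps pa35]
lemma cwI35a: "WI35a us T = WI35a us T" ..
lemmas runI35a = gsI35a wsI35a bs35 bleaf_simps rtI35a dtI35a ftI35a walk_end[where W = WI35a, OF I35a.W] leaf_simps
lemmas conI35a = cwI35a bsel_cong bleaf_cong fin_cong
abbreviation partI35a where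
  "partI35a ds \<equiv> chain 35 (stage GI35a WI35a 35 [R 8, S (R 1) (R 1), R 29]) (R 18) (treeD 35 (map R n35))
    (fold (\<lambda>s. kill (pa 35 s)) ds (tree0 35 (map R n35)))"
lemma partI35a_0:
  "partI35a [] [[R 0], [R 34], [R 33], [R 32], [R 31], [R 30]]"
proof -
  note wt = conj64[OF wtI35a_0] and gt = conj64[OF gtI35a_0] and mt = conj64[OF mt35_0] and pl = conj64[OF pl35_0]
  show ?thesis
    unfolding list.map r_fold treeD_def tree0_def
    apply (simp only: chain.simps fold_simps tree_simps pa35 list.sel pl simp_thms)
    apply ((intro conjI)?; rule stage_abs[unfolded r_fold])
    apply (simp_all only: wt gt mt pl runI35a cong: conI35a)
    done
qed
lemma partI35a_1:
  "partI35a [R 0, R 34, R 33, R 32, R 31, R 30] [[R 29], [R 28], [R 27], [R 26], [R 25], [R 24]]"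
proof -
  note wt = conj64[OF wtI35a_0] and gt = conj64[OF gtI35a_0] and mt = conj64[OF mt35_0] and pl = conj64[OF pl35_0]
  show ?thesis
    unfolding list.map r_fold treeD_def tree0_def
    apply (simp only: chain.simps fold_simps tree_simps pa35 list.sel pl simp_thms)
    apply ((intro conjI)?; rule stage_abs[unfolded r_fold])
    apply (simp_all only: wt gt mt pl runI35a cong: conI35a)
    done
qed
lemma partI35a_2:
  "partI35a [R 0, R 34, R 33, R 32, R 31, R 30, R 29, R 28, R 27, R 26, R 25, R 24] [[R 23], [R 22], [R 21], [R 20], [R 19], [R 18]]"
proof -
  note wt = conj64[OF wtI35a_0] and gt = conj64[OF gtI35a_0] and mt = conj64[OF mt35_0] and pl = conj64[OF pl35_0]
  show ?thesis
    unfolding list.map r_fold treeD_def tree0_def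
    apply (simp only: chain.simps fold_simps tree_simps pa35 list.sel pl simp_thms)
    apply ((intro conjI)?; rule stage_abs[unfolded r_fold])
    apply (simp_all only: wt gt mt pl runI35a cong: conI35a)
    done
qed
lemma partI35a_3:
  "partI35a [R 0, R 34, R 33, R 32, R 31, R 30, R 29, R 28, R 27, R 26, R 25, R 24, R 23, R 22, R 21, R 20, R 19, R 18] [[R 17], [R 16], [R 15], [R 14], [R 13], [R 12]]"
proof -
  note wt = conj64[OF wtI35a_0] and gt = conj64[OF gtI35a_0] and mt = conj64[OF mt35_0] and pl = conj64[OF pl35_0]
  show ?thesis
    unfolding list.map r_fold treeD_def tree0_def
    apply (simp only: chain.simps fold_simps tree_simps pa35 list.sel pl simp_thms)
    apply ((intro conjI)?; rule stage_abs[unfolded r_fold])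
    apply (simp_all only: wt gt mt pl runI35a cong: conI35a)
    done
qed
lemma partI35a_4:
  "partI35a [R 0, R 34, R 33, R 32, R 31, R 30, R 29, R 28, R 27, R 26, R 25, R 24, R 23, R 22, R 21, R 20, R 19, R 18, R 17, R 16, R 15, R 14, R 13, R 12] [[R 11], [R 10], [R 9], [R 8], [R 7], [R 6]]"
proof -
  note wt = conj64[OF wtI35a_0] and gt = conj64[OF gtI35a_0] and mt = conj64[OF mt35_0] and pl = conj64[OF pl35_0]
  show ?thesis
    unfolding list.map r_fold treeD_def tree0_def
    apply (simp only: chain.simps fold_simps tree_simps pa35 list.sel pl simp_thms)
    apply ((intro conjI)?; rule stage_abs[unfolded r_fold])
    apply (simp_all only: wt gt mt pl runI35a cong: conI35a)
    done
qed
lemma partI35a_5: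
  "partI35a [R 0, R 34, R 33, R 32, R 31, R 30, R 29, R 28, R 27, R 26, R 25, R 24, R 23, R 22, R 21, R 20, R 19, R 18, R 17, R 16, R 15, R 14, R 13, R 12, R 11, R 10, R 9, R 8, R 7, R 6] [[R 5], [R 4], [R 3], [R 2], [R 1]]"
proof -
  note wt = conj64[OF wtI35a_0] and gt = conj64[OF gtI35a_0] and mt = conj64[OF mt35_0] and pl = conj64[OF pl35_0]
  show ?thesis
    unfolding list.map r_fold treeD_def tree0_def
    apply (simp only: chain.simps fold_simps tree_simps pa35 list.sel pl simp_thms)
    apply ((intro conjI)?; rule stage_abs[unfolded r_fold])
    apply (simp_all only: wt gt mt pl runI35a cong: conI35a)
    done
qed
lemma tban_35_1:
  assumes "base 35 False A Q C"
  shows "tban 35 False A Q C 7 1"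
proof (rule I35a.chains_tban[where x = 8 and z = 29 and k = 18 and ns = "n35" and cs = "[[[R 0], [R 34], [R 33], [R 32], [R 31], [R 30]], [[R 29], [R 28], [R 27], [R 26], [R 25], [R 24]], [[R 23], [R 22], [R 21], [R 20], [R 19], [R 18]], [[R 17], [R 16], [R 15], [R 14], [R 13], [R 12]], [[R 11], [R 10], [R 9], [R 8], [R 7], [R 6]], [[R 5], [R 4], [R 3], [R 2], [R 1]]]"])
  show "\<forall>x\<in>set []. tban 35 False A Q C (fst x) (snd x)" by simp
  show "base 35 False A Q C" by (rule assms)
  show "chk 35 U35 [(7, 1)] MI35a" by (simp add: chk_def MI35a_def U35_def r_defs)
  show "links 35 (stage GI35a WI35a 35 [R 8, S (R 1) (R 1), R 29]) (R 18) (treeD 35 (map R n35)) (tree0 35 (map R n35)) [] [[[R 0], [R 34], [R 33], [R 32], [R 31], [R 30]], [[R 29], [R 28], [R 27], [R 26], [R 25], [R 24]], [[R 23], [R 22], [R 21], [R 20], [R 19], [R 18]], [[R 17], [R 16], [R 15], [R 14], [R 13], [R 12]], [[R 11], [R 10], [R 9], [R 8], [R 7], [R 6]], [[R 5], [R 4], [R 3], [R 2], [R 1]]]"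
    by (simp only: links.simps append.simps concat.simps partI35a_0 partI35a_1 partI35a_2 partI35a_3 partI35a_4 partI35a_5 simp_thms)
qed (unfold I35a.eqs_def, simp_all add: U35_def upt35[symmetric])

definition MI35b :: marks where "MI35b = []"
definition NI35b :: marks where "NI35b = [(r7, [(r1, r1), (r4, r26), (r6, r6), (r9, r31), (r11, r16), (r16, r11), (r19, r11), (r24, r16), (r26, r31), (r29, r6), (r31, r26), (r34, r1)]), (r14, [(r2, r18), (r3, r23), (r8, r13), (r12, r3), (r13, r8), (r17, r33), (r18, r33), (r22, r8), (r23, r3), (r27, r13), (r32, r23), (r33, r18)]), (r21, [(r2, r17), (r3, r12), (r8, r22), (r12, r32), (r13, r27), (r17, r2), (r18, r2), (r22, r27), (r23, r32), (r27, r22), (r32, r12), (r33, r17)]), (r28, [(r1, r34), (r4, r9), (r6, r29), (r9, r4), (r11, r19), (r16, r24), (r19, r24), (r24, r19), (r26, r4), (r29, r29), (r31, r9), (r34, r34)])]"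
abbreviation "EI35b \<equiv> mkenv 35 False MI35b NI35b"
definition "GI35b B = gen (EI35b B)"
definition "WI35b us = wk 35 False (\<lambda>a. map fst (asc NI35b a)) (hd us) (tl us)"
interpretation I35b: inst 35 False MI35b NI35b GI35b WI35b U35 "[(7, 1)]"
proof unfold_locales
  have "less_marks 35 NI35b" by (simp add: NI35b_def r_defs)
  from asc_set[OF this] show "\<forall>c\<in>set (map fst (asc NI35b a)). val c < 35" for a by auto
  show "chk 35 U35 [(7, 1)] NI35b" by (simp add: chk_def NI35b_def U35_def r_defs)
qed (rule cop35 | simp add: GI35b_def WI35b_def)+
lemma mcI35b: "plain_marks MI35b" by (simp add: MI35b_def r_defs)
lemmas KI35b = env.sel[where ?x1.0 = 35 and ?x2.0 = False and ?x3.0 = "mlf (asc MI35b)" and ?x4.0 = "blf (\<lambda>a. map fst (asc NI35b a))"]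
lemmas wtI35b_0 = walk_table_vs[where W = WI35b and ns = "n35", OF I35b.W z35 le35, THEN bal2[where n = "Suc (Suc (Suc (Suc (Suc 0))))"],
  unfolded map_fold NI35b_def, simplified shape_simps asc.simps eqrs pl35 ng35 pa35 fst_conv snd_conv]
lemmas gtI35b_0 = gen_table[where G = GI35b and K = EI35b and ns = "n35", OF I35b.G KI35b(1-3) asc_list[OF mcI35b], THEN bal2[where n = "Suc (Suc (Suc (Suc (Suc 0))))"],
  unfolded map_fold MI35b_def, simplified bal_simps asc.simps mkl.simps if_True if_False eqrs pl35 fst_conv snd_conv]
lemmas rtI35b = node_table[where G = GI35b and W = WI35b and K = EI35b, OF I35b.G I35b.W KI35b(1,2,4) I35b.N_less z35 le35 upt35, unfolded tree_unf, unfolded r_fold, simplified if_True if_False fold_simps tree_simps pa35]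
lemmas dtI35b = walk_dead[where W = WI35b, OF I35b.W z35 le35 upt35, unfolded tree_unf, unfolded r_fold, simplified fold_simps tree_simps pa35]
lemmas ftI35b = lv_dead[OF le35 upt35, unfolded tree_unf, unfolded r_fold, simplified fold_simps tree_simps pa35]
lemma cwI35b: "WI35b us T = WI35b us T" ..
lemmas runI35b =  rtI35b dtI35b ftI35b walk_end[where W = WI35b, OF I35b.W] leaf_simps
lemmas conI35b = cwI35b bsel_cong bleaf_cong fin_cong
lemma partI35b: "GI35b (Lf (R 0)) [R 0] [R 9, R 2, R 30]"
proof -
  note wt = conj64[OF wtI35b_0] and gt = conj64[OF gtI35b_0]
  show ?thesis
    unfolding r_fold
    by (simp only: wt gt runI35b cong: conI35b)
qed
lemma tban_I35b:
  assumes "base 35 False A Q C"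
  shows "\<forall>t\<in>set [2]. tban 35 False A Q C 7 t"
proof (rule I35b.plain_all)
  show "\<forall>x\<in>set [(7, 1)]. tban 35 False A Q C (fst x) (snd x)" using tban_35_1[OF assms] by simp
qed (use assms partI35b in \<open>simp_all add: MI35b_def\<close>)

definition MI35c :: marks where "MI35c = []"
definition NI35c :: marks where "NI35c = [(r7, [(r1, r1), (r4, r26), (r6, r6), (r9, r31), (r11, r16), (r16, r11), (r19, r11), (r24, r16), (r26, r31), (r29, r6), (r31, r26), (r34, r1), (r2, r1), (r3, r11), (r8, r26), (r12, r6), (r13, r16), (r17, r31), (r18, r31), (r22, r16), (r23, r6), (r27, r26), (r32, r11), (r33, r1)]), (r14, [(r2, r18), (r3, r23), (r8, r13), (r12, r3), (r13, r8), (r17, r33), (r18, r33), (r22, r8), (r23, r3), (r27, r13), (r32, r23), (r33, r18), (r1, r33), (r4, r18), (r6, r23), (r9, r8), (r11, r3), (r16, r13), (r19, r13), (r24, r3), (r26, r8), (r29, r23), (r31, r18), (r34, r33)]), (r21, [(r2, r17), (r3, r12), (r8, r22), (r12, r32), (r13, r27), (r17, r2), (r18, r2), (r22, r27), (r23, r32), (r27, r22), (r32, r12), (r33, r17), (r1, r2), (r4, r17), (r6, r12), (r9, r27), (r11, r32), (r16, r22), (r19, r22), (r24, r32), (r26, r27), (r29, r12), (r31, r17), (r34, r2)]), (r28, [(r1, r34), (r4, r9), (r6, r29), (r9, r4), (r11, r19), (r16, r24), (r19, r24), (r24, r19), (r26, r4), (r29, r29), (r31, r9), (r34, r34), (r2,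 r34), (r3, r24), (r8, r9), (r12, r29), (r13, r19), (r17, r4), (r18, r4), (r22, r19), (r23, r29), (r27, r9), (r32, r24), (r33, r34)])]"
abbreviation "EI35c \<equiv> mkenv 35 False MI35c NI35c"
definition "GI35c B = gen (EI35c B)"
definition "WI35c us = wk 35 False (\<lambda>a. map fst (asc NI35c a)) (hd us) (tl us)"
interpretation I35c: inst 35 False MI35c NI35c GI35c WI35c U35 "[(7, 1), (7, 2)]"
proof unfold_locales
  have "less_marks 35 NI35c" by (simp add: NI35c_def r_defs)
  from asc_set[OF this] show "\<forall>c\<in>set (map fst (asc NI35c a)). val c < 35" for a by auto
  show "chk 35 U35 [(7, 1), (7, 2)] NI35c" by (simp add: chk_def NI35c_def U35_def r_defs)
qed (rule cop35 | simp add: GI35c_def WI35c_def)+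
lemma mcI35c: "plain_marks MI35c" by (simp add: MI35c_def r_defs)
lemmas KI35c = env.sel[where ?x1.0 = 35 and ?x2.0 = False and ?x3.0 = "mlf (asc MI35c)" and ?x4.0 = "blf (\<lambda>a. map fst (asc NI35c a))"]
lemmas wtI35c_0 = walk_table_vs[where W = WI35c and ns = "n35", OF I35c.W z35 le35, THEN bal2[where n = "Suc (Suc (Suc (Suc (Suc 0))))"],
  unfolded map_fold NI35c_def, simplified shape_simps asc.simps eqrs pl35 ng35 pa35 fst_conv snd_conv]
lemmas gtI35c_0 = gen_table[where G = GI35c and K = EI35c and ns = "n35", OF I35c.G KI35c(1-3) asc_list[OF mcI35c], THEN bal2[where n = "Suc (Suc (Suc (Suc (Suc 0))))"],
  unfolded map_fold MI35c_def, simplified bal_simps asc.simps mkl.simps if_True if_False eqrs pl35 fst_conv snd_conv]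
lemmas rtI35c = node_table[where G = GI35c and W = WI35c and K = EI35c, OF I35c.G I35c.W KI35c(1,2,4) I35c.N_less z35 le35 upt35, unfolded tree_unf, unfolded r_fold, simplified if_True if_False fold_simps tree_simps pa35]
lemmas dtI35c = walk_dead[where W = WI35c, OF I35c.W z35 le35 upt35, unfolded tree_unf, unfolded r_fold, simplified fold_simps tree_simps pa35]
lemmas ftI35c = lv_dead[OF le35 upt35, unfolded tree_unf, unfolded r_fold, simplified fold_simps tree_simps pa35]
lemma cwI35c: "WI35c us T = WI35c us T" ..
lemmas runI35c =  rtI35c dtI35c ftI35c walk_end[where W = WI35c, OF I35c.W] leaf_simps
lemmas conI35c = cwI35c bsel_cong bleaf_cong fin_cong
lemma partI35c: "GI35c (Lf (R 0)) [R 0] [R 12, R 5, R 33] \<and>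
  GI35c (Lf (R 0)) [R 0] [R 21, R 14, R 7]"
proof -
  note wt = conj64[OF wtI35c_0] and gt = conj64[OF gtI35c_0]
  show ?thesis
    unfolding r_fold
    by (simp only: wt gt runI35c cong: conI35c)
qed
lemma tban_I35c:
  assumes "base 35 False A Q C"
  shows "\<forall>t\<in>set [5, 14]. tban 35 False A Q C 7 t"
proof (rule I35c.plain_all)
  show "\<forall>x\<in>set [(7, 1), (7, 2)]. tban 35 False A Q C (fst x) (snd x)" using tban_35_1[OF assms] tban_I35b[OF assms] by simp
qed (use assms partI35c in \<open>simp_all add: MI35c_def\<close>)

text \<open>The units congruent to 1 modulo 5 fix 7. Under these units and signs the residues other
  than 0, 7 and 28 form four classes: among those prime to 35 the ones that are 1 or -1 modulo 5 and
  the ones that are 2 or -2, then the nonzero multiples of 5, and finally 14 with 21.\<close>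

lemma reach_35: "reach 35"
proof (rule reach_step[where c = 7 and ?a0.0 = 7 and U = U35 and TS = "[1, 2, 5, 14]" and V = "[(1, 1, 1), (2, 1, 2), (3, 16, 2), (4, 31, 1), (5, 1, 5), (6, 6, 1), (8, 31, 2), (9, 26, 1), (10, 16, 5), (11, 11, 1), (12, 6, 2), (13, 11, 2), (14, 1, 14), (15, 11, 5), (16, 16, 1), (17, 26, 2), (18, 26, 2), (19, 16, 1), (20, 11, 5), (21, 1, 14), (22, 11, 2), (23, 6, 2), (24, 11, 1), (25, 16, 5), (26, 26, 1), (27, 31, 2), (29, 6, 1), (30, 1, 5), (31, 31, 1), (32, 16, 2), (33, 1, 2), (34, 1, 1)]"])
  show "reach 7" by (rule reach_7)
  show "\<forall>t\<in>set [1, 2, 5, 14]. tban 35 False A Q C 7 t" if "base 35 False A Q C" for A Q C using tban_35_1[OF that] tban_I35b[OF that] tban_I35c[OF that] by simp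
qed (rule cop35 | simp add: U35_def upt35[symmetric])+

section \<open>Modulus 37\<close>

abbreviation n37 :: "nat list" where "n37 \<equiv> [0, 1, 2, 3, 4, 5, 6, 7, 8, 9, 10, 11, 12, 13, 14, 15, 16, 17, 18, 19, 20, 21, 22, 23, 24, 25, 26, 27, 28, 29, 30, 31, 32, 33, 34, 35, 36]"
lemma upt37: "n37 = [0..<37]" by (simp add: upt_rec)
lemma le37: "37 \<le> (64::nat)" and z37: "0 < (37::nat)" by simp_all
definition U37 :: "nat list" where "U37 = [1, 2, 3, 4, 5, 6, 7, 8, 9, 10, 11, 12, 13, 14, 15, 16, 17, 18, 19, 20, 21, 22, 23, 24, 25, 26, 27, 28, 29, 30, 31, 32, 33, 34, 35, 36]"
lemma cop37: "list_all (\<lambda>u. coprime u 37) U37" by (rule units_coprime) (simp add: U37_def)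
lemmas pa37 = path_table[of 37 "n37", unfolded code_def bits_numeral, simplified, unfolded One_nat_def[symmetric], unfolded r_fold]
lemmas pl37_0 = pl_table[of 37 "n37", THEN bal2[where n = "Suc (Suc (Suc (Suc (Suc 0))))"], simplified bal_simps arith, unfolded r_fold]
lemmas pl37_1 = pl37_0[THEN q1] pl37_0[THEN q2] pl37_0[THEN q3] pl37_0[THEN q4]
lemmas pl37_2 = pl37_1[THEN q1] pl37_1[THEN q2] pl37_1[THEN q3] pl37_1[THEN q4]
lemmas pl37_3 = pl37_2[THEN q1] pl37_2[THEN q2] pl37_2[THEN q3] pl37_2[THEN q4]
lemmas pl37_4 = pl37_3[THEN q1] pl37_3[THEN q2] pl37_3[THEN q3] pl37_3[THEN q4]
lemmas pl37 = pl37_4[THEN q1] pl37_4[THEN q2] pl37_4[THEN q3] pl37_4[THEN q4]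
lemmas ng37 = ng_table[of 37 "n37", simplified, unfolded One_nat_def[symmetric], unfolded r_fold]
lemmas mt37_0 = mt_table'[OF upt37, THEN gsl_bal[where n = "Suc (Suc (Suc (Suc (Suc 0))))" and m = "Suc (Suc (Suc (Suc (Suc 0))))"], unfolded map_fold, simplified bal_simps gsl.simps fst_conv snd_conv pl37]
lemmas bs37 = bsel_table[where h = 37 and xs = "map R n37" and n = "(Suc (Suc (Suc (Suc (Suc (Suc (Suc 0)))))))" and vs = "[v0,v1,v2,v3,v4,v5,v6]" for v0 v1 v2 v3 v4 v5 v6,
  unfolded map_fold, simplified list.pred_inject simp_thms pt_simps lefts_simps join.simps keep.simps drp.simps fb.simps get_simps pa37]

definition MI37a :: marks where "MI37a = [(r1, [(r2, r1), (r35, r1)]), (r2, [(r4, r19), (r33, r19)]), (r3, [(r6, r25), (r31, r25)]), (r4, [(r8, r28), (r29, r28)]), (r5, [(r10, r15), (r27, r15)]), (r6, [(r12, r31), (r25, r31)]), (r7, [(r14, r16), (r23, r16)]), (r8, [(r16, r14), (r21, r14)]), (r9, [(r18, r33), (r19, r33)]), (r10, [(r17, r26), (r20, r26)]), (r11, [(r15, r27), (r22, r27)]), (r12, [(r13, r34), (r24, r34)]), (r13, [(r11, r20), (r26, r20)]), (r14, [(r9, r8), (r28, r8)]), (r15, [(r7, r5), (r30, r5)]), (r16, [(r5, r7), (r32, r7)]), (r17, [(r3, r24), (r34, r24)]), (r18, [(r1, r35), (r36, r35)]), (r19, [(r1, r2), (r36, r2)]), (r20, [(r3, r13), (r34, r13)]),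 (r21, [(r5, r30), (r32, r30)]), (r22, [(r7, r32), (r30, r32)]), (r23, [(r9, r29), (r28, r29)]), (r24, [(r11, r17), (r26, r17)]), (r25, [(r13, r3), (r24, r3)]), (r26, [(r15, r10), (r22, r10)]), (r27, [(r17, r11), (r20, r11)]), (r28, [(r18, r4), (r19, r4)]), (r29, [(r16, r23), (r21, r23)]), (r30, [(r14, r21), (r23, r21)]), (r31, [(r12, r6), (r25, r6)]), (r32, [(r10, r22), (r27, r22)]), (r33, [(r8, r9), (r29, r9)]), (r34, [(r6, r12), (r31, r12)]), (r35, [(r4, r18), (r33, r18)]), (r36, [(r2, r36), (r35, r36)])]"
definition NI37a :: marks where "NI37a = []"
abbreviation "EI37a \<equiv> mkenv 37 False MI37a NI37a"
definition "GI37a B = gen (EI37a B)"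
definition "WI37a us = wk 37 False (\<lambda>a. map fst (asc NI37a a)) (hd us) (tl us)"
interpretation I37a: inst 37 False MI37a NI37a GI37a WI37a U37 "[]"
proof unfold_locales
  have "less_marks 37 NI37a" by (simp add: NI37a_def r_defs)
  from asc_set[OF this] show "\<forall>c\<in>set (map fst (asc NI37a a)). val c < 37" for a by auto
  show "chk 37 U37 [] NI37a" by (simp add: chk_def NI37a_def U37_def r_defs)
qed (rule cop37 | simp add: GI37a_def WI37a_def)+
lemma mcI37a: "plain_marks MI37a" by (simp add: MI37a_def r_defs)
lemmas KI37a = env.sel[where ?x1.0 = 37 and ?x2.0 = False and ?x3.0 = "mlf (asc MI37a)" and ?x4.0 = "blf (\<lambda>a. map fst (asc NI37a a))"]
lemmas wtI37a_0 = walk_table_vs[where W = WI37a and ns = "n37", OF I37a.W z37 le37, THEN bal2[where n = "Suc (Suc (Suc (Suc (Suc 0))))"],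
  unfolded map_fold NI37a_def, simplified shape_simps asc.simps eqrs pl37 ng37 pa37 fst_conv snd_conv]
lemmas gtI37a_0 = gen_table[where G = GI37a and K = EI37a and ns = "n37", OF I37a.G KI37a(1-3) asc_list[OF mcI37a], THEN bal2[where n = "Suc (Suc (Suc (Suc (Suc 0))))"],
  unfolded map_fold MI37a_def, simplified bal_simps asc.simps mkl.simps if_True if_False eqrs pl37 fst_conv snd_conv]
lemmas gsI37a = gen_table_S[where G = GI37a and K = EI37a and ns = "n37", OF I37a.G KI37a(1,2,5), unfolded map_fold, simplified list_simps]
lemmas wsI37a = walk_table_S[where W = WI37a and ns = "n37", OF I37a.W, unfolded map_fold, simplified list_simps]
lemmas rtI37a = node_table[where G = GI37a and W = WI37a and K = EI37a, OF I37a.G I37a.W KI37a(1,2,4) I37a.N_less z37 le37 upt37, unfolded tree_unf, unfolded r_fold, simplified if_True if_False fold_simps tree_simps pa37]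
lemmas dtI37a = walk_dead[where W = WI37a, OF I37a.W z37 le37 upt37, unfolded tree_unf, unfolded r_fold, simplified fold_simps tree_simps pa37]
lemmas ftI37a = lv_dead[OF le37 upt37, unfolded tree_unf, unfolded r_fold, simplified fold_simps tree_simps pa37]
lemma cwI37a: "WI37a us T = WI37a us T" ..
lemmas runI37a = gsI37a wsI37a bs37 bleaf_simps rtI37a dtI37a ftI37a walk_end[where W = WI37a, OF I37a.W] leaf_simps
lemmas conI37a = cwI37a bsel_cong bleaf_cong fin_cong
abbreviation partI37a where
  "partI37a ds \<equiv> chain 37 (stage GI37a WI37a 37 [R 3, S (R 2) (R 1), R 1]) (R 29) (treeD 37 (map R n37))
    (fold (\<lambda>s. kill (pa 37 s)) ds (tree0 37 (map R n37)))"
text \<open>The chain for \<open>(1, 2)\<close> in pieces of at most four stages, each presupposing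
  the exclusions of all earlier pieces; the shift 29 is -8 modulo 37.\<close>

lemma partI37a_0:
  "partI37a [] [[R 0], [R 36], [R 35], [R 34]]"
proof -
  note wt = conj64[OF wtI37a_0] and gt = conj64[OF gtI37a_0] and mt = conj64[OF mt37_0] and pl = conj64[OF pl37_0]
  show ?thesis
    unfolding list.map r_fold treeD_def tree0_def
    apply (simp only: chain.simps fold_simps tree_simps pa37 list.sel pl simp_thms)
    apply ((intro conjI)?; rule stage_abs[unfolded r_fold])
    apply (simp_all only: wt gt mt pl runI37a cong: conI37a)
    done
qed
lemma partI37a_1:
  "partI37a [R 0, R 36, R 35, R 34] [[R 33], [R 32], [R 31], [R 30]]"
proof -
  note wt = conj64[OF wtI37a_0] and gt = conj64[OF gtI37a_0] and mt = conj64[OF mt37_0] and pl = conj64[OF pl37_0]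
  show ?thesis
    unfolding list.map r_fold treeD_def tree0_def
    apply (simp only: chain.simps fold_simps tree_simps pa37 list.sel pl simp_thms)
    apply ((intro conjI)?; rule stage_abs[unfolded r_fold])
    apply (simp_all only: wt gt mt pl runI37a cong: conI37a)
    done
qed
lemma partI37a_2:
  "partI37a [R 0, R 36, R 35, R 34, R 33, R 32, R 31, R 30] [[R 29], [R 28], [R 27], [R 26]]"
proof -
  note wt = conj64[OF wtI37a_0] and gt = conj64[OF gtI37a_0] and mt = conj64[OF mt37_0] and pl = conj64[OF pl37_0]
  show ?thesis
    unfolding list.map r_fold treeD_def tree0_def
    apply (simp only: chain.simps fold_simps tree_simps pa37 list.sel pl simp_thms)
    apply ((intro conjI)?; rule stage_abs[unfolded r_fold])
    apply (simp_all only: wt gt mt pl runI37a cong: conI37a)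
    done
qed
lemma partI37a_3:
  "partI37a [R 0, R 36, R 35, R 34, R 33, R 32, R 31, R 30, R 29, R 28, R 27, R 26] [[R 25], [R 24], [R 23], [R 22]]"
proof -
  note wt = conj64[OF wtI37a_0] and gt = conj64[OF gtI37a_0] and mt = conj64[OF mt37_0] and pl = conj64[OF pl37_0]
  show ?thesis
    unfolding list.map r_fold treeD_def tree0_def
    apply (simp only: chain.simps fold_simps tree_simps pa37 list.sel pl simp_thms)
    apply ((intro conjI)?; rule stage_abs[unfolded r_fold])
    apply (simp_all only: wt gt mt pl runI37a cong: conI37a)
    done
qed
lemma partI37a_4:
  "partI37a [R 0, R 36, R 35, R 34, R 33, R 32, R 31, R 30, R 29, R 28, R 27, R 26, R 25, R 24, R 23, R 22] [[R 21], [R 20], [R 19], [R 18]]"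
proof -
  note wt = conj64[OF wtI37a_0] and gt = conj64[OF gtI37a_0] and mt = conj64[OF mt37_0] and pl = conj64[OF pl37_0]
  show ?thesis
    unfolding list.map r_fold treeD_def tree0_def
    apply (simp only: chain.simps fold_simps tree_simps pa37 list.sel pl simp_thms)
    apply ((intro conjI)?; rule stage_abs[unfolded r_fold])
    apply (simp_all only: wt gt mt pl runI37a cong: conI37a)
    done
qed
lemma partI37a_5:
  "partI37a [R 0, R 36, R 35, R 34, R 33, R 32, R 31, R 30, R 29, R 28, R 27, R 26, R 25, R 24, R 23, R 22, R 21, R 20, R 19, R 18] [[R 17], [R 16], [R 15], [R 14]]"
proof -
  note wt = conj64[OF wtI37a_0] and gt = conj64[OF gtI37a_0] and mt = conj64[OF mt37_0] and pl = conj64[OF pl37_0]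
  show ?thesis
    unfolding list.map r_fold treeD_def tree0_def
    apply (simp only: chain.simps fold_simps tree_simps pa37 list.sel pl simp_thms)
    apply ((intro conjI)?; rule stage_abs[unfolded r_fold])
    apply (simp_all only: wt gt mt pl runI37a cong: conI37a)
    done
qed
lemma partI37a_6:
  "partI37a [R 0, R 36, R 35, R 34, R 33, R 32, R 31, R 30, R 29, R 28, R 27, R 26, R 25, R 24, R 23, R 22, R 21, R 20, R 19, R 18, R 17, R 16, R 15, R 14] [[R 13], [R 12], [R 11], [R 10]]"
proof -
  note wt = conj64[OF wtI37a_0] and gt = conj64[OF gtI37a_0] and mt = conj64[OF mt37_0] and pl = conj64[OF pl37_0]
  show ?thesis
    unfolding list.map r_fold treeD_def tree0_def
    apply (simp only: chain.simps fold_simps tree_simps pa37 list.sel pl simp_thms)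
    apply ((intro conjI)?; rule stage_abs[unfolded r_fold])
    apply (simp_all only: wt gt mt pl runI37a cong: conI37a)
    done
qed
lemma partI37a_7:
  "partI37a [R 0, R 36, R 35, R 34, R 33, R 32, R 31, R 30, R 29, R 28, R 27, R 26, R 25, R 24, R 23, R 22, R 21, R 20, R 19, R 18, R 17, R 16, R 15, R 14, R 13, R 12, R 11, R 10] [[R 9], [R 8], [R 7], [R 6]]"
proof -
  note wt = conj64[OF wtI37a_0] and gt = conj64[OF gtI37a_0] and mt = conj64[OF mt37_0] and pl = conj64[OF pl37_0]
  show ?thesis
    unfolding list.map r_fold treeD_def tree0_def
    apply (simp only: chain.simps fold_simps tree_simps pa37 list.sel pl simp_thms)
    apply ((intro conjI)?; rule stage_abs[unfolded r_fold])
    apply (simp_all only: wt gt mt pl runI37a cong: conI37a)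
    done
qed
lemma partI37a_8:
  "partI37a [R 0, R 36, R 35, R 34, R 33, R 32, R 31, R 30, R 29, R 28, R 27, R 26, R 25, R 24, R 23, R 22, R 21, R 20, R 19, R 18, R 17, R 16, R 15, R 14, R 13, R 12, R 11, R 10, R 9, R 8, R 7, R 6] [[R 5], [R 4], [R 3], [R 2]]"
proof -
  note wt = conj64[OF wtI37a_0] and gt = conj64[OF gtI37a_0] and mt = conj64[OF mt37_0] and pl = conj64[OF pl37_0]
  show ?thesis
    unfolding list.map r_fold treeD_def tree0_def
    apply (simp only: chain.simps fold_simps tree_simps pa37 list.sel pl simp_thms)
    apply ((intro conjI)?; rule stage_abs[unfolded r_fold])
    apply (simp_all only: wt gt mt pl runI37a cong: conI37a)
    done
qed
lemma partI37a_9: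
  "partI37a [R 0, R 36, R 35, R 34, R 33, R 32, R 31, R 30, R 29, R 28, R 27, R 26, R 25, R 24, R 23, R 22, R 21, R 20, R 19, R 18, R 17, R 16, R 15, R 14, R 13, R 12, R 11, R 10, R 9, R 8, R 7, R 6, R 5, R 4, R 3, R 2] [[R 1]]"
proof -
  note wt = conj64[OF wtI37a_0] and gt = conj64[OF gtI37a_0] and mt = conj64[OF mt37_0] and pl = conj64[OF pl37_0]
  show ?thesis
    unfolding list.map r_fold treeD_def tree0_def
    apply (simp only: chain.simps fold_simps tree_simps pa37 list.sel pl simp_thms)
    apply ((intro conjI)?; rule stage_abs[unfolded r_fold])
    apply (simp_all only: wt gt mt pl runI37a cong: conI37a)
    done
qed
lemma tban_37_2:
  assumes "base 37 False A Q C"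
  shows "tban 37 False A Q C 1 2"
proof (rule I37a.chains_tban[where x = 3 and z = 1 and k = 29 and ns = "n37" and cs = "[[[R 0], [R 36], [R 35], [R 34]], [[R 33], [R 32], [R 31], [R 30]], [[R 29], [R 28], [R 27], [R 26]], [[R 25], [R 24], [R 23], [R 22]], [[R 21], [R 20], [R 19], [R 18]], [[R 17], [R 16], [R 15], [R 14]], [[R 13], [R 12], [R 11], [R 10]], [[R 9], [R 8], [R 7], [R 6]], [[R 5], [R 4], [R 3], [R 2]], [[R 1]]]"])
  show "\<forall>x\<in>set []. tban 37 False A Q C (fst x) (snd x)" by simp
  show "base 37 False A Q C" by (rule assms)
  show "chk 37 U37 [(1, 2)] MI37a" by (simp add: chk_def MI37a_def U37_def r_defs)
  show "links 37 (stage GI37a WI37a 37 [R 3, S (R 2) (R 1), R 1]) (R 29) (treeD 37 (map R n37)) (tree0 37 (map R n37)) [] [[[R 0], [R 36], [R 35], [R 34]], [[R 33], [R 32], [R 31], [R 30]], [[R 29], [R 28], [R 27], [R 26]], [[R 25], [R 24], [R 23], [R 22]], [[R 21], [R 20], [R 19], [R 18]], [[R 17], [R 16], [R 15], [R 14]], [[R 13], [R 12], [R 11], [R 10]], [[R 9], [R 8], [R 7], [R 6]], [[R 5], [R 4], [R 3], [R 2]], [[R 1]]]"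
    by (simp only: links.simps append.simps concat.simps partI37a_0 partI37a_1 partI37a_2 partI37a_3 partI37a_4 partI37a_5 partI37a_6 partI37a_7 partI37a_8 partI37a_9 simp_thms)
qed (unfold I37a.eqs_def, simp_all add: U37_def upt37[symmetric])

definition MI37b :: marks where "MI37b = []"
definition NI37b :: marks where "NI37b = [(r1, [(r2, r1), (r35, r1)]), (r2, [(r4, r19), (r33, r19)]), (r3, [(r6, r25), (r31, r25)]), (r4, [(r8, r28), (r29, r28)]), (r5, [(r10, r15), (r27, r15)]), (r6, [(r12, r31), (r25, r31)]), (r7, [(r14, r16), (r23, r16)]), (r8, [(r16, r14), (r21, r14)]), (r9, [(r18, r33), (r19, r33)]), (r10, [(r17, r26), (r20, r26)]), (r11, [(r15, r27), (r22, r27)]), (r12, [(r13, r34), (r24, r34)]), (r13, [(r11, r20), (r26, r20)]), (r14, [(r9, r8), (r28, r8)]), (r15, [(r7, r5), (r30, r5)]), (r16, [(r5, r7), (r32, r7)]), (r17, [(r3, r24), (r34, r24)]), (r18, [(r1, r35), (r36, r35)]), (r19, [(r1, r2), (r36, r2)]), (r20, [(r3, r13), (r34, r13)]), (r21, [(r5, r30), (r32, r30)]), (r22, [(r7, r32), (r30, r32)]), (r23, [(r9, r29), (r28, r29)]), (r24, [(r11, r17), (r26, r17)]), (r25, [(r13, r3), (r24, r3)]), (r26, [(r15, r10), (r22, r10)]), (r27, [(r17, r11), (r20, r11)]), (r28, [(r18, r4), (r19, r4)]), (r29, [(r16, r23), (r21, r23)]), (r30, [(r14, r21), (r23, r21)]),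 (r31, [(r12, r6), (r25, r6)]), (r32, [(r10, r22), (r27, r22)]), (r33, [(r8, r9), (r29, r9)]), (r34, [(r6, r12), (r31, r12)]), (r35, [(r4, r18), (r33, r18)]), (r36, [(r2, r36), (r35, r36)])]"
abbreviation "EI37b \<equiv> mkenv 37 False MI37b NI37b"
definition "GI37b B = gen (EI37b B)"
definition "WI37b us = wk 37 False (\<lambda>a. map fst (asc NI37b a)) (hd us) (tl us)"
interpretation I37b: inst 37 False MI37b NI37b GI37b WI37b U37 "[(1, 2)]"
proof unfold_locales
  have "less_marks 37 NI37b" by (simp add: NI37b_def r_defs)
  from asc_set[OF this] show "\<forall>c\<in>set (map fst (asc NI37b a)). val c < 37" for a by auto
  show "chk 37 U37 [(1, 2)] NI37b" by (simp add: chk_def NI37b_def U37_def r_defs)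
qed (rule cop37 | simp add: GI37b_def WI37b_def)+
lemma mcI37b: "plain_marks MI37b" by (simp add: MI37b_def r_defs)
lemmas KI37b = env.sel[where ?x1.0 = 37 and ?x2.0 = False and ?x3.0 = "mlf (asc MI37b)" and ?x4.0 = "blf (\<lambda>a. map fst (asc NI37b a))"]
lemmas wtI37b_0 = walk_table_vs[where W = WI37b and ns = "n37", OF I37b.W z37 le37, THEN bal2[where n = "Suc (Suc (Suc (Suc (Suc 0))))"],
  unfolded map_fold NI37b_def, simplified shape_simps asc.simps eqrs pl37 ng37 pa37 fst_conv snd_conv]
lemmas gtI37b_0 = gen_table[where G = GI37b and K = EI37b and ns = "n37", OF I37b.G KI37b(1-3) asc_list[OF mcI37b], THEN bal2[where n = "Suc (Suc (Suc (Suc (Suc 0))))"],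
  unfolded map_fold MI37b_def, simplified bal_simps asc.simps mkl.simps if_True if_False eqrs pl37 fst_conv snd_conv]
lemmas rtI37b = node_table[where G = GI37b and W = WI37b and K = EI37b, OF I37b.G I37b.W KI37b(1,2,4) I37b.N_less z37 le37 upt37, unfolded tree_unf, unfolded r_fold, simplified if_True if_False fold_simps tree_simps pa37]
lemmas dtI37b = walk_dead[where W = WI37b, OF I37b.W z37 le37 upt37, unfolded tree_unf, unfolded r_fold, simplified fold_simps tree_simps pa37]
lemmas ftI37b = lv_dead[OF le37 upt37, unfolded tree_unf, unfolded r_fold, simplified fold_simps tree_simps pa37]
lemma cwI37b: "WI37b us T = WI37b us T" ..
lemmas runI37b =  rtI37b dtI37b ftI37b walk_end[where W = WI37b, OF I37b.W] leaf_simps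
lemmas conI37b = cwI37b bsel_cong bleaf_cong fin_cong
lemma partI37b: "GI37b (Lf (R 0)) [R 0] [R 4, R 3, R 2]"
proof -
  note wt = conj64[OF wtI37b_0] and gt = conj64[OF gtI37b_0]
  show ?thesis
    unfolding r_fold
    by (simp only: wt gt runI37b cong: conI37b)
qed
lemma tban_I37b:
  assumes "base 37 False A Q C"
  shows "\<forall>t\<in>set [3]. tban 37 False A Q C 1 t"
proof (rule I37b.plain_all)
  show "\<forall>x\<in>set [(1, 2)]. tban 37 False A Q C (fst x) (snd x)" using tban_37_2[OF assms] by simp
qed (use assms partI37b in \<open>simp_all add: MI37b_def\<close>)

definition MI37c :: marks where "MI37c = []"
definition NI37c :: marks where "NI37c = [(r1, [(r2, r1), (r35, r1), (r3, r1), (r34, r1)]), (r2, [(r4, r19), (r33, r19), (r6, r19), (r31, r19)]), (r3, [(r6, r25), (r31, r25), (r9, r25), (r28, r25)]), (r4, [(r8, r28), (r29, r28), (r12, r28), (r25, r28)]), (r5, [(r10, r15), (r27, r15), (r15, r15), (r22, r15)]), (r6, [(r12, r31), (r25, r31), (r18, r31), (r19, r31)]), (r7, [(r14, r16), (r23, r16), (r16, r16), (r21, r16)]), (r8, [(r16, r14), (r21, r14), (r13, r14), (r24, r14)]), (r9, [(r18, r33), (r19, r33), (r10, r33), (r27, r33)]), (r10, [(r17, r26), (r20, r26), (r7, r26), (r30, r26)]), (r11, [(r15, r27), (r22, r27), (r4, r27), (r33, r27)]), (r12, [(r13, r34), (r24, r34), (r1, r34), (r36, r34)]), (r13, [(r11,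 r20), (r26, r20), (r2, r20), (r35, r20)]), (r14, [(r9, r8), (r28, r8), (r5, r8), (r32, r8)]), (r15, [(r7, r5), (r30, r5), (r8, r5), (r29, r5)]), (r16, [(r5, r7), (r32, r7), (r11, r7), (r26, r7)]), (r17, [(r3, r24), (r34, r24), (r14, r24), (r23, r24)]), (r18, [(r1, r35), (r36, r35), (r17, r35), (r20, r35)]), (r19, [(r1, r2), (r36, r2), (r17, r2), (r20, r2)]), (r20, [(r3, r13), (r34, r13), (r14, r13), (r23, r13)]), (r21, [(r5, r30), (r32, r30), (r11, r30), (r26, r30)]), (r22, [(r7, r32), (r30, r32), (r8, r32), (r29, r32)]), (r23, [(r9, r29), (r28, r29), (r5, r29), (r32, r29)]), (r24, [(r11, r17), (r26, r17), (r2, r17), (r35, r17)]), (r25, [(r13, r3), (r24, r3), (r1, r3), (r36, r3)]), (r26, [(r15, r10), (r22, r10), (r4, r10), (r33, r10)]), (r27, [(r17, r11), (r20, r11), (r7, r11), (r30, r11)]), (r28, [(r18, r4), (r19, r4), (r10, r4), (r27, r4)]), (r29, [(r16, r23), (r21, r23), (r13, r23), (r24, r23)]), (r30, [(r14, r21), (r23, r21), (r16, r21), (r21, r21)]), (r31, [(r12, r6), (r25, r6), (r18, r6), (r19, r6)]), (r32, [(r10, r22), (r27, r22), (r15, r22), (r22, r22)]), (r33, [(r8, r9), (r29, r9), (r12, r9), (r25, r9)]), (r34, [(r6, r12), (r31, r12), (r9, r12), (r28, r12)]), (r35, [(r4, r18), (r33, r18), (r6, r18), (r31, r18)]), (r36,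 [(r2, r36), (r35, r36), (r3, r36), (r34, r36)])]"
abbreviation "EI37c \<equiv> mkenv 37 False MI37c NI37c"
definition "GI37c B = gen (EI37c B)"
definition "WI37c us = wk 37 False (\<lambda>a. map fst (asc NI37c a)) (hd us) (tl us)"
interpretation I37c: inst 37 False MI37c NI37c GI37c WI37c U37 "[(1, 2), (1, 3)]"
proof unfold_locales
  have "less_marks 37 NI37c" by (simp add: NI37c_def r_defs)
  from asc_set[OF this] show "\<forall>c\<in>set (map fst (asc NI37c a)). val c < 37" for a by auto
  show "chk 37 U37 [(1, 2), (1, 3)] NI37c" by (simp add: chk_def NI37c_def U37_def r_defs)
qed (rule cop37 | simp add: GI37c_def WI37c_def)+
lemma mcI37c: "plain_marks MI37c" by (simp add: MI37c_def r_defs)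
lemmas KI37c = env.sel[where ?x1.0 = 37 and ?x2.0 = False and ?x3.0 = "mlf (asc MI37c)" and ?x4.0 = "blf (\<lambda>a. map fst (asc NI37c a))"]
lemmas wtI37c_0 = walk_table_vs[where W = WI37c and ns = "n37", OF I37c.W z37 le37, THEN bal2[where n = "Suc (Suc (Suc (Suc (Suc 0))))"],
  unfolded map_fold NI37c_def, simplified shape_simps asc.simps eqrs pl37 ng37 pa37 fst_conv snd_conv]
lemmas gtI37c_0 = gen_table[where G = GI37c and K = EI37c and ns = "n37", OF I37c.G KI37c(1-3) asc_list[OF mcI37c], THEN bal2[where n = "Suc (Suc (Suc (Suc (Suc 0))))"],
  unfolded map_fold MI37c_def, simplified bal_simps asc.simps mkl.simps if_True if_False eqrs pl37 fst_conv snd_conv]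
lemmas rtI37c = node_table[where G = GI37c and W = WI37c and K = EI37c, OF I37c.G I37c.W KI37c(1,2,4) I37c.N_less z37 le37 upt37, unfolded tree_unf, unfolded r_fold, simplified if_True if_False fold_simps tree_simps pa37]
lemmas dtI37c = walk_dead[where W = WI37c, OF I37c.W z37 le37 upt37, unfolded tree_unf, unfolded r_fold, simplified fold_simps tree_simps pa37]
lemmas ftI37c = lv_dead[OF le37 upt37, unfolded tree_unf, unfolded r_fold, simplified fold_simps tree_simps pa37]
lemma cwI37c: "WI37c us T = WI37c us T" ..
lemmas runI37c =  rtI37c dtI37c ftI37c walk_end[where W = WI37c, OF I37c.W] leaf_simps
lemmas conI37c = cwI37c bsel_cong bleaf_cong fin_cong
lemma partI37c: "GI37c (Lf (R 0)) [R 0] [R 5, R 4, R 3] \<and>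
  GI37c (Lf (R 0)) [R 0] [R 6, R 5, R 4] \<and>
  GI37c (Lf (R 0)) [R 0] [R 7, R 6, R 5] \<and>
  GI37c (Lf (R 0)) [R 0] [R 8, R 7, R 6] \<and>
  GI37c (Lf (R 0)) [R 0] [R 9, R 8, R 7] \<and>
  GI37c (Lf (R 0)) [R 0] [R 10, R 9, R 8] \<and>
  GI37c (Lf (R 0)) [R 0] [R 11, R 10, R 9] \<and>
  GI37c (Lf (R 0)) [R 0] [R 12, R 11, R 10] \<and>
  GI37c (Lf (R 0)) [R 0] [R 13, R 12, R 11] \<and>
  GI37c (Lf (R 0)) [R 0] [R 14, R 13, R 12] \<and>
  GI37c (Lf (R 0)) [R 0] [R 15, R 14, R 13] \<and>
  GI37c (Lf (R 0)) [R 0] [R 16, R 15, R 14] \<and>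
  GI37c (Lf (R 0)) [R 0] [R 17, R 16, R 15] \<and>
  GI37c (Lf (R 0)) [R 0] [R 18, R 17, R 16] \<and>
  GI37c (Lf (R 0)) [R 0] [R 19, R 18, R 17]"
proof -
  note wt = conj64[OF wtI37c_0] and gt = conj64[OF gtI37c_0]
  show ?thesis
    unfolding r_fold
    by (simp only: wt gt runI37c cong: conI37c)
qed
lemma tban_I37c:
  assumes "base 37 False A Q C"
  shows "\<forall>t\<in>set [4, 5, 6, 7, 8, 9, 10, 11, 12, 13, 14, 15, 16, 17, 18]. tban 37 False A Q C 1 t"
proof (rule I37c.plain_all)
  show "\<forall>x\<in>set [(1, 2), (1, 3)]. tban 37 False A Q C (fst x) (snd x)" using tban_37_2[OF assms] tban_I37b[OF assms] by simp
qed (use assms partI37c in \<open>simp_all add: MI37c_def\<close>)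

lemma reach_37: "reach 37"
proof (rule reach_step[where c = 1 and ?a0.0 = 1 and U = U37 and TS = "[2, 3, 4, 5, 6, 7, 8, 9, 10, 11, 12, 13, 14, 15, 16, 17, 18]" and V = "[(2, 1, 2), (3, 1, 3), (4, 1, 4), (5, 1, 5), (6, 1, 6), (7, 1, 7), (8, 1, 8), (9, 1, 9), (10, 1, 10), (11, 1, 11), (12, 1, 12), (13, 1, 13), (14, 1, 14), (15, 1, 15), (16, 1, 16), (17, 1, 17), (18, 1, 18), (19, 1, 18), (20, 1, 17), (21, 1, 16), (22, 1, 15), (23, 1, 14), (24, 1, 13), (25, 1, 12), (26, 1, 11), (27, 1, 10), (28, 1, 9), (29, 1, 8), (30, 1, 7), (31, 1, 6), (32, 1, 5), (33, 1, 4), (34, 1, 3), (35, 1, 2)]"])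
  show "reach 1" by (rule reach_1)
  show "\<forall>t\<in>set [2, 3, 4, 5, 6, 7, 8, 9, 10, 11, 12, 13, 14, 15, 16, 17, 18]. tban 37 False A Q C 1 t" if "base 37 False A Q C" for A Q C using tban_37_2[OF that] tban_I37b[OF that] tban_I37c[OF that] by simp
qed (rule cop37 | simp add: U37_def upt37[symmetric])+

section \<open>Modulus 39: starting from a value divisible by 13\<close>

abbreviation n39 :: "nat list" where "n39 \<equiv> [0, 1, 2, 3, 4, 5, 6, 7, 8, 9, 10, 11, 12, 13, 14, 15, 16, 17, 18, 19, 20, 21, 22, 23, 24, 25, 26, 27, 28, 29, 30, 31, 32, 33, 34, 35, 36, 37, 38]"
lemma upt39: "n39 = [0..<39]" by (simp add: upt_rec)
lemma le39: "39 \<le> (64::nat)" and z39: "0 < (39::nat)" by simp_all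
definition U39 :: "nat list" where "U39 = [1, 2, 4, 5, 7, 8, 10, 11, 14, 16, 17, 19, 20, 22, 23, 25, 28, 29, 31, 32, 34, 35, 37, 38]"
lemma cop39: "list_all (\<lambda>u. coprime u 39) U39" by (rule units_coprime) (simp add: U39_def)
lemmas pa39 = path_table[of 39 "n39", unfolded code_def bits_numeral, simplified, unfolded One_nat_def[symmetric], unfolded r_fold]
lemmas pl39_0 = pl_table[of 39 "n39", THEN bal2[where n = "Suc (Suc (Suc (Suc (Suc 0))))"], simplified bal_simps arith, unfolded r_fold]
lemmas pl39_1 = pl39_0[THEN q1] pl39_0[THEN q2] pl39_0[THEN q3] pl39_0[THEN q4]
lemmas pl39_2 = pl39_1[THEN q1] pl39_1[THEN q2] pl39_1[THEN q3] pl39_1[THEN q4]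
lemmas pl39_3 = pl39_2[THEN q1] pl39_2[THEN q2] pl39_2[THEN q3] pl39_2[THEN q4]
lemmas pl39_4 = pl39_3[THEN q1] pl39_3[THEN q2] pl39_3[THEN q3] pl39_3[THEN q4]
lemmas pl39 = pl39_4[THEN q1] pl39_4[THEN q2] pl39_4[THEN q3] pl39_4[THEN q4]
lemmas ng39 = ng_table[of 39 "n39", simplified, unfolded One_nat_def[symmetric], unfolded r_fold]
lemmas mt39_0 = mt_table'[OF upt39, THEN gsl_bal[where n = "Suc (Suc (Suc (Suc (Suc 0))))" and m = "Suc (Suc (Suc (Suc (Suc 0))))"], unfolded map_fold, simplified bal_simps gsl.simps fst_conv snd_conv pl39]
lemmas bs39 = bsel_table[where h = 39 and xs = "map R n39" and n = "(Suc (Suc (Suc (Suc (Suc (Suc (Suc 0)))))))" and vs = "[v0,v1,v2,v3,v4,v5,v6]" for v0 v1 v2 v3 v4 v5 v6,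
  unfolded map_fold, simplified list.pred_inject simp_thms pt_simps lefts_simps join.simps keep.simps drp.simps fb.simps get_simps pa39]

definition MI39a :: marks where "MI39a = [(r13, [(r3, r1), (r6, r7), (r9, r4), (r12, r10), (r15, r31), (r18, r28), (r21, r28), (r24, r31), (r27, r10), (r30, r4), (r33, r7), (r36, r1)]), (r26, [(r3, r14), (r6, r20), (r9, r17), (r12, r23), (r15, r5), (r18, r2), (r21, r2), (r24, r5), (r27, r23), (r30, r17), (r33, r20), (r36, r14)])]"
definition NI39a :: marks where "NI39a = []"
abbreviation "EI39a \<equiv> mkenv 39 False MI39a NI39a"
definition "GI39a B = gen (EI39a B)"
definition "WI39a us = wk 39 False (\<lambda>a. map fst (asc NI39a a)) (hd us) (tl us)"
interpretation I39a: inst 39 False MI39a NI39a GI39a WI39a U39 "[]"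
proof unfold_locales
  have "less_marks 39 NI39a" by (simp add: NI39a_def r_defs)
  from asc_set[OF this] show "\<forall>c\<in>set (map fst (asc NI39a a)). val c < 39" for a by auto
  show "chk 39 U39 [] NI39a" by (simp add: chk_def NI39a_def U39_def r_defs)
qed (rule cop39 | simp add: GI39a_def WI39a_def)+
lemma mcI39a: "plain_marks MI39a" by (simp add: MI39a_def r_defs)
lemmas KI39a = env.sel[where ?x1.0 = 39 and ?x2.0 = False and ?x3.0 = "mlf (asc MI39a)" and ?x4.0 = "blf (\<lambda>a. map fst (asc NI39a a))"]
lemmas wtI39a_0 = walk_table_vs[where W = WI39a and ns = "n39", OF I39a.W z39 le39, THEN bal2[where n = "Suc (Suc (Suc (Suc (Suc 0))))"],
  unfolded map_fold NI39a_def, simplified shape_simps asc.simps eqrs pl39 ng39 pa39 fst_conv snd_conv]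
lemmas gtI39a_0 = gen_table[where G = GI39a and K = EI39a and ns = "n39", OF I39a.G KI39a(1-3) asc_list[OF mcI39a], THEN bal2[where n = "Suc (Suc (Suc (Suc (Suc 0))))"],
  unfolded map_fold MI39a_def, simplified bal_simps asc.simps mkl.simps if_True if_False eqrs pl39 fst_conv snd_conv]
lemmas gsI39a = gen_table_S[where G = GI39a and K = EI39a and ns = "n39", OF I39a.G KI39a(1,2,5), unfolded map_fold, simplified list_simps]
lemmas wsI39a = walk_table_S[where W = WI39a and ns = "n39", OF I39a.W, unfolded map_fold, simplified list_simps]
lemmas rtI39a = node_table[where G = GI39a and W = WI39a and K = EI39a, OF I39a.G I39a.W KI39a(1,2,4) I39a.N_less z39 le39 upt39, unfolded tree_unf, unfolded r_fold, simplified if_True if_False fold_simps tree_simps pa39]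
lemmas dtI39a = walk_dead[where W = WI39a, OF I39a.W z39 le39 upt39, unfolded tree_unf, unfolded r_fold, simplified fold_simps tree_simps pa39]
lemmas ftI39a = lv_dead[OF le39 upt39, unfolded tree_unf, unfolded r_fold, simplified fold_simps tree_simps pa39]
lemma cwI39a: "WI39a us T = WI39a us T" ..
lemmas runI39a = gsI39a wsI39a bs39 bleaf_simps rtI39a dtI39a ftI39a walk_end[where W = WI39a, OF I39a.W] leaf_simps
lemmas conI39a = cwI39a bsel_cong bleaf_cong fin_cong
abbreviation partI39a where
  "partI39a ds \<equiv> chain 39 (stage GI39a WI39a 39 [R 16, S (R 3) (R 1), R 29]) (R 4) (treeD 39 (map R n39))
    (fold (\<lambda>s. kill (pa 39 s)) ds (tree0 39 (map R n39)))"
text \<open>The unit 25 fixes 13 and negates 3 modulo 39, so \<open>s\<close> and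
  \<open>25 * s\<close> form a group.\<close>

lemma partI39a_0:
  "partI39a [] [[R 0], [R 38, R 14], [R 37, R 28]]"
proof -
  note wt = conj64[OF wtI39a_0] and gt = conj64[OF gtI39a_0] and mt = conj64[OF mt39_0] and pl = conj64[OF pl39_0]
  show ?thesis
    unfolding list.map r_fold treeD_def tree0_def
    apply (simp only: chain.simps fold_simps tree_simps pa39 list.sel pl simp_thms)
    apply ((intro conjI)?; rule stage_abs[unfolded r_fold])
    apply (simp_all only: wt gt mt pl runI39a cong: conI39a)
    done
qed
lemma partI39a_1:
  "partI39a [R 0, R 38, R 14, R 37, R 28] [[R 36, R 3], [R 35, R 17], [R 34, R 31]]"
proof -
  note wt = conj64[OF wtI39a_0] and gt = conj64[OF gtI39a_0] and mt = conj64[OF mt39_0] and pl = conj64[OF pl39_0]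
  show ?thesis
    unfolding list.map r_fold treeD_def tree0_def
    apply (simp only: chain.simps fold_simps tree_simps pa39 list.sel pl simp_thms)
    apply ((intro conjI)?; rule stage_abs[unfolded r_fold])
    apply (simp_all only: wt gt mt pl runI39a cong: conI39a)
    done
qed
lemma partI39a_2:
  "partI39a [R 0, R 38, R 14, R 37, R 28, R 36, R 3, R 35, R 17, R 34, R 31] [[R 33, R 6], [R 32, R 20], [R 30, R 9]]"
proof -
  note wt = conj64[OF wtI39a_0] and gt = conj64[OF gtI39a_0] and mt = conj64[OF mt39_0] and pl = conj64[OF pl39_0]
  show ?thesis
    unfolding list.map r_fold treeD_def tree0_def
    apply (simp only: chain.simps fold_simps tree_simps pa39 list.sel pl simp_thms)
    apply ((intro conjI)?; rule stage_abs[unfolded r_fold])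
    apply (simp_all only: wt gt mt pl runI39a cong: conI39a)
    done
qed
lemma partI39a_3:
  "partI39a [R 0, R 38, R 14, R 37, R 28, R 36, R 3, R 35, R 17, R 34, R 31, R 33, R 6, R 32, R 20, R 30, R 9] [[R 29, R 23], [R 27, R 12], [R 26]]"
proof -
  note wt = conj64[OF wtI39a_0] and gt = conj64[OF gtI39a_0] and mt = conj64[OF mt39_0] and pl = conj64[OF pl39_0]
  show ?thesis
    unfolding list.map r_fold treeD_def tree0_def
    apply (simp only: chain.simps fold_simps tree_simps pa39 list.sel pl simp_thms)
    apply ((intro conjI)?; rule stage_abs[unfolded r_fold])
    apply (simp_all only: wt gt mt pl runI39a cong: conI39a)
    done
qed
lemma partI39a_4:
  "partI39a [R 0, R 38, R 14, R 37, R 28, R 36, R 3, R 35, R 17, R 34, R 31, R 33, R 6, R 32, R 20, R 30, R 9, R 29, R 23, R 27, R 12, R 26] [[R 25, R 1], [R 24, R 15], [R 22, R 4]]"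
proof -
  note wt = conj64[OF wtI39a_0] and gt = conj64[OF gtI39a_0] and mt = conj64[OF mt39_0] and pl = conj64[OF pl39_0]
  show ?thesis
    unfolding list.map r_fold treeD_def tree0_def
    apply (simp only: chain.simps fold_simps tree_simps pa39 list.sel pl simp_thms)
    apply ((intro conjI)?; rule stage_abs[unfolded r_fold])
    apply (simp_all only: wt gt mt pl runI39a cong: conI39a)
    done
qed
lemma partI39a_5:
  "partI39a [R 0, R 38, R 14, R 37, R 28, R 36, R 3, R 35, R 17, R 34, R 31, R 33, R 6, R 32, R 20, R 30, R 9, R 29, R 23, R 27, R 12, R 26, R 25, R 1, R 24, R 15, R 22, R 4] [[R 21, R 18], [R 19, R 7], [R 16, R 10]]"
proof -
  note wt = conj64[OF wtI39a_0] and gt = conj64[OF gtI39a_0] and mt = conj64[OF mt39_0] and pl = conj64[OF pl39_0]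
  show ?thesis
    unfolding list.map r_fold treeD_def tree0_def
    apply (simp only: chain.simps fold_simps tree_simps pa39 list.sel pl simp_thms)
    apply ((intro conjI)?; rule stage_abs[unfolded r_fold])
    apply (simp_all only: wt gt mt pl runI39a cong: conI39a)
    done
qed
lemma partI39a_6:
  "partI39a [R 0, R 38, R 14, R 37, R 28, R 36, R 3, R 35, R 17, R 34, R 31, R 33, R 6, R 32, R 20, R 30, R 9, R 29, R 23, R 27, R 12, R 26, R 25, R 1, R 24, R 15, R 22, R 4, R 21, R 18, R 19, R 7, R 16, R 10] [[R 13], [R 11, R 2], [R 8, R 5]]"
proof -
  note wt = conj64[OF wtI39a_0] and gt = conj64[OF gtI39a_0] and mt = conj64[OF mt39_0] and pl = conj64[OF pl39_0]
  show ?thesis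
    unfolding list.map r_fold treeD_def tree0_def
    apply (simp only: chain.simps fold_simps tree_simps pa39 list.sel pl simp_thms)
    apply ((intro conjI)?; rule stage_abs[unfolded r_fold])
    apply (simp_all only: wt gt mt pl runI39a cong: conI39a)
    done
qed
lemma tban_39_3:
  assumes "base 39 False A Q C"
  shows "tban 39 False A Q C 13 3"
proof (rule I39a.chains_tban[where x = 16 and z = 29 and k = 4 and ns = "n39" and cs = "[[[R 0], [R 38, R 14], [R 37, R 28]], [[R 36, R 3], [R 35, R 17], [R 34, R 31]], [[R 33, R 6], [R 32, R 20], [R 30, R 9]], [[R 29, R 23], [R 27, R 12], [R 26]], [[R 25, R 1], [R 24, R 15], [R 22, R 4]], [[R 21, R 18], [R 19, R 7], [R 16, R 10]], [[R 13], [R 11, R 2], [R 8, R 5]]]"])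
  show "\<forall>x\<in>set []. tban 39 False A Q C (fst x) (snd x)" by simp
  show "base 39 False A Q C" by (rule assms)
  show "chk 39 U39 [(13, 3)] MI39a" by (simp add: chk_def MI39a_def U39_def r_defs)
  show "links 39 (stage GI39a WI39a 39 [R 16, S (R 3) (R 1), R 29]) (R 4) (treeD 39 (map R n39)) (tree0 39 (map R n39)) [] [[[R 0], [R 38, R 14], [R 37, R 28]], [[R 36, R 3], [R 35, R 17], [R 34, R 31]], [[R 33, R 6], [R 32, R 20], [R 30, R 9]], [[R 29, R 23], [R 27, R 12], [R 26]], [[R 25, R 1], [R 24, R 15], [R 22, R 4]], [[R 21, R 18], [R 19, R 7], [R 16, R 10]], [[R 13], [R 11, R 2], [R 8, R 5]]]"
    by (simp only: links.simps append.simps concat.simps partI39a_0 partI39a_1 partI39a_2 partI39a_3 partI39a_4 partI39a_5 partI39a_6 simp_thms)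
qed (unfold I39a.eqs_def, simp_all add: U39_def upt39[symmetric])

definition MI39b :: marks where "MI39b = [(r13, [(r1, r1), (r2, r19), (r4, r10), (r5, r31), (r7, r28), (r8, r34), (r10, r4), (r11, r7), (r14, r25), (r16, r22), (r17, r16), (r19, r37), (r20, r37), (r22, r16), (r23, r22), (r25, r25), (r28, r7), (r29, r4), (r31, r34), (r32, r28), (r34, r31), (r35, r10), (r37, r19), (r38, r1)]), (r26, [(r1, r38), (r2, r20), (r4, r29), (r5, r8), (r7, r11), (r8, r5), (r10, r35), (r11, r32), (r14, r14), (r16, r17), (r17, r23), (r19, r2), (r20, r2), (r22, r23), (r23, r17), (r25, r14), (r28, r32), (r29, r35), (r31, r5), (r32, r11), (r34, r8), (r35, r29), (r37, r20), (r38, r38)])]"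
text \<open>The refuted type \<open>(13, 3)\<close> is available at every position while
  \<open>(13, 1)\<close> is being split by \<open>A (4 * m)\<close>.\<close>

definition NI39b :: marks where "NI39b = [(r13, [(r3, r1), (r6, r7), (r9, r4), (r12, r10), (r15, r31), (r18, r28), (r21, r28), (r24, r31), (r27, r10), (r30, r4), (r33, r7), (r36, r1)]), (r26, [(r3, r14), (r6, r20), (r9, r17), (r12, r23), (r15, r5), (r18, r2), (r21, r2), (r24, r5), (r27, r23), (r30, r17), (r33, r20), (r36, r14)])]"
abbreviation "EI39b \<equiv> mkenv 39 False MI39b NI39b"
definition "GI39b B = gen (EI39b B)"
definition "WI39b us = wk 39 False (\<lambda>a. map fst (asc NI39b a)) (hd us) (tl us)"
interpretation I39b: inst 39 False MI39b NI39b GI39b WI39b U39 "[(13, 3)]"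
proof unfold_locales
  have "less_marks 39 NI39b" by (simp add: NI39b_def r_defs)
  from asc_set[OF this] show "\<forall>c\<in>set (map fst (asc NI39b a)). val c < 39" for a by auto
  show "chk 39 U39 [(13, 3)] NI39b" by (simp add: chk_def NI39b_def U39_def r_defs)
qed (rule cop39 | simp add: GI39b_def WI39b_def)+
lemma mcI39b: "plain_marks MI39b" by (simp add: MI39b_def r_defs)
lemmas KI39b = env.sel[where ?x1.0 = 39 and ?x2.0 = False and ?x3.0 = "mlf (asc MI39b)" and ?x4.0 = "blf (\<lambda>a. map fst (asc NI39b a))"]
lemmas wtI39b_0 = walk_table_vs[where W = WI39b and ns = "n39", OF I39b.W z39 le39, THEN bal2[where n = "Suc (Suc (Suc (Suc (Suc 0))))"],
  unfolded map_fold NI39b_def, simplified shape_simps asc.simps eqrs pl39 ng39 pa39 fst_conv snd_conv]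
lemmas gtI39b_0 = gen_table[where G = GI39b and K = EI39b and ns = "n39", OF I39b.G KI39b(1-3) asc_list[OF mcI39b], THEN bal2[where n = "Suc (Suc (Suc (Suc (Suc 0))))"],
  unfolded map_fold MI39b_def, simplified bal_simps asc.simps mkl.simps if_True if_False eqrs pl39 fst_conv snd_conv]
lemmas gsI39b = gen_table_S[where G = GI39b and K = EI39b and ns = "n39", OF I39b.G KI39b(1,2,5), unfolded map_fold, simplified list_simps]
lemmas wsI39b = walk_table_S[where W = WI39b and ns = "n39", OF I39b.W, unfolded map_fold, simplified list_simps]
lemmas rtI39b = node_table[where G = GI39b and W = WI39b and K = EI39b, OF I39b.G I39b.W KI39b(1,2,4) I39b.N_less z39 le39 upt39, unfolded tree_unf, unfolded r_fold, simplified if_True if_False fold_simps tree_simps pa39]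
lemmas dtI39b = walk_dead[where W = WI39b, OF I39b.W z39 le39 upt39, unfolded tree_unf, unfolded r_fold, simplified fold_simps tree_simps pa39]
lemmas ftI39b = lv_dead[OF le39 upt39, unfolded tree_unf, unfolded r_fold, simplified fold_simps tree_simps pa39]
lemma cwI39b: "WI39b us T = WI39b us T" ..
lemmas runI39b = gsI39b wsI39b bs39 bleaf_simps rtI39b dtI39b ftI39b walk_end[where W = WI39b, OF I39b.W] leaf_simps
lemmas conI39b = cwI39b bsel_cong bleaf_cong fin_cong
abbreviation partI39b where
  "partI39b ds \<equiv> chain 39 (stage GI39b WI39b 39 [R 14, S (R 1) (R 1), R 27]) (R 10) (treeD 39 (map R n39))
    (fold (\<lambda>s. kill (pa 39 s)) ds (tree0 39 (map R n39)))"
lemma partI39b_0: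
  "partI39b [] [[R 0], [R 38], [R 37]]"
proof -
  note wt = conj64[OF wtI39b_0] and gt = conj64[OF gtI39b_0] and mt = conj64[OF mt39_0] and pl = conj64[OF pl39_0]
  show ?thesis
    unfolding list.map r_fold treeD_def tree0_def
    apply (simp only: chain.simps fold_simps tree_simps pa39 list.sel pl simp_thms)
    apply ((intro conjI)?; rule stage_abs[unfolded r_fold])
    apply (simp_all only: wt gt mt pl runI39b cong: conI39b)
    done
qed
lemma partI39b_1:
  "partI39b [R 0, R 38, R 37] [[R 36], [R 35], [R 34]]"
proof -
  note wt = conj64[OF wtI39b_0] and gt = conj64[OF gtI39b_0] and mt = conj64[OF mt39_0] and pl = conj64[OF pl39_0]
  show ?thesis
    unfolding list.map r_fold treeD_def tree0_def
    apply (simp only: chain.simps fold_simps tree_simps pa39 list.sel pl simp_thms)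
    apply ((intro conjI)?; rule stage_abs[unfolded r_fold])
    apply (simp_all only: wt gt mt pl runI39b cong: conI39b)
    done
qed
lemma partI39b_2:
  "partI39b [R 0, R 38, R 37, R 36, R 35, R 34] [[R 33], [R 32], [R 31]]"
proof -
  note wt = conj64[OF wtI39b_0] and gt = conj64[OF gtI39b_0] and mt = conj64[OF mt39_0] and pl = conj64[OF pl39_0]
  show ?thesis
    unfolding list.map r_fold treeD_def tree0_def
    apply (simp only: chain.simps fold_simps tree_simps pa39 list.sel pl simp_thms)
    apply ((intro conjI)?; rule stage_abs[unfolded r_fold])
    apply (simp_all only: wt gt mt pl runI39b cong: conI39b)
    done
qed
lemma partI39b_3:
  "partI39b [R 0, R 38, R 37, R 36, R 35, R 34, R 33, R 32, R 31] [[R 30], [R 29], [R 28]]"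
proof -
  note wt = conj64[OF wtI39b_0] and gt = conj64[OF gtI39b_0] and mt = conj64[OF mt39_0] and pl = conj64[OF pl39_0]
  show ?thesis
    unfolding list.map r_fold treeD_def tree0_def
    apply (simp only: chain.simps fold_simps tree_simps pa39 list.sel pl simp_thms)
    apply ((intro conjI)?; rule stage_abs[unfolded r_fold])
    apply (simp_all only: wt gt mt pl runI39b cong: conI39b)
    done
qed
lemma partI39b_4:
  "partI39b [R 0, R 38, R 37, R 36, R 35, R 34, R 33, R 32, R 31, R 30, R 29, R 28] [[R 27], [R 26], [R 25]]"
proof -
  note wt = conj64[OF wtI39b_0] and gt = conj64[OF gtI39b_0] and mt = conj64[OF mt39_0] and pl = conj64[OF pl39_0]
  show ?thesis
    unfolding list.map r_fold treeD_def tree0_def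
    apply (simp only: chain.simps fold_simps tree_simps pa39 list.sel pl simp_thms)
    apply ((intro conjI)?; rule stage_abs[unfolded r_fold])
    apply (simp_all only: wt gt mt pl runI39b cong: conI39b)
    done
qed
lemma partI39b_5:
  "partI39b [R 0, R 38, R 37, R 36, R 35, R 34, R 33, R 32, R 31, R 30, R 29, R 28, R 27, R 26, R 25] [[R 24], [R 23], [R 22]]"
proof -
  note wt = conj64[OF wtI39b_0] and gt = conj64[OF gtI39b_0] and mt = conj64[OF mt39_0] and pl = conj64[OF pl39_0]
  show ?thesis
    unfolding list.map r_fold treeD_def tree0_def
    apply (simp only: chain.simps fold_simps tree_simps pa39 list.sel pl simp_thms)
    apply ((intro conjI)?; rule stage_abs[unfolded r_fold])
    apply (simp_all only: wt gt mt pl runI39b cong: conI39b)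
    done
qed
lemma partI39b_6:
  "partI39b [R 0, R 38, R 37, R 36, R 35, R 34, R 33, R 32, R 31, R 30, R 29, R 28, R 27, R 26, R 25, R 24, R 23, R 22] [[R 21], [R 20], [R 19]]"
proof -
  note wt = conj64[OF wtI39b_0] and gt = conj64[OF gtI39b_0] and mt = conj64[OF mt39_0] and pl = conj64[OF pl39_0]
  show ?thesis
    unfolding list.map r_fold treeD_def tree0_def
    apply (simp only: chain.simps fold_simps tree_simps pa39 list.sel pl simp_thms)
    apply ((intro conjI)?; rule stage_abs[unfolded r_fold])
    apply (simp_all only: wt gt mt pl runI39b cong: conI39b)
    done
qed
lemma partI39b_7:
  "partI39b [R 0, R 38, R 37, R 36, R 35, R 34, R 33, R 32, R 31, R 30, R 29, R 28, R 27, R 26, R 25, R 24, R 23, R 22, R 21, R 20, R 19] [[R 18], [R 17], [R 16]]"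
proof -
  note wt = conj64[OF wtI39b_0] and gt = conj64[OF gtI39b_0] and mt = conj64[OF mt39_0] and pl = conj64[OF pl39_0]
  show ?thesis
    unfolding list.map r_fold treeD_def tree0_def
    apply (simp only: chain.simps fold_simps tree_simps pa39 list.sel pl simp_thms)
    apply ((intro conjI)?; rule stage_abs[unfolded r_fold])
    apply (simp_all only: wt gt mt pl runI39b cong: conI39b)
    done
qed
lemma partI39b_8:
  "partI39b [R 0, R 38, R 37, R 36, R 35, R 34, R 33, R 32, R 31, R 30, R 29, R 28, R 27, R 26, R 25, R 24, R 23, R 22, R 21, R 20, R 19, R 18, R 17, R 16] [[R 15], [R 14], [R 13]]"
proof -
  note wt = conj64[OF wtI39b_0] and gt = conj64[OF gtI39b_0] and mt = conj64[OF mt39_0] and pl = conj64[OF pl39_0]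
  show ?thesis
    unfolding list.map r_fold treeD_def tree0_def
    apply (simp only: chain.simps fold_simps tree_simps pa39 list.sel pl simp_thms)
    apply ((intro conjI)?; rule stage_abs[unfolded r_fold])
    apply (simp_all only: wt gt mt pl runI39b cong: conI39b)
    done
qed
lemma partI39b_9:
  "partI39b [R 0, R 38, R 37, R 36, R 35, R 34, R 33, R 32, R 31, R 30, R 29, R 28, R 27, R 26, R 25, R 24, R 23, R 22, R 21, R 20, R 19, R 18, R 17, R 16, R 15, R 14, R 13] [[R 12], [R 11], [R 10]]"
proof -
  note wt = conj64[OF wtI39b_0] and gt = conj64[OF gtI39b_0] and mt = conj64[OF mt39_0] and pl = conj64[OF pl39_0]
  show ?thesis
    unfolding list.map r_fold treeD_def tree0_def
    apply (simp only: chain.simps fold_simps tree_simps pa39 list.sel pl simp_thms)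
    apply ((intro conjI)?; rule stage_abs[unfolded r_fold])
    apply (simp_all only: wt gt mt pl runI39b cong: conI39b)
    done
qed
lemma partI39b_10:
  "partI39b [R 0, R 38, R 37, R 36, R 35, R 34, R 33, R 32, R 31, R 30, R 29, R 28, R 27, R 26, R 25, R 24, R 23, R 22, R 21, R 20, R 19, R 18, R 17, R 16, R 15, R 14, R 13, R 12, R 11, R 10] [[R 9], [R 8], [R 7]]"
proof -
  note wt = conj64[OF wtI39b_0] and gt = conj64[OF gtI39b_0] and mt = conj64[OF mt39_0] and pl = conj64[OF pl39_0]
  show ?thesis
    unfolding list.map r_fold treeD_def tree0_def
    apply (simp only: chain.simps fold_simps tree_simps pa39 list.sel pl simp_thms)
    apply ((intro conjI)?; rule stage_abs[unfolded r_fold])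
    apply (simp_all only: wt gt mt pl runI39b cong: conI39b)
    done
qed
lemma partI39b_11:
  "partI39b [R 0, R 38, R 37, R 36, R 35, R 34, R 33, R 32, R 31, R 30, R 29, R 28, R 27, R 26, R 25, R 24, R 23, R 22, R 21, R 20, R 19, R 18, R 17, R 16, R 15, R 14, R 13, R 12, R 11, R 10, R 9, R 8, R 7] [[R 6], [R 5], [R 4]]"
proof -
  note wt = conj64[OF wtI39b_0] and gt = conj64[OF gtI39b_0] and mt = conj64[OF mt39_0] and pl = conj64[OF pl39_0]
  show ?thesis
    unfolding list.map r_fold treeD_def tree0_def
    apply (simp only: chain.simps fold_simps tree_simps pa39 list.sel pl simp_thms)
    apply ((intro conjI)?; rule stage_abs[unfolded r_fold])
    apply (simp_all only: wt gt mt pl runI39b cong: conI39b)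
    done
qed
lemma partI39b_12:
  "partI39b [R 0, R 38, R 37, R 36, R 35, R 34, R 33, R 32, R 31, R 30, R 29, R 28, R 27, R 26, R 25, R 24, R 23, R 22, R 21, R 20, R 19, R 18, R 17, R 16, R 15, R 14, R 13, R 12, R 11, R 10, R 9, R 8, R 7, R 6, R 5, R 4] [[R 3], [R 2], [R 1]]"
proof -
  note wt = conj64[OF wtI39b_0] and gt = conj64[OF gtI39b_0] and mt = conj64[OF mt39_0] and pl = conj64[OF pl39_0]
  show ?thesis
    unfolding list.map r_fold treeD_def tree0_def
    apply (simp only: chain.simps fold_simps tree_simps pa39 list.sel pl simp_thms)
    apply ((intro conjI)?; rule stage_abs[unfolded r_fold])
    apply (simp_all only: wt gt mt pl runI39b cong: conI39b)
    done
qed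
lemma tban_39_1:
  assumes "base 39 False A Q C"
  shows "tban 39 False A Q C 13 1"
proof (rule I39b.chains_tban[where x = 14 and z = 27 and k = 10 and ns = "n39" and cs = "[[[R 0], [R 38], [R 37]], [[R 36], [R 35], [R 34]], [[R 33], [R 32], [R 31]], [[R 30], [R 29], [R 28]], [[R 27], [R 26], [R 25]], [[R 24], [R 23], [R 22]], [[R 21], [R 20], [R 19]], [[R 18], [R 17], [R 16]], [[R 15], [R 14], [R 13]], [[R 12], [R 11], [R 10]], [[R 9], [R 8], [R 7]], [[R 6], [R 5], [R 4]], [[R 3], [R 2], [R 1]]]"])
  show "\<forall>x\<in>set [(13, 3)]. tban 39 False A Q C (fst x) (snd x)" using tban_39_3[OF assms] by simp
  show "base 39 False A Q C" by (rule assms)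
  show "chk 39 U39 [(13, 1)] MI39b" by (simp add: chk_def MI39b_def U39_def r_defs)
  show "links 39 (stage GI39b WI39b 39 [R 14, S (R 1) (R 1), R 27]) (R 10) (treeD 39 (map R n39)) (tree0 39 (map R n39)) [] [[[R 0], [R 38], [R 37]], [[R 36], [R 35], [R 34]], [[R 33], [R 32], [R 31]], [[R 30], [R 29], [R 28]], [[R 27], [R 26], [R 25]], [[R 24], [R 23], [R 22]], [[R 21], [R 20], [R 19]], [[R 18], [R 17], [R 16]], [[R 15], [R 14], [R 13]], [[R 12], [R 11], [R 10]], [[R 9], [R 8], [R 7]], [[R 6], [R 5], [R 4]], [[R 3], [R 2], [R 1]]]"
    by (simp only: links.simps append.simps concat.simps partI39b_0 partI39b_1 partI39b_2 partI39b_3 partI39b_4 partI39b_5 partI39b_6 partI39b_7 partI39b_8 partI39b_9 partI39b_10 partI39b_11 partI39b_12 simp_thms)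
qed (unfold I39b.eqs_def, simp_all add: U39_def upt39[symmetric])

lemma reach_39: "reach 39"
proof (rule reach_step[where c = 13 and ?a0.0 = 13 and U = U39 and TS = "[3, 1]" and V = "[(1, 1, 1), (2, 37, 1), (3, 1, 3), (4, 4, 1), (5, 34, 1), (6, 28, 3), (7, 7, 1), (8, 31, 1), (9, 10, 3), (10, 10, 1), (11, 28, 1), (12, 4, 3), (14, 25, 1), (15, 31, 3), (16, 16, 1), (17, 22, 1), (18, 7, 3), (19, 19, 1), (20, 19, 1), (21, 7, 3), (22, 22, 1), (23, 16, 1), (24, 31, 3), (25, 25, 1), (27, 4, 3), (28, 28, 1), (29, 10, 1), (30, 10, 3), (31, 31, 1), (32, 7, 1), (33, 28, 3), (34, 34, 1), (35, 4, 1), (36, 1, 3), (37, 37, 1), (38, 1, 1)]"])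
  show "reach 13" by (rule reach_13)
  show "\<forall>t\<in>set [3, 1]. tban 39 False A Q C 13 t" if "base 39 False A Q C" for A Q C using tban_39_3[OF that] tban_39_1[OF that] by simp
qed (rule cop39 | simp add: U39_def upt39[symmetric])+

section \<open>Modulus 41\<close>

abbreviation n41 :: "nat list" where "n41 \<equiv> [0, 1, 2, 3, 4, 5, 6, 7, 8, 9, 10, 11, 12, 13, 14, 15, 16, 17, 18, 19, 20, 21, 22, 23, 24, 25, 26, 27, 28, 29, 30, 31, 32, 33, 34, 35, 36, 37, 38, 39, 40]"
lemma upt41: "n41 = [0..<41]" by (simp add: upt_rec)
lemma le41: "41 \<le> (64::nat)" and z41: "0 < (41::nat)" by simp_all
definition U41 :: "nat list" where "U41 = [1, 2, 3, 4, 5, 6, 7, 8, 9, 10, 11, 12, 13, 14, 15, 16, 17, 18, 19, 20, 21, 22, 23, 24, 25, 26, 27, 28, 29, 30, 31, 32, 33, 34, 35, 36, 37, 38, 39, 40]"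
lemma cop41: "list_all (\<lambda>u. coprime u 41) U41" by (rule units_coprime) (simp add: U41_def)
lemmas pa41 = path_table[of 41 "n41", unfolded code_def bits_numeral, simplified, unfolded One_nat_def[symmetric], unfolded r_fold]
lemmas pl41_0 = pl_table[of 41 "n41", THEN bal2[where n = "Suc (Suc (Suc (Suc (Suc 0))))"], simplified bal_simps arith, unfolded r_fold]
lemmas pl41_1 = pl41_0[THEN q1] pl41_0[THEN q2] pl41_0[THEN q3] pl41_0[THEN q4]
lemmas pl41_2 = pl41_1[THEN q1] pl41_1[THEN q2] pl41_1[THEN q3] pl41_1[THEN q4]
lemmas pl41_3 = pl41_2[THEN q1] pl41_2[THEN q2] pl41_2[THEN q3] pl41_2[THEN q4]
lemmas pl41_4 = pl41_3[THEN q1] pl41_3[THEN q2] pl41_3[THEN q3] pl41_3[THEN q4]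
lemmas pl41 = pl41_4[THEN q1] pl41_4[THEN q2] pl41_4[THEN q3] pl41_4[THEN q4]
lemmas ng41 = ng_table[of 41 "n41", simplified, unfolded One_nat_def[symmetric], unfolded r_fold]
lemmas mt41_0 = mt_table'[OF upt41, THEN gsl_bal[where n = "Suc (Suc (Suc (Suc (Suc 0))))" and m = "Suc (Suc (Suc (Suc (Suc 0))))"], unfolded map_fold, simplified bal_simps gsl.simps fst_conv snd_conv pl41]
lemmas bs41 = bsel_table[where h = 41 and xs = "map R n41" and n = "(Suc (Suc (Suc (Suc (Suc (Suc (Suc 0)))))))" and vs = "[v0,v1,v2,v3,v4,v5,v6]" for v0 v1 v2 v3 v4 v5 v6,
  unfolded map_fold, simplified list.pred_inject simp_thms pt_simps lefts_simps join.simps keep.simps drp.simps fb.simps get_simps pa41]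

definition MI41a :: marks where "MI41a = [(r1, [(r2, r1), (r39, r1)]), (r2, [(r4, r21), (r37, r21)]), (r3, [(r6, r14), (r35, r14)]), (r4, [(r8, r31), (r33, r31)]), (r5, [(r10, r33), (r31, r33)]), (r6, [(r12, r7), (r29, r7)]), (r7, [(r14, r6), (r27, r6)]), (r8, [(r16, r36), (r25, r36)]), (r9, [(r18, r32), (r23, r32)]), (r10, [(r20, r37), (r21, r37)]), (r11, [(r19, r15), (r22, r15)]), (r12, [(r17, r24), (r24, r24)]), (r13, [(r15, r19), (r26, r19)]), (r14, [(r13, r3), (r28, r3)]), (r15, [(r11, r11), (r30, r11)]), (r16, [(r9, r18), (r32, r18)]), (r17, [(r7, r29), (r34, r29)]), (r18, [(r5, r16), (r36, r16)]), (r19, [(r3, r13), (r38, r13)]), (r20, [(r1, r39), (r40, r39)]), (r21, [(r1, r2), (r40, r2)]), (r22, [(r3, r28), (r38, r28)]), (r23, [(r5, r25), (r36, r25)]), (r24, [(r7, r12), (r34, r12)]), (r25, [(r9, r23), (r32, r23)]), (r26, [(r11, r30), (r30, r30)]), (r27, [(r13, r38), (r28, r38)]), (r28, [(r15, r22), (r26, r22)]), (r29, [(r17, r17), (r24, r17)]), (r30, [(r19, r26), (r22, r26)]), (r31, [(r20, r4), (r21, r4)]), (r32, [(r18, r9), (r23, r9)]), (r33, [(r16, r5), (r25, r5)]), (r34, [(r14, r35), (r27, r35)]), (r35, [(r12, r34), (r29, r34)]), (r36, [(r10, r8), (r31, r8)]), (r37, [(r8, r10), (r33, r10)]), (r38,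 [(r6, r27), (r35, r27)]), (r39, [(r4, r20), (r37, r20)]), (r40, [(r2, r40), (r39, r40)])]"
definition NI41a :: marks where "NI41a = []"
abbreviation "EI41a \<equiv> mkenv 41 False MI41a NI41a"
definition "GI41a B = gen (EI41a B)"
definition "WI41a us = wk 41 False (\<lambda>a. map fst (asc NI41a a)) (hd us) (tl us)"
interpretation I41a: inst 41 False MI41a NI41a GI41a WI41a U41 "[]"
proof unfold_locales
  have "less_marks 41 NI41a" by (simp add: NI41a_def r_defs)
  from asc_set[OF this] show "\<forall>c\<in>set (map fst (asc NI41a a)). val c < 41" for a by auto
  show "chk 41 U41 [] NI41a" by (simp add: chk_def NI41a_def U41_def r_defs)
qed (rule cop41 | simp add: GI41a_def WI41a_def)+
lemma mcI41a: "plain_marks MI41a" by (simp add: MI41a_def r_defs)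
lemmas KI41a = env.sel[where ?x1.0 = 41 and ?x2.0 = False and ?x3.0 = "mlf (asc MI41a)" and ?x4.0 = "blf (\<lambda>a. map fst (asc NI41a a))"]
lemmas wtI41a_0 = walk_table_vs[where W = WI41a and ns = "n41", OF I41a.W z41 le41, THEN bal2[where n = "Suc (Suc (Suc (Suc (Suc 0))))"],
  unfolded map_fold NI41a_def, simplified shape_simps asc.simps eqrs pl41 ng41 pa41 fst_conv snd_conv]
lemmas gtI41a_0 = gen_table[where G = GI41a and K = EI41a and ns = "n41", OF I41a.G KI41a(1-3) asc_list[OF mcI41a], THEN bal2[where n = "Suc (Suc (Suc (Suc (Suc 0))))"],
  unfolded map_fold MI41a_def, simplified bal_simps asc.simps mkl.simps if_True if_False eqrs pl41 fst_conv snd_conv]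
lemmas gsI41a = gen_table_S[where G = GI41a and K = EI41a and ns = "n41", OF I41a.G KI41a(1,2,5), unfolded map_fold, simplified list_simps]
lemmas wsI41a = walk_table_S[where W = WI41a and ns = "n41", OF I41a.W, unfolded map_fold, simplified list_simps]
lemmas rtI41a = node_table[where G = GI41a and W = WI41a and K = EI41a, OF I41a.G I41a.W KI41a(1,2,4) I41a.N_less z41 le41 upt41, unfolded tree_unf, unfolded r_fold, simplified if_True if_False fold_simps tree_simps pa41]
lemmas dtI41a = walk_dead[where W = WI41a, OF I41a.W z41 le41 upt41, unfolded tree_unf, unfolded r_fold, simplified fold_simps tree_simps pa41]
lemmas ftI41a = lv_dead[OF le41 upt41, unfolded tree_unf, unfolded r_fold, simplified fold_simps tree_simps pa41]
lemma cwI41a: "WI41a us T = WI41a us T" ..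
lemmas runI41a = gsI41a wsI41a bs41 bleaf_simps rtI41a dtI41a ftI41a walk_end[where W = WI41a, OF I41a.W] leaf_simps
lemmas conI41a = cwI41a bsel_cong bleaf_cong fin_cong
abbreviation partI41a where
  "partI41a ds \<equiv> chain 41 (stage GI41a WI41a 41 [R 3, S (R 2) (R 1), R 1]) (R 33) (treeD 41 (map R n41))
    (fold (\<lambda>s. kill (pa 41 s)) ds (tree0 41 (map R n41)))"
lemma partI41a_0:
  "partI41a [] [[R 0], [R 40], [R 39], [R 38]]"
proof -
  note wt = conj64[OF wtI41a_0] and gt = conj64[OF gtI41a_0] and mt = conj64[OF mt41_0] and pl = conj64[OF pl41_0]
  show ?thesis
    unfolding list.map r_fold treeD_def tree0_def
    apply (simp only: chain.simps fold_simps tree_simps pa41 list.sel pl simp_thms)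
    apply ((intro conjI)?; rule stage_abs[unfolded r_fold])
    apply (simp_all only: wt gt mt pl runI41a cong: conI41a)
    done
qed
lemma partI41a_1:
  "partI41a [R 0, R 40, R 39, R 38] [[R 37], [R 36], [R 35], [R 34]]"
proof -
  note wt = conj64[OF wtI41a_0] and gt = conj64[OF gtI41a_0] and mt = conj64[OF mt41_0] and pl = conj64[OF pl41_0]
  show ?thesis
    unfolding list.map r_fold treeD_def tree0_def
    apply (simp only: chain.simps fold_simps tree_simps pa41 list.sel pl simp_thms)
    apply ((intro conjI)?; rule stage_abs[unfolded r_fold])
    apply (simp_all only: wt gt mt pl runI41a cong: conI41a)
    done
qed
lemma partI41a_2:
  "partI41a [R 0, R 40, R 39, R 38, R 37, R 36, R 35, R 34] [[R 33], [R 32], [R 31], [R 30]]"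
proof -
  note wt = conj64[OF wtI41a_0] and gt = conj64[OF gtI41a_0] and mt = conj64[OF mt41_0] and pl = conj64[OF pl41_0]
  show ?thesis
    unfolding list.map r_fold treeD_def tree0_def
    apply (simp only: chain.simps fold_simps tree_simps pa41 list.sel pl simp_thms)
    apply ((intro conjI)?; rule stage_abs[unfolded r_fold])
    apply (simp_all only: wt gt mt pl runI41a cong: conI41a)
    done
qed
lemma partI41a_3:
  "partI41a [R 0, R 40, R 39, R 38, R 37, R 36, R 35, R 34, R 33, R 32, R 31, R 30] [[R 29], [R 28], [R 27], [R 26]]"
proof -
  note wt = conj64[OF wtI41a_0] and gt = conj64[OF gtI41a_0] and mt = conj64[OF mt41_0] and pl = conj64[OF pl41_0]
  show ?thesis
    unfolding list.map r_fold treeD_def tree0_def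
    apply (simp only: chain.simps fold_simps tree_simps pa41 list.sel pl simp_thms)
    apply ((intro conjI)?; rule stage_abs[unfolded r_fold])
    apply (simp_all only: wt gt mt pl runI41a cong: conI41a)
    done
qed
lemma partI41a_4:
  "partI41a [R 0, R 40, R 39, R 38, R 37, R 36, R 35, R 34, R 33, R 32, R 31, R 30, R 29, R 28, R 27, R 26] [[R 25], [R 24], [R 23], [R 22]]"
proof -
  note wt = conj64[OF wtI41a_0] and gt = conj64[OF gtI41a_0] and mt = conj64[OF mt41_0] and pl = conj64[OF pl41_0]
  show ?thesis
    unfolding list.map r_fold treeD_def tree0_def
    apply (simp only: chain.simps fold_simps tree_simps pa41 list.sel pl simp_thms)
    apply ((intro conjI)?; rule stage_abs[unfolded r_fold])
    apply (simp_all only: wt gt mt pl runI41a cong: conI41a)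
    done
qed
lemma partI41a_5:
  "partI41a [R 0, R 40, R 39, R 38, R 37, R 36, R 35, R 34, R 33, R 32, R 31, R 30, R 29, R 28, R 27, R 26, R 25, R 24, R 23, R 22] [[R 21], [R 20], [R 19], [R 18]]"
proof -
  note wt = conj64[OF wtI41a_0] and gt = conj64[OF gtI41a_0] and mt = conj64[OF mt41_0] and pl = conj64[OF pl41_0]
  show ?thesis
    unfolding list.map r_fold treeD_def tree0_def
    apply (simp only: chain.simps fold_simps tree_simps pa41 list.sel pl simp_thms)
    apply ((intro conjI)?; rule stage_abs[unfolded r_fold])
    apply (simp_all only: wt gt mt pl runI41a cong: conI41a)
    done
qed
lemma partI41a_6:
  "partI41a [R 0, R 40, R 39, R 38, R 37, R 36, R 35, R 34, R 33, R 32, R 31, R 30, R 29, R 28, R 27, R 26, R 25, R 24, R 23, R 22, R 21, R 20, R 19, R 18] [[R 17], [R 16], [R 15], [R 14]]"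
proof -
  note wt = conj64[OF wtI41a_0] and gt = conj64[OF gtI41a_0] and mt = conj64[OF mt41_0] and pl = conj64[OF pl41_0]
  show ?thesis
    unfolding list.map r_fold treeD_def tree0_def
    apply (simp only: chain.simps fold_simps tree_simps pa41 list.sel pl simp_thms)
    apply ((intro conjI)?; rule stage_abs[unfolded r_fold])
    apply (simp_all only: wt gt mt pl runI41a cong: conI41a)
    done
qed
lemma partI41a_7:
  "partI41a [R 0, R 40, R 39, R 38, R 37, R 36, R 35, R 34, R 33, R 32, R 31, R 30, R 29, R 28, R 27, R 26, R 25, R 24, R 23, R 22, R 21, R 20, R 19, R 18, R 17, R 16, R 15, R 14] [[R 13], [R 12], [R 11], [R 10]]"
proof -
  note wt = conj64[OF wtI41a_0] and gt = conj64[OF gtI41a_0] and mt = conj64[OF mt41_0] and pl = conj64[OF pl41_0]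
  show ?thesis
    unfolding list.map r_fold treeD_def tree0_def
    apply (simp only: chain.simps fold_simps tree_simps pa41 list.sel pl simp_thms)
    apply ((intro conjI)?; rule stage_abs[unfolded r_fold])
    apply (simp_all only: wt gt mt pl runI41a cong: conI41a)
    done
qed
lemma partI41a_8:
  "partI41a [R 0, R 40, R 39, R 38, R 37, R 36, R 35, R 34, R 33, R 32, R 31, R 30, R 29, R 28, R 27, R 26, R 25, R 24, R 23, R 22, R 21, R 20, R 19, R 18, R 17, R 16, R 15, R 14, R 13, R 12, R 11, R 10] [[R 9], [R 8], [R 7], [R 6]]"
proof -
  note wt = conj64[OF wtI41a_0] and gt = conj64[OF gtI41a_0] and mt = conj64[OF mt41_0] and pl = conj64[OF pl41_0]
  show ?thesis
    unfolding list.map r_fold treeD_def tree0_def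
    apply (simp only: chain.simps fold_simps tree_simps pa41 list.sel pl simp_thms)
    apply ((intro conjI)?; rule stage_abs[unfolded r_fold])
    apply (simp_all only: wt gt mt pl runI41a cong: conI41a)
    done
qed
lemma partI41a_9:
  "partI41a [R 0, R 40, R 39, R 38, R 37, R 36, R 35, R 34, R 33, R 32, R 31, R 30, R 29, R 28, R 27, R 26, R 25, R 24, R 23, R 22, R 21, R 20, R 19, R 18, R 17, R 16, R 15, R 14, R 13, R 12, R 11, R 10, R 9, R 8, R 7, R 6] [[R 5], [R 4], [R 3], [R 2]]"
proof -
  note wt = conj64[OF wtI41a_0] and gt = conj64[OF gtI41a_0] and mt = conj64[OF mt41_0] and pl = conj64[OF pl41_0]
  show ?thesis
    unfolding list.map r_fold treeD_def tree0_def
    apply (simp only: chain.simps fold_simps tree_simps pa41 list.sel pl simp_thms)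
    apply ((intro conjI)?; rule stage_abs[unfolded r_fold])
    apply (simp_all only: wt gt mt pl runI41a cong: conI41a)
    done
qed
lemma partI41a_10:
  "partI41a [R 0, R 40, R 39, R 38, R 37, R 36, R 35, R 34, R 33, R 32, R 31, R 30, R 29, R 28, R 27, R 26, R 25, R 24, R 23, R 22, R 21, R 20, R 19, R 18, R 17, R 16, R 15, R 14, R 13, R 12, R 11, R 10, R 9, R 8, R 7, R 6, R 5, R 4, R 3, R 2] [[R 1]]"
proof -
  note wt = conj64[OF wtI41a_0] and gt = conj64[OF gtI41a_0] and mt = conj64[OF mt41_0] and pl = conj64[OF pl41_0]
  show ?thesis
    unfolding list.map r_fold treeD_def tree0_def
    apply (simp only: chain.simps fold_simps tree_simps pa41 list.sel pl simp_thms)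
    apply ((intro conjI)?; rule stage_abs[unfolded r_fold])
    apply (simp_all only: wt gt mt pl runI41a cong: conI41a)
    done
qed
lemma tban_41_2:
  assumes "base 41 False A Q C"
  shows "tban 41 False A Q C 1 2"
proof (rule I41a.chains_tban[where x = 3 and z = 1 and k = 33 and ns = "n41" and cs = "[[[R 0], [R 40], [R 39], [R 38]], [[R 37], [R 36], [R 35], [R 34]], [[R 33], [R 32], [R 31], [R 30]], [[R 29], [R 28], [R 27], [R 26]], [[R 25], [R 24], [R 23], [R 22]], [[R 21], [R 20], [R 19], [R 18]], [[R 17], [R 16], [R 15], [R 14]], [[R 13], [R 12], [R 11], [R 10]], [[R 9], [R 8], [R 7], [R 6]], [[R 5], [R 4], [R 3], [R 2]], [[R 1]]]"])
  show "\<forall>x\<in>set []. tban 41 False A Q C (fst x) (snd x)" by simp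
  show "base 41 False A Q C" by (rule assms)
  show "chk 41 U41 [(1, 2)] MI41a" by (simp add: chk_def MI41a_def U41_def r_defs)
  show "links 41 (stage GI41a WI41a 41 [R 3, S (R 2) (R 1), R 1]) (R 33) (treeD 41 (map R n41)) (tree0 41 (map R n41)) [] [[[R 0], [R 40], [R 39], [R 38]], [[R 37], [R 36], [R 35], [R 34]], [[R 33], [R 32], [R 31], [R 30]], [[R 29], [R 28], [R 27], [R 26]], [[R 25], [R 24], [R 23], [R 22]], [[R 21], [R 20], [R 19], [R 18]], [[R 17], [R 16], [R 15], [R 14]], [[R 13], [R 12], [R 11], [R 10]], [[R 9], [R 8], [R 7], [R 6]], [[R 5], [R 4], [R 3], [R 2]], [[R 1]]]"
    by (simp only: links.simps append.simps concat.simps partI41a_0 partI41a_1 partI41a_2 partI41a_3 partI41a_4 partI41a_5 partI41a_6 partI41a_7 partI41a_8 partI41a_9 partI41a_10 simp_thms)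
qed (unfold I41a.eqs_def, simp_all add: U41_def upt41[symmetric])

definition MI41b :: marks where "MI41b = []"
definition NI41b :: marks where "NI41b = [(r1, [(r2, r1), (r39, r1)]), (r2, [(r4, r21), (r37, r21)]), (r3, [(r6, r14), (r35, r14)]), (r4, [(r8, r31), (r33, r31)]), (r5, [(r10, r33), (r31, r33)]), (r6, [(r12, r7), (r29, r7)]), (r7, [(r14, r6), (r27, r6)]), (r8, [(r16, r36), (r25, r36)]), (r9, [(r18, r32), (r23, r32)]), (r10, [(r20, r37), (r21, r37)]), (r11, [(r19, r15), (r22, r15)]), (r12, [(r17, r24), (r24, r24)]), (r13, [(r15, r19), (r26, r19)]), (r14, [(r13, r3), (r28, r3)]), (r15, [(r11, r11), (r30, r11)]), (r16, [(r9, r18), (r32, r18)]), (r17, [(r7, r29), (r34, r29)]), (r18, [(r5, r16), (r36, r16)]), (r19, [(r3, r13), (r38, r13)]), (r20, [(r1, r39), (r40, r39)]), (r21, [(r1, r2), (r40, r2)]), (r22, [(r3, r28), (r38, r28)]), (r23, [(r5, r25), (r36, r25)]), (r24, [(r7, r12), (r34, r12)]), (r25, [(r9, r23), (r32, r23)]), (r26, [(r11, r30), (r30, r30)]), (r27, [(r13, r38), (r28, r38)]), (r28, [(r15, r22), (r26, r22)]), (r29, [(r17, r17), (r24, r17)]), (r30, [(r19, r26), (r22, r26)]), (r31, [(r20, r4), (r21, r4)]), (r32, [(r18, r9), (r23, r9)]), (r33, [(r16, r5), (r25, r5)]), (r34, [(r14, r35), (r27, r35)]), (r35, [(r12, r34),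 (r29, r34)]), (r36, [(r10, r8), (r31, r8)]), (r37, [(r8, r10), (r33, r10)]), (r38, [(r6, r27), (r35, r27)]), (r39, [(r4, r20), (r37, r20)]), (r40, [(r2, r40), (r39, r40)])]"
abbreviation "EI41b \<equiv> mkenv 41 False MI41b NI41b"
definition "GI41b B = gen (EI41b B)"
definition "WI41b us = wk 41 False (\<lambda>a. map fst (asc NI41b a)) (hd us) (tl us)"
interpretation I41b: inst 41 False MI41b NI41b GI41b WI41b U41 "[(1, 2)]"
proof unfold_locales
  have "less_marks 41 NI41b" by (simp add: NI41b_def r_defs)
  from asc_set[OF this] show "\<forall>c\<in>set (map fst (asc NI41b a)). val c < 41" for a by auto
  show "chk 41 U41 [(1, 2)] NI41b" by (simp add: chk_def NI41b_def U41_def r_defs)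
qed (rule cop41 | simp add: GI41b_def WI41b_def)+
lemma mcI41b: "plain_marks MI41b" by (simp add: MI41b_def r_defs)
lemmas KI41b = env.sel[where ?x1.0 = 41 and ?x2.0 = False and ?x3.0 = "mlf (asc MI41b)" and ?x4.0 = "blf (\<lambda>a. map fst (asc NI41b a))"]
lemmas wtI41b_0 = walk_table_vs[where W = WI41b and ns = "n41", OF I41b.W z41 le41, THEN bal2[where n = "Suc (Suc (Suc (Suc (Suc 0))))"],
  unfolded map_fold NI41b_def, simplified shape_simps asc.simps eqrs pl41 ng41 pa41 fst_conv snd_conv]
lemmas gtI41b_0 = gen_table[where G = GI41b and K = EI41b and ns = "n41", OF I41b.G KI41b(1-3) asc_list[OF mcI41b], THEN bal2[where n = "Suc (Suc (Suc (Suc (Suc 0))))"],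
  unfolded map_fold MI41b_def, simplified bal_simps asc.simps mkl.simps if_True if_False eqrs pl41 fst_conv snd_conv]
lemmas rtI41b = node_table[where G = GI41b and W = WI41b and K = EI41b, OF I41b.G I41b.W KI41b(1,2,4) I41b.N_less z41 le41 upt41, unfolded tree_unf, unfolded r_fold, simplified if_True if_False fold_simps tree_simps pa41]
lemmas dtI41b = walk_dead[where W = WI41b, OF I41b.W z41 le41 upt41, unfolded tree_unf, unfolded r_fold, simplified fold_simps tree_simps pa41]
lemmas ftI41b = lv_dead[OF le41 upt41, unfolded tree_unf, unfolded r_fold, simplified fold_simps tree_simps pa41]
lemma cwI41b: "WI41b us T = WI41b us T" ..
lemmas runI41b =  rtI41b dtI41b ftI41b walk_end[where W = WI41b, OF I41b.W] leaf_simps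
lemmas conI41b = cwI41b bsel_cong bleaf_cong fin_cong
lemma partI41b: "GI41b (Lf (R 0)) [R 0] [R 4, R 3, R 2]"
proof -
  note wt = conj64[OF wtI41b_0] and gt = conj64[OF gtI41b_0]
  show ?thesis
    unfolding r_fold
    by (simp only: wt gt runI41b cong: conI41b)
qed
lemma tban_I41b:
  assumes "base 41 False A Q C"
  shows "\<forall>t\<in>set [3]. tban 41 False A Q C 1 t"
proof (rule I41b.plain_all)
  show "\<forall>x\<in>set [(1, 2)]. tban 41 False A Q C (fst x) (snd x)" using tban_41_2[OF assms] by simp
qed (use assms partI41b in \<open>simp_all add: MI41b_def\<close>)

definition MI41c :: marks where "MI41c = []"
definition NI41c :: marks where "NI41c = [(r1, [(r2, r1), (r39, r1), (r3, r1), (r38, r1)]), (r2, [(r4, r21), (r37, r21), (r6, r21), (r35, r21)]), (r3, [(r6, r14), (r35, r14), (r9, r14), (r32, r14)]), (r4, [(r8, r31), (r33, r31), (r12, r31), (r29, r31)]), (r5, [(r10, r33), (r31, r33), (r15, r33), (r26, r33)]), (r6, [(r12, r7), (r29, r7), (r18, r7), (r23, r7)]), (r7, [(r14, r6), (r27, r6), (r20, r6), (r21, r6)]), (r8, [(r16, r36), (r25, r36), (r17, r36), (r24, r36)]), (r9, [(r18, r32), (r23, r32), (r14, r32), (r27, r32)]), (r10, [(r20, r37), (r21, r37), (r11, r37), (r30, r37)]), (r11, [(r19, r15), (r22, r15), (r8, r15), (r33, r15)]), (r12, [(r17, r24), (r24, r24), (r5, r24), (r36, r24)]), (r13, [(r15,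 r19), (r26, r19), (r2, r19), (r39, r19)]), (r14, [(r13, r3), (r28, r3), (r1, r3), (r40, r3)]), (r15, [(r11, r11), (r30, r11), (r4, r11), (r37, r11)]), (r16, [(r9, r18), (r32, r18), (r7, r18), (r34, r18)]), (r17, [(r7, r29), (r34, r29), (r10, r29), (r31, r29)]), (r18, [(r5, r16), (r36, r16), (r13, r16), (r28, r16)]), (r19, [(r3, r13), (r38, r13), (r16, r13), (r25, r13)]), (r20, [(r1, r39), (r40, r39), (r19, r39), (r22, r39)]), (r21, [(r1, r2), (r40, r2), (r19, r2), (r22, r2)]), (r22, [(r3, r28), (r38, r28), (r16, r28), (r25, r28)]), (r23, [(r5, r25), (r36, r25), (r13, r25), (r28, r25)]), (r24, [(r7, r12), (r34, r12), (r10, r12), (r31, r12)]), (r25, [(r9, r23), (r32, r23), (r7, r23), (r34, r23)]), (r26, [(r11, r30), (r30, r30), (r4, r30), (r37, r30)]), (r27, [(r13, r38), (r28, r38), (r1, r38), (r40, r38)]), (r28, [(r15, r22), (r26, r22), (r2, r22), (r39, r22)]), (r29, [(r17, r17), (r24, r17), (r5, r17), (r36, r17)]), (r30, [(r19, r26), (r22, r26), (r8, r26), (r33, r26)]), (r31, [(r20, r4), (r21, r4), (r11, r4), (r30, r4)]), (r32, [(r18, r9), (r23, r9), (r14, r9), (r27, r9)]), (r33, [(r16, r5), (r25, r5), (r17, r5), (r24, r5)]), (r34, [(r14, r35), (r27, r35), (r20, r35), (r21, r35)]), (r35, [(r12, r34), (r29, r34), (r18, r34), (r23, r34)]), (r36,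 [(r10, r8), (r31, r8), (r15, r8), (r26, r8)]), (r37, [(r8, r10), (r33, r10), (r12, r10), (r29, r10)]), (r38, [(r6, r27), (r35, r27), (r9, r27), (r32, r27)]), (r39, [(r4, r20), (r37, r20), (r6, r20), (r35, r20)]), (r40, [(r2, r40), (r39, r40), (r3, r40), (r38, r40)])]"
abbreviation "EI41c \<equiv> mkenv 41 False MI41c NI41c"
definition "GI41c B = gen (EI41c B)"
definition "WI41c us = wk 41 False (\<lambda>a. map fst (asc NI41c a)) (hd us) (tl us)"
interpretation I41c: inst 41 False MI41c NI41c GI41c WI41c U41 "[(1, 2), (1, 3)]"
proof unfold_locales
  have "less_marks 41 NI41c" by (simp add: NI41c_def r_defs)
  from asc_set[OF this] show "\<forall>c\<in>set (map fst (asc NI41c a)). val c < 41" for a by auto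
  show "chk 41 U41 [(1, 2), (1, 3)] NI41c" by (simp add: chk_def NI41c_def U41_def r_defs)
qed (rule cop41 | simp add: GI41c_def WI41c_def)+
lemma mcI41c: "plain_marks MI41c" by (simp add: MI41c_def r_defs)
lemmas KI41c = env.sel[where ?x1.0 = 41 and ?x2.0 = False and ?x3.0 = "mlf (asc MI41c)" and ?x4.0 = "blf (\<lambda>a. map fst (asc NI41c a))"]
lemmas wtI41c_0 = walk_table_vs[where W = WI41c and ns = "n41", OF I41c.W z41 le41, THEN bal2[where n = "Suc (Suc (Suc (Suc (Suc 0))))"],
  unfolded map_fold NI41c_def, simplified shape_simps asc.simps eqrs pl41 ng41 pa41 fst_conv snd_conv]
lemmas gtI41c_0 = gen_table[where G = GI41c and K = EI41c and ns = "n41", OF I41c.G KI41c(1-3) asc_list[OF mcI41c], THEN bal2[where n = "Suc (Suc (Suc (Suc (Suc 0))))"],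
  unfolded map_fold MI41c_def, simplified bal_simps asc.simps mkl.simps if_True if_False eqrs pl41 fst_conv snd_conv]
lemmas rtI41c = node_table[where G = GI41c and W = WI41c and K = EI41c, OF I41c.G I41c.W KI41c(1,2,4) I41c.N_less z41 le41 upt41, unfolded tree_unf, unfolded r_fold, simplified if_True if_False fold_simps tree_simps pa41]
lemmas dtI41c = walk_dead[where W = WI41c, OF I41c.W z41 le41 upt41, unfolded tree_unf, unfolded r_fold, simplified fold_simps tree_simps pa41]
lemmas ftI41c = lv_dead[OF le41 upt41, unfolded tree_unf, unfolded r_fold, simplified fold_simps tree_simps pa41]
lemma cwI41c: "WI41c us T = WI41c us T" ..
lemmas runI41c =  rtI41c dtI41c ftI41c walk_end[where W = WI41c, OF I41c.W] leaf_simps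
lemmas conI41c = cwI41c bsel_cong bleaf_cong fin_cong
lemma partI41c: "GI41c (Lf (R 0)) [R 0] [R 5, R 4, R 3] \<and>
  GI41c (Lf (R 0)) [R 0] [R 6, R 5, R 4] \<and>
  GI41c (Lf (R 0)) [R 0] [R 7, R 6, R 5] \<and>
  GI41c (Lf (R 0)) [R 0] [R 8, R 7, R 6] \<and>
  GI41c (Lf (R 0)) [R 0] [R 9, R 8, R 7] \<and>
  GI41c (Lf (R 0)) [R 0] [R 10, R 9, R 8] \<and>
  GI41c (Lf (R 0)) [R 0] [R 11, R 10, R 9] \<and>
  GI41c (Lf (R 0)) [R 0] [R 12, R 11, R 10] \<and>
  GI41c (Lf (R 0)) [R 0] [R 13, R 12, R 11] \<and>
  GI41c (Lf (R 0)) [R 0] [R 14, R 13, R 12] \<and>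
  GI41c (Lf (R 0)) [R 0] [R 15, R 14, R 13] \<and>
  GI41c (Lf (R 0)) [R 0] [R 16, R 15, R 14] \<and>
  GI41c (Lf (R 0)) [R 0] [R 17, R 16, R 15] \<and>
  GI41c (Lf (R 0)) [R 0] [R 18, R 17, R 16] \<and>
  GI41c (Lf (R 0)) [R 0] [R 19, R 18, R 17] \<and>
  GI41c (Lf (R 0)) [R 0] [R 20, R 19, R 18] \<and>
  GI41c (Lf (R 0)) [R 0] [R 21, R 20, R 19]"
proof -
  note wt = conj64[OF wtI41c_0] and gt = conj64[OF gtI41c_0]
  show ?thesis
    unfolding r_fold
    by (simp only: wt gt runI41c cong: conI41c)
qed
lemma tban_I41c:
  assumes "base 41 False A Q C"
  shows "\<forall>t\<in>set [4, 5, 6, 7, 8, 9, 10, 11, 12, 13, 14, 15, 16, 17, 18, 19, 20]. tban 41 False A Q C 1 t"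
proof (rule I41c.plain_all)
  show "\<forall>x\<in>set [(1, 2), (1, 3)]. tban 41 False A Q C (fst x) (snd x)" using tban_41_2[OF assms] tban_I41b[OF assms] by simp
qed (use assms partI41c in \<open>simp_all add: MI41c_def\<close>)

lemma reach_41: "reach 41"
proof (rule reach_step[where c = 1 and ?a0.0 = 1 and U = U41 and TS = "[2, 3, 4, 5, 6, 7, 8, 9, 10, 11, 12, 13, 14, 15, 16, 17, 18, 19, 20]" and V = "[(2, 1, 2), (3, 1, 3), (4, 1, 4), (5, 1, 5), (6, 1, 6), (7, 1, 7), (8, 1, 8), (9, 1, 9), (10, 1, 10), (11, 1, 11), (12, 1, 12), (13, 1, 13), (14, 1, 14), (15, 1, 15), (16, 1, 16), (17, 1, 17), (18, 1, 18), (19, 1, 19), (20, 1, 20), (21, 1, 20), (22, 1, 19), (23, 1, 18), (24, 1, 17), (25, 1, 16), (26, 1, 15), (27, 1, 14), (28, 1, 13), (29, 1, 12), (30, 1, 11), (31, 1, 10), (32, 1, 9), (33, 1, 8), (34, 1, 7), (35, 1, 6), (36, 1, 5), (37, 1, 4), (38, 1, 3), (39, 1, 2)]"])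
  show "reach 1" by (rule reach_1)
  show "\<forall>t\<in>set [2, 3, 4, 5, 6, 7, 8, 9, 10, 11, 12, 13, 14, 15, 16, 17, 18, 19, 20]. tban 41 False A Q C 1 t" if "base 41 False A Q C" for A Q C using tban_41_2[OF that] tban_I41b[OF that] tban_I41c[OF that] by simp
qed (rule cop41 | simp add: U41_def upt41[symmetric])+

section \<open>Moduli \<open>2 * q\<close>: the search modulo \<open>q\<close> in the parity
  mode\<close>

definition MI7pa :: marks where "MI7pa = []"
definition NI7pa :: marks where "NI7pa = []"
abbreviation "EI7pa \<equiv> mkenv 7 True MI7pa NI7pa"
definition "GI7pa B = gen (EI7pa B)"
definition "WI7pa us = wk 7 True (\<lambda>a. map fst (asc NI7pa a)) (hd us) (tl us)"
interpretation I7pa: inst 7 True MI7pa NI7pa GI7pa WI7pa U7 "[]"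
proof unfold_locales
  have "less_marks 7 NI7pa" by (simp add: NI7pa_def r_defs)
  from asc_set[OF this] show "\<forall>c\<in>set (map fst (asc NI7pa a)). val c < 7" for a by auto
  show "chk 7 U7 [] NI7pa" by (simp add: chk_def NI7pa_def U7_def r_defs)
qed (rule cop7 | simp add: GI7pa_def WI7pa_def)+
lemma mcI7pa: "plain_marks MI7pa" by (simp add: MI7pa_def r_defs)
lemmas KI7pa = env.sel[where ?x1.0 = 7 and ?x2.0 = True and ?x3.0 = "mlf (asc MI7pa)" and ?x4.0 = "blf (\<lambda>a. map fst (asc NI7pa a))"]
lemmas wtI7pa_0 = walk_table_vs[where W = WI7pa and ns = "n7", OF I7pa.W z7 le7, THEN bal2[where n = "Suc (Suc 0)"],
  unfolded map_fold NI7pa_def, simplified shape_simps asc.simps eqrs pl7 ng7 pa7 fst_conv snd_conv]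
lemmas gtI7pa_0 = gen_table[where G = GI7pa and K = EI7pa and ns = "n7", OF I7pa.G KI7pa(1-3) asc_list[OF mcI7pa], THEN bal2[where n = "Suc (Suc 0)"],
  unfolded map_fold MI7pa_def, simplified bal_simps asc.simps mkl.simps if_True if_False eqrs pl7 fst_conv snd_conv]
lemmas geI7pa = gen_table_E[where G = GI7pa and K = EI7pa and ns = "n7", OF I7pa.G KI7pa(1), unfolded map_fold, simplified list.pred_inject simp_thms pl7]
lemmas weI7pa = walk_table_E[where W = WI7pa and ns = "n7", OF I7pa.W TrueI, unfolded map_fold, simplified list.pred_inject simp_thms pl7]
lemmas rtI7pa = node_table[where G = GI7pa and W = WI7pa and K = EI7pa, OF I7pa.G I7pa.W KI7pa(1,2,4) I7pa.N_less z7 le7 upt7, unfolded tree_unf, unfolded r_fold, simplified if_True if_False fold_simps tree_simps pa7]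
lemmas dtI7pa = walk_dead[where W = WI7pa, OF I7pa.W z7 le7 upt7, unfolded tree_unf, unfolded r_fold, simplified fold_simps tree_simps pa7]
lemmas ftI7pa = lv_dead[OF le7 upt7, unfolded tree_unf, unfolded r_fold, simplified fold_simps tree_simps pa7]
lemma cwI7pa: "WI7pa us T = WI7pa us T" ..
lemmas runI7pa = geI7pa weI7pa rtI7pa dtI7pa ftI7pa walk_end[where W = WI7pa, OF I7pa.W] leaf_simps
lemmas conI7pa = cwI7pa bsel_cong bleaf_cong fin_cong
text \<open>As \<open>A m\<close> is 0 modulo 7, the three values around \<open>2 * m\<close> agree.
  Only the one at \<open>2 * m\<close> is an even number, whence its tag \<open>E\<close>.\<close>

lemma partI7pa: "GI7pa (Lf (R 0)) [R 0] [R 1, E (R 1), R 1]"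
proof -
  note wt = conj4[OF wtI7pa_0] and gt = conj4[OF gtI7pa_0]
  show ?thesis
    unfolding r_fold
    by (simp only: wt gt runI7pa cong: conI7pa)
qed
lemma tban_I7pa:
  assumes "base 7 True A Q C"
  shows "\<forall>t\<in>set [1]. tban 7 True A Q C 0 t"
proof (rule I7pa.plain_all)
  show "\<forall>x\<in>set []. tban 7 True A Q C (fst x) (snd x)" by simp
qed (use assms partI7pa in \<open>simp_all add: MI7pa_def\<close>)

text \<open>All units fix \<open>a0 = 0\<close>, so for a prime \<open>q\<close> the single type
  with \<open>t = 1\<close> represents every nonzero residue.\<close>

lemma upward_14: "upward (2 * 7)"
proof (rule parity_step[where U = U7 and TS = "[1]" and V = "[(1, 1, 1), (2, 2, 1), (3, 3, 1), (4, 3, 1), (5, 2, 1), (6, 1, 1)]"])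
  show "reach 7" by (rule reach_7)
  show "\<forall>t\<in>set [1]. tban 7 True A Q C 0 t" if "base 7 True A Q C" for A Q C using tban_I7pa[OF that] by simp
qed (rule cop7 | simp add: U7_def upt7[symmetric])+

definition MI9pa :: marks where "MI9pa = []"
definition NI9pa :: marks where "NI9pa = []"
abbreviation "EI9pa \<equiv> mkenv 9 True MI9pa NI9pa"
definition "GI9pa B = gen (EI9pa B)"
definition "WI9pa us = wk 9 True (\<lambda>a. map fst (asc NI9pa a)) (hd us) (tl us)"
interpretation I9pa: inst 9 True MI9pa NI9pa GI9pa WI9pa U9 "[]"
proof unfold_locales
  have "less_marks 9 NI9pa" by (simp add: NI9pa_def r_defs)
  from asc_set[OF this] show "\<forall>c\<in>set (map fst (asc NI9pa a)). val c < 9" for a by auto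
  show "chk 9 U9 [] NI9pa" by (simp add: chk_def NI9pa_def U9_def r_defs)
qed (rule cop9 | simp add: GI9pa_def WI9pa_def)+
lemma mcI9pa: "plain_marks MI9pa" by (simp add: MI9pa_def r_defs)
lemmas KI9pa = env.sel[where ?x1.0 = 9 and ?x2.0 = True and ?x3.0 = "mlf (asc MI9pa)" and ?x4.0 = "blf (\<lambda>a. map fst (asc NI9pa a))"]
lemmas wtI9pa_0 = walk_table_vs[where W = WI9pa and ns = "n9", OF I9pa.W z9 le9, THEN bal2[where n = "Suc (Suc (Suc 0))"],
  unfolded map_fold NI9pa_def, simplified shape_simps asc.simps eqrs pl9 ng9 pa9 fst_conv snd_conv]
lemmas gtI9pa_0 = gen_table[where G = GI9pa and K = EI9pa and ns = "n9", OF I9pa.G KI9pa(1-3) asc_list[OF mcI9pa], THEN bal2[where n = "Suc (Suc (Suc 0))"],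
  unfolded map_fold MI9pa_def, simplified bal_simps asc.simps mkl.simps if_True if_False eqrs pl9 fst_conv snd_conv]
lemmas geI9pa = gen_table_E[where G = GI9pa and K = EI9pa and ns = "n9", OF I9pa.G KI9pa(1), unfolded map_fold, simplified list.pred_inject simp_thms pl9]
lemmas weI9pa = walk_table_E[where W = WI9pa and ns = "n9", OF I9pa.W TrueI, unfolded map_fold, simplified list.pred_inject simp_thms pl9]
lemmas rtI9pa = node_table[where G = GI9pa and W = WI9pa and K = EI9pa, OF I9pa.G I9pa.W KI9pa(1,2,4) I9pa.N_less z9 le9 upt9, unfolded tree_unf, unfolded r_fold, simplified if_True if_False fold_simps tree_simps pa9]
lemmas dtI9pa = walk_dead[where W = WI9pa, OF I9pa.W z9 le9 upt9, unfolded tree_unf, unfolded r_fold, simplified fold_simps tree_simps pa9]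
lemmas ftI9pa = lv_dead[OF le9 upt9, unfolded tree_unf, unfolded r_fold, simplified fold_simps tree_simps pa9]
lemma cwI9pa: "WI9pa us T = WI9pa us T" ..
lemmas runI9pa = geI9pa weI9pa rtI9pa dtI9pa ftI9pa walk_end[where W = WI9pa, OF I9pa.W] leaf_simps
lemmas conI9pa = cwI9pa bsel_cong bleaf_cong fin_cong
lemma partI9pa: "GI9pa (Lf (R 0)) [R 0] [R 1, E (R 1), R 1] \<and>
  GI9pa (Lf (R 0)) [R 0] [R 3, E (R 3), R 3]"
proof -
  note wt = conj64[OF wtI9pa_0] and gt = conj64[OF gtI9pa_0]
  show ?thesis
    unfolding r_fold
    by (simp only: wt gt runI9pa cong: conI9pa)
qed
lemma tban_I9pa:
  assumes "base 9 True A Q C"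
  shows "\<forall>t\<in>set [1, 3]. tban 9 True A Q C 0 t"
proof (rule I9pa.plain_all)
  show "\<forall>x\<in>set []. tban 9 True A Q C (fst x) (snd x)" by simp
qed (use assms partI9pa in \<open>simp_all add: MI9pa_def\<close>)

text \<open>With \<open>a0 = 0\<close> a type is determined by the greatest common divisor of
  \<open>t\<close> and 9, which is 1 or 3.\<close>

lemma upward_18: "upward (2 * 9)"
proof (rule parity_step[where U = U9 and TS = "[1, 3]" and V = "[(1, 1, 1), (2, 2, 1), (3, 1, 3), (4, 4, 1), (5, 4, 1), (6, 1, 3), (7, 2, 1), (8, 1, 1)]"])
  show "reach 9" by (rule reach_9)
  show "\<forall>t\<in>set [1, 3]. tban 9 True A Q C 0 t" if "base 9 True A Q C" for A Q C using tban_I9pa[OF that] by simp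
qed (rule cop9 | simp add: U9_def upt9[symmetric])+

definition MI11pa :: marks where "MI11pa = []"
definition NI11pa :: marks where "NI11pa = []"
abbreviation "EI11pa \<equiv> mkenv 11 True MI11pa NI11pa"
definition "GI11pa B = gen (EI11pa B)"
definition "WI11pa us = wk 11 True (\<lambda>a. map fst (asc NI11pa a)) (hd us) (tl us)"
interpretation I11pa: inst 11 True MI11pa NI11pa GI11pa WI11pa U11 "[]"
proof unfold_locales
  have "less_marks 11 NI11pa" by (simp add: NI11pa_def r_defs)
  from asc_set[OF this] show "\<forall>c\<in>set (map fst (asc NI11pa a)). val c < 11" for a by auto
  show "chk 11 U11 [] NI11pa" by (simp add: chk_def NI11pa_def U11_def r_defs)
qed (rule cop11 | simp add: GI11pa_def WI11pa_def)+
lemma mcI11pa: "plain_marks MI11pa" by (simp add: MI11pa_def r_defs)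
lemmas KI11pa = env.sel[where ?x1.0 = 11 and ?x2.0 = True and ?x3.0 = "mlf (asc MI11pa)" and ?x4.0 = "blf (\<lambda>a. map fst (asc NI11pa a))"]
lemmas wtI11pa_0 = walk_table_vs[where W = WI11pa and ns = "n11", OF I11pa.W z11 le11, THEN bal2[where n = "Suc (Suc (Suc 0))"],
  unfolded map_fold NI11pa_def, simplified shape_simps asc.simps eqrs pl11 ng11 pa11 fst_conv snd_conv]
lemmas gtI11pa_0 = gen_table[where G = GI11pa and K = EI11pa and ns = "n11", OF I11pa.G KI11pa(1-3) asc_list[OF mcI11pa], THEN bal2[where n = "Suc (Suc (Suc 0))"],
  unfolded map_fold MI11pa_def, simplified bal_simps asc.simps mkl.simps if_True if_False eqrs pl11 fst_conv snd_conv]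
lemmas geI11pa = gen_table_E[where G = GI11pa and K = EI11pa and ns = "n11", OF I11pa.G KI11pa(1), unfolded map_fold, simplified list.pred_inject simp_thms pl11]
lemmas weI11pa = walk_table_E[where W = WI11pa and ns = "n11", OF I11pa.W TrueI, unfolded map_fold, simplified list.pred_inject simp_thms pl11]
lemmas rtI11pa = node_table[where G = GI11pa and W = WI11pa and K = EI11pa, OF I11pa.G I11pa.W KI11pa(1,2,4) I11pa.N_less z11 le11 upt11, unfolded tree_unf, unfolded r_fold, simplified if_True if_False fold_simps tree_simps pa11]
lemmas dtI11pa = walk_dead[where W = WI11pa, OF I11pa.W z11 le11 upt11, unfolded tree_unf, unfolded r_fold, simplified fold_simps tree_simps pa11]
lemmas ftI11pa = lv_dead[OF le11 upt11, unfolded tree_unf, unfolded r_fold, simplified fold_simps tree_simps pa11]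
lemma cwI11pa: "WI11pa us T = WI11pa us T" ..
lemmas runI11pa = geI11pa weI11pa rtI11pa dtI11pa ftI11pa walk_end[where W = WI11pa, OF I11pa.W] leaf_simps
lemmas conI11pa = cwI11pa bsel_cong bleaf_cong fin_cong
lemma partI11pa: "GI11pa (Lf (R 0)) [R 0] [R 1, E (R 1), R 1]"
proof -
  note wt = conj64[OF wtI11pa_0] and gt = conj64[OF gtI11pa_0]
  show ?thesis
    unfolding r_fold
    by (simp only: wt gt runI11pa cong: conI11pa)
qed
lemma tban_I11pa:
  assumes "base 11 True A Q C"
  shows "\<forall>t\<in>set [1]. tban 11 True A Q C 0 t"
proof (rule I11pa.plain_all)
  show "\<forall>x\<in>set []. tban 11 True A Q C (fst x) (snd x)" by simp
qed (use assms partI11pa in \<open>simp_all add: MI11pa_def\<close>)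

lemma upward_22: "upward (2 * 11)"
proof (rule parity_step[where U = U11 and TS = "[1]" and V = "[(1, 1, 1), (2, 2, 1), (3, 3, 1), (4, 4, 1), (5, 5, 1), (6, 5, 1), (7, 4, 1), (8, 3, 1), (9, 2, 1), (10, 1, 1)]"])
  show "reach 11" by (rule reach_11)
  show "\<forall>t\<in>set [1]. tban 11 True A Q C 0 t" if "base 11 True A Q C" for A Q C using tban_I11pa[OF that] by simp
qed (rule cop11 | simp add: U11_def upt11[symmetric])+

definition MI13pa :: marks where "MI13pa = []"
definition NI13pa :: marks where "NI13pa = []"
abbreviation "EI13pa \<equiv> mkenv 13 True MI13pa NI13pa"
definition "GI13pa B = gen (EI13pa B)"
definition "WI13pa us = wk 13 True (\<lambda>a. map fst (asc NI13pa a)) (hd us) (tl us)"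
interpretation I13pa: inst 13 True MI13pa NI13pa GI13pa WI13pa U13 "[]"
proof unfold_locales
  have "less_marks 13 NI13pa" by (simp add: NI13pa_def r_defs)
  from asc_set[OF this] show "\<forall>c\<in>set (map fst (asc NI13pa a)). val c < 13" for a by auto
  show "chk 13 U13 [] NI13pa" by (simp add: chk_def NI13pa_def U13_def r_defs)
qed (rule cop13 | simp add: GI13pa_def WI13pa_def)+
lemma mcI13pa: "plain_marks MI13pa" by (simp add: MI13pa_def r_defs)
lemmas KI13pa = env.sel[where ?x1.0 = 13 and ?x2.0 = True and ?x3.0 = "mlf (asc MI13pa)" and ?x4.0 = "blf (\<lambda>a. map fst (asc NI13pa a))"]
lemmas wtI13pa_0 = walk_table_vs[where W = WI13pa and ns = "n13", OF I13pa.W z13 le13, THEN bal2[where n = "Suc (Suc (Suc 0))"],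
  unfolded map_fold NI13pa_def, simplified shape_simps asc.simps eqrs pl13 ng13 pa13 fst_conv snd_conv]
lemmas gtI13pa_0 = gen_table[where G = GI13pa and K = EI13pa and ns = "n13", OF I13pa.G KI13pa(1-3) asc_list[OF mcI13pa], THEN bal2[where n = "Suc (Suc (Suc 0))"],
  unfolded map_fold MI13pa_def, simplified bal_simps asc.simps mkl.simps if_True if_False eqrs pl13 fst_conv snd_conv]
lemmas geI13pa = gen_table_E[where G = GI13pa and K = EI13pa and ns = "n13", OF I13pa.G KI13pa(1), unfolded map_fold, simplified list.pred_inject simp_thms pl13]
lemmas weI13pa = walk_table_E[where W = WI13pa and ns = "n13", OF I13pa.W TrueI, unfolded map_fold, simplified list.pred_inject simp_thms pl13]
lemmas rtI13pa = node_table[where G = GI13pa and W = WI13pa and K = EI13pa, OF I13pa.G I13pa.W KI13pa(1,2,4) I13pa.N_less z13 le13 upt13, unfolded tree_unf, unfolded r_fold, simplified if_True if_False fold_simps tree_simps pa13]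
lemmas dtI13pa = walk_dead[where W = WI13pa, OF I13pa.W z13 le13 upt13, unfolded tree_unf, unfolded r_fold, simplified fold_simps tree_simps pa13]
lemmas ftI13pa = lv_dead[OF le13 upt13, unfolded tree_unf, unfolded r_fold, simplified fold_simps tree_simps pa13]
lemma cwI13pa: "WI13pa us T = WI13pa us T" ..
lemmas runI13pa = geI13pa weI13pa rtI13pa dtI13pa ftI13pa walk_end[where W = WI13pa, OF I13pa.W] leaf_simps
lemmas conI13pa = cwI13pa bsel_cong bleaf_cong fin_cong
lemma partI13pa: "GI13pa (Lf (R 0)) [R 0] [R 1, E (R 1), R 1]"
proof -
  note wt = conj64[OF wtI13pa_0] and gt = conj64[OF gtI13pa_0]
  show ?thesis
    unfolding r_fold
    by (simp only: wt gt runI13pa cong: conI13pa)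
qed
lemma tban_I13pa:
  assumes "base 13 True A Q C"
  shows "\<forall>t\<in>set [1]. tban 13 True A Q C 0 t"
proof (rule I13pa.plain_all)
  show "\<forall>x\<in>set []. tban 13 True A Q C (fst x) (snd x)" by simp
qed (use assms partI13pa in \<open>simp_all add: MI13pa_def\<close>)

lemma upward_26: "upward (2 * 13)"
proof (rule parity_step[where U = U13 and TS = "[1]" and V = "[(1, 1, 1), (2, 2, 1), (3, 3, 1), (4, 4, 1), (5, 5, 1), (6, 6, 1), (7, 6, 1), (8, 5, 1), (9, 4, 1), (10, 3, 1), (11, 2, 1), (12, 1, 1)]"])
  show "reach 13" by (rule reach_13)
  show "\<forall>t\<in>set [1]. tban 13 True A Q C 0 t" if "base 13 True A Q C" for A Q C using tban_I13pa[OF that] by simp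
qed (rule cop13 | simp add: U13_def upt13[symmetric])+

definition MI15pa :: marks where "MI15pa = [(r0, [(r1, r1), (r2, r7), (r4, r4), (r7, r2), (r8, r2), (r11, r4), (r13, r7), (r14, r1)])]"
definition NI15pa :: marks where "NI15pa = []"
abbreviation "EI15pa \<equiv> mkenv 15 True MI15pa NI15pa"
definition "GI15pa B = gen (EI15pa B)"
definition "WI15pa us = wk 15 True (\<lambda>a. map fst (asc NI15pa a)) (hd us) (tl us)"
interpretation I15pa: inst 15 True MI15pa NI15pa GI15pa WI15pa U15 "[]"
proof unfold_locales
  have "less_marks 15 NI15pa" by (simp add: NI15pa_def r_defs)
  from asc_set[OF this] show "\<forall>c\<in>set (map fst (asc NI15pa a)). val c < 15" for a by auto
  show "chk 15 U15 [] NI15pa" by (simp add: chk_def NI15pa_def U15_def r_defs)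
qed (rule cop15 | simp add: GI15pa_def WI15pa_def)+
lemma mcI15pa: "plain_marks MI15pa" by (simp add: MI15pa_def r_defs)
lemmas KI15pa = env.sel[where ?x1.0 = 15 and ?x2.0 = True and ?x3.0 = "mlf (asc MI15pa)" and ?x4.0 = "blf (\<lambda>a. map fst (asc NI15pa a))"]
lemmas wtI15pa_0 = walk_table_vs[where W = WI15pa and ns = "n15", OF I15pa.W z15 le15, THEN bal2[where n = "Suc (Suc (Suc 0))"],
  unfolded map_fold NI15pa_def, simplified shape_simps asc.simps eqrs pl15 ng15 pa15 fst_conv snd_conv]
lemmas gtI15pa_0 = gen_table[where G = GI15pa and K = EI15pa and ns = "n15", OF I15pa.G KI15pa(1-3) asc_list[OF mcI15pa], THEN bal2[where n = "Suc (Suc (Suc 0))"],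
  unfolded map_fold MI15pa_def, simplified bal_simps asc.simps mkl.simps if_True if_False eqrs pl15 fst_conv snd_conv]
lemmas gsI15pa = gen_table_S[where G = GI15pa and K = EI15pa and ns = "n15", OF I15pa.G KI15pa(1,2,5), unfolded map_fold, simplified list_simps]
lemmas wsI15pa = walk_table_S[where W = WI15pa and ns = "n15", OF I15pa.W, unfolded map_fold, simplified list_simps]
lemmas geI15pa = gen_table_E[where G = GI15pa and K = EI15pa and ns = "n15", OF I15pa.G KI15pa(1), unfolded map_fold, simplified list.pred_inject simp_thms pl15]
lemmas weI15pa = walk_table_E[where W = WI15pa and ns = "n15", OF I15pa.W TrueI, unfolded map_fold, simplified list.pred_inject simp_thms pl15]
lemmas rtI15pa = node_table[where G = GI15pa and W = WI15pa and K = EI15pa, OF I15pa.G I15pa.W KI15pa(1,2,4) I15pa.N_less z15 le15 upt15, unfolded tree_unf, unfolded r_fold, simplified if_True if_False fold_simps tree_simps pa15]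
lemmas dtI15pa = walk_dead[where W = WI15pa, OF I15pa.W z15 le15 upt15, unfolded tree_unf, unfolded r_fold, simplified fold_simps tree_simps pa15]
lemmas ftI15pa = lv_dead[OF le15 upt15, unfolded tree_unf, unfolded r_fold, simplified fold_simps tree_simps pa15]
lemma cwI15pa: "WI15pa us T = WI15pa us T" ..
lemmas runI15pa = gsI15pa wsI15pa bs15 bleaf_simps geI15pa weI15pa rtI15pa dtI15pa ftI15pa walk_end[where W = WI15pa, OF I15pa.W] leaf_simps
lemmas conI15pa = cwI15pa bsel_cong bleaf_cong fin_cong
abbreviation partI15pa where
  "partI15pa ds \<equiv> chain 15 (stage GI15pa WI15pa 15 [R 1, S (R 1) (R 1), R 1]) (R 12) (treeD 15 (map R n15))
    (fold (\<lambda>s. kill (pa 15 s)) ds (tree0 15 (map R n15)))"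
text \<open>Every unit fixes 0, and 1 and -1 are the units that fix 1 up to sign; hence the groups
  consist of \<open>s\<close> and \<open>- s\<close>.\<close>

lemma partI15pa_0:
  "partI15pa [] [[R 0], [R 14, R 1], [R 13, R 2], [R 12, R 3], [R 11, R 4], [R 10, R 5], [R 9, R 6], [R 8, R 7]]"
proof -
  note wt = conj64[OF wtI15pa_0] and gt = conj64[OF gtI15pa_0] and mt = conj64[OF mt15_0] and pl = conj64[OF pl15_0]
  show ?thesis
    unfolding list.map r_fold treeD_def tree0_def
    apply (simp only: chain.simps fold_simps tree_simps pa15 list.sel pl simp_thms)
    apply ((intro conjI)?; rule stage_abs[unfolded r_fold])
    apply (simp_all only: wt gt mt pl runI15pa cong: conI15pa)
    done
qed
lemma tban_15p_1:
  assumes "base 15 True A Q C"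
  shows "tban 15 True A Q C 0 1"
proof (rule I15pa.chains_tban[where x = 1 and z = 1 and k = 12 and ns = "n15" and cs = "[[[R 0], [R 14, R 1], [R 13, R 2], [R 12, R 3], [R 11, R 4], [R 10, R 5], [R 9, R 6], [R 8, R 7]]]"])
  show "\<forall>x\<in>set []. tban 15 True A Q C (fst x) (snd x)" by simp
  show "base 15 True A Q C" by (rule assms)
  show "chk 15 U15 [(0, 1)] MI15pa" by (simp add: chk_def MI15pa_def U15_def r_defs)
  show "links 15 (stage GI15pa WI15pa 15 [R 1, S (R 1) (R 1), R 1]) (R 12) (treeD 15 (map R n15)) (tree0 15 (map R n15)) [] [[[R 0], [R 14, R 1], [R 13, R 2], [R 12, R 3], [R 11, R 4], [R 10, R 5], [R 9, R 6], [R 8, R 7]]]"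
    by (simp only: links.simps append.simps concat.simps partI15pa_0 simp_thms)
qed (unfold I15pa.eqs_def, simp_all add: U15_def upt15[symmetric])

definition MI15pb :: marks where "MI15pb = []"
text \<open>All unit values at \<open>2 * m\<close> next to the value 0 at \<open>m\<close>: the
  type \<open>(0, 1)\<close> is excluded while \<open>(0, 3)\<close> and \<open>(0, 5)\<close> are
  searched.\<close>

definition NI15pb :: marks where "NI15pb = [(r0, [(r1, r1), (r2, r7), (r4, r4), (r7, r2), (r8, r2), (r11, r4), (r13, r7), (r14, r1)])]"
abbreviation "EI15pb \<equiv> mkenv 15 True MI15pb NI15pb"
definition "GI15pb B = gen (EI15pb B)"
definition "WI15pb us = wk 15 True (\<lambda>a. map fst (asc NI15pb a)) (hd us) (tl us)"
interpretation I15pb: inst 15 True MI15pb NI15pb GI15pb WI15pb U15 "[(0, 1)]"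
proof unfold_locales
  have "less_marks 15 NI15pb" by (simp add: NI15pb_def r_defs)
  from asc_set[OF this] show "\<forall>c\<in>set (map fst (asc NI15pb a)). val c < 15" for a by auto
  show "chk 15 U15 [(0, 1)] NI15pb" by (simp add: chk_def NI15pb_def U15_def r_defs)
qed (rule cop15 | simp add: GI15pb_def WI15pb_def)+
lemma mcI15pb: "plain_marks MI15pb" by (simp add: MI15pb_def r_defs)
lemmas KI15pb = env.sel[where ?x1.0 = 15 and ?x2.0 = True and ?x3.0 = "mlf (asc MI15pb)" and ?x4.0 = "blf (\<lambda>a. map fst (asc NI15pb a))"]
lemmas wtI15pb_0 = walk_table_vs[where W = WI15pb and ns = "n15", OF I15pb.W z15 le15, THEN bal2[where n = "Suc (Suc (Suc 0))"],
  unfolded map_fold NI15pb_def, simplified shape_simps asc.simps eqrs pl15 ng15 pa15 fst_conv snd_conv]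
lemmas gtI15pb_0 = gen_table[where G = GI15pb and K = EI15pb and ns = "n15", OF I15pb.G KI15pb(1-3) asc_list[OF mcI15pb], THEN bal2[where n = "Suc (Suc (Suc 0))"],
  unfolded map_fold MI15pb_def, simplified bal_simps asc.simps mkl.simps if_True if_False eqrs pl15 fst_conv snd_conv]
lemmas geI15pb = gen_table_E[where G = GI15pb and K = EI15pb and ns = "n15", OF I15pb.G KI15pb(1), unfolded map_fold, simplified list.pred_inject simp_thms pl15]
lemmas weI15pb = walk_table_E[where W = WI15pb and ns = "n15", OF I15pb.W TrueI, unfolded map_fold, simplified list.pred_inject simp_thms pl15]
lemmas rtI15pb = node_table[where G = GI15pb and W = WI15pb and K = EI15pb, OF I15pb.G I15pb.W KI15pb(1,2,4) I15pb.N_less z15 le15 upt15, unfolded tree_unf, unfolded r_fold, simplified if_True if_False fold_simps tree_simps pa15]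
lemmas dtI15pb = walk_dead[where W = WI15pb, OF I15pb.W z15 le15 upt15, unfolded tree_unf, unfolded r_fold, simplified fold_simps tree_simps pa15]
lemmas ftI15pb = lv_dead[OF le15 upt15, unfolded tree_unf, unfolded r_fold, simplified fold_simps tree_simps pa15]
lemma cwI15pb: "WI15pb us T = WI15pb us T" ..
lemmas runI15pb = geI15pb weI15pb rtI15pb dtI15pb ftI15pb walk_end[where W = WI15pb, OF I15pb.W] leaf_simps
lemmas conI15pb = cwI15pb bsel_cong bleaf_cong fin_cong
lemma partI15pb: "GI15pb (Lf (R 0)) [R 0] [R 3, E (R 3), R 3] \<and>
  GI15pb (Lf (R 0)) [R 0] [R 5, E (R 5), R 5]"
proof -
  note wt = conj64[OF wtI15pb_0] and gt = conj64[OF gtI15pb_0]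
  show ?thesis
    unfolding r_fold
    by (simp only: wt gt runI15pb cong: conI15pb)
qed
lemma tban_I15pb:
  assumes "base 15 True A Q C"
  shows "\<forall>t\<in>set [3, 5]. tban 15 True A Q C 0 t"
proof (rule I15pb.plain_all)
  show "\<forall>x\<in>set [(0, 1)]. tban 15 True A Q C (fst x) (snd x)" using tban_15p_1[OF assms] by simp
qed (use assms partI15pb in \<open>simp_all add: MI15pb_def\<close>)

text \<open>The three types correspond to the greatest common divisors 1, 3 and 5 that a nonzero
  residue can have with 15.\<close>

lemma upward_30: "upward (2 * 15)"
proof (rule parity_step[where U = U15 and TS = "[1, 3, 5]" and V = "[(1, 1, 1), (2, 2, 1), (3, 1, 3), (4, 4, 1), (5, 1, 5), (6, 2, 3), (7, 7, 1), (8, 7, 1), (9, 2, 3), (10, 1, 5), (11, 4, 1), (12, 1, 3), (13, 2, 1), (14, 1, 1)]"])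
  show "reach 15" by (rule reach_15)
  show "\<forall>t\<in>set [1, 3, 5]. tban 15 True A Q C 0 t" if "base 15 True A Q C" for A Q C using tban_15p_1[OF that] tban_I15pb[OF that] by simp
qed (rule cop15 | simp add: U15_def upt15[symmetric])+

definition MI17pa :: marks where "MI17pa = [(r0, [(r1, r1), (r2, r8), (r3, r6), (r4, r4), (r5, r7), (r6, r3), (r7, r5), (r8, r2), (r9, r2), (r10, r5), (r11, r3), (r12, r7), (r13, r4), (r14, r6), (r15, r8), (r16, r1)])]"
definition NI17pa :: marks where "NI17pa = []"
abbreviation "EI17pa \<equiv> mkenv 17 True MI17pa NI17pa"
definition "GI17pa B = gen (EI17pa B)"
definition "WI17pa us = wk 17 True (\<lambda>a. map fst (asc NI17pa a)) (hd us) (tl us)"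
interpretation I17pa: inst 17 True MI17pa NI17pa GI17pa WI17pa U17 "[]"
proof unfold_locales
  have "less_marks 17 NI17pa" by (simp add: NI17pa_def r_defs)
  from asc_set[OF this] show "\<forall>c\<in>set (map fst (asc NI17pa a)). val c < 17" for a by auto
  show "chk 17 U17 [] NI17pa" by (simp add: chk_def NI17pa_def U17_def r_defs)
qed (rule cop17 | simp add: GI17pa_def WI17pa_def)+
lemma mcI17pa: "plain_marks MI17pa" by (simp add: MI17pa_def r_defs)
lemmas KI17pa = env.sel[where ?x1.0 = 17 and ?x2.0 = True and ?x3.0 = "mlf (asc MI17pa)" and ?x4.0 = "blf (\<lambda>a. map fst (asc NI17pa a))"]
lemmas wtI17pa_0 = walk_table_vs[where W = WI17pa and ns = "n17", OF I17pa.W z17 le17, THEN bal2[where n = "Suc (Suc (Suc (Suc 0)))"],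
  unfolded map_fold NI17pa_def, simplified shape_simps asc.simps eqrs pl17 ng17 pa17 fst_conv snd_conv]
lemmas gtI17pa_0 = gen_table[where G = GI17pa and K = EI17pa and ns = "n17", OF I17pa.G KI17pa(1-3) asc_list[OF mcI17pa], THEN bal2[where n = "Suc (Suc (Suc (Suc 0)))"],
  unfolded map_fold MI17pa_def, simplified bal_simps asc.simps mkl.simps if_True if_False eqrs pl17 fst_conv snd_conv]
lemmas gsI17pa = gen_table_S[where G = GI17pa and K = EI17pa and ns = "n17", OF I17pa.G KI17pa(1,2,5), unfolded map_fold, simplified list_simps]
lemmas wsI17pa = walk_table_S[where W = WI17pa and ns = "n17", OF I17pa.W, unfolded map_fold, simplified list_simps]
lemmas geI17pa = gen_table_E[where G = GI17pa and K = EI17pa and ns = "n17", OF I17pa.G KI17pa(1), unfolded map_fold, simplified list.pred_inject simp_thms pl17]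
lemmas weI17pa = walk_table_E[where W = WI17pa and ns = "n17", OF I17pa.W TrueI, unfolded map_fold, simplified list.pred_inject simp_thms pl17]
lemmas rtI17pa = node_table[where G = GI17pa and W = WI17pa and K = EI17pa, OF I17pa.G I17pa.W KI17pa(1,2,4) I17pa.N_less z17 le17 upt17, unfolded tree_unf, unfolded r_fold, simplified if_True if_False fold_simps tree_simps pa17]
lemmas dtI17pa = walk_dead[where W = WI17pa, OF I17pa.W z17 le17 upt17, unfolded tree_unf, unfolded r_fold, simplified fold_simps tree_simps pa17]
lemmas ftI17pa = lv_dead[OF le17 upt17, unfolded tree_unf, unfolded r_fold, simplified fold_simps tree_simps pa17]
lemma cwI17pa: "WI17pa us T = WI17pa us T" ..
lemmas runI17pa = gsI17pa wsI17pa bs17 bleaf_simps geI17pa weI17pa rtI17pa dtI17pa ftI17pa walk_end[where W = WI17pa, OF I17pa.W] leaf_simps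
lemmas conI17pa = cwI17pa bsel_cong bleaf_cong fin_cong
abbreviation partI17pa where
  "partI17pa ds \<equiv> chain 17 (stage GI17pa WI17pa 17 [R 1, S (R 1) (R 1), R 1]) (R 14) (treeD 17 (map R n17))
    (fold (\<lambda>s. kill (pa 17 s)) ds (tree0 17 (map R n17)))"
lemma partI17pa_0:
  "partI17pa [] [[R 0], [R 16, R 1], [R 15, R 2], [R 14, R 3], [R 13, R 4], [R 12, R 5], [R 11, R 6], [R 10, R 7], [R 9, R 8]]"
proof -
  note wt = conj64[OF wtI17pa_0] and gt = conj64[OF gtI17pa_0] and mt = conj64[OF mt17_0] and pl = conj64[OF pl17_0]
  show ?thesis
    unfolding list.map r_fold treeD_def tree0_def
    apply (simp only: chain.simps fold_simps tree_simps pa17 list.sel pl simp_thms)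
    apply ((intro conjI)?; rule stage_abs[unfolded r_fold])
    apply (simp_all only: wt gt mt pl runI17pa cong: conI17pa)
    done
qed
lemma tban_17p_1:
  assumes "base 17 True A Q C"
  shows "tban 17 True A Q C 0 1"
proof (rule I17pa.chains_tban[where x = 1 and z = 1 and k = 14 and ns = "n17" and cs = "[[[R 0], [R 16, R 1], [R 15, R 2], [R 14, R 3], [R 13, R 4], [R 12, R 5], [R 11, R 6], [R 10, R 7], [R 9, R 8]]]"])
  show "\<forall>x\<in>set []. tban 17 True A Q C (fst x) (snd x)" by simp
  show "base 17 True A Q C" by (rule assms)
  show "chk 17 U17 [(0, 1)] MI17pa" by (simp add: chk_def MI17pa_def U17_def r_defs)
  show "links 17 (stage GI17pa WI17pa 17 [R 1, S (R 1) (R 1), R 1]) (R 14) (treeD 17 (map R n17)) (tree0 17 (map R n17)) [] [[[R 0], [R 16, R 1], [R 15, R 2], [R 14, R 3], [R 13, R 4], [R 12, R 5], [R 11, R 6], [R 10, R 7], [R 9, R 8]]]"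
    by (simp only: links.simps append.simps concat.simps partI17pa_0 simp_thms)
qed (unfold I17pa.eqs_def, simp_all add: U17_def upt17[symmetric])

lemma upward_34: "upward (2 * 17)"
proof (rule parity_step[where U = U17 and TS = "[1]" and V = "[(1, 1, 1), (2, 2, 1), (3, 3, 1), (4, 4, 1), (5, 5, 1), (6, 6, 1), (7, 7, 1), (8, 8, 1), (9, 8, 1), (10, 7, 1), (11, 6, 1), (12, 5, 1), (13, 4, 1), (14, 3, 1), (15, 2, 1), (16, 1, 1)]"])
  show "reach 17" by (rule reach_17)
  show "\<forall>t\<in>set [1]. tban 17 True A Q C 0 t" if "base 17 True A Q C" for A Q C using tban_17p_1[OF that] by simp
qed (rule cop17 | simp add: U17_def upt17[symmetric])+

definition MI19pa :: marks where "MI19pa = [(r0, [(r1, r1), (r2, r9), (r3, r6), (r4, r5), (r5, r4), (r6, r3), (r7, r8), (r8, r7), (r9, r2), (r10, r2), (r11, r7), (r12, r8), (r13, r3), (r14, r4), (r15, r5), (r16, r6), (r17, r9), (r18, r1)])]"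
definition NI19pa :: marks where "NI19pa = []"
abbreviation "EI19pa \<equiv> mkenv 19 True MI19pa NI19pa"
definition "GI19pa B = gen (EI19pa B)"
definition "WI19pa us = wk 19 True (\<lambda>a. map fst (asc NI19pa a)) (hd us) (tl us)"
interpretation I19pa: inst 19 True MI19pa NI19pa GI19pa WI19pa U19 "[]"
proof unfold_locales
  have "less_marks 19 NI19pa" by (simp add: NI19pa_def r_defs)
  from asc_set[OF this] show "\<forall>c\<in>set (map fst (asc NI19pa a)). val c < 19" for a by auto
  show "chk 19 U19 [] NI19pa" by (simp add: chk_def NI19pa_def U19_def r_defs)
qed (rule cop19 | simp add: GI19pa_def WI19pa_def)+
lemma mcI19pa: "plain_marks MI19pa" by (simp add: MI19pa_def r_defs)
lemmas KI19pa = env.sel[where ?x1.0 = 19 and ?x2.0 = True and ?x3.0 = "mlf (asc MI19pa)" and ?x4.0 = "blf (\<lambda>a. map fst (asc NI19pa a))"]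
lemmas wtI19pa_0 = walk_table_vs[where W = WI19pa and ns = "n19", OF I19pa.W z19 le19, THEN bal2[where n = "Suc (Suc (Suc (Suc 0)))"],
  unfolded map_fold NI19pa_def, simplified shape_simps asc.simps eqrs pl19 ng19 pa19 fst_conv snd_conv]
lemmas gtI19pa_0 = gen_table[where G = GI19pa and K = EI19pa and ns = "n19", OF I19pa.G KI19pa(1-3) asc_list[OF mcI19pa], THEN bal2[where n = "Suc (Suc (Suc (Suc 0)))"],
  unfolded map_fold MI19pa_def, simplified bal_simps asc.simps mkl.simps if_True if_False eqrs pl19 fst_conv snd_conv]
lemmas gsI19pa = gen_table_S[where G = GI19pa and K = EI19pa and ns = "n19", OF I19pa.G KI19pa(1,2,5), unfolded map_fold, simplified list_simps]
lemmas wsI19pa = walk_table_S[where W = WI19pa and ns = "n19", OF I19pa.W, unfolded map_fold, simplified list_simps]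
lemmas geI19pa = gen_table_E[where G = GI19pa and K = EI19pa and ns = "n19", OF I19pa.G KI19pa(1), unfolded map_fold, simplified list.pred_inject simp_thms pl19]
lemmas weI19pa = walk_table_E[where W = WI19pa and ns = "n19", OF I19pa.W TrueI, unfolded map_fold, simplified list.pred_inject simp_thms pl19]
lemmas rtI19pa = node_table[where G = GI19pa and W = WI19pa and K = EI19pa, OF I19pa.G I19pa.W KI19pa(1,2,4) I19pa.N_less z19 le19 upt19, unfolded tree_unf, unfolded r_fold, simplified if_True if_False fold_simps tree_simps pa19]
lemmas dtI19pa = walk_dead[where W = WI19pa, OF I19pa.W z19 le19 upt19, unfolded tree_unf, unfolded r_fold, simplified fold_simps tree_simps pa19]
lemmas ftI19pa = lv_dead[OF le19 upt19, unfolded tree_unf, unfolded r_fold, simplified fold_simps tree_simps pa19]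
lemma cwI19pa: "WI19pa us T = WI19pa us T" ..
lemmas runI19pa = gsI19pa wsI19pa bs19 bleaf_simps geI19pa weI19pa rtI19pa dtI19pa ftI19pa walk_end[where W = WI19pa, OF I19pa.W] leaf_simps
lemmas conI19pa = cwI19pa bsel_cong bleaf_cong fin_cong
abbreviation partI19pa where
  "partI19pa ds \<equiv> chain 19 (stage GI19pa WI19pa 19 [R 1, S (R 1) (R 1), R 1]) (R 16) (treeD 19 (map R n19))
    (fold (\<lambda>s. kill (pa 19 s)) ds (tree0 19 (map R n19)))"
lemma partI19pa_0:
  "partI19pa [] [[R 0], [R 18, R 1], [R 17, R 2], [R 16, R 3], [R 15, R 4], [R 14, R 5], [R 13, R 6], [R 12, R 7], [R 11, R 8], [R 10, R 9]]"
proof -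
  note wt = conj64[OF wtI19pa_0] and gt = conj64[OF gtI19pa_0] and mt = conj64[OF mt19_0] and pl = conj64[OF pl19_0]
  show ?thesis
    unfolding list.map r_fold treeD_def tree0_def
    apply (simp only: chain.simps fold_simps tree_simps pa19 list.sel pl simp_thms)
    apply ((intro conjI)?; rule stage_abs[unfolded r_fold])
    apply (simp_all only: wt gt mt pl runI19pa cong: conI19pa)
    done
qed
lemma tban_19p_1:
  assumes "base 19 True A Q C"
  shows "tban 19 True A Q C 0 1"
proof (rule I19pa.chains_tban[where x = 1 and z = 1 and k = 16 and ns = "n19" and cs = "[[[R 0], [R 18, R 1], [R 17, R 2], [R 16, R 3], [R 15, R 4], [R 14, R 5], [R 13, R 6], [R 12, R 7], [R 11, R 8], [R 10, R 9]]]"])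
  show "\<forall>x\<in>set []. tban 19 True A Q C (fst x) (snd x)" by simp
  show "base 19 True A Q C" by (rule assms)
  show "chk 19 U19 [(0, 1)] MI19pa" by (simp add: chk_def MI19pa_def U19_def r_defs)
  show "links 19 (stage GI19pa WI19pa 19 [R 1, S (R 1) (R 1), R 1]) (R 16) (treeD 19 (map R n19)) (tree0 19 (map R n19)) [] [[[R 0], [R 18, R 1], [R 17, R 2], [R 16, R 3], [R 15, R 4], [R 14, R 5], [R 13, R 6], [R 12, R 7], [R 11, R 8], [R 10, R 9]]]"
    by (simp only: links.simps append.simps concat.simps partI19pa_0 simp_thms)
qed (unfold I19pa.eqs_def, simp_all add: U19_def upt19[symmetric])

lemma upward_38: "upward (2 * 19)"
proof (rule parity_step[where U = U19 and TS = "[1]" and V = "[(1, 1, 1), (2, 2, 1), (3, 3, 1), (4, 4, 1), (5, 5, 1), (6, 6, 1), (7, 7, 1), (8, 8, 1), (9, 9, 1), (10, 9, 1), (11, 8, 1), (12, 7, 1), (13, 6, 1), (14, 5, 1), (15, 4, 1), (16, 3, 1), (17, 2, 1), (18, 1, 1)]"])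
  show "reach 19" by (rule reach_19)
  show "\<forall>t\<in>set [1]. tban 19 True A Q C 0 t" if "base 19 True A Q C" for A Q C using tban_19p_1[OF that] by simp
qed (rule cop19 | simp add: U19_def upt19[symmetric])+

theorem theorem5:
  fixes k :: "nat \<Rightarrow> nat" and b :: "nat \<Rightarrow> int" and h :: int
  assumes "strict_mono k" and "k 0 = 0"
    and "has_degree k 2"
    and "associated k b"
    and "2 \<le> h" and "h \<le> 41" and "\<not> 4 dvd h"
  shows "infinite {n. h dvd b n}"
proof -
  define n where "n = nat h"
  have hn: "h = int n" "2 \<le> n" "n < 42" using assms(5,6) unfolding n_def by arith+
  have n: "h = int n" "n \<in> set [2..<42]"
    unfolding set_upt atLeastLessThan_iff by (intro hn conjI)+
  have range: "[2..<42] = [2, 3, 4, 5, 6, 7, 8, 9, 10, 11, 12, 13, 14, 15, 16, 17, 18, 19, 20, 21, 22, 23, 24, 25, 26, 27, 28, 29, 30, 31, 32, 33, 34, 35, 36, 37, 38, 39, 40, 41]" by (simp add: upt_rec)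
  \<comment> \<open>Divisibility passes to divisors, so the doubles of the odd numbers from 7 to 19
    and the odd numbers from 21 to 41 suffice: each admissible \<open>n\<close> divides one of
    them.\<close>
  have "list_all (\<lambda>n. (4::nat) dvd n \<or> list_ex (\<lambda>u. n dvd u) [14, 18, 22, 26, 30, 34, 38, 21, 23, 25, 27, 29, 31, 33, 35, 37, 39, 41]) [2, 3, 4, 5, 6, 7, 8, 9, 10, 11, 12, 13, 14, 15, 16, 17, 18, 19, 20, 21, 22, 23, 24, 25, 26, 27, 28, 29, 30, 31, 32, 33, 34, 35, 36, 37, 38, 39, 40, 41]" by simp
  from bspec[OF this[unfolded list_all_iff] n(2)[unfolded range]]
  have "4 dvd n \<or> list_ex (\<lambda>u. n dvd u) [14, 18, 22, 26, 30, 34, 38, 21, 23, 25, 27, 29, 31, 33, 35, 37, 39, 41]" .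
  moreover have "\<not> 4 dvd n" using assms(7) unfolding n(1) by presburger
  ultimately have "list_ex (\<lambda>u. n dvd u) [14, 18, 22, 26, 30, 34, 38, 21, 23, 25, 27, 29, 31, 33, 35, 37, 39, 41]" by blast
  then obtain u where u: "u \<in> set [14, 18, 22, 26, 30, 34, 38, 21, 23, 25, 27, 29, 31, 33, 35, 37, 39, 41]" "n dvd u" unfolding list_ex_iff by blast
  have "list_all upward [14, 18, 22, 26, 30, 34, 38, 21, 23, 25, 27, 29, 31, 33, 35, 37, 39, 41]"
    using upward_14 upward_18 upward_22 upward_26 upward_30 upward_34 upward_38
      reach_21[THEN reach_upward] reach_23[THEN reach_upward] reach_25[THEN reach_upward] reach_27[THEN reach_upward] reach_29[THEN reach_upward] reach_31[THEN reach_upward] reach_33[THEN reach_upward] reach_35[THEN reach_upward] reach_37[THEN reach_upward] reach_39[THEN reach_upward] reach_41[THEN reach_upward] by simp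
  then have "upward u" using u(1) unfolding list_all_iff by blast
  moreover have "h dvd int u" using u(2) n(1) by simp
  ultimately show ?thesis using upward_infinite[OF assms(1,3,4)] by blast
qed

end
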